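(* Let $K$ be a field, $n\ge 2$, $l\ge 1$, and let $F\in K[z_1,\ldots,z_n]^{l\times l}$ satisfy $$\det(F)=(z_1-f_1(z_2,\ldots,z_n))(z_2-f_2(z_3,\ldots,z_n))\cdots(z_{n-1}-f_{n-1}(z_n))\,h,$$ where $f_i\in K[z_{i+1},\ldots,z_n]$ for $i=1,\ldots,n-1$ and $h\in K[z_n]$ is nonzero. Then $F$ is equivalent to its Smith form if and only if $J_k(F)=K[z_1,\ldots,z_n]$ for all $k=1,\ldots,l$.
   Context: Let $R=K[z_1,\ldots,z_n]$. A square matrix over $R$ is unimodular if its determinant is a unit of $R$. Two matrices $F_1,F_2\in R^{l\times m}$ are equivalent, $F_1\sim F_2$, if $F_1=UF_2V$ for some unimodular $U\in R^{l\times l}$, $V\in R^{m\times m}$. For $F\in R^{l\times m}$ of rank $r$, $d_k(F)$ denotes the greatest common divisor (defined up to a unit) of all $k\times k$ minors of $F$, with $d_0(F)=1$. For $1\le k\le r$, if $u_1,\ldots,u_\beta$ are all the $k\times k$ minors and $u_j=d_k(F)v_j$, then $v_1,\ldots,v_\beta$ are the $k\times k$ reduced minors of $F$, and $J_k(F)$ is the ideal of $R$ they generate. For $l\le m$, the Smith form of $F$ is $S=(\mathrm{diag}\{\Phi_1,\ldots,\Phi_l\}\ \ 0_{l,m-l})$, where $\Phi_i=d_i(F)/d_{i-1}(F)$ for $1\le i\le r$ and $\Phi_i=0$ for $r<i\le l$ (with $\Phi_1\mid\Phi_2\mid\cdots\mid\Phi_r$). *)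

theory Defs
  imports
    "HOL-Library.Cardinality"
    "HOL-Library.Poly_Mapping"
    "HOL-Computational_Algebra.Polynomial_Factorial"
    "Jordan_Normal_Form.Determinant"
    "Jordan_Normal_Form.DL_Submatrix"
    "Jordan_Normal_Form.DL_Rank"
begin

text \<open>
  The ring K[z_1, ..., z_n] is the type of finitely supported maps from exponent vectors to
  coefficients. The variables are indexed by a finite linearly ordered type \<open>'n\<close>
  with \<open>CARD('n) = n\<close>; its least element plays the role of 1 and its greatest one that of n.
\<close>

type_synonym ('n, 'a) mpoly = "('n \<Rightarrow>\<^sub>0 nat) \<Rightarrow>\<^sub>0 'a"

definition Var :: "'n \<Rightarrow> ('n, 'a::field) mpoly" where
  "Var i = Poly_Mapping.single (Poly_Mapping.single i 1) 1"

text \<open>The subring K[z_i : i in I].\<close>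

definition polys_in :: "'n set \<Rightarrow> ('n, 'a::field) mpoly set" where
  "polys_in I = {p. \<forall>m \<in> Poly_Mapping.keys p. Poly_Mapping.keys m \<subseteq> I}"

definition unimodular :: "'r::idom mat \<Rightarrow> bool" where
  "unimodular U \<longleftrightarrow> square_mat U \<and> det U dvd 1"

definition equivalent_mat :: "'r::idom mat \<Rightarrow> 'r mat \<Rightarrow> bool" where
  "equivalent_mat F G \<longleftrightarrow>
     dim_row F = dim_row G \<and> dim_col F = dim_col G \<and>
     (\<exists>U \<in> carrier_mat (dim_row G) (dim_row G). \<exists>V \<in> carrier_mat (dim_col G) (dim_col G).
        unimodular U \<and> unimodular V \<and> F = U * G * V)"

definition rank_mat :: "'r::idom mat \<Rightarrow> nat" where
  "rank_mat F = vec_space.rank (dim_row F) (map_mat to_fract F)"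

definition minors :: "nat \<Rightarrow> 'r::idom mat \<Rightarrow> 'r set" where
  "minors k F = {det (submatrix F I J) | I J.
     I \<subseteq> {..<dim_row F} \<and> J \<subseteq> {..<dim_col F} \<and> card I = k \<and> card J = k}"

definition is_gcd_of :: "'r::idom \<Rightarrow> 'r set \<Rightarrow> bool" where
  "is_gcd_of d A \<longleftrightarrow> (\<forall>a \<in> A. d dvd a) \<and> (\<forall>c. (\<forall>a \<in> A. c dvd a) \<longrightarrow> c dvd d)"

text \<open>
  A greatest common divisor is determined up to a unit only; \<open>minors_gcd\<close> fixes one choice.
  Another choice leaves \<open>reduced_minors_ideal\<close> unchanged and changes the Smith form only by
  units on the diagonal, hence within its equivalence class.
\<close>

definition minors_gcd :: "nat \<Rightarrow> 'r::idom mat \<Rightarrow> 'r" where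
  "minors_gcd k F = (if k = 0 then 1 else (SOME d. is_gcd_of d (minors k F)))"

text \<open>Meaningful for k at most the rank, where \<open>minors_gcd k F\<close> is nonzero.\<close>

definition reduced_minors :: "nat \<Rightarrow> 'r::idom mat \<Rightarrow> 'r set" where
  "reduced_minors k F = {v. \<exists>u \<in> minors k F. u = minors_gcd k F * v}"

text \<open>The ideal generated by the reduced minors: the span in the ring as a module over itself.\<close>

definition reduced_minors_ideal :: "nat \<Rightarrow> 'r::idom mat \<Rightarrow> 'r set" where
  "reduced_minors_ideal k F = Modules.module.span (*) (reduced_minors k F)"

definition invariant_factor :: "nat \<Rightarrow> 'r::idom mat \<Rightarrow> 'r" where
  "invariant_factor i F = (THE q. minors_gcd i F = minors_gcd (i - 1) F * q)"

text \<open>Matrix indices start at 0, so the diagonal entry at position i is the (i + 1)-st factor.\<close>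

definition smith_form :: "'r::idom mat \<Rightarrow> 'r mat" where
  "smith_form F = mat (dim_row F) (dim_col F)
     (\<lambda>(i, j). if i = j \<and> i < rank_mat F then invariant_factor (i + 1) F else 0)"

end

theory Submission
  imports Defs
begin

text \<open>Write \<open>R = K[z_1, ..., z_n]\<close>, \<open>y_i = z_i - f_i\<close> and \<open>d_k\<close> for the greatest common divisor of the minors
of order \<open>k\<close>. These divisors exist because the determinant is a product of primes: each \<open>y_i\<close> is prime,
and so are the prime factors of \<open>h\<close> in \<open>K[z_n]\<close>.

Necessity is the Cauchy--Binet formula. Equivalent matrices have the same determinantal ideals, and
\<open>d_k\<close> is a minor of the Smith form, namely the product of its first \<open>k\<close> diagonal entries. So \<open>d_k\<close> is a
combination of the minors of \<open>F\<close>, that is, the reduced minors generate \<open>R\<close>.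

For sufficiency, the hypothesis says that every determinantal ideal of \<open>F\<close> is principal, generated by
\<open>d_k\<close>. This condition is the predicate \<open>det_ideal\<close>; it is stable under equivalence and under ring
homomorphisms and therefore survives all reductions below. It implies that the invariant factors
divide one another (\<open>principal_det_ideals_chain\<close>). Since the determinant is divisible by no \<open>y_i\<close> twice,
all the \<open>y_i\<close> divide the last invariant factor only; what remains of the invariant factors lies in
\<open>K[z_n]\<close>.

The equivalence is constructed by induction on the number of variables, over the rings
\<open>K(z_i : i \<in> I)[z_j : j \<in> J]\<close> (\<open>smith_ratpoly\<close>). With one variable left the ring is a principal
ideal domain, and the invariant factors are peeled off one at a time (\<open>smith_of_det_ideals\<close>). Otherwise let
\<open>x\<close> be the first variable of \<open>J\<close> and \<open>A\<close> the ring in the remaining ones, so that the whole ring is \<open>A[x]\<close>,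
and also \<open>A[y]\<close> for \<open>y = x - f\<close> with \<open>f \<in> A\<close>.

If \<open>y\<close> does not divide the last invariant factor, then the Smith form has entries in \<open>A\<close>, and \<open>F\<close> can be
shown to be equivalent to its value at \<open>y = 0\<close>, a matrix over \<open>A\<close>, to which the induction hypothesis
applies (\<open>const_equivalent_of_infinity\<close>). This is the argument of Quillen and Suslin, for matrices with
principal determinantal ideals. By induction, \<open>F\<close> is equivalent to its Smith form once the nonzero
polynomials in \<open>x\<close> and the variables \<open>I\<close> are inverted, hence once the polynomials in \<open>y\<close> with a unit as leading coefficient are inverted. Over
a local ring \<open>A\<close>, this implies equivalence over \<open>A[y]\<close> (\<open>horrocks_smith\<close>): there are two pairs of matrices with
\<open>X * S = F * Y\<close>, one with determinants that have unit leading coefficients, the other with determinants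
that are units modulo the maximal ideal. The columns of the two pairs are made equal one after the other,
and then the determinants are units. The equivalences over the local rings are glued by Quillen patching
(\<open>patch_const_equivalent\<close>, \<open>local_global_principle\<close>).

If \<open>y\<close> divides the last invariant factor, then modulo \<open>y\<close> this factor becomes zero, and the induction
hypothesis diagonalizes the residue of \<open>F\<close>. Thereby the last column becomes divisible by \<open>y\<close>. Dividing it by
\<open>y\<close> leads to a matrix of the first kind, and putting the factor back preserves the equivalence
(\<open>smith_step_variable\<close>).\<close>

section \<open>Matrices over a subring and their determinantal ideals\<close>

text \<open>The rings that occur are subsets of one field or of the polynomials over it. Localizations and
polynomial subrings depend on elements and on sets of variables, and with subsets their embeddings into
each other are inclusions.\<close>

definition subring_set :: "'a::comm_ring_1 set \<Rightarrow> bool" where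
  "subring_set A \<longleftrightarrow> 1 \<in> A \<and> (\<forall>x\<in>A. \<forall>y\<in>A. x - y \<in> A \<and> x * y \<in> A)"

lemma subring_one: "subring_set A \<Longrightarrow> 1 \<in> A"
  and subring_minus: "subring_set A \<Longrightarrow> x \<in> A \<Longrightarrow> y \<in> A \<Longrightarrow> x - y \<in> A"
  and subring_mult: "subring_set A \<Longrightarrow> x \<in> A \<Longrightarrow> y \<in> A \<Longrightarrow> x * y \<in> A"
  unfolding subring_set_def by auto

lemma subring_zero: "subring_set A \<Longrightarrow> 0 \<in> A"
  using subring_minus[of A 1 1] subring_one by auto

lemma subring_uminus: "subring_set A \<Longrightarrow> x \<in> A \<Longrightarrow> - x \<in> A"
  using subring_minus[of A 0 x] subring_zero by auto

lemma subring_add: "subring_set A \<Longrightarrow> x \<in> A \<Longrightarrow> y \<in> A \<Longrightarrow> x + y \<in> A"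
  using subring_minus[of A x "- y"] subring_uminus by auto

lemma subring_sum: "subring_set A \<Longrightarrow> (\<And>i. i \<in> I \<Longrightarrow> f i \<in> A) \<Longrightarrow> sum f I \<in> A"
  by (induction I rule: infinite_finite_induct) (auto simp: subring_zero subring_add)

lemma subring_prod: "subring_set A \<Longrightarrow> (\<And>i. i \<in> I \<Longrightarrow> f i \<in> A) \<Longrightarrow> prod f I \<in> A"
  by (induction I rule: infinite_finite_induct) (auto simp: subring_one subring_mult)

lemma subring_power: "subring_set A \<Longrightarrow> x \<in> A \<Longrightarrow> x ^ n \<in> A"
  by (induction n) (auto simp: subring_one subring_mult)

lemma subring_signof: "subring_set A \<Longrightarrow> signof p \<in> A"
  by (auto simp: sign_def subring_one subring_uminus)

lemmas subring_closed = subring_one subring_zero subring_uminus subring_minus subring_add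
  subring_mult subring_sum subring_prod subring_power subring_signof

definition mat_over :: "'a set \<Rightarrow> 'a mat \<Rightarrow> bool" where
  "mat_over A M \<longleftrightarrow> (\<forall>i<dim_row M. \<forall>j<dim_col M. M $$ (i, j) \<in> A)"

lemma mat_overD: "mat_over A M \<Longrightarrow> M \<in> carrier_mat n m \<Longrightarrow> i < n \<Longrightarrow> j < m \<Longrightarrow> M $$ (i, j) \<in> A"
  unfolding mat_over_def by auto

lemma mat_over_mat: "(\<And>i j. i < n \<Longrightarrow> j < m \<Longrightarrow> f (i, j) \<in> A) \<Longrightarrow> mat_over A (mat n m f)"
  unfolding mat_over_def by auto

lemma mat_over_mono: "mat_over A M \<Longrightarrow> A \<subseteq> B \<Longrightarrow> mat_over B M"
  unfolding mat_over_def by auto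

lemma mat_over_one: "subring_set A \<Longrightarrow> mat_over A (1\<^sub>m n)"
  unfolding mat_over_def by (auto simp: subring_closed)

lemma mat_over_mult:
  assumes "subring_set A" "mat_over A M" "mat_over A N" "M \<in> carrier_mat n k" "N \<in> carrier_mat k m"
  shows "mat_over A (M * N)"
  unfolding mat_over_def
proof (intro allI impI)
  fix i j assume "i < dim_row (M * N)" "j < dim_col (M * N)"
  then have i: "i < n" and j: "j < m" using assms by auto
  have "(M * N) $$ (i, j) = (\<Sum>l\<in>{0..<k}. M $$ (i, l) * N $$ (l, j))"
    using assms i j by (auto simp: scalar_prod_def intro!: sum.cong)
  then show "(M * N) $$ (i, j) \<in> A"
    using assms i j by (auto intro!: subring_closed mat_overD)
qed

lemma det_in_subring:
  assumes "subring_set A" "mat_over A M" "M \<in> carrier_mat n n"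
  shows "det M \<in> A"
  unfolding det_def'[OF assms(3)]
proof (intro subring_sum subring_mult subring_prod subring_signof mat_overD[OF assms(2,3)] assms(1))
  fix p i assume "p \<in> {p. p permutes {0..<n}}" "i \<in> {0..<n}"
  then show "p i < n" using permutes_in_image[of p "{0..<n}" i] by auto
qed auto

lemma mat_over_adj:
  assumes "subring_set A" "mat_over A M" "M \<in> carrier_mat n n"
  shows "mat_over A (adj_mat M)"
proof -
  have "det (mat_delete M j i) \<in> A" if "i < n" "j < n" for i j
  proof (rule det_in_subring[OF assms(1)])
    show "mat_delete M j i \<in> carrier_mat (n - 1) (n - 1)" using assms(3) by auto
    show "mat_over A (mat_delete M j i)"
      using assms(2,3) that unfolding mat_over_def mat_delete_def by auto
  qed
  then show ?thesis using assms
    unfolding mat_over_def adj_mat_def cofactor_def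
    by (auto intro!: subring_mult subring_power subring_uminus subring_one)
qed

definition GLs :: "'a::comm_ring_1 set \<Rightarrow> nat \<Rightarrow> 'a mat set" where
  "GLs A n = {U \<in> carrier_mat n n. mat_over A U \<and>
     (\<exists>U'\<in>carrier_mat n n. mat_over A U' \<and> U * U' = 1\<^sub>m n \<and> U' * U = 1\<^sub>m n)}"

lemma GLs_carrier: "U \<in> GLs A n \<Longrightarrow> U \<in> carrier_mat n n"
  and GLs_over: "U \<in> GLs A n \<Longrightarrow> mat_over A U"
  unfolding GLs_def by auto

lemma GLsI: "U \<in> carrier_mat n n \<Longrightarrow> mat_over A U \<Longrightarrow> U' \<in> carrier_mat n n \<Longrightarrow> mat_over A U' \<Longrightarrow>
   U * U' = 1\<^sub>m n \<Longrightarrow> U' * U = 1\<^sub>m n \<Longrightarrow> U \<in> GLs A n"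
  unfolding GLs_def by auto

lemma GLsE:
  assumes "U \<in> GLs A n"
  obtains U' where "U' \<in> GLs A n" "U * U' = 1\<^sub>m n" "U' * U = 1\<^sub>m n"
  using assms unfolding GLs_def by auto

lemma GLs_one: "subring_set A \<Longrightarrow> 1\<^sub>m n \<in> GLs A n"
  by (rule GLsI[of _ _ _ "1\<^sub>m n"]) (auto simp: mat_over_one)

lemma GLs_mono: "U \<in> GLs A n \<Longrightarrow> A \<subseteq> B \<Longrightarrow> U \<in> GLs B n"
  unfolding GLs_def using mat_over_mono by blast

lemma GLs_mult:
  assumes A: "subring_set A" and U: "U \<in> GLs A n" and V: "V \<in> GLs A n"
  shows "U * V \<in> GLs A n"
proof -
  obtain U' where U': "U' \<in> GLs A n" "U * U' = 1\<^sub>m n" "U' * U = 1\<^sub>m n" using GLsE[OF U] .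
  obtain V' where V': "V' \<in> GLs A n" "V * V' = 1\<^sub>m n" "V' * V = 1\<^sub>m n" using GLsE[OF V] .
  note c = GLs_carrier[OF U] GLs_carrier[OF V] GLs_carrier[OF U'(1)] GLs_carrier[OF V'(1)]
  note o = GLs_over[OF U] GLs_over[OF V] GLs_over[OF U'(1)] GLs_over[OF V'(1)]
  have "U * V * (V' * U') = U * (V * V') * U'" using c by (simp add: assoc_mult_mat[of _ n n _ n _ n])
  moreover have "V' * U' * (U * V) = V' * (U' * U) * V" using c by (simp add: assoc_mult_mat[of _ n n _ n _ n])
  ultimately show ?thesis using c o U' V' A
    by (intro GLsI[of _ _ _ "V' * U'"]) (auto intro: mat_over_mult)
qed

text \<open>One direction takes determinants, the other one uses the adjugate matrix.\<close>

lemma GLs_iff_det: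
  fixes U :: "'a::idom mat"
  assumes A: "subring_set A" and U: "U \<in> carrier_mat n n" "mat_over A U"
  shows "U \<in> GLs A n \<longleftrightarrow> (\<exists>e\<in>A. det U * e = 1)"
proof
  assume "U \<in> GLs A n"
  then obtain U' where U': "U' \<in> GLs A n" "U * U' = 1\<^sub>m n" by (rule GLsE)
  have "det U * det U' = 1"
    using det_mult[OF U(1) GLs_carrier[OF U'(1)]] U'(2) by simp
  moreover have "det U' \<in> A" using U'(1) by (auto intro: det_in_subring[OF A] GLs_carrier GLs_over)
  ultimately show "\<exists>e\<in>A. det U * e = 1" by blast
next
  assume "\<exists>e\<in>A. det U * e = 1"
  then obtain e where e: "e \<in> A" "det U * e = 1" by blast
  note adj = adj_mat[OF U(1)]
  show "U \<in> GLs A n"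
  proof (rule GLsI[OF U, of "e \<cdot>\<^sub>m adj_mat U"])
    show "mat_over A (e \<cdot>\<^sub>m adj_mat U)"
      using mat_over_adj[OF A U(2,1)] e(1) A unfolding mat_over_def by (auto intro: subring_mult)
    show "U * (e \<cdot>\<^sub>m adj_mat U) = 1\<^sub>m n"
      using mult_smult_distrib[OF U(1) adj(1)] adj(2) e(2)
      by (auto intro!: eq_matI simp: ac_simps)
    show "(e \<cdot>\<^sub>m adj_mat U) * U = 1\<^sub>m n"
      using mult_smult_assoc_mat[OF adj(1) U(1)] adj(3) e(2)
      by (auto intro!: eq_matI simp: ac_simps)
  qed (use adj in auto)
qed

definition eqv :: "'a::comm_ring_1 set \<Rightarrow> nat \<Rightarrow> 'a mat \<Rightarrow> 'a mat \<Rightarrow> bool" where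
  "eqv A n F G \<longleftrightarrow> (\<exists>U\<in>GLs A n. \<exists>V\<in>GLs A n. F = U * G * V)"

lemma eqvI: "U \<in> GLs A n \<Longrightarrow> V \<in> GLs A n \<Longrightarrow> F = U * G * V \<Longrightarrow> eqv A n F G"
  unfolding eqv_def by auto

lemma eqv_refl: "subring_set A \<Longrightarrow> G \<in> carrier_mat n n \<Longrightarrow> eqv A n G G"
  by (rule eqvI[OF GLs_one GLs_one]) auto

lemma mult_cancel_inverses:
  fixes U :: "'a::comm_ring_1 mat"
  assumes "U \<in> carrier_mat n n" "V \<in> carrier_mat n n" "U' \<in> carrier_mat n n" "V' \<in> carrier_mat n n"
    and "G \<in> carrier_mat n n" "U' * U = 1\<^sub>m n" "V * V' = 1\<^sub>m n"
  shows "U' * (U * G * V) * V' = G"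
proof -
  have "U' * (U * G * V) * V' = (U' * U) * G * (V * V')"
    using assms(1-5) by (simp add: assoc_mult_mat[of _ n n _ n _ n])
  also have "\<dots> = G" using assms(5-7) by simp
  finally show ?thesis .
qed

lemma eqv_sym:
  assumes "eqv A n F G" "G \<in> carrier_mat n n" shows "eqv A n G F"
proof -
  obtain U V where U: "U \<in> GLs A n" and V: "V \<in> GLs A n" and F: "F = U * G * V"
    using assms unfolding eqv_def by auto
  obtain U' where U': "U' \<in> GLs A n" "U * U' = 1\<^sub>m n" "U' * U = 1\<^sub>m n" using GLsE[OF U] .
  obtain V' where V': "V' \<in> GLs A n" "V * V' = 1\<^sub>m n" "V' * V = 1\<^sub>m n" using GLsE[OF V] .
  show ?thesis using U V U' V' assms(2) unfolding F
    by (intro eqvI[OF U'(1) V'(1)] mult_cancel_inverses[symmetric]) (auto dest: GLs_carrier)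
qed

lemma eqv_trans:
  assumes A: "subring_set A" and "eqv A n F G" "eqv A n G H" "H \<in> carrier_mat n n"
  shows "eqv A n F H"
proof -
  obtain U V where U: "U \<in> GLs A n" and V: "V \<in> GLs A n" and F: "F = U * G * V"
    using assms unfolding eqv_def by auto
  obtain U' V' where U': "U' \<in> GLs A n" and V': "V' \<in> GLs A n" and G: "G = U' * H * V'"
    using assms unfolding eqv_def by auto
  have "F = (U * U') * H * (V' * V)"
    using GLs_carrier[OF U] GLs_carrier[OF V] GLs_carrier[OF U'] GLs_carrier[OF V'] assms(4)
    unfolding F G by (simp add: assoc_mult_mat[of _ n n _ n _ n])
  then show ?thesis by (intro eqvI[OF GLs_mult[OF A U U'] GLs_mult[OF A V' V]])
qed

lemma eqv_carrier: "eqv A n F G \<Longrightarrow> F \<in> carrier_mat n n"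
  unfolding eqv_def by (auto dest!: GLs_carrier)

lemma eqv_over:
  assumes "subring_set A" "eqv A n F G" "G \<in> carrier_mat n n" "mat_over A G"
  shows "mat_over A F"
proof -
  obtain U V where U: "U \<in> GLs A n" and V: "V \<in> GLs A n" and F: "F = U * G * V"
    using assms unfolding eqv_def by auto
  show ?thesis unfolding F using assms GLs_carrier[OF U] GLs_carrier[OF V] GLs_over[OF U] GLs_over[OF V]
    by (auto intro!: mat_over_mult[of _ _ _ n n n])
qed

lemma eqv_mono: "eqv A n F G \<Longrightarrow> A \<subseteq> B \<Longrightarrow> eqv B n F G"
  unfolding eqv_def using GLs_mono by blast

subsection \<open>Linear spans and minors\<close>

text \<open>The \<open>A\<close>-submodule generated by \<open>M\<close>. The inductive form adds one multiple at a time and gives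
an induction rule for combinations.\<close>

inductive_set lin :: "'a::comm_ring_1 set \<Rightarrow> 'a set \<Rightarrow> 'a set" for A M where
  zero: "0 \<in> lin A M"
| step: "c \<in> A \<Longrightarrow> m \<in> M \<Longrightarrow> v \<in> lin A M \<Longrightarrow> c * m + v \<in> lin A M"

lemma lin_add: "u \<in> lin A M \<Longrightarrow> v \<in> lin A M \<Longrightarrow> u + v \<in> lin A M"
  by (induction u rule: lin.induct) (auto simp: add.assoc intro: lin.intros)

lemma lin_gen: "subring_set A \<Longrightarrow> m \<in> M \<Longrightarrow> m \<in> lin A M"
  using lin.step[of 1 A m M 0] by (simp add: subring_one lin.zero)

lemma lin_mult:
  assumes "subring_set A" "a \<in> A" "u \<in> lin A M" shows "a * u \<in> lin A M"
  using assms(3)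
proof (induction u rule: lin.induct)
  case zero then show ?case by (simp add: lin.zero)
next
  case (step c m v)
  have "(a * c) * m + a * v \<in> lin A M" using step assms by (intro lin.step) (auto intro: subring_mult)
  then show ?case by (simp add: algebra_simps)
qed

lemma lin_sum: "(\<And>i. i \<in> I \<Longrightarrow> f i \<in> lin A M) \<Longrightarrow> sum f I \<in> lin A M"
  by (induction I rule: infinite_finite_induct) (auto simp: lin.zero lin_add)

lemma lin_trans:
  assumes "subring_set A" "M \<subseteq> lin A N" "u \<in> lin A M" shows "u \<in> lin A N"
  using assms(3) by (induction u rule: lin.induct) (use assms in \<open>auto simp: lin.zero intro!: lin_add lin_mult\<close>)

lemma lin_mono:
  assumes "A \<subseteq> B" "M \<subseteq> N" "u \<in> lin A M" shows "u \<in> lin B N"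
  using assms(3) by (induction u rule: lin.induct) (use assms in \<open>auto intro: lin.intros\<close>)

lemma lin_closed_ideal:
  assumes "u \<in> lin A M" and "0 \<in> I" and "\<And>c m v. c \<in> A \<Longrightarrow> m \<in> M \<Longrightarrow> v \<in> I \<Longrightarrow> c * m + v \<in> I"
  shows "u \<in> I"
  using assms(1) by induction (use assms in auto)

text \<open>The row and column maps need not be increasing or injective. Expansions and products of matrices then
produce minors again, without any sorting of indices; the additional minors are zero or equal to other
ones up to sign.\<close>

definition minor :: "nat \<Rightarrow> (nat \<Rightarrow> nat) \<Rightarrow> (nat \<Rightarrow> nat) \<Rightarrow> 'a::comm_ring_1 mat \<Rightarrow> 'a" where
  "minor k f g F = det (mat k k (\<lambda>(i, j). F $$ (f i, g j)))"

definition kminors :: "nat \<Rightarrow> nat \<Rightarrow> 'a::comm_ring_1 mat \<Rightarrow> 'a set" where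
  "kminors n k F = {minor k f g F | f g. \<forall>i<k. f i < n \<and> g i < n}"

lemma kminorsI: "(\<And>i. i < k \<Longrightarrow> f i < n \<and> g i < n) \<Longrightarrow> minor k f g F \<in> kminors n k F"
  unfolding kminors_def by blast

lemma minor_in_subring:
  assumes "subring_set A" "mat_over A F" "F \<in> carrier_mat n n" "m \<in> kminors n k F"
  shows "m \<in> A"
proof -
  obtain f g where m: "m = minor k f g F" "\<forall>i<k. f i < n \<and> g i < n"
    using assms(4) unfolding kminors_def by auto
  show ?thesis unfolding m(1) minor_def using assms m(2)
    by (intro det_in_subring) (auto intro!: mat_over_mat mat_overD)
qed

text \<open>The rows of \<open>P * M\<close> are combinations of the rows of \<open>M\<close>, and the determinant is multilinear in the rows.\<close>

lemma det_mult_lin_rows: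
  fixes P M :: "'a::comm_ring_1 mat"
  assumes A: "subring_set A" and P: "P \<in> carrier_mat k n" "mat_over A P" and M: "M \<in> carrier_mat n k"
  shows "det (P * M) \<in> lin A {det (mat k k (\<lambda>(i, j). M $$ (f i, j))) | f. \<forall>i<k. f i < n}"
    (is "_ \<in> lin A ?S")
proof -
  let ?F = "{f. (\<forall>i\<in>{0..<k}. f i \<in> {0..<n}) \<and> (\<forall>i. i \<notin> {0..<k} \<longrightarrow> f i = i)}"
  have "det (P * M) = (\<Sum>f\<in>?F. det (mat\<^sub>r k k (\<lambda>i. P $$ (i, f i) \<cdot>\<^sub>v row M (f i))))"
    unfolding mat_mul_finsum_alt[OF P(1) M]
    by (rule det_linear_rows_sum) (use M in auto)
  also have "\<dots> = (\<Sum>f\<in>?F. (\<Prod>i\<in>{0..<k}. P $$ (i, f i)) * det (mat k k (\<lambda>(i, j). M $$ (f i, j))))"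
  proof (rule sum.cong[OF refl])
    fix f assume f: "f \<in> ?F"
    have "det (mat\<^sub>r k k (\<lambda>i. P $$ (i, f i) \<cdot>\<^sub>v row M (f i)))
        = (\<Prod>i\<in>{0..<k}. P $$ (i, f i)) * det (mat\<^sub>r k k (\<lambda>i. row M (f i)))"
      by (rule det_rows_mul) (use M in auto)
    moreover have "mat\<^sub>r k k (\<lambda>i. row M (f i)) = mat k k (\<lambda>(i, j). M $$ (f i, j))"
      using M f by (intro eq_matI) auto
    ultimately show "det (mat\<^sub>r k k (\<lambda>i. P $$ (i, f i) \<cdot>\<^sub>v row M (f i)))
        = (\<Prod>i\<in>{0..<k}. P $$ (i, f i)) * det (mat k k (\<lambda>(i, j). M $$ (f i, j)))" by simp
  qed
  also have "\<dots> \<in> lin A ?S"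
  proof (intro lin_sum lin_mult[OF A] lin_gen[OF A])
    fix f assume f: "f \<in> ?F"
    show "(\<Prod>i\<in>{0..<k}. P $$ (i, f i)) \<in> A" using f P A
      by (intro subring_prod) (auto intro: mat_overD)
    show "det (mat k k (\<lambda>(i, j). M $$ (f i, j))) \<in> ?S" using f by auto
  qed
  finally show ?thesis .
qed

text \<open>One half of the Cauchy--Binet formula: the minors of a product \<open>P * F * Q\<close> are combinations
  of the minors of \<open>F\<close>.\<close>

lemma minors_mult_subset:
  fixes F :: "'a::comm_ring_1 mat"
  assumes A: "subring_set A" and P: "P \<in> carrier_mat n n" "mat_over A P"
    and Q: "Q \<in> carrier_mat n n" "mat_over A Q" and F: "F \<in> carrier_mat n n"
    and m: "m \<in> kminors n k (P * F * Q)"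
  shows "m \<in> lin A (kminors n k F)"
proof -
  obtain f g where m: "m = minor k f g (P * F * Q)" "\<forall>i<k. f i < n \<and> g i < n"
    using m unfolding kminors_def by auto
  define P' where "P' = mat k n (\<lambda>(i, j). P $$ (f i, j))"
  define Q' where "Q' = mat n k (\<lambda>(i, j). Q $$ (i, g j))"
  have P': "P' \<in> carrier_mat k n" "mat_over A P'" and Q': "Q' \<in> carrier_mat n k" "mat_over A Q'"
    unfolding P'_def Q'_def using P Q m(2) by (auto intro!: mat_over_mat mat_overD)
  have "mat k k (\<lambda>(i, j). (P * F * Q) $$ (f i, g j)) = P' * F * Q'"
  proof (rule eq_matI)
    fix i j assume "i < dim_row (P' * F * Q')" "j < dim_col (P' * F * Q')"
    then have i: "i < k" and j: "j < k" using P' Q' by auto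
    have r: "row P' i = row P (f i)" using i m(2) P unfolding P'_def by (auto intro!: eq_vecI)
    have c: "col Q' j = col Q (g j)" using j m(2) Q unfolding Q'_def by (auto intro!: eq_vecI)
    have r2: "row (P' * F) i = row (P * F) (f i)"
      using i m(2) P P' F r by (auto intro!: eq_vecI)
    have "(P' * F * Q') $$ (i, j) = row (P' * F) i \<bullet> col Q' j"
      by (rule index_mult_mat(1)) (use i j P' Q' in auto)
    moreover have "(P * F * Q) $$ (f i, g j) = row (P * F) (f i) \<bullet> col Q (g j)"
      by (rule index_mult_mat(1)) (use i j m(2) P Q in auto)
    ultimately show "mat k k (\<lambda>(i, j). (P * F * Q) $$ (f i, g j)) $$ (i, j) = (P' * F * Q') $$ (i, j)"
      using i j r2 c by simp
  qed (use P' Q' in auto)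
  then have m1: "m = det (P' * (F * Q'))" using m P' Q' F unfolding minor_def
    by (simp add: assoc_mult_mat[of _ k n _ n _ k])
  have FQ: "F * Q' \<in> carrier_mat n k" using F Q' by auto
  have "det (P' * (F * Q')) \<in> lin A {det (mat k k (\<lambda>(i, j). (F * Q') $$ (f i, j))) | f. \<forall>i<k. f i < n}"
    by (rule det_mult_lin_rows[OF A P' FQ])
  moreover have "{det (mat k k (\<lambda>(i, j). (F * Q') $$ (f i, j))) | f. \<forall>i<k. f i < n} \<subseteq> lin A (kminors n k F)"
  proof clarify
    fix h :: "nat \<Rightarrow> nat" assume h: "\<forall>i<k. h i < n"
    define F' where "F' = mat k n (\<lambda>(i, j). F $$ (h i, j))"
    have F': "F' \<in> carrier_mat k n" unfolding F'_def by auto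
    have QT: "transpose_mat Q' \<in> carrier_mat k n" "mat_over A (transpose_mat Q')"
      using Q' unfolding mat_over_def by auto
    have "mat k k (\<lambda>(i, j). (F * Q') $$ (h i, j)) = F' * Q'"
    proof (rule eq_matI)
      fix i j assume "i < dim_row (F' * Q')" "j < dim_col (F' * Q')"
      then have i: "i < k" and j: "j < k" using F' Q' by auto
      have "row F' i = row F (h i)" using i h F unfolding F'_def by (auto intro!: eq_vecI)
      then show "mat k k (\<lambda>(i, j). (F * Q') $$ (h i, j)) $$ (i, j) = (F' * Q') $$ (i, j)"
        using i j h F Q' F' by simp
    qed (use F' Q' in auto)
    then have "det (mat k k (\<lambda>(i, j). (F * Q') $$ (h i, j))) = det (transpose_mat (F' * Q'))"
      using F' Q' by (simp add: det_transpose[of _ k])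
    also have "transpose_mat (F' * Q') = transpose_mat Q' * transpose_mat F'"
      by (rule transpose_mult[OF F' Q'(1)])
    finally have e: "det (mat k k (\<lambda>(i, j). (F * Q') $$ (h i, j))) = det (transpose_mat Q' * transpose_mat F')" .
    have "det (transpose_mat Q' * transpose_mat F')
      \<in> lin A {det (mat k k (\<lambda>(i, j). transpose_mat F' $$ (f i, j))) | f. \<forall>i<k. f i < n}"
      by (rule det_mult_lin_rows[OF A QT]) (use F' in auto)
    moreover have "{det (mat k k (\<lambda>(i, j). transpose_mat F' $$ (f i, j))) | f. \<forall>i<k. f i < n} \<subseteq> kminors n k F"
    proof clarify
      fix g :: "nat \<Rightarrow> nat" assume g: "\<forall>i<k. g i < n"
      have "mat k k (\<lambda>(i, j). transpose_mat F' $$ (g i, j)) = transpose_mat (mat k k (\<lambda>(i, j). F $$ (h i, g j)))"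
        using g F' unfolding F'_def by (intro eq_matI) auto
      then have "det (mat k k (\<lambda>(i, j). transpose_mat F' $$ (g i, j))) = minor k h g F"
        unfolding minor_def by (simp add: det_transpose[of _ k])
      then show "det (mat k k (\<lambda>(i, j). transpose_mat F' $$ (g i, j))) \<in> kminors n k F"
        using g h by (auto intro: kminorsI)
    qed
    ultimately show "det (mat k k (\<lambda>(i, j). (F * Q') $$ (h i, j))) \<in> lin A (kminors n k F)"
      unfolding e using lin_mono by blast
  qed
  ultimately show ?thesis unfolding m1 using lin_trans[OF A] by blast
qed

text \<open>The ideal of \<open>A\<close> generated by the minors of order \<open>k\<close> is principal, with generator \<open>d\<close>.\<close>

definition det_ideal :: "'a::comm_ring_1 set \<Rightarrow> nat \<Rightarrow> nat \<Rightarrow> 'a mat \<Rightarrow> 'a \<Rightarrow> bool" where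
  "det_ideal A n k F d \<longleftrightarrow> (\<forall>m\<in>kminors n k F. \<exists>c\<in>A. m = d * c) \<and> d \<in> lin A (kminors n k F)"

lemma lin_multiple:
  assumes A: "subring_set A" and "u \<in> lin A M" "\<forall>m\<in>M. \<exists>c\<in>A. m = d * c"
  shows "\<exists>c\<in>A. u = d * c"
  using assms(2)
proof induction
  case zero then show ?case using subring_zero[OF A] by (intro bexI[of _ 0]) auto
next
  case (step a m v)
  then obtain c c' where "c \<in> A" "m = d * c" "c' \<in> A" "v = d * c'" using assms(3) by blast
  then show ?case using step A
    by (intro bexI[of _ "a * c + c'"]) (auto intro: subring_closed simp: algebra_simps)
qed

lemma det_ideal_mono:
  assumes "det_ideal A n k F d" "A \<subseteq> B" shows "det_ideal B n k F d"
  using assms lin_mono[OF assms(2) subset_refl] unfolding det_ideal_def by blast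

lemma det_ideal_eqv:
  assumes A: "subring_set A" and G: "G \<in> carrier_mat n n" and e: "eqv A n F G" and d: "det_ideal A n k G d"
  shows "det_ideal A n k F d"
proof -
  have F: "F \<in> carrier_mat n n" using eqv_carrier[OF e] .
  have sub: "m \<in> lin A (kminors n k G')"
    if e': "eqv A n F' G'" "G' \<in> carrier_mat n n" "m \<in> kminors n k F'" for F' G' m
  proof -
    obtain U V where U: "U \<in> GLs A n" and V: "V \<in> GLs A n" and F: "F' = U * G' * V"
      using e'(1) unfolding eqv_def by blast
    show ?thesis using minors_mult_subset[OF A, of U n V G' m k] e' U V
      by (simp add: F GLs_carrier GLs_over)
  qed
  have "\<exists>c\<in>A. m = d * c" if "m \<in> kminors n k F" for m
    using lin_multiple[OF A sub[OF e G that]] d unfolding det_ideal_def by blast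
  moreover have "d \<in> lin A (kminors n k F)"
    using d sub[OF eqv_sym[OF e G] F] lin_trans[OF A] unfolding det_ideal_def by blast
  ultimately show ?thesis unfolding det_ideal_def by blast
qed

section \<open>Rings that are Euclidean modulo their radical\<close>

lemma mat_mult_entry:
  "M \<in> carrier_mat n k \<Longrightarrow> N \<in> carrier_mat k m \<Longrightarrow> i < n \<Longrightarrow> j < m \<Longrightarrow>
    (M * N) $$ (i, j) = (\<Sum>l\<in>{0..<k}. M $$ (i, l) * N $$ (l, j))"
  by (auto simp: scalar_prod_def intro!: sum.cong)

lemma eqv_left: "subring_set A \<Longrightarrow> U \<in> GLs A n \<Longrightarrow> G \<in> carrier_mat n n \<Longrightarrow> eqv A n (U * G) G"
  by (rule eqvI[OF _ GLs_one]) (auto dest: GLs_carrier)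

lemma eqv_right: "subring_set A \<Longrightarrow> V \<in> GLs A n \<Longrightarrow> G \<in> carrier_mat n n \<Longrightarrow> eqv A n (G * V) G"
  by (rule eqvI[OF GLs_one]) (auto dest: GLs_carrier)

lemma addrow_mat_GLs:
  fixes a :: "'a::idom"
  assumes A: "subring_set A" and "a \<in> A" "k < n" "l < n" "k \<noteq> l"
  shows "addrow_mat n a k l \<in> GLs A n"
proof -
  have "mat_over A (addrow_mat n a k l)"
    using assms unfolding addrow_mat_def by (auto intro!: mat_over_mat simp: subring_closed)
  then show ?thesis
    using det_addrow_mat[OF assms(5), of n a] subring_one[OF A] by (subst GLs_iff_det[OF A]) auto
qed

lemma eqv_addrow:
  fixes G :: "'a::idom mat"
  assumes "subring_set A" "a \<in> A" "k < n" "l < n" "k \<noteq> l" and G: "G \<in> carrier_mat n n"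
  shows "eqv A n (addrow a k l G) G"
  unfolding addrow_mat[OF G assms(4)] by (intro eqv_left addrow_mat_GLs assms)

lemma eqv_addcol:
  fixes G :: "'a::idom mat"
  assumes "subring_set A" "a \<in> A" "k < n" "l < n" "k \<noteq> l" and G: "G \<in> carrier_mat n n"
  shows "eqv A n (addcol a k l G) G"
  unfolding addcol_mat[OF G assms(4)] by (intro eqv_right addrow_mat_GLs assms) (use assms in auto)

lemma swaprows_mat_GLs:
  fixes A :: "'a::idom set"
  assumes A: "subring_set A" and "k < n" "l < n"
  shows "swaprows_mat n k l \<in> GLs A n"
proof -
  have "mat_over A (swaprows_mat n k l)"
    using A unfolding swaprows_mat_def by (auto intro!: mat_over_mat simp: subring_closed)
  then show ?thesis
    using assms swaprows_mat_inv by (intro GLsI[of _ _ _ "swaprows_mat n k l"]) auto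
qed

lemma eqv_swap:
  fixes G :: "'a::idom mat"
  assumes A: "subring_set A" and "k < n" "l < n" "i < n" "j < n" and G: "G \<in> carrier_mat n n"
  shows "eqv A n (swaprows k i (swapcols l j G)) G"
proof -
  have "eqv A n (swaprows k i (swapcols l j G)) (swapcols l j G)"
    by (subst swaprows_mat[where n = n and nc = n]) (use assms in \<open>auto intro!: eqv_left swaprows_mat_GLs\<close>)
  moreover have "eqv A n (swapcols l j G) G"
    by (subst swapcols_mat[where nr = n and n = n]) (use assms in \<open>auto intro!: eqv_right swaprows_mat_GLs\<close>)
  ultimately show ?thesis using eqv_trans[OF A] G by blast
qed

text \<open>The block diagonal matrix with blocks \<open>1\<close> and \<open>G\<close>.\<close>

definition one_dsum :: "nat \<Rightarrow> 'a::comm_ring_1 mat \<Rightarrow> 'a mat" where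
  "one_dsum m G = four_block_mat (1\<^sub>m 1) (0\<^sub>m 1 m) (0\<^sub>m m 1) G"

lemma one_dsum_carrier: "G \<in> carrier_mat m m \<Longrightarrow> one_dsum m G \<in> carrier_mat (Suc m) (Suc m)"
  unfolding one_dsum_def carrier_mat_def by auto

lemma one_dsum_index:
  "G \<in> carrier_mat m m \<Longrightarrow> i < Suc m \<Longrightarrow> j < Suc m \<Longrightarrow> one_dsum m G $$ (i, j) =
    (if i = 0 \<and> j = 0 then 1 else if i = 0 \<or> j = 0 then 0 else G $$ (i - 1, j - 1))"
  unfolding one_dsum_def by auto

lemma one_dsum_over:
  "subring_set A \<Longrightarrow> G \<in> carrier_mat m m \<Longrightarrow> mat_over A G \<Longrightarrow> mat_over A (one_dsum m G)"
  unfolding mat_over_def[of A "one_dsum m G"]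
  using one_dsum_carrier[of G m] by (auto simp: one_dsum_index subring_closed intro!: mat_overD)

lemma one_dsum_mult:
  "G \<in> carrier_mat m m \<Longrightarrow> H \<in> carrier_mat m m \<Longrightarrow> one_dsum m (G * H) = one_dsum m G * one_dsum m H"
  unfolding one_dsum_def by (subst mult_four_block_mat[of _ 1 1 _ m _ m _ _ 1 _ m]) auto

lemma one_dsum_one: "one_dsum m (1\<^sub>m m) = 1\<^sub>m (Suc m)"
  unfolding one_dsum_def by auto

lemma one_dsum_GLs:
  assumes A: "subring_set A" and U: "U \<in> GLs A m" shows "one_dsum m U \<in> GLs A (Suc m)"
proof -
  obtain U' where U': "U' \<in> GLs A m" "U * U' = 1\<^sub>m m" "U' * U = 1\<^sub>m m" using GLsE[OF U] .
  note c = GLs_carrier[OF U] GLs_carrier[OF U'(1)]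
  have "one_dsum m U * one_dsum m U' = 1\<^sub>m (Suc m)" "one_dsum m U' * one_dsum m U = 1\<^sub>m (Suc m)"
    using one_dsum_mult[OF c] one_dsum_mult[OF c(2,1)] U'(2,3) one_dsum_one by metis+
  then show ?thesis
    using one_dsum_carrier[OF c(1)] one_dsum_carrier[OF c(2)]
      one_dsum_over[OF A c(1) GLs_over[OF U]] one_dsum_over[OF A c(2) GLs_over[OF U'(1)]]
    by (intro GLsI[of _ _ _ "one_dsum m U'"])
qed

lemma eqv_one_dsum:
  assumes A: "subring_set A" and e: "eqv A m F G" and G: "G \<in> carrier_mat m m"
  shows "eqv A (Suc m) (one_dsum m F) (one_dsum m G)"
proof -
  obtain U V where U: "U \<in> GLs A m" and V: "V \<in> GLs A m" and F: "F = U * G * V"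
    using e unfolding eqv_def by auto
  have c: "U \<in> carrier_mat m m" "V \<in> carrier_mat m m" "U * G \<in> carrier_mat m m"
    using GLs_carrier[OF U] GLs_carrier[OF V] G by auto
  show ?thesis unfolding F
    by (rule eqvI[OF one_dsum_GLs[OF A U] one_dsum_GLs[OF A V]])
       (simp only: one_dsum_mult[OF c(3,2)] one_dsum_mult[OF c(1) G])
qed

text \<open>Schur complement: a pivot equal to 1 in the corner splits off a direct summand.\<close>

lemma split_off_one:
  fixes F :: "'a::idom mat"
  assumes A: "subring_set A" and F: "F \<in> carrier_mat (Suc m) (Suc m)" "mat_over A F" and p: "F $$ (0, 0) = 1"
  shows "\<exists>G\<in>carrier_mat m m. mat_over A G \<and> eqv A (Suc m) F (one_dsum m G)"
proof -
  define B where "B = mat 1 m (\<lambda>(i, j). F $$ (0, Suc j))"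
  define C where "C = mat m 1 (\<lambda>(i, j). F $$ (Suc i, 0))"
  define D where "D = mat m m (\<lambda>(i, j). F $$ (Suc i, Suc j))"
  have c: "B \<in> carrier_mat 1 m" "C \<in> carrier_mat m 1" "D \<in> carrier_mat m m"
    unfolding B_def C_def D_def by auto
  have o: "mat_over A B" "mat_over A C" "mat_over A D"
    unfolding B_def C_def D_def using F by (auto intro!: mat_over_mat mat_overD[OF F(2,1)])
  have Fb: "F = four_block_mat (1\<^sub>m 1) B C D"
    using F(1) p unfolding B_def C_def D_def by (intro eq_matI) auto
  define G where "G = D - C * B"
  have G: "G \<in> carrier_mat m m" using c unfolding G_def by auto
  have "mat_over A (C * B)" using c o A by (intro mat_over_mult[of _ _ _ m 1 m])
  then have oG: "mat_over A G" using c o A unfolding G_def mat_over_def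
    by (auto intro: subring_minus)
  define L where "L c = four_block_mat (1\<^sub>m 1) (0\<^sub>m 1 m) c (1\<^sub>m m)" for c :: "'a mat"
  define R where "R b = four_block_mat (1\<^sub>m 1) b (0\<^sub>m m 1) (1\<^sub>m m)" for b :: "'a mat"
  have cL: "L C \<in> carrier_mat (Suc m) (Suc m)" and cR: "R B \<in> carrier_mat (Suc m) (Suc m)"
    unfolding L_def R_def carrier_mat_def by auto
  have "det (L C) = 1" "det (R B) = 1" unfolding L_def R_def
    using det_four_block_mat_upper_right_zero[of "1\<^sub>m 1 :: 'a mat" 1 "0\<^sub>m 1 m" m C "1\<^sub>m m"]
      det_four_block_mat_lower_left_zero[of "1\<^sub>m 1 :: 'a mat" 1 B m "0\<^sub>m m 1" "1\<^sub>m m"] c by auto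
  moreover have "mat_over A (L C)" "mat_over A (R B)"
    using o c A unfolding L_def R_def mat_over_def by (auto simp: subring_closed)
  ultimately have gl: "L C \<in> GLs A (Suc m)" "R B \<in> GLs A (Suc m)"
    using GLs_iff_det[OF A cL] GLs_iff_det[OF A cR] subring_one[OF A] by auto
  have "L C * one_dsum m G = four_block_mat (1\<^sub>m 1) (0\<^sub>m 1 m) C G"
    unfolding L_def one_dsum_def using c G by (subst mult_four_block_mat[of _ 1 1 _ m _ m _ _ 1 _ m]) auto
  then have "L C * one_dsum m G * R B = four_block_mat (1\<^sub>m 1) B C (C * B + G)"
    unfolding R_def using c G by (simp, subst mult_four_block_mat[of _ 1 1 _ m _ m _ _ 1 _ m]) auto
  moreover have "C * B + G = D" using c unfolding G_def by (intro eq_matI) auto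
  ultimately have "F = L C * one_dsum m G * R B" using Fb by simp
  then show ?thesis using G oG gl by (auto intro: eqvI)
qed

text \<open>Division with remainder is only required modulo an ideal \<open>J\<close> of the Jacobson radical. This
covers three cases at once: polynomials over a field (\<open>J = 0\<close>), local rings (\<open>J\<close> the maximal ideal, \<open>e\<close>
constant), and polynomials over a local ring after inverting those that are 1 modulo the maximal ideal.\<close>

locale euclidean_mod_radical =
  fixes C J :: "'f::field set" and e :: "'f \<Rightarrow> nat"
  assumes C: "subring_set C"
    and J_subset: "J \<subseteq> C" and J_zero: "0 \<in> J"
    and J_add: "x \<in> J \<Longrightarrow> y \<in> J \<Longrightarrow> x + y \<in> J"
    and J_mult: "c \<in> C \<Longrightarrow> x \<in> J \<Longrightarrow> c * x \<in> J"
    and J_radical: "x \<in> J \<Longrightarrow> \<exists>u\<in>C. (1 + x) * u = 1"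
    and division: "a \<in> C \<Longrightarrow> b \<in> C \<Longrightarrow> b \<notin> J \<Longrightarrow> \<exists>q\<in>C. a - q * b \<in> J \<or> e (a - q * b) < e b"
    and e_cong: "a \<in> C \<Longrightarrow> x \<in> J \<Longrightarrow> e (a + x) = e a"
begin

lemma J_minus: "x \<in> J \<Longrightarrow> - x \<in> J"
  using J_mult[of "-1" x] subring_uminus[OF C subring_one[OF C]] by auto

text \<open>An entry outside the radical of least size, among all matrices equivalent to \<open>F\<close>, divides
  every entry modulo the radical, as in the Smith algorithm. As the entries of \<open>F\<close> generate the unit
  ideal, it is a unit.\<close>

lemma unit_pivot:
  assumes F: "F \<in> carrier_mat n n" "mat_over C F"
    and one: "1 \<in> lin C {F $$ (i, j) | i j. i < n \<and> j < n}"
  shows "\<exists>G i j u. eqv C n G F \<and> i < n \<and> j < n \<and> u \<in> C \<and> G $$ (i, j) * u = 1"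
proof -
  define att where "att d \<longleftrightarrow> (\<exists>G i j. eqv C n G F \<and> i < n \<and> j < n \<and> G $$ (i, j) \<notin> J \<and> e (G $$ (i, j)) = d)" for d
  have "1 \<notin> J"
  proof
    assume "1 \<in> J"
    then have "-1 \<in> J" by (rule J_minus)
    then show False using J_radical[of "-1"] by auto
  qed
  have "\<exists>d. att d"
  proof (rule ccontr)
    assume no: "\<not> ?thesis"
    have "F $$ (i, j) \<in> J" if "i < n" "j < n" for i j
      using no that eqv_refl[OF C F(1)] unfolding att_def by blast
    then have "1 \<in> J"
      by (intro lin_closed_ideal[OF one]) (auto intro: J_zero J_add J_mult)
    then show False using \<open>1 \<notin> J\<close> by blast
  qed
  define d where "d = (LEAST d. att d)"
  have "att d" unfolding d_def using \<open>\<exists>d. att d\<close> by (auto intro: LeastI)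
  then obtain G i j where G: "eqv C n G F" and ij: "i < n" "j < n" and nJ: "G $$ (i, j) \<notin> J"
    and ed: "e (G $$ (i, j)) = d" unfolding att_def by auto
  have least: "d \<le> e (H $$ (k, l))" if "eqv C n H F" "k < n" "l < n" "H $$ (k, l) \<notin> J" for H k l
    unfolding d_def by (rule Least_le) (use that att_def in blast)
  define a where "a = G $$ (i, j)"
  have cG: "G \<in> carrier_mat n n" "mat_over C G"
    using eqv_carrier[OF G] eqv_over[OF C G F] .
  have aC: "a \<in> C" unfolding a_def using mat_overD[OF cG(2,1) ij] .
  define aJ where "aJ = {x. \<exists>c\<in>C. x - c * a \<in> J}"
  have aJ_add: "x + y \<in> aJ" if xy: "x \<in> aJ" "y \<in> aJ" for x y
  proof -
    obtain c c' where "c \<in> C" "x - c * a \<in> J" "c' \<in> C" "y - c' * a \<in> J"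
      using xy unfolding aJ_def by auto
    then have "c + c' \<in> C" "(x + y) - (c + c') * a \<in> J"
      using J_add[of "x - c * a" "y - c' * a"] C by (auto intro: subring_add simp: algebra_simps)
    then show ?thesis unfolding aJ_def by blast
  qed
  have aJ_mult: "b * x \<in> aJ" if bx: "b \<in> C" "x \<in> aJ" for b x
  proof -
    obtain c where "c \<in> C" "x - c * a \<in> J" using bx unfolding aJ_def by auto
    then have "b * c \<in> C" "b * x - (b * c) * a \<in> J"
      using J_mult[of b "x - c * a"] bx(1) C by (auto intro: subring_mult simp: algebra_simps)
    then show ?thesis unfolding aJ_def by blast
  qed
  have J_aJ: "x \<in> aJ" if "x \<in> J" for x
    using that subring_zero[OF C] unfolding aJ_def by (auto intro!: bexI[of _ 0])
  have aJ_zero: "0 \<in> aJ" using J_aJ J_zero by blast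
  have aJ_sum: "sum f T \<in> aJ" if "\<And>t. t \<in> T \<Longrightarrow> f t \<in> aJ" for f :: "nat \<Rightarrow> 'f" and T
    using that by (induction T rule: infinite_finite_induct) (auto intro: aJ_add aJ_zero)
  have a_aJ: "a \<in> aJ" using subring_one[OF C] J_zero unfolding aJ_def by (auto intro!: bexI[of _ 1])

  have row_div: "H $$ (i, l) \<in> aJ"
    if H: "eqv C n H F" and l: "l < n" and a': "H $$ (i, j) - a \<in> J" for H l
  proof (cases "l = j")
    case True
    then show ?thesis using aJ_add[OF a_aJ J_aJ[OF a']] by simp
  next
    case False
    have cH: "H \<in> carrier_mat n n" "mat_over C H" using eqv_carrier[OF H] eqv_over[OF C H F] .
    have "a \<notin> J" using nJ unfolding a_def .
    have HnJ: "H $$ (i, j) \<notin> J"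
      using J_add[OF _ J_minus[OF a'], of "H $$ (i, j)"] \<open>a \<notin> J\<close> by auto
    have "e (H $$ (i, j)) = d" using e_cong[OF aC a'] ed unfolding a_def by simp
    obtain q where q: "q \<in> C"
      "H $$ (i, l) - q * H $$ (i, j) \<in> J \<or> e (H $$ (i, l) - q * H $$ (i, j)) < e (H $$ (i, j))"
      using division[OF mat_overD[OF cH(2,1) ij(1) l] mat_overD[OF cH(2,1) ij] HnJ] by blast
    define H' where "H' = addcol (- q) l j H"
    have H': "eqv C n H' F" unfolding H'_def
      by (rule eqv_trans[OF C eqv_addcol[OF C _ l ij(2) False cH(1)] H F(1)])
         (use q C in \<open>auto intro: subring_uminus\<close>)
    have e1: "H' $$ (i, l) = H $$ (i, l) - q * H $$ (i, j)"
      unfolding H'_def using cH ij l False by simp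
    have "H $$ (i, l) - q * H $$ (i, j) \<in> J"
      using least[OF H' ij(1) l] q(2) \<open>e (H $$ (i, j)) = d\<close> unfolding e1 by (metis linorder_not_le)
    from aJ_add[OF J_aJ[OF this] aJ_mult[OF q(1) aJ_add[OF a_aJ J_aJ[OF a']]]]
    show ?thesis by simp
  qed
  have all: "G $$ (k, l) \<in> aJ" if k: "k < n" and l: "l < n" for k l
  proof (cases "k = i")
    case True
    then show ?thesis using row_div[OF G l] J_zero by (simp add: a_def)
  next
    case False
    obtain q where q: "q \<in> C"
      "G $$ (k, j) - q * G $$ (i, j) \<in> J \<or> e (G $$ (k, j) - q * G $$ (i, j)) < e (G $$ (i, j))"
      using division[OF mat_overD[OF cG(2,1) k ij(2)] mat_overD[OF cG(2,1) ij] nJ] by blast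
    define H where "H = addrow (- q) k i G"
    have mq: "- q \<in> C" using q C by (auto intro: subring_uminus)
    have H: "eqv C n H F" unfolding H_def
      by (rule eqv_trans[OF C eqv_addrow[OF C mq k ij(1) False cG(1)] G F(1)])
    have cH: "H \<in> carrier_mat n n" using eqv_carrier[OF H] .
    have e1: "H $$ (k, c) = G $$ (k, c) - q * G $$ (i, c)" if "c < n" for c
      unfolding H_def using cG ij k False that by simp
    have e2: "H $$ (i, c) = G $$ (i, c)" if "c < n" for c
      unfolding H_def using cG ij k False that by simp
    have kj: "H $$ (k, j) \<in> J"
      using least[OF H k ij(2)] q(2) ed unfolding e1[OF ij(2)] by (metis linorder_not_le)
  
    \<comment> \<open>The entry in column \<open>j\<close> of row \<open>k\<close> now lies in \<open>J\<close>. So adding this row to row \<open>i\<close> keeps the pivot modulo \<open>J\<close>,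
      and the result on row \<open>i\<close> applies to the sum.\<close>
    define H' where "H' = addrow 1 i k H"
    have H': "eqv C n H' F" unfolding H'_def
      by (rule eqv_trans[OF C eqv_addrow[OF C subring_one[OF C] ij(1) k _ cH] H F(1)]) (use False in auto)
    have e3: "H' $$ (i, c) = H $$ (k, c) + G $$ (i, c)" if "c < n" for c
      unfolding H'_def using cH ij k False that e2[OF that] by simp
    have 1: "H' $$ (i, l) \<in> aJ"
      by (rule row_div[OF H' l]) (use kj in \<open>simp add: e3[OF ij(2)] a_def\<close>)
    have 2: "G $$ (i, l) \<in> aJ" using row_div[OF G l] J_zero by (simp add: a_def)
    have "G $$ (k, l) = H' $$ (i, l) + (q - 1) * G $$ (i, l)"
      unfolding e3[OF l] e1[OF l] by (simp add: algebra_simps)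
    then show ?thesis
      using aJ_add[OF 1 aJ_mult[OF _ 2], of "q - 1"] q(1) C by (auto intro: subring_minus subring_one)
  qed
  have "1 \<in> aJ"
  proof (rule lin_closed_ideal[OF one aJ_zero])
    fix c m v assume "c \<in> C" "m \<in> {F $$ (i, j) | i j. i < n \<and> j < n}" "v \<in> aJ"
    moreover have "F $$ (k, l) \<in> aJ" if kl: "k < n" "l < n" for k l
    proof -
      obtain U V where U: "U \<in> GLs C n" and V: "V \<in> GLs C n" and FG: "F = U * G * V"
        using eqv_sym[OF G F(1)] unfolding eqv_def by blast
      note cU = GLs_carrier[OF U] and cV = GLs_carrier[OF V]
      have UG: "(U * G) $$ (k, r) \<in> aJ" if "r < n" for r
      proof -
        have "(U * G) $$ (k, r) = (\<Sum>t\<in>{0..<n}. U $$ (k, t) * G $$ (t, r))"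
          by (rule mat_mult_entry[OF cU cG(1) kl(1) that])
        also have "\<dots> \<in> aJ"
          by (intro aJ_sum aJ_mult) (use all that mat_overD[OF GLs_over[OF U] cU kl(1)] in auto)
        finally show ?thesis .
      qed
      have "F $$ (k, l) = (\<Sum>t\<in>{0..<n}. V $$ (t, l) * (U * G) $$ (k, t))"
        unfolding FG mat_mult_entry[OF mult_carrier_mat[OF cU cG(1)] cV kl] by (simp only: mult.commute)
      also have "\<dots> \<in> aJ"
        by (intro aJ_sum aJ_mult) (use UG mat_overD[OF GLs_over[OF V] cV _ kl(2)] in auto)
      finally show ?thesis .
    qed
    ultimately show "c * m + v \<in> aJ" by (auto intro!: aJ_add aJ_mult)
  qed
  then obtain c where c: "c \<in> C" "1 - c * a \<in> J" unfolding aJ_def by auto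
  obtain u where u: "u \<in> C" "(1 + - (1 - c * a)) * u = 1" using J_radical[OF J_minus[OF c(2)]] by blast
  have "G $$ (i, j) * (c * u) = 1" using u(2) unfolding a_def by (simp add: algebra_simps)
  moreover have "c * u \<in> C" using c u C by (auto intro: subring_mult)
  ultimately show ?thesis using G ij by blast
qed

lemma split_off_unit:
  assumes F: "F \<in> carrier_mat (Suc m) (Suc m)" "mat_over C F"
    and one: "1 \<in> lin C {F $$ (i, j) | i j. i < Suc m \<and> j < Suc m}"
  shows "\<exists>G\<in>carrier_mat m m. mat_over C G \<and> eqv C (Suc m) F (one_dsum m G)"
proof -
  let ?n = "Suc m"
  obtain G i j u where G: "eqv C ?n G F" and ij: "i < ?n" "j < ?n" and u: "u \<in> C" "G $$ (i, j) * u = 1"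
    using unit_pivot[OF F one] by blast
  have cG: "G \<in> carrier_mat ?n ?n" "mat_over C G" using eqv_carrier[OF G] eqv_over[OF C G F] .
  define H where "H = swaprows 0 i (swapcols 0 j G)"
  have H: "eqv C ?n H F" unfolding H_def
    by (rule eqv_trans[OF C eqv_swap[OF C _ _ _ _ cG(1)] G F(1)]) (use ij in auto)
  have cH: "H \<in> carrier_mat ?n ?n" using eqv_carrier[OF H] .
  have H0: "H $$ (0, 0) = G $$ (i, j)" unfolding H_def using cG ij by auto
  define K where "K = multrow 0 u H"
  have K_eq: "K = multrow_mat ?n 0 u * H" unfolding K_def by (rule multrow_mat[OF cH])
  have "multrow_mat ?n 0 u \<in> GLs C ?n"
  proof (subst GLs_iff_det[OF C])
    show "mat_over C (multrow_mat ?n 0 u)"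
      using u C unfolding multrow_mat_def by (auto intro!: mat_over_mat simp: subring_closed)
    show "\<exists>e\<in>C. det (multrow_mat ?n 0 u) * e = 1"
      using u mat_overD[OF cG(2,1) ij] by (subst det_multrow_mat) (auto simp: mult.commute intro!: bexI[of _ "G $$ (i, j)"])
  qed auto
  then have "eqv C ?n K H" unfolding K_eq by (rule eqv_left[OF C _ cH])
  then have K: "eqv C ?n K F" by (rule eqv_trans[OF C _ H F(1)])
  have cK: "K \<in> carrier_mat ?n ?n" "mat_over C K" using eqv_carrier[OF K] eqv_over[OF C K F] .
  have "K $$ (0, 0) = 1" unfolding K_def using cH H0 u by (simp add: mult.commute)
  from split_off_one[OF C cK this] obtain D where
    D: "D \<in> carrier_mat m m" "mat_over C D" "eqv C ?n K (one_dsum m D)" by blast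
  show ?thesis
    using D eqv_trans[OF C eqv_sym[OF K F(1)] D(3) one_dsum_carrier[OF D(1)]] by blast
qed

end

subsection \<open>Peeling off invariant factors\<close>

lemma minor_laplace:
  fixes F :: "'a::comm_ring_1 mat"
  assumes i: "i < Suc k"
  shows "minor (Suc k) f g F =
    (\<Sum>j<Suc k. F $$ (f i, g j) * ((-1) ^ (i + j) * minor k (f \<circ> insert_index i) (g \<circ> insert_index j) F))"
proof -
  let ?M = "mat (Suc k) (Suc k) (\<lambda>(i, j). F $$ (f i, g j))"
  have "mat_delete ?M i j = mat k k (\<lambda>(a, b). F $$ ((f \<circ> insert_index i) a, (g \<circ> insert_index j) b))" for j
    unfolding mat_delete_def insert_index_def by (intro eq_matI) auto
  then have "cofactor ?M i j = (-1) ^ (i + j) * minor k (f \<circ> insert_index i) (g \<circ> insert_index j) F" for j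
    unfolding cofactor_def minor_def by simp
  then show ?thesis
    unfolding minor_def[of "Suc k"]
    by (subst laplace_expansion_row[where n = "Suc k" and i = i]) (use i in auto)
qed

lemma minor_zero_col:
  assumes "j < k" "\<And>i. i < k \<Longrightarrow> F $$ (f i, g j) = 0"
  shows "minor k f g F = 0"
  unfolding minor_def
  by (subst laplace_expansion_column[where n = k and j = j]) (use assms in \<open>auto intro!: sum.neutral\<close>)

lemma minor_repeated_row:
  assumes "i < k" "i' < k" "i \<noteq> i'" "f i = f i'"
  shows "minor k f g F = 0"
  unfolding minor_def
  by (rule det_identical_rows[of _ k i i']) (use assms in \<open>auto intro!: eq_vecI\<close>)

lemma insert_index_less: "a < k \<Longrightarrow> insert_index i a < Suc k"
  unfolding insert_index_def by auto

lemma insert_index_neq: "insert_index i a \<noteq> i"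
  unfolding insert_index_def by auto

lemma minor_one_dsum:
  assumes G: "G \<in> carrier_mat m m" and fg: "\<forall>i<k. f i < Suc m \<and> g i < Suc m" and f: "\<forall>i<k. f i \<noteq> 0"
  shows "minor k f g (one_dsum m G) \<in> insert 0 (kminors m k G)"
proof (cases "\<exists>j<k. g j = 0")
  case True
  then obtain j where "j < k" "g j = 0" by blast
  then have "minor k f g (one_dsum m G) = 0"
    using fg f by (intro minor_zero_col[of j]) (auto simp: one_dsum_index[OF G])
  then show ?thesis by simp
next
  case False
  have "mat k k (\<lambda>(i, j). one_dsum m G $$ (f i, g j)) = mat k k (\<lambda>(i, j). G $$ (f i - 1, g j - 1))"
    using fg f False by (intro eq_matI) (auto simp: one_dsum_index[OF G])
  then have "minor k f g (one_dsum m G) = minor k (\<lambda>i. f i - 1) (\<lambda>i. g i - 1) G"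
    unfolding minor_def by simp
  also have "\<dots> \<in> kminors m k G"
  proof (intro kminorsI)
    fix i assume "i < k"
    then have "f i < Suc m" "f i \<noteq> 0" "g i < Suc m" "g i \<noteq> 0" using fg f False by auto
    then show "f i - 1 < m \<and> g i - 1 < m" by linarith
  qed
  finally show ?thesis by simp
qed

lemma minors_one_dsum_subset:
  fixes G :: "'a::comm_ring_1 mat"
  assumes A: "subring_set A" and G: "G \<in> carrier_mat m m" "mat_over A G"
    and x: "x \<in> kminors (Suc m) (Suc k) (one_dsum m G)"
  shows "x \<in> lin A (kminors m k G)"
proof -
  obtain f g where x: "x = minor (Suc k) f g (one_dsum m G)" and fg: "\<forall>i<Suc k. f i < Suc m \<and> g i < Suc m"
    using x unfolding kminors_def by auto
  have over: "one_dsum m G $$ (f i, g j) \<in> A" if "i < Suc k" "j < Suc k" for i j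
    using mat_overD[OF one_dsum_over[OF A G] one_dsum_carrier[OF G(1)]] fg that by blast
  have expand: "x \<in> lin A (kminors m k G)"
    if i: "i < Suc k" and f: "\<And>a. a < k \<Longrightarrow> f (insert_index i a) \<noteq> 0" for i
  proof -
    have "minor k (f \<circ> insert_index i) (g \<circ> insert_index j) (one_dsum m G) \<in> lin A (kminors m k G)" for j
    proof -
      have "minor k (f \<circ> insert_index i) (g \<circ> insert_index j) (one_dsum m G) \<in> insert 0 (kminors m k G)"
        by (rule minor_one_dsum[OF G(1)]) (use fg f in \<open>auto simp: insert_index_less\<close>)
      then show ?thesis using lin_gen[OF A] lin.zero by auto
    qed
    then show ?thesis unfolding x minor_laplace[OF i]
      using i over A by (intro lin_sum lin_mult[OF A]) (auto intro: subring_closed)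
  qed
  show ?thesis
  proof (cases "\<exists>i<Suc k. f i = 0")
    case True
    then obtain i where i: "i < Suc k" "f i = 0" by blast
    show ?thesis
    proof (cases "\<exists>i'<Suc k. i' \<noteq> i \<and> f i' = 0")
      case True
      then obtain i' where "i' < Suc k" "i' \<noteq> i" "f i' = 0" by blast
      then have "x = 0" unfolding x using i by (intro minor_repeated_row[of i' _ i]) auto
      then show ?thesis by (simp add: lin.zero)
    next
      case False
      show ?thesis
      proof (rule expand[OF i(1)])
        fix a assume "a < k"
        then show "f (insert_index i a) \<noteq> 0"
          using False insert_index_less[of a k i] insert_index_neq[of i a] by auto
      qed
    qed
  next
    case False
    then show ?thesis using insert_index_less[of _ k 0] by (intro expand[of 0]) auto
  qed
qed

lemma minor_of_one_dsum:
  assumes G: "(G :: 'a::idom mat) \<in> carrier_mat m m" and fg: "\<forall>i<k. f i < m \<and> g i < m"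
  shows "minor k f g G = minor (Suc k) (case_nat 0 (Suc \<circ> f)) (case_nat 0 (Suc \<circ> g)) (one_dsum m G)"
proof -
  have "mat (Suc k) (Suc k) (\<lambda>(i, j). one_dsum m G $$ (case_nat 0 (Suc \<circ> f) i, case_nat 0 (Suc \<circ> g) j))
      = one_dsum k (mat k k (\<lambda>(i, j). G $$ (f i, g j)))"
  proof (rule eq_matI)
    fix i j
    assume "i < dim_row (one_dsum k (mat k k (\<lambda>(i, j). G $$ (f i, g j))))"
      "j < dim_col (one_dsum k (mat k k (\<lambda>(i, j). G $$ (f i, g j))))"
    then have ij: "i < Suc k" "j < Suc k" unfolding one_dsum_def by auto
    have "case_nat 0 (Suc \<circ> f) i < Suc m" "case_nat 0 (Suc \<circ> g) j < Suc m"
      using ij fg by (auto split: nat.splits)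
    then show "mat (Suc k) (Suc k) (\<lambda>(i, j). one_dsum m G $$ (case_nat 0 (Suc \<circ> f) i, case_nat 0 (Suc \<circ> g) j)) $$ (i, j)
      = one_dsum k (mat k k (\<lambda>(i, j). G $$ (f i, g j))) $$ (i, j)"
      using ij by (auto simp: one_dsum_index[OF G] one_dsum_index[of _ k] split: nat.splits)
  qed (auto simp: one_dsum_def)
  then show ?thesis unfolding minor_def one_dsum_def
    by (simp add: det_four_block_mat_upper_right_zero[of _ 1 _ k])
qed

text \<open>A minor of \<open>G\<close> becomes one of the direct sum when the corner is added. Conversely, expansion along the
corner row, or along any row if that one is not used, makes a minor of the direct sum a combination of
minors of \<open>G\<close> of one order less.\<close>

lemma det_ideal_one_dsum:
  fixes G :: "'a::idom mat"
  assumes A: "subring_set A" and G: "G \<in> carrier_mat m m" "mat_over A G"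
    and d: "det_ideal A (Suc m) (Suc k) (one_dsum m G) d"
  shows "det_ideal A m k G d"
  unfolding det_ideal_def
proof (intro conjI ballI)
  fix x assume "x \<in> kminors m k G"
  then obtain f g where fg: "\<forall>i<k. f i < m \<and> g i < m" and x: "x = minor k f g G"
    unfolding kminors_def by auto
  have "x \<in> kminors (Suc m) (Suc k) (one_dsum m G)"
    unfolding x minor_of_one_dsum[OF G(1) fg] using fg
    by (intro kminorsI) (auto split: nat.splits)
  then show "\<exists>c\<in>A. x = d * c" using d unfolding det_ideal_def by blast
next
  have "kminors (Suc m) (Suc k) (one_dsum m G) \<subseteq> lin A (kminors m k G)"
    using minors_one_dsum_subset[OF A G] by blast
  then show "d \<in> lin A (kminors m k G)"
    using d lin_trans[OF A] unfolding det_ideal_def by blast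
qed

lemma minor_smult:
  assumes F: "F \<in> carrier_mat n n" and fg: "\<forall>i<k. f i < n \<and> g i < n"
  shows "minor k f g (c \<cdot>\<^sub>m F) = c ^ k * minor k f g F"
proof -
  have "mat k k (\<lambda>(i, j). (c \<cdot>\<^sub>m F) $$ (f i, g j)) = c \<cdot>\<^sub>m mat k k (\<lambda>(i, j). F $$ (f i, g j))"
    using F fg by (intro eq_matI) auto
  then show ?thesis unfolding minor_def by (simp add: det_smult)
qed

lemma lin_scale:
  fixes c :: "'f::field"
  assumes "c \<noteq> 0" "u \<in> lin A ((\<lambda>x. c * x) ` M)" shows "u / c \<in> lin A M"
  using assms(2)
proof induction
  case zero then show ?case by (simp add: lin.zero)
next
  case (step a m v)
  then obtain x where "x \<in> M" "m = c * x" by blast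
  then show ?case using lin.step[of a A x M "v / c"] step assms(1) by (simp add: field_simps)
qed

lemma det_ideal_smult:
  fixes F :: "'f::field mat"
  assumes A: "subring_set A" and F: "F \<in> carrier_mat n n" and c: "c \<noteq> 0"
    and d: "det_ideal A n k (c \<cdot>\<^sub>m F) d"
  shows "det_ideal A n k F (d / c ^ k)"
proof -
  have e: "kminors n k (c \<cdot>\<^sub>m F) = (\<lambda>x. c ^ k * x) ` kminors n k F"
  proof (intro equalityI subsetI)
    fix x assume "x \<in> kminors n k (c \<cdot>\<^sub>m F)"
    then obtain f g where fg: "\<forall>i<k. f i < n \<and> g i < n" and x: "x = minor k f g (c \<cdot>\<^sub>m F)"
      unfolding kminors_def by blast
    then show "x \<in> (\<lambda>x. c ^ k * x) ` kminors n k F"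
      unfolding x minor_smult[OF F fg] by (intro imageI kminorsI) blast
  next
    fix x assume "x \<in> (\<lambda>x. c ^ k * x) ` kminors n k F"
    then obtain f g where fg: "\<forall>i<k. f i < n \<and> g i < n" and x: "x = c ^ k * minor k f g F"
      unfolding kminors_def by blast
    then show "x \<in> kminors n k (c \<cdot>\<^sub>m F)"
      unfolding x minor_smult[OF F fg, symmetric] by (intro kminorsI) blast
  qed
  have "\<exists>a\<in>A. x = d / c ^ k * a" if x: "x \<in> kminors n k F" for x
  proof -
    obtain a where "a \<in> A" "c ^ k * x = d * a" using d x unfolding det_ideal_def e by auto
    then show ?thesis using c by (intro bexI[of _ a]) (auto simp: field_simps)
  qed
  moreover have "d / c ^ k \<in> lin A (kminors n k F)"
    using d c unfolding det_ideal_def e by (intro lin_scale) auto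
  ultimately show ?thesis unfolding det_ideal_def by blast
qed

lemma det_ideal_in:
  assumes A: "subring_set A" and "F \<in> carrier_mat n n" "mat_over A F" "det_ideal A n k F d"
  shows "d \<in> A"
proof -
  have "d \<in> lin A (kminors n k F)" using assms unfolding det_ideal_def by auto
  then show ?thesis
    by (rule lin_closed_ideal) (use assms minor_in_subring[OF assms(1,3,2)] in \<open>auto intro: subring_closed\<close>)
qed

lemma entry_in_kminors: "i < n \<Longrightarrow> j < n \<Longrightarrow> F $$ (i, j) \<in> kminors n 1 (F :: 'a::comm_ring_1 mat)"
proof -
  assume ij: "i < n" "j < n"
  have "minor 1 (\<lambda>_. i) (\<lambda>_. j) F = F $$ (i, j)" unfolding minor_def by (subst det_single) auto
  then show ?thesis using kminorsI[of 1 "\<lambda>_. i" n "\<lambda>_. j" F] ij by simp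
qed

lemma kminors_1: "kminors n 1 (F :: 'a::comm_ring_1 mat) = {F $$ (i, j) | i j. i < n \<and> j < n}"
proof
  show "kminors n 1 F \<subseteq> {F $$ (i, j) | i j. i < n \<and> j < n}"
    unfolding kminors_def minor_def by (auto simp: det_single)
  show "{F $$ (i, j) | i j. i < n \<and> j < n} \<subseteq> kminors n 1 F"
    using entry_in_kminors by blast
qed

definition diag_of :: "nat \<Rightarrow> (nat \<Rightarrow> 'a::comm_ring_1) \<Rightarrow> 'a mat" where
  "diag_of n s = mat n n (\<lambda>(i, j). if i = j then s i else 0)"

lemma diag_of_carrier[simp]: "diag_of n s \<in> carrier_mat n n"
  unfolding diag_of_def by auto

lemma diag_of_over: "subring_set A \<Longrightarrow> (\<And>i. i < n \<Longrightarrow> s i \<in> A) \<Longrightarrow> mat_over A (diag_of n s)"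
  unfolding diag_of_def by (auto intro!: mat_over_mat simp: subring_zero)

lemma eqv_smult:
  assumes "eqv A n F G" "G \<in> carrier_mat n n" shows "eqv A n (c \<cdot>\<^sub>m F) (c \<cdot>\<^sub>m G)"
proof -
  obtain U V where U: "U \<in> GLs A n" and V: "V \<in> GLs A n" and F: "F = U * G * V"
    using assms(1) unfolding eqv_def by auto
  note c = GLs_carrier[OF U] GLs_carrier[OF V]
  have "c \<cdot>\<^sub>m F = U * (c \<cdot>\<^sub>m G) * V" unfolding F using c assms(2)
    by (simp add: mult_smult_distrib[of _ n n _ n] mult_smult_assoc_mat[of _ n n _ n])
  then show ?thesis using eqvI[OF U V] by blast
qed

context euclidean_mod_radical
begin

text \<open>If the first determinantal ideal is generated by \<open>d 1\<close>, a matrix is \<open>d 1\<close> times a matrix whose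
  entries generate the unit ideal; split off the resulting unit.\<close>

lemma split_off_gcd:
  assumes F: "F \<in> carrier_mat (Suc m) (Suc m)" "mat_over C F"
    and d: "\<And>k. k \<le> Suc m \<Longrightarrow> det_ideal C (Suc m) k F (d k)" and d1: "d 1 \<noteq> 0"
  shows "\<exists>G\<in>carrier_mat m m. mat_over C G \<and> eqv C (Suc m) F (d 1 \<cdot>\<^sub>m one_dsum m G) \<and>
    (\<forall>k\<le>m. det_ideal C m k G (d (Suc k) / d 1 ^ Suc k))"
proof -
  let ?n = "Suc m"
  define F1 where "F1 = mat ?n ?n (\<lambda>(i, j). F $$ (i, j) / d 1)"
  have F1: "F1 \<in> carrier_mat ?n ?n" unfolding F1_def by auto
  have FF1: "F = d 1 \<cdot>\<^sub>m F1" using F d1 unfolding F1_def by (intro eq_matI) auto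
  have "\<exists>c\<in>C. F $$ (i, j) = d 1 * c" if "i < ?n" "j < ?n" for i j
    using d[of 1] entry_in_kminors[OF that] unfolding det_ideal_def by auto
  then have "F $$ (i, j) / d 1 \<in> C" if "i < ?n" "j < ?n" for i j
    using that d1 by fastforce
  then have o1: "mat_over C F1" unfolding F1_def by (intro mat_over_mat) auto
  have di: "det_ideal C ?n k F1 (d k / d 1 ^ k)" if "k \<le> ?n" for k
    using det_ideal_smult[OF C F1 d1] d[OF that] unfolding FF1 by blast
  have "1 \<in> lin C {F1 $$ (i, j) | i j. i < ?n \<and> j < ?n}"
    using di[of 1] d1 unfolding det_ideal_def kminors_1 by simp
  from split_off_unit[OF F1 o1 this] obtain G where
    G: "G \<in> carrier_mat m m" "mat_over C G" "eqv C ?n F1 (one_dsum m G)" by blast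
  have "det_ideal C m k G (d (Suc k) / d 1 ^ Suc k)" if "k \<le> m" for k
  proof (rule det_ideal_one_dsum[OF C G(1,2)])
    show "det_ideal C ?n (Suc k) (one_dsum m G) (d (Suc k) / d 1 ^ Suc k)"
      by (rule det_ideal_eqv[OF C F1 eqv_sym[OF G(3) one_dsum_carrier[OF G(1)]] di]) (use that in auto)
  qed
  moreover have "eqv C ?n F (d 1 \<cdot>\<^sub>m one_dsum m G)"
    unfolding FF1 by (rule eqv_smult[OF G(3) one_dsum_carrier[OF G(1)]])
  ultimately show ?thesis using G by blast
qed

text \<open>The entries have the greatest common divisor \<open>s 0\<close>, and it is a combination of them. If it is
zero, so is the matrix. Otherwise dividing by it makes the entries generate the unit ideal; a unit splits off, and the remaining block again has principal
determinantal ideals.\<close>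

theorem smith_of_det_ideals:
  assumes "F \<in> carrier_mat n n" "mat_over C F"
    and "\<And>i. Suc i < n \<Longrightarrow> \<exists>c\<in>C. s (Suc i) = s i * c"
    and "\<And>k. k \<le> n \<Longrightarrow> det_ideal C n k F (\<Prod>i<k. s i)"
  shows "eqv C n F (diag_of n s)"
  using assms
proof (induction n arbitrary: F s)
  case 0
  have "F = diag_of 0 s" using 0(1) unfolding diag_of_def by (intro eq_matI) auto
  then show ?case using eqv_refl[OF C 0(1)] by simp
next
  case (Suc m)
  show ?case
  proof (cases "s 0 = 0")
    case True
    have "s i = 0" if "i < Suc m" for i
      using that
    proof (induction i)
      case (Suc i)
      then show ?case using Suc.prems(1) \<open>\<And>i. Suc i < Suc m \<Longrightarrow> \<exists>c\<in>C. s (Suc i) = s i * c\<close>[of i] by auto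
    qed (use True in simp)
    moreover have "F $$ (i, j) = 0" if "i < Suc m" "j < Suc m" for i j
      using Suc.prems(4)[of 1] entry_in_kminors[OF that, of F] True unfolding det_ideal_def by auto
    ultimately have "F = diag_of (Suc m) s"
      using Suc.prems(1) unfolding diag_of_def by (intro eq_matI) auto
    then show ?thesis using eqv_refl[OF C Suc.prems(1)] by simp
  next
    case False
    have d1: "(\<Prod>i<1. s i) = s 0" by simp
    obtain G where G: "G \<in> carrier_mat m m" "mat_over C G" "eqv C (Suc m) F (s 0 \<cdot>\<^sub>m one_dsum m G)"
      and di: "\<And>k. k \<le> m \<Longrightarrow> det_ideal C m k G ((\<Prod>i<Suc k. s i) / s 0 ^ Suc k)"
      using split_off_gcd[OF Suc.prems(1,2), of "\<lambda>k. \<Prod>i<k. s i"] Suc.prems(4) False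
      unfolding d1 by blast
    have e: "(\<Prod>i<Suc k. s i) / s 0 ^ Suc k = (\<Prod>i<k. s (Suc i) / s 0)" for k
      using False by (subst prod.lessThan_Suc_shift) (simp add: prod_dividef)
    have "eqv C m G (diag_of m (\<lambda>i. s (Suc i) / s 0))"
    proof (rule Suc.IH[OF G(1,2)])
      fix i assume "Suc i < m"
      then obtain c where "c \<in> C" "s (Suc (Suc i)) = s (Suc i) * c" using Suc.prems(3)[of "Suc i"] by auto
      then show "\<exists>c\<in>C. s (Suc (Suc i)) / s 0 = s (Suc i) / s 0 * c" by auto
    qed (use di e in auto)
    from eqv_smult[OF eqv_one_dsum[OF C this diag_of_carrier] one_dsum_carrier[OF diag_of_carrier]]
    have "eqv C (Suc m) (s 0 \<cdot>\<^sub>m one_dsum m G) (s 0 \<cdot>\<^sub>m one_dsum m (diag_of m (\<lambda>i. s (Suc i) / s 0)))" .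
    moreover have "s 0 \<cdot>\<^sub>m one_dsum m (diag_of m (\<lambda>i. s (Suc i) / s 0)) = diag_of (Suc m) s"
      using False unfolding one_dsum_def diag_of_def by (intro eq_matI) auto
    ultimately show ?thesis using eqv_trans[OF C G(3)] by simp
  qed
qed

text \<open>After splitting off the first generator, \<open>d 2 / d 1 ^ 2\<close> generates the ideal of the entries of the
remaining block, and so it lies in the ring. The other cases are the same statement for smaller matrices.\<close>

lemma det_ideals_divisibility:
  assumes "F \<in> carrier_mat n n" "mat_over C F"
    and "\<And>k. k \<le> n \<Longrightarrow> det_ideal C n k F (d k) \<and> d k \<noteq> 0" and "d 0 = 1" and "Suc k < n"
  shows "\<exists>c\<in>C. d k * d (Suc (Suc k)) = d (Suc k) ^ 2 * c"
  using assms
proof (induction n arbitrary: F d k)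
  case (Suc m)
  have d1: "d 1 \<noteq> 0" using Suc.prems(3)[of 1] by simp
  obtain G where G: "G \<in> carrier_mat m m" "mat_over C G"
    and di: "\<And>k. k \<le> m \<Longrightarrow> det_ideal C m k G (d (Suc k) / d 1 ^ Suc k)"
    using split_off_gcd[OF Suc.prems(1,2), of d] Suc.prems(3) d1 by blast
  show ?case
  proof (cases k)
    case 0
    have "d 2 / d 1 ^ 2 \<in> C"
      using det_ideal_in[OF C G di[of 1]] Suc.prems(5) by (simp add: numeral_2_eq_2)
    then show ?thesis using 0 d1 Suc.prems(4)
      by (intro bexI[of _ "d 2 / d 1 ^ 2"]) (auto simp: numeral_2_eq_2)
  next
    case (Suc j)
    define d' where "d' k = d (Suc k) / d 1 ^ Suc k" for k
    have "\<exists>c\<in>C. d' j * d' (Suc (Suc j)) = d' (Suc j) ^ 2 * c"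
    proof (rule Suc.IH[OF G])
      show "det_ideal C m k G (d' k) \<and> d' k \<noteq> 0" if "k \<le> m" for k
        using di[OF that] Suc.prems(3)[of "Suc k"] d1 that unfolding d'_def by auto
      show "d' 0 = 1" unfolding d'_def using d1 by simp
      show "Suc j < m" using Suc Suc.prems(5) by simp
    qed
    then obtain c where "c \<in> C" "d' j * d' (Suc (Suc j)) = d' (Suc j) ^ 2 * c" by blast
    then show ?thesis unfolding Suc d'_def using d1
      by (intro bexI[of _ c]) (auto simp: field_simps power2_eq_square power_add[symmetric] mult_2_right)
  qed
qed simp

end

section \<open>Polynomials over a local ring\<close>

definition polys_over :: "'k::comm_ring_1 set \<Rightarrow> 'k poly set" where
  "polys_over A = {p. \<forall>i. coeff p i \<in> A}"

lemma polys_over_coeff: "p \<in> polys_over A \<Longrightarrow> coeff p i \<in> A"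
  unfolding polys_over_def by auto

lemma polys_overI: "(\<And>i. coeff p i \<in> A) \<Longrightarrow> p \<in> polys_over A"
  unfolding polys_over_def by auto

lemma polys_over_mono: "A \<subseteq> B \<Longrightarrow> polys_over A \<subseteq> polys_over B"
  unfolding polys_over_def by auto

lemma polys_over_subring: "subring_set A \<Longrightarrow> subring_set (polys_over A)"
  unfolding subring_set_def[of "polys_over A"]
  by (auto intro!: polys_overI subring_sum subring_minus subring_mult
      simp: coeff_mult coeff_1 subring_one subring_zero polys_over_coeff)

lemma polys_over_const: "0 \<in> A \<Longrightarrow> a \<in> A \<Longrightarrow> [:a:] \<in> polys_over A"
  by (auto intro!: polys_overI simp: coeff_pCons split: nat.splits)

lemma polys_over_monom: "0 \<in> A \<Longrightarrow> a \<in> A \<Longrightarrow> monom a n \<in> polys_over A"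
  by (auto intro!: polys_overI)

lemma polys_over_smult: "subring_set A \<Longrightarrow> a \<in> A \<Longrightarrow> p \<in> polys_over A \<Longrightarrow> Polynomial.smult a p \<in> polys_over A"
  by (auto intro!: polys_overI subring_mult simp: polys_over_coeff)

locale local_subring =
  fixes A m :: "'k::field set"
  assumes A: "subring_set A" and m_subset: "m \<subseteq> A" and m_zero: "0 \<in> m"
    and m_add: "x \<in> m \<Longrightarrow> y \<in> m \<Longrightarrow> x + y \<in> m"
    and m_mult: "a \<in> A \<Longrightarrow> x \<in> m \<Longrightarrow> a * x \<in> m"
    and m_proper: "1 \<notin> m"
    and units: "a \<in> A \<Longrightarrow> a \<notin> m \<Longrightarrow> inverse a \<in> A"
begin

abbreviation "P \<equiv> polys_over A"
abbreviation "Pm \<equiv> polys_over m"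

definition unit_lead :: "'k poly \<Rightarrow> bool" where
  "unit_lead p \<longleftrightarrow> p \<in> P \<and> lead_coeff p \<notin> m"

lemma P: "subring_set P" using polys_over_subring[OF A] .

lemma m_uminus: "x \<in> m \<Longrightarrow> - x \<in> m"
  using m_mult[of "-1" x] A by (auto intro: subring_closed)

lemma m_minus: "x \<in> m \<Longrightarrow> y \<in> m \<Longrightarrow> x - y \<in> m"
  using m_add[of x "- y"] m_uminus by auto

lemma m_sum: "(\<And>i. i \<in> I \<Longrightarrow> f i \<in> m) \<Longrightarrow> sum f I \<in> m"
  by (induction I rule: infinite_finite_induct) (auto simp: m_zero m_add)

lemma m_prime: "a \<in> A \<Longrightarrow> b \<in> A \<Longrightarrow> a * b \<in> m \<Longrightarrow> a \<in> m \<or> b \<in> m"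
proof (rule ccontr)
  assume a: "a \<in> A" "b \<in> A" "a * b \<in> m" and n: "\<not> (a \<in> m \<or> b \<in> m)"
  then have "inverse a * (a * b) \<in> m" using m_mult[OF units] by blast
  moreover have "a \<noteq> 0" using n m_zero by auto
  ultimately show False using n by (simp add: mult.assoc[symmetric])
qed

lemma Pm_subset: "Pm \<subseteq> P" by (rule polys_over_mono[OF m_subset])

lemma Pm_zero: "0 \<in> Pm" by (auto intro!: polys_overI simp: m_zero)

lemma Pm_add: "p \<in> Pm \<Longrightarrow> q \<in> Pm \<Longrightarrow> p + q \<in> Pm"
  by (auto intro!: polys_overI m_add simp: polys_over_coeff)

lemma Pm_minus: "p \<in> Pm \<Longrightarrow> q \<in> Pm \<Longrightarrow> p - q \<in> Pm"
  by (auto intro!: polys_overI m_minus simp: polys_over_coeff)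

lemma Pm_mult: "p \<in> P \<Longrightarrow> q \<in> Pm \<Longrightarrow> p * q \<in> Pm"
  by (auto intro!: polys_overI m_sum m_mult simp: polys_over_coeff coeff_mult)

lemma Pm_sum: "(\<And>i. i \<in> I \<Longrightarrow> f i \<in> Pm) \<Longrightarrow> sum f I \<in> Pm"
  by (induction I rule: infinite_finite_induct) (auto simp: Pm_zero Pm_add)

lemma one_notin_Pm: "1 \<notin> Pm"
  using m_proper polys_over_coeff[of 1 m 0] by auto

lemma last_unit_coeff:
  assumes "p \<in> P" "p \<notin> Pm"
  obtains d where "coeff p d \<notin> m" "\<And>i. i > d \<Longrightarrow> coeff p i \<in> m"
proof -
  let ?D = "{i. coeff p i \<notin> m}"
  have sub: "?D \<subseteq> {..degree p}" using m_zero coeff_eq_0[of p] by (auto simp: not_le[symmetric]) (metis leI)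
  then have fin: "finite ?D" by (rule finite_subset) simp
  have "?D \<noteq> {}" using assms(2) unfolding polys_over_def by auto
  then have "coeff p (Max ?D) \<notin> m" using Max_in[OF fin] by auto
  moreover have "coeff p i \<in> m" if "i > Max ?D" for i using Max_ge[OF fin, of i] that by auto
  ultimately show ?thesis by (rule that)
qed

text \<open>The residue field has no zero divisors, and degrees of residues add up.\<close>

lemma coeff_mult_last_unit:
  assumes pq: "p \<in> P" "q \<in> P" and d: "coeff p d \<notin> m" "\<And>i. i > d \<Longrightarrow> coeff p i \<in> m"
    and e: "coeff q e \<notin> m" "\<And>i. i > e \<Longrightarrow> coeff q i \<in> m"
  shows "coeff (p * q) (d + e) \<notin> m"
proof
  assume in_m: "coeff (p * q) (d + e) \<in> m"
  have "coeff (p * q) (d + e) = (\<Sum>i\<le>d + e. coeff p i * coeff q (d + e - i))"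
    by (rule coeff_mult)
  also have "\<dots> = coeff p d * coeff q e + (\<Sum>i\<in>{..d + e} - {d}. coeff p i * coeff q (d + e - i))"
    by (subst sum.remove[of _ d]) auto
  finally have "coeff p d * coeff q e
      = coeff (p * q) (d + e) - (\<Sum>i\<in>{..d + e} - {d}. coeff p i * coeff q (d + e - i))" by simp
  also have "\<dots> \<in> m"
  proof (intro m_minus[OF in_m] m_sum)
    fix i assume i: "i \<in> {..d + e} - {d}"
    show "coeff p i * coeff q (d + e - i) \<in> m"
    proof (cases "i > d")
      case True
      then show ?thesis using m_mult[of "coeff q (d + e - i)" "coeff p i"] d pq
        by (simp add: polys_over_coeff mult.commute)
    next
      case False
      then have "d + e - i > e" using i by auto
      then show ?thesis using m_mult e pq by (simp add: polys_over_coeff)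
    qed
  qed
  finally show False using m_prime d e pq polys_over_coeff by blast
qed

lemma Pm_prime:
  assumes "p \<in> P" "q \<in> P" "p * q \<in> Pm" shows "p \<in> Pm \<or> q \<in> Pm"
proof (rule ccontr)
  assume "\<not> ?thesis"
  then obtain d e where "coeff p d \<notin> m" "\<And>i. i > d \<Longrightarrow> coeff p i \<in> m"
    "coeff q e \<notin> m" "\<And>i. i > e \<Longrightarrow> coeff q i \<in> m"
    using last_unit_coeff assms by metis
  from coeff_mult_last_unit[OF assms(1,2) this] show False using assms(3) polys_over_coeff by blast
qed

lemma unit_lead_notin_Pm: "unit_lead p \<Longrightarrow> p \<notin> Pm"
  unfolding unit_lead_def polys_over_def by auto

lemma unit_lead_in: "unit_lead p \<Longrightarrow> p \<in> P"
  unfolding unit_lead_def by auto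

lemma unit_lead_nonzero: "unit_lead p \<Longrightarrow> p \<noteq> 0"
  unfolding unit_lead_def using m_zero by auto

lemma unit_lead_mult: "unit_lead p \<Longrightarrow> unit_lead q \<Longrightarrow> unit_lead (p * q)"
  unfolding unit_lead_def using m_prime P subring_mult polys_over_coeff by (metis lead_coeff_mult)

lemma unit_lead_factor:
  assumes "unit_lead (p * q)" "p \<in> P" "q \<in> P" shows "unit_lead p"
proof -
  have "lead_coeff p * lead_coeff q \<notin> m" using assms(1) unfolding unit_lead_def lead_coeff_mult by simp
  then have "lead_coeff p \<notin> m"
    using m_mult[of "lead_coeff q" "lead_coeff p"] assms(3) polys_over_coeff by (auto simp: mult.commute)
  then show ?thesis using assms(2) unfolding unit_lead_def by simp
qed

text \<open>A polynomial with unit leading coefficient that is a unit modulo the maximal ideal is constant,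
  because degrees of residues add up.\<close>

lemma unit_lead_residue_unit:
  assumes d: "unit_lead d" and r: "r \<in> P" "d * r - 1 \<in> Pm"
  shows "\<exists>c\<in>P. d * c = 1"
proof -
  have dP: "d \<in> P" and dl: "lead_coeff d \<notin> m" using d unfolding unit_lead_def by auto
  have "r \<notin> Pm"
  proof
    assume "r \<in> Pm"
    then have "d * r - (d * r - 1) \<in> Pm" using Pm_mult[OF dP] Pm_minus r by blast
    then show False using one_notin_Pm by simp
  qed
  then obtain e where e: "coeff r e \<notin> m" "\<And>i. i > e \<Longrightarrow> coeff r i \<in> m" using last_unit_coeff r by blast
  have nm: "coeff (d * r) (degree d + e) \<notin> m"
    by (rule coeff_mult_last_unit[OF dP r(1) dl _ e]) (auto simp: coeff_eq_0 m_zero)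
  have "degree d = 0"
  proof (rule ccontr)
    assume "degree d \<noteq> 0"
    then have "coeff (d * r - 1) (degree d + e) = coeff (d * r) (degree d + e)" by (simp add: coeff_1)
    then show False using nm r(2) polys_over_coeff by metis
  qed
  then obtain c where c: "d = [:c:]" by (rule degree_eq_zeroE)
  then have "c \<in> A" "c \<notin> m" "c \<noteq> 0" using dP dl m_zero polys_over_coeff[of d A 0] by auto
  then show ?thesis using units[of c] subring_zero[OF A] unfolding c
    by (intro bexI[of _ "[:inverse c:]"]) (auto intro: polys_over_const simp: one_pCons)
qed

text \<open>Division by a polynomial whose leading coefficient is a unit only changes a polynomial whose
  high coefficients lie in the maximal ideal by multiples that lie in the maximal ideal.\<close>

lemma reduce_high_coeffs:
  assumes I: "\<And>p x. p \<in> P \<Longrightarrow> x \<in> I \<Longrightarrow> p * x \<in> I" and u: "u \<in> I" "unit_lead u"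
    and K: "0 \<in> K" "\<And>x y. x \<in> K \<Longrightarrow> y \<in> K \<Longrightarrow> x + y \<in> K" "K \<subseteq> Pm"
      "\<And>c x. c \<in> m \<Longrightarrow> x \<in> I \<Longrightarrow> Polynomial.smult c x \<in> K"
    and w: "\<And>i. i > E \<Longrightarrow> coeff w i \<in> m" and E: "degree u \<le> Suc E"
  shows "\<exists>k\<in>K. degree (w + k) \<le> E"
  using w
proof (induction "degree w" arbitrary: w rule: less_induct)
  case less
  show ?case
  proof (cases "degree w \<le> E")
    case True
    then show ?thesis using K(1) by (intro bexI[of _ 0]) auto
  next
    case False
    define c where "c = - (lead_coeff w * inverse (lead_coeff u))"
    define k where "k = Polynomial.smult c (monom 1 (degree w - degree u) * u)"
    have lw: "lead_coeff w \<in> m" using less.prems False by auto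
    have lu: "lead_coeff u \<in> A" "lead_coeff u \<notin> m" "u \<in> P" "u \<noteq> 0"
      using u(2) polys_over_coeff unit_lead_nonzero[OF u(2)] unfolding unit_lead_def by auto
    have cm: "c \<in> m" unfolding c_def
      using m_uminus m_mult[OF units[OF lu(1,2)] lw] by (simp add: mult.commute)
    have kK: "k \<in> K" unfolding k_def
      using cm I u(1) polys_over_monom[of A 1] A by (intro K(4)) (auto simp: subring_zero subring_one)
    have "degree w \<ge> degree u" using False E by simp
    then have dk: "degree (monom 1 (degree w - degree u) * u) = degree w"
      using lu(4) by (simp add: degree_mult_eq degree_monom_eq)
    have "coeff k (degree w) = c * lead_coeff u"
      unfolding k_def using \<open>degree w \<ge> degree u\<close> by (simp add: coeff_monom_mult)
    then have top: "coeff (w + k) (degree w) = 0"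
      unfolding c_def using lu(4) by simp
    have "degree (w + k) \<le> degree w"
      using dk unfolding k_def by (intro degree_add_le) (auto simp: degree_smult_eq)
    moreover have "degree (w + k) \<noteq> degree w"
    proof
      assume eq: "degree (w + k) = degree w"
      then have "w + k = 0" using top by (metis leading_coeff_0_iff)
      then show False using eq False by simp
    qed
    ultimately have lt: "degree (w + k) < degree w" by simp
    have "coeff (w + k) i \<in> m" if "i > E" for i
      using m_add[OF less.prems[OF that] polys_over_coeff[of k m i]] kK K(3) by auto
    then obtain k' where "k' \<in> K" "degree (w + k + k') \<le> E" using less.hyps[OF lt] by blast
    then show ?thesis using K(2)[OF kK] by (intro bexI[of _ "k + k'"]) (auto simp: add.assoc)
  qed
qed

text \<open>The key to Horrocks' theorem. Suppose an ideal \<open>I\<close> of \<open>A[x]\<close> contains a polynomial with unit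
  leading coefficient, and take one of least degree. If its degree exceeded the degree \<open>d\<close> of the residue
  of \<open>w\<^sub>0 \<in> I\<close>, then reducing a multiple of \<open>w\<^sub>0\<close> by a power of the variable would produce one of smaller
  degree. So it can be used to remove the terms of \<open>w\<^sub>0\<close> of degree above \<open>d\<close>, and this does not change
  the residue.\<close>

lemma unit_lead_in_coset:
  assumes I: "I \<subseteq> P" "\<And>p x. p \<in> P \<Longrightarrow> x \<in> I \<Longrightarrow> p * x \<in> I" "\<And>x y. x \<in> I \<Longrightarrow> y \<in> I \<Longrightarrow> x + y \<in> I"
    and K: "0 \<in> K" "\<And>x y. x \<in> K \<Longrightarrow> y \<in> K \<Longrightarrow> x + y \<in> K" "K \<subseteq> Pm" "K \<subseteq> I"
      "\<And>c x. c \<in> m \<Longrightarrow> x \<in> I \<Longrightarrow> Polynomial.smult c x \<in> K"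
    and u: "u \<in> I" "unit_lead u" and w0: "w0 \<in> I" "w0 \<notin> Pm"
  shows "\<exists>k\<in>K. unit_lead (w0 + k)"
proof -
  obtain d where d: "coeff w0 d \<notin> m" "\<And>i. i > d \<Longrightarrow> coeff w0 i \<in> m"
    using last_unit_coeff w0 I(1) by blast
  define D where "D = (LEAST k. \<exists>v\<in>I. unit_lead v \<and> degree v = k)"
  have "\<exists>v\<in>I. unit_lead v \<and> degree v = D"
    unfolding D_def by (rule LeastI_ex) (use u in blast)
  then obtain v where v: "v \<in> I" "unit_lead v" "degree v = D" by blast
  have least: "D \<le> degree v'" if "v' \<in> I" "unit_lead v'" for v'
    unfolding D_def by (rule Least_le) (use that in blast)
  have "D \<le> d"
  proof (rule ccontr)
    assume "\<not> D \<le> d"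
    define j where "j = D - 1 - d"
    define w where "w = monom 1 j * w0"
    have wI: "w \<in> I" unfolding w_def using A
      by (intro I(2) w0 polys_over_monom) (auto simp: subring_zero subring_one)
    have cw: "coeff w i = (if i < j then 0 else coeff w0 (i - j))" for i
      unfolding w_def coeff_monom_mult by simp
    have "coeff w i \<in> m" if "i > D - 1" for i
      unfolding cw using d(2) that \<open>\<not> D \<le> d\<close> m_zero unfolding j_def by auto
    moreover have "degree v \<le> Suc (D - 1)" using v(3) by simp
    ultimately obtain k where k: "k \<in> K" "degree (w + k) \<le> D - 1"
      using reduce_high_coeffs[OF I(2) v(1,2) K(1,2,3,5), of "D - 1" w] by blast
    have "coeff w (D - 1) \<notin> m" unfolding cw using d(1) \<open>\<not> D \<le> d\<close> unfolding j_def by auto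
    then have nm: "coeff (w + k) (D - 1) \<notin> m"
      using m_minus[of "coeff w (D - 1) + coeff k (D - 1)" "coeff k (D - 1)"] k(1) K(3) polys_over_coeff
      by auto
    then have "D - 1 \<le> degree (w + k)" using m_zero le_degree by metis
    then have deg: "degree (w + k) = D - 1" using k(2) by simp
    have "w + k \<in> I" using wI k(1) K(4) I(3) by blast
    moreover have "unit_lead (w + k)" unfolding unit_lead_def
      using nm deg \<open>w + k \<in> I\<close> I(1) by auto
    ultimately show False using least[of "w + k"] deg \<open>\<not> D \<le> d\<close> by simp
  qed
  then have "degree v \<le> Suc d" using v(3) by simp
  then obtain k where k: "k \<in> K" "degree (w0 + k) \<le> d"
    using reduce_high_coeffs[OF I(2) v(1,2) K(1,2,3,5), of d w0] d(2) by blast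
  have nm: "coeff (w0 + k) d \<notin> m"
    using m_minus[of "coeff w0 d + coeff k d" "coeff k d"] d(1) k(1) K(3) polys_over_coeff by auto
  then have "d \<le> degree (w0 + k)" using m_zero le_degree by metis
  then have "degree (w0 + k) = d" using k(2) by simp
  then have "unit_lead (w0 + k)" unfolding unit_lead_def
    using nm I(1,3) w0(1) k(1) K(4) by auto
  then show ?thesis using k(1) by blast
qed

lemma unit_lead_division:
  assumes b: "unit_lead b" and a: "a \<in> P"
  shows "\<exists>q\<in>P. a - q * b \<in> P \<and> (a - q * b = 0 \<or> degree (a - q * b) < degree b)"
  using a
proof (induction "degree a" arbitrary: a rule: less_induct)
  case less
  have b': "b \<in> P" "lead_coeff b \<in> A" "lead_coeff b \<notin> m" "b \<noteq> 0"
    using b polys_over_coeff unit_lead_nonzero[OF b] unfolding unit_lead_def by auto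
  show ?case
  proof (cases "a = 0 \<or> degree a < degree b")
    case True
    then show ?thesis using less.prems subring_zero[OF P] by (intro bexI[of _ 0]) auto
  next
    case False
    define t where "t = monom (lead_coeff a * inverse (lead_coeff b)) (degree a - degree b)"
    have tP: "t \<in> P" unfolding t_def using less.prems b' units A
      by (intro polys_over_monom) (auto simp: polys_over_coeff subring_closed)
    define a' where "a' = a - t * b"
    have a'P: "a' \<in> P" unfolding a'_def using tP b' less.prems P by (auto intro: subring_closed)
    have deg: "degree (t * b) \<le> degree a" unfolding t_def
      using False degree_mult_le[of "monom (lead_coeff a * inverse (lead_coeff b)) (degree a - degree b)" b]
        degree_monom_le[of "lead_coeff a * inverse (lead_coeff b)" "degree a - degree b"] by linarith
    have "coeff (t * b) (degree a) = lead_coeff a"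
      unfolding t_def using False b'(4) by (simp add: coeff_monom_mult)
    then have top: "coeff a' (degree a) = 0" unfolding a'_def by simp
    have le: "degree a' \<le> degree a" unfolding a'_def using deg by (intro degree_diff_le) auto
    show ?thesis
    proof (cases "a' = 0")
      case True
      then show ?thesis using tP subring_zero[OF P] unfolding a'_def by (intro bexI[of _ t]) auto
    next
      case False
      then have "degree a' \<noteq> degree a" using top by (metis leading_coeff_0_iff)
      then have "degree a' < degree a" using le by simp
      from less.hyps[OF this a'P] obtain q where
        q: "q \<in> P" "a' - q * b \<in> P" "a' - q * b = 0 \<or> degree (a' - q * b) < degree b" by blast
      then show ?thesis using tP P unfolding a'_def
        by (intro bexI[of _ "q + t"]) (auto intro: subring_add simp: algebra_simps)
    qed
  qed
qed

end

subsection \<open>Localization\<close>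

definition loc :: "'f::field set \<Rightarrow> 'f set \<Rightarrow> 'f set" where
  "loc A T = {a / t | a t. a \<in> A \<and> t \<in> T}"

definition mult_set :: "'f::field set \<Rightarrow> 'f set \<Rightarrow> bool" where
  "mult_set A T \<longleftrightarrow> T \<subseteq> A \<and> 1 \<in> T \<and> 0 \<notin> T \<and> (\<forall>s\<in>T. \<forall>t\<in>T. s * t \<in> T)"

lemma locI: "a \<in> A \<Longrightarrow> t \<in> T \<Longrightarrow> a / t \<in> loc A T"
  unfolding loc_def by blast

lemma loc_incl: "1 \<in> T \<Longrightarrow> A \<subseteq> loc A T"
  using locI[of _ A 1 T] by auto

lemma loc_subring:
  assumes A: "subring_set A" and T: "mult_set A T" shows "subring_set (loc A T)"
proof -
  have "x - y \<in> loc A T \<and> x * y \<in> loc A T" if xy: "x \<in> loc A T" "y \<in> loc A T" for x y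
  proof -
    obtain a s b t where x: "x = a / s" "a \<in> A" "s \<in> T" and y: "y = b / t" "b \<in> A" "t \<in> T"
      using xy unfolding loc_def by auto
    have st: "s \<in> A" "t \<in> A" "s \<noteq> 0" "t \<noteq> 0" "s * t \<in> T" using x y T unfolding mult_set_def by auto
    have "x - y = (a * t - b * s) / (s * t)" "x * y = (a * b) / (s * t)"
      using x y st by (auto simp: field_simps)
    moreover have "a * t - b * s \<in> A" "a * b \<in> A" using x y st A by (auto intro: subring_closed)
    ultimately show ?thesis using st locI by metis
  qed
  moreover have "1 \<in> loc A T" using locI[of 1 A 1 T] T subring_one[OF A] unfolding mult_set_def by auto
  ultimately show ?thesis unfolding subring_set_def by auto
qed

lemma common_denominator:
  assumes A: "subring_set A" and T: "mult_set A T" and "finite X" "X \<subseteq> loc A T"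
  shows "\<exists>t\<in>T. \<forall>x\<in>X. t * x \<in> A"
  using assms(3,4)
proof (induction X rule: finite_induct)
  case empty
  then show ?case using T unfolding mult_set_def by auto
next
  case (insert y X)
  then obtain t where t: "t \<in> T" "\<forall>x\<in>X. t * x \<in> A" by auto
  obtain a s where y: "y = a / s" "a \<in> A" "s \<in> T" using insert unfolding loc_def by auto
  have "s \<in> A" "t \<in> A" "s \<noteq> 0" "t * s \<in> T" using y t T unfolding mult_set_def by auto
  moreover from this have "t * s * y \<in> A" using y A by (auto intro: subring_mult)
  moreover have "t * s * x \<in> A" if "x \<in> X" for x
    using subring_mult[OF A \<open>s \<in> A\<close>, of "t * x"] t that by (simp add: ac_simps)
  ultimately show ?case by blast
qed

lemma common_denominator_mat:
  assumes A: "subring_set A" and T: "mult_set A T" and M: "M \<in> carrier_mat n n'" "mat_over (loc A T) M"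
  shows "\<exists>t\<in>T. mat_over A (t \<cdot>\<^sub>m M)"
proof -
  have "finite ((\<lambda>(i, j). M $$ (i, j)) ` ({..<n} \<times> {..<n'}))" by auto
  moreover have "(\<lambda>(i, j). M $$ (i, j)) ` ({..<n} \<times> {..<n'}) \<subseteq> loc A T"
    using mat_overD[OF M(2,1)] by auto
  ultimately obtain t where t: "t \<in> T"
    "\<forall>x\<in>(\<lambda>(i, j). M $$ (i, j)) ` ({..<n} \<times> {..<n'}). t * x \<in> A"
    using common_denominator[OF A T] by blast
  then have "\<forall>i<n. \<forall>j<n'. t * M $$ (i, j) \<in> A" by auto
  with t(1) show ?thesis using M(1) unfolding mat_over_def by (intro bexI[of _ t]) auto
qed

lemma common_denominator_mats:
  assumes A: "subring_set A" and T: "mult_set A T" and M: "M \<in> carrier_mat n n" "mat_over (loc A T) M"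
    and N: "N \<in> carrier_mat n n" "mat_over (loc A T) N"
  shows "\<exists>t\<in>T. mat_over A (t \<cdot>\<^sub>m M) \<and> mat_over A (t \<cdot>\<^sub>m N)"
proof -
  obtain t where t: "t \<in> T" "mat_over A (t \<cdot>\<^sub>m M)" using common_denominator_mat[OF A T M] by blast
  obtain s where s: "s \<in> T" "mat_over A (s \<cdot>\<^sub>m N)" using common_denominator_mat[OF A T N] by blast
  have st: "s \<in> A" "t \<in> A" "t * s \<in> T" using s t T unfolding mult_set_def by auto
  have "mat_over A ((t * s) \<cdot>\<^sub>m M)" unfolding mat_over_def
  proof (intro allI impI)
    fix i j assume ij: "i < dim_row ((t * s) \<cdot>\<^sub>m M)" "j < dim_col ((t * s) \<cdot>\<^sub>m M)"
    then have "s * (t * M $$ (i, j)) \<in> A" using t(2) st A unfolding mat_over_def by (auto intro: subring_mult)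
    then show "((t * s) \<cdot>\<^sub>m M) $$ (i, j) \<in> A" using ij by (simp add: ac_simps)
  qed
  moreover have "mat_over A ((t * s) \<cdot>\<^sub>m N)" unfolding mat_over_def
  proof (intro allI impI)
    fix i j assume ij: "i < dim_row ((t * s) \<cdot>\<^sub>m N)" "j < dim_col ((t * s) \<cdot>\<^sub>m N)"
    then have "t * (s * N $$ (i, j)) \<in> A" using s(2) st A unfolding mat_over_def by (auto intro: subring_mult)
    then show "((t * s) \<cdot>\<^sub>m N) $$ (i, j) \<in> A" using ij by (simp add: ac_simps)
  qed
  ultimately show ?thesis using st by blast
qed

subsection \<open>Ring homomorphisms\<close>

lemma (in comm_ring_hom) subring_image: "subring_set A \<Longrightarrow> subring_set (hom ` A)"
  unfolding subring_set_def
  by (auto simp: hom_distribs[symmetric] intro!: imageI) (metis hom_one imageI)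

lemma (in comm_ring_hom) lin_image: "u \<in> lin A M \<Longrightarrow> hom u \<in> lin (hom ` A) (hom ` M)"
  by (induction u rule: lin.induct) (auto simp: hom_distribs intro: lin.intros)

lemma (in comm_ring_hom) minor_map:
  assumes "F \<in> carrier_mat n n" "\<forall>i<k. f i < n \<and> g i < n"
  shows "minor k f g (map_mat hom F) = hom (minor k f g F)"
proof -
  have "mat k k (\<lambda>(i, j). map_mat hom F $$ (f i, g j)) = map_mat hom (mat k k (\<lambda>(i, j). F $$ (f i, g j)))"
    using assms by (intro eq_matI) auto
  then show ?thesis unfolding minor_def by (metis hom_det)
qed

lemma (in comm_ring_hom) kminors_map:
  assumes F: "F \<in> carrier_mat n n" shows "kminors n k (map_mat hom F) = hom ` kminors n k F"
proof (intro equalityI subsetI)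
  fix x assume "x \<in> kminors n k (map_mat hom F)"
  then obtain f g where fg: "\<forall>i<k. f i < n \<and> g i < n" and x: "x = minor k f g (map_mat hom F)"
    unfolding kminors_def by blast
  then show "x \<in> hom ` kminors n k F"
    unfolding x minor_map[OF F fg] by (intro imageI kminorsI) blast
next
  fix x assume "x \<in> hom ` kminors n k F"
  then obtain f g where fg: "\<forall>i<k. f i < n \<and> g i < n" and x: "x = hom (minor k f g F)"
    unfolding kminors_def by blast
  then show "x \<in> kminors n k (map_mat hom F)"
    unfolding x minor_map[OF F fg, symmetric] by (intro kminorsI) blast
qed

lemma (in comm_ring_hom) det_ideal_map:
  assumes F: "F \<in> carrier_mat n n" and d: "det_ideal A n k F d"
  shows "det_ideal (hom ` A) n k (map_mat hom F) (hom d)"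
  using d lin_image unfolding det_ideal_def kminors_map[OF F] by (fastforce simp: hom_distribs)

lemma (in comm_ring_hom) mat_over_map: "mat_over A M \<Longrightarrow> mat_over (hom ` A) (map_mat hom M)"
  unfolding mat_over_def by auto

lemma (in comm_ring_hom) GLs_map:
  assumes "U \<in> GLs A n" shows "map_mat hom U \<in> GLs (hom ` A) n"
proof -
  obtain U' where U': "U' \<in> GLs A n" "U * U' = 1\<^sub>m n" "U' * U = 1\<^sub>m n" using GLsE[OF assms] .
  note c = GLs_carrier[OF assms] GLs_carrier[OF U'(1)]
  have "map_mat hom U * map_mat hom U' = 1\<^sub>m n" "map_mat hom U' * map_mat hom U = 1\<^sub>m n"
    using mat_hom_mult[OF c] mat_hom_mult[OF c(2,1)] U'(2,3) mat_hom_one by metis+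
  then show ?thesis using c GLs_over[OF assms] GLs_over[OF U'(1)]
    by (intro GLsI[of _ _ _ "map_mat hom U'"]) (auto intro: mat_over_map)
qed

lemma (in comm_ring_hom) eqv_map:
  assumes "eqv A n F G" "G \<in> carrier_mat n n"
  shows "eqv (hom ` A) n (map_mat hom F) (map_mat hom G)"
proof -
  obtain U V where U: "U \<in> GLs A n" and V: "V \<in> GLs A n" and F: "F = U * G * V"
    using assms unfolding eqv_def by auto
  have "map_mat hom F = map_mat hom U * map_mat hom G * map_mat hom V" unfolding F
    using GLs_carrier[OF U] GLs_carrier[OF V] assms(2) mat_hom_mult by (metis mult_carrier_mat)
  then show ?thesis by (intro eqvI[OF GLs_map[OF U] GLs_map[OF V]])
qed

lemma (in comm_ring_hom) map_diag_of: "map_mat hom (diag_of n s) = diag_of n (hom \<circ> s)"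
  unfolding diag_of_def by (intro eq_matI) auto

interpretation to_fract_hom: inj_comm_ring_hom to_fract
  by unfold_locales auto

subsection \<open>Smith form modulo the maximal ideal\<close>

context local_subring
begin

text \<open>Units modulo the maximal ideal.\<close>

definition res_unit :: "'k poly \<Rightarrow> bool" where
  "res_unit p \<longleftrightarrow> (\<exists>r\<in>P. p * r - 1 \<in> Pm)"

text \<open>The polynomials congruent to 1 modulo the maximal ideal. Inverting them moves the maximal ideal into
the radical: \<open>Cl\<close> is the localization of \<open>A[x]\<close>, and \<open>Jl\<close> is its ideal generated by the maximal ideal of \<open>A\<close>.\<close>

definition T1 :: "'k poly fract set" where "T1 = to_fract ` {g. g - 1 \<in> Pm}"

lemma T1_poly: "g - 1 \<in> Pm \<Longrightarrow> g \<in> P"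
  using subring_add[OF P _ subring_one[OF P], of "g - 1"] Pm_subset by auto

lemma T1_mult_poly: assumes "g - 1 \<in> Pm" "h - 1 \<in> Pm" shows "g * h - 1 \<in> Pm"
proof -
  have "g * h - 1 = g * (h - 1) + (g - 1)" by (simp add: algebra_simps)
  then show ?thesis using Pm_mult[OF T1_poly[OF assms(1)] assms(2)] Pm_add assms(1) by metis
qed

lemma T1_nonzero: "g - 1 \<in> Pm \<Longrightarrow> g \<noteq> 0"
  using Pm_minus[OF Pm_zero, of "-1"] one_notin_Pm by auto

lemma T1_mult_set: "mult_set (to_fract ` P) T1"
  unfolding mult_set_def T1_def
  by (auto simp: T1_poly T1_nonzero Pm_zero to_fract_mult[symmetric] simp del: to_fract_mult
      intro!: imageI T1_mult_poly)

definition Cl :: "'k poly fract set" where "Cl = loc (to_fract ` P) T1"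
definition Jl :: "'k poly fract set" where "Jl = loc (to_fract ` Pm) T1"

lemma Cl: "subring_set Cl"
  unfolding Cl_def by (rule loc_subring[OF to_fract_hom.subring_image[OF P] T1_mult_set])

lemma ClE:
  assumes "c \<in> Cl" obtains p g where "p \<in> P" "g - 1 \<in> Pm" "c = to_fract p / to_fract g"
  using assms unfolding Cl_def loc_def T1_def by auto

lemma JlE:
  assumes "c \<in> Jl" obtains p g where "p \<in> Pm" "g - 1 \<in> Pm" "c = to_fract p / to_fract g"
  using assms unfolding Jl_def loc_def T1_def by auto

lemma ClI: "p \<in> P \<Longrightarrow> g - 1 \<in> Pm \<Longrightarrow> to_fract p / to_fract g \<in> Cl"
  unfolding Cl_def T1_def by (intro locI imageI) auto

lemma JlI: "p \<in> Pm \<Longrightarrow> g - 1 \<in> Pm \<Longrightarrow> to_fract p / to_fract g \<in> Jl"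
  unfolding Jl_def T1_def by (intro locI imageI) auto

lemma to_fract_Cl: "p \<in> P \<Longrightarrow> to_fract p \<in> Cl"
  using ClI[of p 1] Pm_zero by simp

lemma to_fract_Jl: "p \<in> Pm \<Longrightarrow> to_fract p \<in> Jl"
  using JlI[of p 1] Pm_zero by simp

lemma Jl_mult: assumes "c \<in> Cl" "x \<in> Jl" shows "c * x \<in> Jl"
proof -
  obtain p g where c: "p \<in> P" "g - 1 \<in> Pm" "c = to_fract p / to_fract g" using ClE[OF assms(1)] .
  obtain q h where x: "q \<in> Pm" "h - 1 \<in> Pm" "x = to_fract q / to_fract h" using JlE[OF assms(2)] .
  have "to_fract (p * q) / to_fract (g * h) \<in> Jl"
    using c x by (intro JlI T1_mult_poly Pm_mult) auto
  then show ?thesis unfolding c x by simp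
qed

lemma Jl_add: assumes "x \<in> Jl" "y \<in> Jl" shows "x + y \<in> Jl"
proof -
  obtain p g where c: "p \<in> Pm" "g - 1 \<in> Pm" "x = to_fract p / to_fract g" using JlE[OF assms(1)] .
  obtain q h where x: "q \<in> Pm" "h - 1 \<in> Pm" "y = to_fract q / to_fract h" using JlE[OF assms(2)] .
  have "to_fract (h * p + g * q) / to_fract (g * h) \<in> Jl"
    using c x by (intro JlI T1_mult_poly Pm_add Pm_mult T1_poly) auto
  then show ?thesis using T1_nonzero[OF c(2)] T1_nonzero[OF x(2)] unfolding c x
    by (simp add: field_simps)
qed

lemma Jl_zero: "0 \<in> Jl" using to_fract_Jl[OF Pm_zero] by simp

lemma Jl_uminus: "x \<in> Jl \<Longrightarrow> - x \<in> Jl"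
  using Jl_mult[of "-1" x] subring_uminus[OF Cl subring_one[OF Cl]] by auto

lemma residue_poly: assumes "c \<in> Cl" shows "\<exists>p\<in>P. c - to_fract p \<in> Jl"
proof -
  obtain p g where c: "p \<in> P" "g - 1 \<in> Pm" "c = to_fract p / to_fract g" using ClE[OF assms(1)] .
  have "1 - g \<in> Pm" using Pm_minus[OF Pm_zero c(2)] by simp
  then have "to_fract (p * (1 - g)) / to_fract g \<in> Jl"
    using c by (intro JlI Pm_mult) auto
  moreover have "to_fract (p * (1 - g)) / to_fract g = c - to_fract p"
    using T1_nonzero[OF c(2)] unfolding c by (simp add: field_simps)
  ultimately show ?thesis using c(1) by metis
qed

text \<open>The degree of the residue, as a polynomial over the residue field.\<close>

definition res_size :: "'k poly fract \<Rightarrow> nat" where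
  "res_size c = (LEAST d. \<exists>p\<in>P. c - to_fract p \<in> Jl \<and> degree p = d)"

lemma res_size_le: "p \<in> P \<Longrightarrow> c - to_fract p \<in> Jl \<Longrightarrow> res_size c \<le> degree p"
  unfolding res_size_def by (rule Least_le) blast

text \<open>Modulo the radical, \<open>Cl\<close> is the polynomial ring over the residue field, hence Euclidean.\<close>

lemma Cl_euclidean: "euclidean_mod_radical Cl Jl res_size"
proof
  show "subring_set Cl" by (rule Cl)
  show "Jl \<subseteq> Cl" using Pm_subset by (auto elim!: JlE intro!: ClI)
  show "0 \<in> Jl" by (rule Jl_zero)
  show "x + y \<in> Jl" if "x \<in> Jl" "y \<in> Jl" for x y using that by (rule Jl_add)
  show "c * x \<in> Jl" if "c \<in> Cl" "x \<in> Jl" for c x using that by (rule Jl_mult)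
  show "\<exists>u\<in>Cl. (1 + x) * u = 1" if xJ: "x \<in> Jl" for x
  proof -
    obtain p g where x: "p \<in> Pm" "g - 1 \<in> Pm" "x = to_fract p / to_fract g" using JlE[OF xJ] .
    have gp: "(g + p) - 1 \<in> Pm" using Pm_add[OF x(2,1)] by (simp add: algebra_simps)
    have "1 + x = to_fract (g + p) / to_fract g"
      using T1_nonzero[OF x(2)] unfolding x by (simp add: field_simps)
    moreover have "to_fract (g + p) \<noteq> 0" using T1_nonzero[OF gp] by (simp only: to_fract_eq_0_iff not_False_eq_True)
    ultimately have "(1 + x) * (to_fract g / to_fract (g + p)) = 1"
      using T1_nonzero[OF x(2)] by (simp del: to_fract_add)
    then show ?thesis using ClI[OF T1_poly[OF x(2)] gp] by blast
  qed
  show "res_size (a + x) = res_size a" if "a \<in> Cl" "x \<in> Jl" for a x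
  proof -
    have "a + x - to_fract p \<in> Jl \<longleftrightarrow> a - to_fract p \<in> Jl" for p
      using Jl_add[OF _ that(2), of "a - to_fract p"] Jl_add[OF _ Jl_uminus[OF that(2)], of "a + x - to_fract p"]
      by (auto simp: algebra_simps)
    then show ?thesis unfolding res_size_def by simp
  qed
  show "\<exists>q\<in>Cl. a - q * b \<in> Jl \<or> res_size (a - q * b) < res_size b"
    if a: "a \<in> Cl" and b: "b \<in> Cl" "b \<notin> Jl" for a b
  proof -
    have "\<exists>p\<in>P. b - to_fract p \<in> Jl \<and> degree p = res_size b"
      unfolding res_size_def by (rule LeastI_ex) (use residue_poly[OF b(1)] in blast)
    then obtain pb where pb: "pb \<in> P" "b - to_fract pb \<in> Jl" "degree pb = res_size b" by blast
    have ul: "unit_lead pb"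
    proof (rule ccontr)
      assume "\<not> unit_lead pb"
      then have lm: "lead_coeff pb \<in> m" using pb(1) unfolding unit_lead_def by simp
      define t where "t = monom (lead_coeff pb) (degree pb)"
      have tm: "t \<in> Pm" unfolding t_def by (rule polys_over_monom[OF m_zero lm])
      have "b - to_fract (pb - t) \<in> Jl"
        using Jl_add[OF pb(2) to_fract_Jl[OF tm]] by (simp add: algebra_simps)
      moreover have "pb - t \<in> P" using pb(1) tm Pm_subset P by (auto intro: subring_minus)
      ultimately have le: "degree pb \<le> degree (pb - t)" unfolding pb(3) by (intro res_size_le)
      have "coeff (pb - t) (degree pb) = 0" unfolding t_def by simp
      moreover have "degree (pb - t) \<le> degree pb"
        unfolding t_def by (intro degree_diff_le degree_monom_le) auto
      ultimately have "pb - t = 0" using le by (metis leading_coeff_0_iff le_antisym)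
      then have "b \<in> Jl" using Jl_add[OF pb(2) to_fract_Jl[OF tm]] by simp
      then show False using b by blast
    qed
    obtain pa where pa: "pa \<in> P" "a - to_fract pa \<in> Jl" using residue_poly[OF a] by blast
    obtain q where q: "q \<in> P" "pa - q * pb \<in> P" "pa - q * pb = 0 \<or> degree (pa - q * pb) < degree pb"
      using unit_lead_division[OF ul pa(1)] by blast
    have "a - to_fract q * b - to_fract (pa - q * pb)
        = (a - to_fract pa) + (- to_fract q) * (b - to_fract pb)" by (simp add: algebra_simps)
    also have "\<dots> \<in> Jl"
      using pa(2) pb(2) to_fract_Cl[OF q(1)] by (intro Jl_add Jl_mult subring_uminus[OF Cl])
    finally have r: "a - to_fract q * b - to_fract (pa - q * pb) \<in> Jl" .
    from q(3) show ?thesis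
    proof
      assume "pa - q * pb = 0"
      then show ?thesis using r to_fract_Cl[OF q(1)] by (intro bexI[of _ "to_fract q"]) auto
    next
      assume "degree (pa - q * pb) < degree pb"
      then have "res_size (a - to_fract q * b) < res_size b"
        using res_size_le[OF q(2) r] pb(3) by simp
      then show ?thesis using to_fract_Cl[OF q(1)] by blast
    qed
  qed
qed

text \<open>Over the localization \<open>Cl\<close> the matrix is equivalent to the diagonal matrix. Clearing denominators, which
are congruent to 1, yields an intertwining relation over \<open>A[x]\<close>; it is invertible modulo the maximal ideal.\<close>

lemma residue_smith:
  assumes F: "F \<in> carrier_mat n n" "mat_over P F"
    and s: "\<And>i. Suc i < n \<Longrightarrow> \<exists>c\<in>P. s (Suc i) = s i * c"
    and d: "\<And>k. k \<le> n \<Longrightarrow> det_ideal P n k F (\<Prod>i<k. s i)"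
  shows "\<exists>X\<in>carrier_mat n n. \<exists>Y\<in>carrier_mat n n. mat_over P X \<and> mat_over P Y \<and>
    X * diag_of n s = F * Y \<and> res_unit (det X) \<and> res_unit (det Y)"
proof -
  interpret Cl: euclidean_mod_radical Cl Jl res_size by (rule Cl_euclidean)
  have sub: "to_fract ` P \<subseteq> Cl" using to_fract_Cl by auto
  let ?F = "map_mat to_fract F" and ?S = "diag_of n (to_fract \<circ> s)"
  have "eqv Cl n ?F ?S"
  proof (rule Cl.smith_of_det_ideals)
    show "mat_over Cl ?F" using to_fract_hom.mat_over_map[OF F(2)] mat_over_mono[OF _ sub] by blast
    show "\<exists>c\<in>Cl. (to_fract \<circ> s) (Suc i) = (to_fract \<circ> s) i * c" if "Suc i < n" for i
      using s[OF that] to_fract_Cl by fastforce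
    show "det_ideal Cl n k ?F (\<Prod>i<k. (to_fract \<circ> s) i)" if "k \<le> n" for k
      using det_ideal_mono[OF to_fract_hom.det_ideal_map[OF F(1) d[OF that]] sub]
      by (simp add: to_fract_hom.hom_prod)
  qed (use F in auto)
  then obtain U V where U: "U \<in> GLs Cl n" and V: "V \<in> GLs Cl n" and F': "?F = U * ?S * V"
    unfolding eqv_def by blast
  obtain V' where V': "V' \<in> GLs Cl n" "V * V' = 1\<^sub>m n" "V' * V = 1\<^sub>m n" using GLsE[OF V] .
  note c = GLs_carrier[OF U] GLs_carrier[OF V] GLs_carrier[OF V'(1)]
  have "?F * V' = U * ?S * (V * V')" unfolding F'
    by (rule assoc_mult_mat[OF mult_carrier_mat[OF c(1) diag_of_carrier] c(2,3)])
  then have rel: "?F * V' = U * ?S"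
    using right_mult_one_mat[OF mult_carrier_mat[OF c(1) diag_of_carrier]] V'(2) by simp
  obtain t where t: "t \<in> T1" "mat_over (to_fract ` P) (t \<cdot>\<^sub>m U)" "mat_over (to_fract ` P) (t \<cdot>\<^sub>m V')"
    using common_denominator_mats[OF to_fract_hom.subring_image[OF P] T1_mult_set]
      GLs_over[OF U] GLs_over[OF V'(1)] c unfolding Cl_def[symmetric] by blast
  obtain g where g: "g - 1 \<in> Pm" "t = to_fract g" using t(1) unfolding T1_def by auto
  have lift: "\<exists>X\<in>carrier_mat n n. mat_over P X \<and> map_mat to_fract X = t \<cdot>\<^sub>m W \<and> res_unit (det X)"
    if W: "W \<in> GLs Cl n" "mat_over (to_fract ` P) (t \<cdot>\<^sub>m W)" for W
  proof -
    note cW = GLs_carrier[OF W(1)]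
    define X where "X = mat n n (\<lambda>(i, j). SOME p. p \<in> P \<and> to_fract p = t * W $$ (i, j))"
    have X: "X $$ (i, j) \<in> P \<and> to_fract (X $$ (i, j)) = t * W $$ (i, j)" if "i < n" "j < n" for i j
    proof -
      have "t * W $$ (i, j) \<in> to_fract ` P"
        using W(2) cW that unfolding mat_over_def by auto
      then have "\<exists>p. p \<in> P \<and> to_fract p = t * W $$ (i, j)" by force
      from someI_ex[OF this] show ?thesis unfolding X_def using that by simp
    qed
    have cX: "X \<in> carrier_mat n n" unfolding X_def by auto
    have mX: "map_mat to_fract X = t \<cdot>\<^sub>m W" using X cX cW by (intro eq_matI) auto
    obtain e where e: "e \<in> Cl" "det W * e = 1" using GLs_iff_det[OF Cl cW GLs_over[OF W(1)]] W(1) by blast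
    obtain p h where ph: "p \<in> P" "h - 1 \<in> Pm" "e = to_fract p / to_fract h" using ClE[OF e(1)] .
    have "to_fract (det X) = det (t \<cdot>\<^sub>m W)" unfolding mX[symmetric] by simp
    also have "\<dots> = t ^ n * det W" using cW by (simp add: det_smult)
    finally have "to_fract (det X * p) = to_fract (g ^ n * h) * (det W * e)"
      unfolding g ph(3) using T1_nonzero[OF ph(2)] by (simp add: to_fract_hom.hom_power)
    then have "to_fract (det X * p) = to_fract (g ^ n * h)" unfolding e(2) by simp
    then have eq: "det X * p = g ^ n * h" by (simp only: to_fract_eq_iff)
    have "g ^ k - 1 \<in> Pm" for k by (induction k) (auto simp: Pm_zero intro: T1_mult_poly[OF g(1)])
    from T1_mult_poly[OF this ph(2)] have "res_unit (det X)" unfolding res_unit_def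
      using ph(1) eq by (intro bexI[of _ p]) auto
    moreover have "mat_over P X" using X cX unfolding mat_over_def by auto
    ultimately show ?thesis using cX mX by blast
  qed
  obtain X where X: "X \<in> carrier_mat n n" "mat_over P X" "map_mat to_fract X = t \<cdot>\<^sub>m U" "res_unit (det X)"
    using lift[OF U t(2)] by blast
  obtain Y where Y: "Y \<in> carrier_mat n n" "mat_over P Y" "map_mat to_fract Y = t \<cdot>\<^sub>m V'" "res_unit (det Y)"
    using lift[OF V'(1) t(3)] by blast
  have "map_mat to_fract (X * diag_of n s) = map_mat to_fract X * ?S"
    by (simp add: to_fract_hom.mat_hom_mult[OF X(1) diag_of_carrier] to_fract_hom.map_diag_of)
  also have "\<dots> = t \<cdot>\<^sub>m (?F * V')" unfolding X(3) rel by (rule mult_smult_assoc_mat[OF c(1) diag_of_carrier])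
  also have "\<dots> = ?F * map_mat to_fract Y" unfolding Y(3) using c F by (simp add: mult_smult_distrib[of _ n n _ n])
  also have "\<dots> = map_mat to_fract (F * Y)"
    using F Y(1) by (simp add: to_fract_hom.mat_hom_mult[of _ n n _ n])
  finally have eq: "map_mat to_fract (X * diag_of n s) = map_mat to_fract (F * Y)" .
  have "X * diag_of n s = F * Y" by (rule to_fract_hom.mat_hom_inj[OF eq])
  then show ?thesis using X Y by blast
qed

end

section \<open>The local case: Horrocks' theorem for matrices\<close>

definition vec_over :: "'a set \<Rightarrow> 'a vec \<Rightarrow> bool" where
  "vec_over A v \<longleftrightarrow> (\<forall>i<dim_vec v. v $ i \<in> A)"

text \<open>The \<open>j\<close>-th coordinate of \<open>b\<close> with respect to the columns of \<open>M\<close>, multiplied by \<open>det M\<close> (Cramer's rule).\<close>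

definition det_col :: "'a::comm_ring_1 mat \<Rightarrow> nat \<Rightarrow> 'a vec \<Rightarrow> 'a" where
  "det_col M j b = det (replace_col M b j)"

lemma replace_col_carrier: "M \<in> carrier_mat n n \<Longrightarrow> replace_col M b j \<in> carrier_mat n n"
  unfolding replace_col_def by auto

lemma col_replace_col:
  "M \<in> carrier_mat n n \<Longrightarrow> b \<in> carrier_vec n \<Longrightarrow> q < n \<Longrightarrow>
    col (replace_col M b j) q = (if q = j then b else col M q)"
  unfolding replace_col_def by (intro eq_vecI) auto

lemma det_col_laplace:
  assumes M: "M \<in> carrier_mat n n" and j: "j < n"
  shows "det_col M j b = (\<Sum>i<n. b $ i * cofactor M i j)"
proof -
  have "cofactor (replace_col M b j) i j = cofactor M i j" for i
  proof -
    have "mat_delete (replace_col M b j) i j = mat_delete M i j"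
      unfolding mat_delete_def replace_col_def using M j by (intro eq_matI) auto
    then show ?thesis unfolding cofactor_def by simp
  qed
  moreover have "replace_col M b j $$ (i, j) = b $ i" if "i < n" for i
    unfolding replace_col_def using M j that by auto
  ultimately show ?thesis unfolding det_col_def
    by (subst laplace_expansion_column[OF replace_col_carrier[OF M] j]) simp
qed

lemma det_col_add:
  assumes "M \<in> carrier_mat n n" "j < n" "a \<in> carrier_vec n" "b \<in> carrier_vec n"
  shows "det_col M j (a + b) = det_col M j a + det_col M j b"
  unfolding det_col_laplace[OF assms(1,2)] sum.distrib[symmetric]
  using assms(3,4) by (intro sum.cong) (auto simp: distrib_right)

lemma det_col_smult:
  assumes "M \<in> carrier_mat n n" "j < n" "a \<in> carrier_vec n"
  shows "det_col M j (c \<cdot>\<^sub>v a) = c * det_col M j a"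
  unfolding det_col_laplace[OF assms(1,2)] sum_distrib_left
  using assms(3) by (intro sum.cong) (auto simp: mult.assoc)

lemma det_col_self:
  assumes "M \<in> carrier_mat n n" "j < n" shows "det_col M j (col M j) = det M"
proof -
  have "replace_col M (col M j) j = M" using assms unfolding replace_col_def by (intro eq_matI) auto
  then show ?thesis unfolding det_col_def by simp
qed

lemma det_col_repeated:
  assumes M: "M \<in> carrier_mat n n" and j: "j < n" and p: "p < n" "p \<noteq> j"
  shows "det_col M j (col M p) = 0"
  unfolding det_col_def
  by (rule det_identical_columns[OF replace_col_carrier[OF M] p(2) p(1) j])
     (use assms in \<open>simp add: col_replace_col[OF M]\<close>)

lemma det_col_mult_vec:
  assumes X: "X \<in> carrier_mat n n" and j: "j < n" and M: "M \<in> carrier_mat n n" and y: "y \<in> carrier_vec n"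
  shows "det_col X j (M *\<^sub>v y) = (\<Sum>p<n. y $ p * det_col X j (col M p))"
proof -
  have "(M *\<^sub>v y) $ i = (\<Sum>p<n. M $$ (i, p) * y $ p)" if "i < n" for i
    using M y that by (auto simp: scalar_prod_def lessThan_atLeast0 intro!: sum.cong)
  then have "det_col X j (M *\<^sub>v y) = (\<Sum>i<n. \<Sum>p<n. M $$ (i, p) * y $ p * cofactor X i j)"
    unfolding det_col_laplace[OF X j] by (simp add: sum_distrib_right)
  also have "\<dots> = (\<Sum>p<n. \<Sum>i<n. M $$ (i, p) * y $ p * cofactor X i j)" by (rule sum.swap)
  also have "\<dots> = (\<Sum>p<n. y $ p * det_col X j (col M p))"
    unfolding det_col_laplace[OF X j] using M
    by (auto simp: sum_distrib_left ac_simps intro!: sum.cong)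
  finally show ?thesis .
qed

lemma cramer_solution:
  assumes M: "M \<in> carrier_mat n n" and b: "b \<in> carrier_vec n"
  shows "M *\<^sub>v vec n (\<lambda>p. det_col M p b) = det M \<cdot>\<^sub>v b"
proof -
  note adj = adj_mat[OF M]
  have "adj_mat M *\<^sub>v b = vec n (\<lambda>p. det_col M p b)"
  proof (rule eq_vecI)
    fix p assume "p < dim_vec (vec n (\<lambda>p. det_col M p b))"
    then have p: "p < n" by simp
    have "(adj_mat M *\<^sub>v b) $ p = (\<Sum>i<n. cofactor M i p * b $ i)"
      using M b p adj(1) unfolding adj_mat_def
      by (auto simp: scalar_prod_def lessThan_atLeast0 intro!: sum.cong)
    then show "(adj_mat M *\<^sub>v b) $ p = vec n (\<lambda>p. det_col M p b) $ p"
      using p by (simp add: det_col_laplace[OF M p] ac_simps)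
  qed (use adj in auto)
  then have "M *\<^sub>v vec n (\<lambda>p. det_col M p b) = (M * adj_mat M) *\<^sub>v b"
    using assoc_mult_mat_vec[OF M adj(1) b] by simp
  also have "\<dots> = det M \<cdot>\<^sub>v b" unfolding adj(2) using b
    by (intro eq_vecI) (auto simp: scalar_prod_def if_distrib if_distribR sum.If_cases intro!: trans[OF sum.cong])
  finally show ?thesis .
qed

text \<open>If column \<open>j\<close> is subtracted from column \<open>p\<close>, the \<open>j\<close>-th coordinate of a vector increases by the \<open>p\<close>-th one.\<close>

lemma det_col_addcol:
  fixes X :: "'a::idom mat"
  assumes X: "X \<in> carrier_mat n n" and j: "j < n" and p: "p < n" "p \<noteq> j" and nz: "det X \<noteq> 0"
    and b: "b \<in> carrier_vec n"
  shows "det_col (addcol (-1) p j X) j b = det_col X j b + det_col X p b"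
proof -
  define X' where "X' = addcol (-1) p j X"
  have X': "X' \<in> carrier_mat n n" unfolding X'_def using X by auto
  have dX': "det X' = det X" unfolding X'_def by (rule det_addcol) (use X j p in auto)
  define y where "y = vec n (\<lambda>p. det_col X p b)"
  define y' where "y' = vec n (\<lambda>q. y $ q + (if q = j then y $ p else 0))"
  have y: "y \<in> carrier_vec n" "y' \<in> carrier_vec n" unfolding y_def y'_def by auto
  have "X' *\<^sub>v y' = X *\<^sub>v y"
  proof (rule eq_vecI)
    fix i assume "i < dim_vec (X *\<^sub>v y)"
    then have i: "i < n" using X by simp
    have "(X' *\<^sub>v y') $ i = (\<Sum>q<n. X' $$ (i, q) * y' $ q)"
      using X' y i by (auto simp: scalar_prod_def lessThan_atLeast0 intro!: sum.cong)
    also have "\<dots> = (\<Sum>q<n. X $$ (i, q) * y $ q + (if q = j then X $$ (i, j) * y $ p else 0)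
          - (if q = p then X $$ (i, j) * y $ p else 0))"
      unfolding X'_def y'_def using X i p by (intro sum.cong) (auto simp: algebra_simps)
    also have "\<dots> = (\<Sum>q<n. X $$ (i, q) * y $ q)"
      using j p by (simp add: sum.distrib sum_subtractf)
    also have "\<dots> = (X *\<^sub>v y) $ i"
      using X y i by (auto simp: scalar_prod_def lessThan_atLeast0 intro!: sum.cong)
    finally show "(X' *\<^sub>v y') $ i = (X *\<^sub>v y) $ i" .
  qed (use X X' in auto)
  then have "X' *\<^sub>v y' = det X \<cdot>\<^sub>v b" unfolding y_def cramer_solution[OF X b] .
  then have "det X * det_col X' j b = y' $ j * det X"
    using cramer_lemma_mat[OF X' y(2) j] det_col_smult[OF X' j b] dX'
    unfolding det_col_def[symmetric] by simp
  then show ?thesis using nz j p unfolding X'_def[symmetric] y'_def y_def by simp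
qed

lemma dim_diag_of[simp]: "dim_row (diag_of n s) = n" "dim_col (diag_of n s) = n"
  unfolding diag_of_def by auto

lemma mult_diag_of_cols:
  assumes X: "X \<in> carrier_mat n n" and Y: "Y \<in> carrier_mat n n" and F: "F \<in> carrier_mat n n"
  shows "X * diag_of n s = F * Y \<longleftrightarrow> (\<forall>q<n. s q \<cdot>\<^sub>v col X q = F *\<^sub>v col Y q)"
proof -
  have "(X * diag_of n s) $$ (i, q) = s q * X $$ (i, q)" if "i < n" "q < n" for i q
  proof -
    have "(X * diag_of n s) $$ (i, q) = (\<Sum>l\<in>{0..<n}. X $$ (i, l) * diag_of n s $$ (l, q))"
      by (rule mat_mult_entry[OF X diag_of_carrier that])
    also have "\<dots> = (\<Sum>l\<in>{0..<n}. if l = q then s q * X $$ (i, q) else 0)"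
      using that unfolding diag_of_def by (intro sum.cong) auto
    finally show ?thesis using that by simp
  qed
  then have c1: "col (X * diag_of n s) q = s q \<cdot>\<^sub>v col X q" if "q < n" for q
    using that X diag_of_carrier[of n s] by (intro eq_vecI) (auto simp del: index_mult_mat(1))
  have c2: "col (F * Y) q = F *\<^sub>v col Y q" if "q < n" for q
    using col_mult2[OF F Y that] .
  have "X * diag_of n s = F * Y \<longleftrightarrow> (\<forall>q<n. col (X * diag_of n s) q = col (F * Y) q)"
  proof
    assume "\<forall>q<n. col (X * diag_of n s) q = col (F * Y) q"
    then show "X * diag_of n s = F * Y"
      by (intro mat_col_eqI) (use X F Y in \<open>simp_all only: index_mult_mat(2,3) carrier_matD dim_diag_of\<close>)
  qed auto
  then show ?thesis using c1 c2 by auto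
qed

context local_subring
begin

lemma cofactor_in:
  assumes "M \<in> carrier_mat n n" "mat_over P M" "i < n" "j < n" shows "cofactor M i j \<in> P"
proof -
  have "adj_mat M $$ (j, i) \<in> P"
    by (rule mat_overD[OF mat_over_adj[OF P assms(2,1)] adj_mat(1)[OF assms(1)] assms(4,3)])
  then show ?thesis using assms unfolding adj_mat_def by simp
qed

lemma det_col_in:
  "M \<in> carrier_mat n n \<Longrightarrow> mat_over P M \<Longrightarrow> j < n \<Longrightarrow> b \<in> carrier_vec n \<Longrightarrow> vec_over P b \<Longrightarrow> det_col M j b \<in> P"
  unfolding vec_over_def by (auto simp: det_col_laplace intro!: subring_sum[OF P] subring_mult[OF P] cofactor_in)

lemma det_col_in_Pm:
  "M \<in> carrier_mat n n \<Longrightarrow> mat_over P M \<Longrightarrow> j < n \<Longrightarrow> b \<in> carrier_vec n \<Longrightarrow> vec_over Pm b \<Longrightarrow> det_col M j b \<in> Pm"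
  unfolding vec_over_def det_col_laplace
  by (subst mult.commute) (auto intro!: Pm_sum Pm_mult cofactor_in)

lemma res_unit_notin_Pm: "res_unit p \<Longrightarrow> p \<notin> Pm"
proof
  assume "res_unit p" "p \<in> Pm"
  then obtain r where "p * r - 1 \<in> Pm" "r * p \<in> Pm" unfolding res_unit_def using Pm_mult by blast
  then have "r * p - (p * r - 1) \<in> Pm" using Pm_minus by blast
  then show False using one_notin_Pm by (simp add: mult.commute)
qed

lemma res_unit_cong: "res_unit p \<Longrightarrow> x \<in> Pm \<Longrightarrow> res_unit (p + x)"
proof -
  assume "res_unit p" and x: "x \<in> Pm"
  then obtain r where r: "r \<in> P" "p * r - 1 \<in> Pm" unfolding res_unit_def by blast
  have "(p + x) * r - 1 = (p * r - 1) + r * x" by (simp add: algebra_simps)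
  then show ?thesis using Pm_add[OF r(2) Pm_mult[OF r(1) x]] r(1) unfolding res_unit_def by metis
qed

text \<open>Otherwise, up to a factor and modulo the maximal ideal, column \<open>j\<close> of \<open>XC\<close> would be a combination of the
first \<open>j\<close> columns of \<open>XD\<close>. These are also columns of \<open>XC\<close>, and \<open>det XC\<close> would vanish modulo the maximal ideal.\<close>

lemma pivot_exists:
  assumes XD: "XD \<in> carrier_mat n n" "mat_over P XD" and XC: "XC \<in> carrier_mat n n" "mat_over P XC"
    and j: "j < n" and common: "\<forall>q<j. col XD q = col XC q" and D: "det XD \<notin> Pm" and C: "det XC \<notin> Pm"
  shows "\<exists>p. j \<le> p \<and> p < n \<and> det_col XD p (col XC j) \<notin> Pm"
proof (rule ccontr)
  assume no: "\<not> ?thesis"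
  let ?c = "col XC j"
  define y where "y = vec n (\<lambda>p. det_col XD p ?c)"
  have c: "?c \<in> carrier_vec n" "y \<in> carrier_vec n" using XC j unfolding y_def by auto
  have "det XD * det XC = det_col XC j (det XD \<cdot>\<^sub>v ?c)"
    using det_col_smult[OF XC(1) j c(1)] det_col_self[OF XC(1) j] by simp
  also have "\<dots> = det_col XC j (XD *\<^sub>v y)" unfolding y_def cramer_solution[OF XD(1) c(1)] ..
  also have "\<dots> = (\<Sum>p<n. y $ p * det_col XC j (col XD p))"
    by (rule det_col_mult_vec[OF XC(1) j XD(1) c(2)])
  also have "\<dots> \<in> Pm"
  proof (rule Pm_sum)
    fix p assume p: "p \<in> {..<n}"
    show "y $ p * det_col XC j (col XD p) \<in> Pm"
    proof (cases "p < j")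
      case True
      then have "det_col XC j (col XD p) = 0"
        using det_col_repeated[OF XC(1) j, of p] common p by simp
      then show ?thesis by (simp add: Pm_zero)
    next
      case False
      then have "y $ p \<in> Pm" using no p unfolding y_def by simp
      moreover have "det_col XC j (col XD p) \<in> P"
        using p XD XC j by (intro det_col_in) (auto simp: vec_over_def intro: mat_overD)
      ultimately show ?thesis using Pm_mult by (subst mult.commute) blast
    qed
  qed
  finally show False
    using Pm_prime C D det_in_subring[OF P XD(2,1)] det_in_subring[OF P XC(2,1)] by blast
qed

text \<open>Adding a later column to column \<open>j\<close> makes the residue of the \<open>j\<close>-th coordinate nonzero.\<close>

lemma make_pivot:
  assumes XD: "XD \<in> carrier_mat n n" "mat_over P XD" and XC: "XC \<in> carrier_mat n n" "mat_over P XC"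
    and j: "j < n" and common: "\<forall>q<j. col XD q = col XC q" and D: "det XD \<notin> Pm" and C: "det XC \<notin> Pm"
  shows "det_col XD j (col XC j) \<notin> Pm \<or>
    (\<exists>p. j < p \<and> p < n \<and> det_col (addcol (-1) p j XD) j (col XC j) \<notin> Pm)"
proof (cases "det_col XD j (col XC j) \<in> Pm")
  case True
  obtain p where p: "j \<le> p" "p < n" "det_col XD p (col XC j) \<notin> Pm"
    using pivot_exists[OF assms] by blast
  then have "j < p" using True by (cases "j = p") auto
  have "det XD \<noteq> 0" using D Pm_zero by auto
  then have "det_col (addcol (-1) p j XD) j (col XC j) = det_col XD j (col XC j) + det_col XD p (col XC j)"
    using \<open>j < p\<close> p XC by (intro det_col_addcol[OF XD(1) j p(2)]) (auto simp: carrier_vecI)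
  then have "det_col (addcol (-1) p j XD) j (col XC j) \<notin> Pm"
    using Pm_minus[OF _ True, of "det_col XD j (col XC j) + det_col XD p (col XC j)"] p(3) by auto
  then show ?thesis using \<open>j < p\<close> p(2) by blast
qed auto

text \<open>\<open>intertwiners\<close> is the module of possible pairs of corresponding columns of matrices \<open>X\<close> and \<open>Y\<close>
  with \<open>X * diag s = F * Y\<close>.\<close>

definition intertwiners :: "'k poly mat \<Rightarrow> nat \<Rightarrow> 'k poly \<Rightarrow> ('k poly vec \<times> 'k poly vec) set" where
  "intertwiners F n t = {(a, b). a \<in> carrier_vec n \<and> b \<in> carrier_vec n \<and> vec_over P a \<and> vec_over P b \<and>
     t \<cdot>\<^sub>v a = F *\<^sub>v b}"

text \<open>The values of the linear functional \<open>\<phi>\<close> form an ideal that contains a polynomial with unit leading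
coefficient; \<open>unit_lead_in_coset\<close> applies to it.\<close>

lemma adjust_residue_class:
  assumes F: "F \<in> carrier_mat n n"
    and add: "\<And>a b a' b'. (a, b) \<in> intertwiners F n t \<Longrightarrow> (a', b') \<in> intertwiners F n t \<Longrightarrow>
      \<phi> (a + a') (b + b') = \<phi> a b + \<phi> a' b'"
    and mult: "\<And>a b c. (a, b) \<in> intertwiners F n t \<Longrightarrow> c \<in> P \<Longrightarrow> \<phi> (c \<cdot>\<^sub>v a) (c \<cdot>\<^sub>v b) = c * \<phi> a b"
    and into: "\<And>a b. (a, b) \<in> intertwiners F n t \<Longrightarrow> \<phi> a b \<in> P"
    and into_m: "\<And>a b. (a, b) \<in> intertwiners F n t \<Longrightarrow> vec_over Pm a \<Longrightarrow> vec_over Pm b \<Longrightarrow> \<phi> a b \<in> Pm"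
    and D: "(aD, bD) \<in> intertwiners F n t" "unit_lead (\<phi> aD bD)"
    and C: "(aC, bC) \<in> intertwiners F n t" "\<phi> aC bC \<notin> Pm"
  shows "\<exists>a b. (a, b) \<in> intertwiners F n t \<and> vec_over Pm a \<and> vec_over Pm b \<and> unit_lead (\<phi> (aC + a) (bC + b))"
proof -
  let ?N = "intertwiners F n t"
  have N_add: "(a + a', b + b') \<in> ?N" if "(a, b) \<in> ?N" "(a', b') \<in> ?N" for a b a' b'
    using that F P unfolding intertwiners_def vec_over_def
    by (auto intro: subring_add simp: smult_add_distrib_vec[of _ n] mult_add_distrib_mat_vec[of _ n n])
  have N_mult: "(c \<cdot>\<^sub>v a, c \<cdot>\<^sub>v b) \<in> ?N" if abc: "(a, b) \<in> ?N" "c \<in> P" for a b c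
  proof -
    have "b \<in> carrier_vec n" using abc unfolding intertwiners_def by simp
    then have "F *\<^sub>v (c \<cdot>\<^sub>v b) = c \<cdot>\<^sub>v (F *\<^sub>v b)"
      using F by (intro eq_vecI) auto
    moreover have "t \<cdot>\<^sub>v (c \<cdot>\<^sub>v a) = c \<cdot>\<^sub>v (t \<cdot>\<^sub>v a)" by (simp add: smult_smult_assoc mult.commute)
    ultimately show ?thesis using abc P unfolding intertwiners_def vec_over_def
      by (auto intro: subring_mult)
  qed
  define I where "I = {\<phi> a b | a b. (a, b) \<in> ?N}"
  define K where "K = {\<phi> a b | a b. (a, b) \<in> ?N \<and> vec_over Pm a \<and> vec_over Pm b}"
  have "\<exists>k\<in>K. unit_lead (\<phi> aC bC + k)"
  proof (rule unit_lead_in_coset[of I K])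
    show "I \<subseteq> P" unfolding I_def using into by auto
    show "p * x \<in> I" if px: "p \<in> P" "x \<in> I" for p x
    proof -
      obtain a b where ab: "x = \<phi> a b" "(a, b) \<in> ?N" using px(2) unfolding I_def by blast
      show ?thesis unfolding I_def ab(1) mult[OF ab(2) px(1), symmetric] using N_mult[OF ab(2) px(1)] by blast
    qed
    show "x + y \<in> I" if xy: "x \<in> I" "y \<in> I" for x y
    proof -
      obtain a b a' b' where ab: "x = \<phi> a b" "(a, b) \<in> ?N" "y = \<phi> a' b'" "(a', b') \<in> ?N"
        using xy unfolding I_def by blast
      show ?thesis unfolding I_def ab(1,3) add[OF ab(2,4), symmetric] using N_add[OF ab(2,4)] by blast
    qed
    show "0 \<in> K"
    proof -
      have "(0 \<cdot>\<^sub>v aD, 0 \<cdot>\<^sub>v bD) \<in> ?N" "\<phi> (0 \<cdot>\<^sub>v aD) (0 \<cdot>\<^sub>v bD) = 0"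
        using N_mult[OF D(1) subring_zero[OF P]] mult[OF D(1) subring_zero[OF P]] by auto
      moreover have "vec_over Pm (0 \<cdot>\<^sub>v aD)" "vec_over Pm (0 \<cdot>\<^sub>v bD)" unfolding vec_over_def by (auto simp: Pm_zero)
      ultimately show ?thesis unfolding K_def mem_Collect_eq
        by (intro exI[of _ "0 \<cdot>\<^sub>v aD"] exI[of _ "0 \<cdot>\<^sub>v bD"]) simp
    qed
    show "x + y \<in> K" if xy: "x \<in> K" "y \<in> K" for x y
    proof -
      obtain a b a' b' where ab: "x = \<phi> a b" "(a, b) \<in> ?N" "vec_over Pm a" "vec_over Pm b"
        "y = \<phi> a' b'" "(a', b') \<in> ?N" "vec_over Pm a'" "vec_over Pm b'"
        using xy unfolding K_def by blast
      have "vec_over Pm (a + a')" "vec_over Pm (b + b')"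
        using ab unfolding vec_over_def intertwiners_def by (auto intro: Pm_add)
      then show ?thesis unfolding K_def ab(1,5) add[OF ab(2,6), symmetric] using N_add[OF ab(2,6)] by blast
    qed
    show "K \<subseteq> Pm" unfolding K_def using into_m by auto
    show "K \<subseteq> I" unfolding K_def I_def by auto
    show "Polynomial.smult c x \<in> K" if c: "c \<in> m" and x: "x \<in> I" for c x
    proof -
      obtain a b where ab: "x = \<phi> a b" "(a, b) \<in> ?N" using x unfolding I_def by blast
      have cm: "[:c:] \<in> Pm" "[:c:] \<in> P" using c m_subset m_zero subring_zero[OF A]
        by (auto intro: polys_over_const)
      have "vec_over Pm ([:c:] \<cdot>\<^sub>v a)" "vec_over Pm ([:c:] \<cdot>\<^sub>v b)"
        using ab(2) Pm_mult[OF _ cm(1)] unfolding vec_over_def intertwiners_def by (auto simp: mult.commute)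
      then show ?thesis using N_mult[OF ab(2) cm(2)] mult[OF ab(2) cm(2)] unfolding K_def mem_Collect_eq ab(1)
        by (intro exI[of _ "[:c:] \<cdot>\<^sub>v a"] exI[of _ "[:c:] \<cdot>\<^sub>v b"]) simp
    qed
    show "\<phi> aD bD \<in> I" "unit_lead (\<phi> aD bD)" "\<phi> aC bC \<in> I" "\<phi> aC bC \<notin> Pm"
      using D C unfolding I_def by auto
  qed
  then obtain a b where ab: "(a, b) \<in> ?N" "vec_over Pm a" "vec_over Pm b" "unit_lead (\<phi> aC bC + \<phi> a b)"
    unfolding K_def by blast
  then show ?thesis using add[OF C(1) ab(1)] by (intro exI[of _ a] exI[of _ b]) simp
qed

end

lemma mult_mat_vec_smult:
  "(F :: 'a::comm_ring_1 mat) \<in> carrier_mat n n \<Longrightarrow> b \<in> carrier_vec n \<Longrightarrow> F *\<^sub>v (c \<cdot>\<^sub>v b) = c \<cdot>\<^sub>v (F *\<^sub>v b)"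
  by (intro eq_vecI) auto

context local_subring
begin

text \<open>A pair of matrices with \<open>X * diag s = F * Y\<close>; if both are invertible, \<open>F\<close> is equivalent to
  \<open>diag s\<close>.\<close>

definition intertwining :: "'k poly mat \<Rightarrow> nat \<Rightarrow> (nat \<Rightarrow> 'k poly) \<Rightarrow> 'k poly mat \<Rightarrow> 'k poly mat \<Rightarrow> bool" where
  "intertwining F n s X Y \<longleftrightarrow> X \<in> carrier_mat n n \<and> Y \<in> carrier_mat n n \<and> mat_over P X \<and> mat_over P Y \<and>
     X * diag_of n s = F * Y"

lemma intertwining_col:
  assumes "intertwining F n s X Y" "F \<in> carrier_mat n n" "q < n"
  shows "(col X q, col Y q) \<in> intertwiners F n (s q)"
  using assms mult_diag_of_cols[of X n Y F s] unfolding intertwining_def intertwiners_def vec_over_def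
  by (auto intro: mat_overD)

lemma intertwining_cols:
  assumes "X \<in> carrier_mat n n" "Y \<in> carrier_mat n n" "F \<in> carrier_mat n n"
    and "\<And>q. q < n \<Longrightarrow> (col X q, col Y q) \<in> intertwiners F n (s q)"
  shows "intertwining F n s X Y"
proof -
  have "mat_over P X" "mat_over P Y"
    using assms unfolding mat_over_def intertwiners_def vec_over_def by force+
  then show ?thesis using assms mult_diag_of_cols[OF assms(1-3), of s]
    unfolding intertwining_def intertwiners_def by auto
qed

lemma intertwining_replace:
  assumes i: "intertwining F n s X Y" and F: "F \<in> carrier_mat n n" and ab: "(a, b) \<in> intertwiners F n (s j)"
  shows "intertwining F n s (replace_col X a j) (replace_col Y b j)"
proof -
  have c: "X \<in> carrier_mat n n" "Y \<in> carrier_mat n n" using i unfolding intertwining_def by auto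
  have v: "a \<in> carrier_vec n" "b \<in> carrier_vec n" using ab unfolding intertwiners_def by auto
  show ?thesis using intertwining_col[OF i F] ab
    by (intro intertwining_cols replace_col_carrier c F)
       (auto simp: col_replace_col[OF c(1) v(1)] col_replace_col[OF c(2) v(2)])
qed

lemma intertwiners_add:
  assumes "(a, b) \<in> intertwiners F n t" "(a', b') \<in> intertwiners F n t" "F \<in> carrier_mat n n"
  shows "(a + a', b + b') \<in> intertwiners F n t"
  using assms P unfolding intertwiners_def vec_over_def
  by (auto intro: subring_add simp: smult_add_distrib_vec[of _ n] mult_add_distrib_mat_vec[of _ n n])

lemma col_addcol_other:
  "X \<in> carrier_mat n n \<Longrightarrow> q < n \<Longrightarrow> q \<noteq> p \<Longrightarrow> col (addcol c p j X) q = col X q"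
  by (intro eq_vecI) auto

lemma col_addcol_same:
  "X \<in> carrier_mat n n \<Longrightarrow> p < n \<Longrightarrow> j < n \<Longrightarrow> col (addcol c p j X) p = c \<cdot>\<^sub>v col X j + col X p"
  by (intro eq_vecI) auto

text \<open>Adding a multiple of column \<open>j\<close> to a later column \<open>p\<close> can be matched on the other side, since
  \<open>s j\<close> divides \<open>s p\<close>.\<close>

lemma intertwining_addcol:
  assumes i: "intertwining F n s X Y" and F: "F \<in> carrier_mat n n" and jp: "j < n" "p < n" "p \<noteq> j"
    and c: "c \<in> P" "c' \<in> P" "c * s p = c' * s j"
  shows "intertwining F n s (addcol c p j X) (addcol c' p j Y)"
proof -
  have X: "X \<in> carrier_mat n n" "Y \<in> carrier_mat n n" "mat_over P X" "mat_over P Y"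
    using i unfolding intertwining_def by auto
  have "(col (addcol c p j X) q, col (addcol c' p j Y) q) \<in> intertwiners F n (s q)" if q: "q < n" for q
  proof (cases "q = p")
    case False
    then show ?thesis using intertwining_col[OF i F q] X q by (simp add: col_addcol_other)
  next
    case True
    have j: "(col X j, col Y j) \<in> intertwiners F n (s j)" and p: "(col X p, col Y p) \<in> intertwiners F n (s p)"
      using intertwining_col[OF i F] jp by auto
    have cj: "col X j \<in> carrier_vec n" "col Y j \<in> carrier_vec n" using X jp by auto
    have "s p \<cdot>\<^sub>v (c \<cdot>\<^sub>v col X j) = (c * s p) \<cdot>\<^sub>v col X j" by (simp add: smult_smult_assoc mult.commute)
    also have "\<dots> = c' \<cdot>\<^sub>v (s j \<cdot>\<^sub>v col X j)" unfolding c(3) by (simp add: smult_smult_assoc)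
    also have "\<dots> = c' \<cdot>\<^sub>v (F *\<^sub>v col Y j)" using j unfolding intertwiners_def by simp
    also have "\<dots> = F *\<^sub>v (c' \<cdot>\<^sub>v col Y j)" by (rule mult_mat_vec_smult[OF F cj(2), symmetric])
    finally have "(c \<cdot>\<^sub>v col X j, c' \<cdot>\<^sub>v col Y j) \<in> intertwiners F n (s p)"
      using j c cj P unfolding intertwiners_def vec_over_def by (auto intro: subring_mult)
    from intertwiners_add[OF this p F] show ?thesis
      unfolding True col_addcol_same[OF X(1) jp(2,1)] col_addcol_same[OF X(2) jp(2,1)] .
  qed
  then show ?thesis using X F by (intro intertwining_cols) auto
qed

definition agree :: "nat \<Rightarrow> 'k poly mat \<Rightarrow> 'k poly mat \<Rightarrow> bool" where
  "agree j X Y \<longleftrightarrow> (\<forall>q<j. col X q = col Y q)"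

lemma agree_replace:
  assumes "agree j X X'" "X \<in> carrier_mat n n" "X' \<in> carrier_mat n n" "j < n" "a \<in> carrier_vec n"
  shows "agree (Suc j) (replace_col X a j) (replace_col X' a j)"
  using assms unfolding agree_def by (auto simp: col_replace_col less_Suc_eq)

lemma res_unit_replace:
  assumes X: "X \<in> carrier_mat n n" "mat_over P X" and j: "j < n" and u: "res_unit (det X)"
    and a: "a \<in> carrier_vec n" "vec_over Pm a"
  shows "res_unit (det (replace_col X (col X j + a) j))"
proof -
  have "det (replace_col X (col X j + a) j) = det X + det_col X j a"
    using det_col_add[OF X(1) j, of "col X j" a] det_col_self[OF X(1) j] X a j
    unfolding det_col_def[symmetric] by simp
  then show ?thesis using res_unit_cong[OF u det_col_in_Pm[OF X j a]] by simp
qed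

text \<open>The pair of columns with index \<open>j\<close> of \<open>XC\<close> and \<open>YC\<close> is changed by multiples of the maximal ideal, which
keeps their determinants units modulo the maximal ideal, until its coordinate with respect to \<open>XD\<close> has a
unit leading coefficient. Then it can replace column \<open>j\<close> in all four matrices. The coordinate with
respect to \<open>YD\<close> then has one as well: for a nonzero invariant factor, both are proportional.\<close>

lemma match_column_nonzero:
  assumes F: "F \<in> carrier_mat n n" and j: "j < n" and sj: "s j \<noteq> 0"
    and chain: "\<And>p. j \<le> p \<Longrightarrow> p < n \<Longrightarrow> \<exists>c\<in>P. s p = s j * c"
    and C: "intertwining F n s XC YC" "res_unit (det XC)" "res_unit (det YC)"
    and D: "intertwining F n s XD YD" "unit_lead (det XD)" "unit_lead (det YD)"
    and agr: "agree j XD XC" "agree j YD YC"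
  shows "\<exists>XC YC XD YD. intertwining F n s XC YC \<and> res_unit (det XC) \<and> res_unit (det YC) \<and>
    intertwining F n s XD YD \<and> unit_lead (det XD) \<and> unit_lead (det YD) \<and>
    agree (Suc j) XD XC \<and> agree (Suc j) YD YC"
proof -
  have cC: "XC \<in> carrier_mat n n" "mat_over P XC" "YC \<in> carrier_mat n n" "mat_over P YC"
    using C unfolding intertwining_def by auto
  have "\<exists>XE YE. intertwining F n s XE YE \<and> unit_lead (det XE) \<and> unit_lead (det YE) \<and>
    agree j XE XC \<and> agree j YE YC \<and> det_col XE j (col XC j) \<notin> Pm"
  proof -
    have cD: "XD \<in> carrier_mat n n" "mat_over P XD" "YD \<in> carrier_mat n n" "mat_over P YD"
      using D unfolding intertwining_def by auto
    consider "det_col XD j (col XC j) \<notin> Pm"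
      | p where "j < p" "p < n" "det_col (addcol (-1) p j XD) j (col XC j) \<notin> Pm"
      using make_pivot[OF cD(1,2) cC(1,2) j] agr(1) unit_lead_notin_Pm[OF D(2)] res_unit_notin_Pm[OF C(2)]
      unfolding agree_def by blast
    then show ?thesis
    proof cases
      case 1
      then show ?thesis using D agr by blast
    next
      case 2
      obtain c where c: "c \<in> P" "s p = s j * c" using chain[of p] 2 by auto
      have m1: "-1 \<in> P" "- c \<in> P" using c P by (auto intro: subring_uminus subring_one)
      have "intertwining F n s (addcol (-1) p j XD) (addcol (- c) p j YD)"
        using 2 c by (intro intertwining_addcol[OF D(1) F j] m1) auto
      moreover have "det (addcol (-1) p j XD) = det XD" "det (addcol (- c) p j YD) = det YD"
        using 2 j cD by (auto intro!: det_addcol[where n = n])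
      moreover have "agree j (addcol (-1) p j XD) XC" "agree j (addcol (- c) p j YD) YC"
        using agr 2 cD j unfolding agree_def by (auto simp: col_addcol_other)
      ultimately show ?thesis using D 2 by metis
    qed
  qed
  then obtain XE YE where E: "intertwining F n s XE YE" "unit_lead (det XE)" "unit_lead (det YE)"
    "agree j XE XC" "agree j YE YC" "det_col XE j (col XC j) \<notin> Pm" by blast
  have cE: "XE \<in> carrier_mat n n" "mat_over P XE" "YE \<in> carrier_mat n n" "mat_over P YE"
    using E unfolding intertwining_def by auto
  have colC: "(col XC j, col YC j) \<in> intertwiners F n (s j)" and colE: "(col XE j, col YE j) \<in> intertwiners F n (s j)"
    using intertwining_col[OF C(1) F j] intertwining_col[OF E(1) F j] .
  obtain a0 b0 where ab0: "(a0, b0) \<in> intertwiners F n (s j)" "vec_over Pm a0" "vec_over Pm b0"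
    "unit_lead (det_col XE j (col XC j + a0))"
    using adjust_residue_class[OF F, of "s j" "\<lambda>a b. det_col XE j a", OF _ _ _ _ colE _ colC E(6)]
      E(2) det_col_self[OF cE(1) j] det_col_add[OF cE(1) j] det_col_smult[OF cE(1) j]
      det_col_in[OF cE(1,2) j] det_col_in_Pm[OF cE(1,2) j]
    unfolding intertwiners_def by auto
  define a where "a = col XC j + a0"
  define b where "b = col YC j + b0"
  have ab: "(a, b) \<in> intertwiners F n (s j)" unfolding a_def b_def by (rule intertwiners_add[OF colC ab0(1) F])
  have v: "a \<in> carrier_vec n" "b \<in> carrier_vec n" "a0 \<in> carrier_vec n" "b0 \<in> carrier_vec n" "vec_over P b"
    using ab ab0(1) unfolding intertwiners_def by auto
  have "unit_lead (det_col YE j b)"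
  proof -
    \<comment> \<open>Solving \<open>s j * a = F * b\<close> for the coordinates shows that those with respect to \<open>XE\<close> and \<open>YE\<close> are proportional.\<close>
    define x where "x = vec n (\<lambda>p. det_col XE p a)"
    define y where "y = vec n (\<lambda>p. det_col YE p b)"
    have xy: "XE *\<^sub>v x = det XE \<cdot>\<^sub>v a" "YE *\<^sub>v y = det YE \<cdot>\<^sub>v b"
      unfolding x_def y_def using cramer_solution cE v by blast+
    have cx: "x \<in> carrier_vec n" "y \<in> carrier_vec n" unfolding x_def y_def by auto
    define z where "z = diag_of n s *\<^sub>v y"
    have cz: "z \<in> carrier_vec n" unfolding z_def using cx by (auto intro!: carrier_vecI)
    have zj: "z $ j = s j * y $ j"
    proof -
      have "z $ j = (\<Sum>q<n. diag_of n s $$ (j, q) * y $ q)"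
        unfolding z_def using cx j by (auto simp: scalar_prod_def lessThan_atLeast0 intro!: sum.cong)
      also have "\<dots> = (\<Sum>q<n. if q = j then s j * y $ j else 0)"
        using j unfolding diag_of_def by (intro sum.cong) auto
      finally show ?thesis using j by simp
    qed
    have "XE *\<^sub>v z = (XE * diag_of n s) *\<^sub>v y"
      unfolding z_def using cE cx by (simp add: assoc_mult_mat_vec[OF cE(1) diag_of_carrier])
    also have "\<dots> = (F * YE) *\<^sub>v y" using E(1) unfolding intertwining_def by simp
    also have "\<dots> = F *\<^sub>v (det YE \<cdot>\<^sub>v b)" using F cE cx xy(2) by (simp add: assoc_mult_mat_vec[OF F cE(3)])
    also have "\<dots> = det YE \<cdot>\<^sub>v (F *\<^sub>v b)" using F v by (intro eq_vecI) auto
    also have "\<dots> = (det YE * s j) \<cdot>\<^sub>v a" using ab unfolding intertwiners_def by (auto simp: smult_smult_assoc[symmetric])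
    finally have "z $ j * det XE = det_col XE j ((det YE * s j) \<cdot>\<^sub>v a)"
      using cramer_lemma_mat[OF cE(1) cz j] unfolding det_col_def by simp
    then have "s j * (det_col YE j b * det XE) = s j * (det YE * det_col XE j a)"
      unfolding zj det_col_smult[OF cE(1) j v(1)] y_def using j by (simp add: ac_simps)
    then have eq: "det_col YE j b * det XE = det YE * det_col XE j a" using sj by simp
    have "unit_lead (det_col YE j b * det XE)" unfolding eq
      using E(3) ab0(4) unfolding a_def by (rule unit_lead_mult)
    then show ?thesis
      by (rule unit_lead_factor[OF _ det_col_in[OF cE(3,4) j v(2,5)] unit_lead_in[OF E(2)]])
  qed
  then have "unit_lead (det (replace_col XE a j))" "unit_lead (det (replace_col YE b j))"
    using ab0(4) unfolding a_def det_col_def by auto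
  moreover have "res_unit (det (replace_col XC a j))" "res_unit (det (replace_col YC b j))"
    unfolding a_def b_def using res_unit_replace cC j C ab0 v by auto
  moreover have "agree (Suc j) (replace_col XE a j) (replace_col XC a j)"
    "agree (Suc j) (replace_col YE b j) (replace_col YC b j)"
    using agree_replace[OF _ _ _ j] E cE cC v by auto
  ultimately show ?thesis
    using intertwining_replace[OF C(1) F ab] intertwining_replace[OF E(1) F ab] by blast
qed

text \<open>If the invariant factor is zero, the two columns of a pair are independent of each other. They can be
adjusted separately.\<close>

lemma match_column_zero:
  assumes F: "F \<in> carrier_mat n n" and j: "j < n" and zero: "\<And>p. j \<le> p \<Longrightarrow> p < n \<Longrightarrow> s p = 0"
    and C: "intertwining F n s XC YC" "res_unit (det XC)" "res_unit (det YC)"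
    and D: "intertwining F n s XD YD" "unit_lead (det XD)" "unit_lead (det YD)"
    and agr: "agree j XD XC" "agree j YD YC"
  shows "\<exists>XC YC XD YD. intertwining F n s XC YC \<and> res_unit (det XC) \<and> res_unit (det YC) \<and>
    intertwining F n s XD YD \<and> unit_lead (det XD) \<and> unit_lead (det YD) \<and>
    agree (Suc j) XD XC \<and> agree (Suc j) YD YC"
proof -
  have sj: "s j = 0" using zero j by simp
  have cC: "XC \<in> carrier_mat n n" "mat_over P XC" "YC \<in> carrier_mat n n" "mat_over P YC"
    and cD: "XD \<in> carrier_mat n n" "mat_over P XD" "YD \<in> carrier_mat n n" "mat_over P YD"
    using C D unfolding intertwining_def by auto
  have pivot: "\<exists>E. (E = XD' \<or> (\<exists>c p. c \<in> P \<and> j < p \<and> p < n \<and> E = addcol c p j XD')) \<and> det E = det XD' \<and>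
      agree j E XC' \<and> det_col E j (col XC' j) \<notin> Pm"
    if h: "XD' \<in> carrier_mat n n" "mat_over P XD'" "XC' \<in> carrier_mat n n" "mat_over P XC'"
      "unit_lead (det XD')" "res_unit (det XC')" "agree j XD' XC'" for XD' XC'
  proof -
    consider "det_col XD' j (col XC' j) \<notin> Pm"
      | p where "j < p" "p < n" "det_col (addcol (-1) p j XD') j (col XC' j) \<notin> Pm"
      using make_pivot[OF h(1-4) j] h(7) unit_lead_notin_Pm[OF h(5)] res_unit_notin_Pm[OF h(6)]
      unfolding agree_def by blast
    then show ?thesis
    proof cases
      case 1
      then show ?thesis using h(7) by blast
    next
      case 2
      have "-1 \<in> P" using P by (auto intro: subring_uminus subring_one)
      moreover have "det (addcol (-1) p j XD') = det XD'" using 2 j h(1) by (intro det_addcol[where n = n]) auto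
      moreover have "agree j (addcol (-1) p j XD') XC'"
        using h 2 j unfolding agree_def by (auto simp: col_addcol_other)
      ultimately show ?thesis using 2 by (intro exI[of _ "addcol (-1) p j XD'"]) auto
    qed
  qed
  have zero_s: "c * s p = c' * s j" if "j < p" "p < n" for c c' p using zero[of p] sj that by simp
  have P0: "0 \<in> P" by (rule subring_zero[OF P])
  have add0: "addcol 0 p j Z = Z" for p and Z :: "'k poly mat" unfolding mat_addcol_def by (intro eq_matI) auto
  obtain XE where XE: "XE = XD \<or> (\<exists>c p. c \<in> P \<and> j < p \<and> p < n \<and> XE = addcol c p j XD)" "det XE = det XD"
    "agree j XE XC" "det_col XE j (col XC j) \<notin> Pm"
    using pivot[OF cD(1,2) cC(1,2) D(2) C(2) agr(1)] by blast
  have E1: "intertwining F n s XE YD"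
  proof -
    consider "XE = XD" | c p where "c \<in> P" "j < p" "p < n" "XE = addcol c p j XD" using XE(1) by blast
    then show ?thesis
    proof cases
      case 2
      then show ?thesis
        using intertwining_addcol[OF D(1) F j 2(3) _ 2(1) P0 zero_s[OF 2(2,3)]] by (simp add: add0)
    qed (use D in simp)
  qed
  obtain YE where YE: "YE = YD \<or> (\<exists>c p. c \<in> P \<and> j < p \<and> p < n \<and> YE = addcol c p j YD)" "det YE = det YD"
    "agree j YE YC" "det_col YE j (col YC j) \<notin> Pm"
    using pivot[OF cD(3,4) cC(3,4) D(3) C(3) agr(2)] by blast
  have E: "intertwining F n s XE YE"
  proof -
    consider "YE = YD" | c p where "c \<in> P" "j < p" "p < n" "YE = addcol c p j YD" using YE(1) by blast
    then show ?thesis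
    proof cases
      case 2
      then show ?thesis
        using intertwining_addcol[OF E1 F j 2(3) _ P0 2(1) zero_s[OF 2(2,3)]] by (simp add: add0)
    qed (use E1 in simp)
  qed
  have cE: "XE \<in> carrier_mat n n" "mat_over P XE" "YE \<in> carrier_mat n n" "mat_over P YE"
    using E unfolding intertwining_def by auto
  have colC: "(col XC j, col YC j) \<in> intertwiners F n (s j)" and colE: "(col XE j, col YE j) \<in> intertwiners F n (s j)"
    using intertwining_col[OF C(1) F j] intertwining_col[OF E F j] .
  obtain a0 b1 where a0: "(a0, b1) \<in> intertwiners F n (s j)" "vec_over Pm a0"
    "unit_lead (det_col XE j (col XC j + a0))"
    using adjust_residue_class[OF F, of "s j" "\<lambda>a b. det_col XE j a", OF _ _ _ _ colE _ colC XE(4)]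
      D(2) XE(2) det_col_self[OF cE(1) j] det_col_add[OF cE(1) j] det_col_smult[OF cE(1) j]
      det_col_in[OF cE(1,2) j] det_col_in_Pm[OF cE(1,2) j]
    unfolding intertwiners_def by auto
  obtain a1 b0 where b0: "(a1, b0) \<in> intertwiners F n (s j)" "vec_over Pm b0"
    "unit_lead (det_col YE j (col YC j + b0))"
    using adjust_residue_class[OF F, of "s j" "\<lambda>a b. det_col YE j b", OF _ _ _ _ colE _ colC YE(4)]
      D(3) YE(2) det_col_self[OF cE(3) j] det_col_add[OF cE(3) j] det_col_smult[OF cE(3) j]
      det_col_in[OF cE(3,4) j] det_col_in_Pm[OF cE(3,4) j]
    unfolding intertwiners_def by auto
  define a where "a = col XC j + a0"
  define b where "b = col YC j + b0"
  have "0 \<cdot>\<^sub>v a0 = 0 \<cdot>\<^sub>v a1" using a0(1) b0(1) unfolding intertwiners_def by (intro eq_vecI) auto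
  then have "(a0, b0) \<in> intertwiners F n (s j)" using a0(1) b0(1) unfolding intertwiners_def sj by auto
  then have ab: "(a, b) \<in> intertwiners F n (s j)" unfolding a_def b_def by (rule intertwiners_add[OF colC _ F])
  have v: "a \<in> carrier_vec n" "b \<in> carrier_vec n" "a0 \<in> carrier_vec n" "b0 \<in> carrier_vec n"
    using ab a0(1) b0(1) unfolding intertwiners_def by auto
  have "unit_lead (det (replace_col XE a j))" "unit_lead (det (replace_col YE b j))"
    using a0(3) b0(3) unfolding a_def b_def det_col_def by auto
  moreover have "res_unit (det (replace_col XC a j))" "res_unit (det (replace_col YC b j))"
    unfolding a_def b_def using res_unit_replace cC j C a0 b0 v by auto
  moreover have "agree (Suc j) (replace_col XE a j) (replace_col XC a j)"
    "agree (Suc j) (replace_col YE b j) (replace_col YC b j)"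
    using agree_replace[OF _ _ _ j] XE YE cE cC v by auto
  ultimately show ?thesis
    using intertwining_replace[OF C(1) F ab] intertwining_replace[OF E F ab] by blast
qed

text \<open>The columns of the two pairs are made equal one by one. In the end the determinants have unit leading
coefficients and are units modulo the maximal ideal, hence they are units.\<close>

theorem horrocks_smith:
  assumes F: "F \<in> carrier_mat n n" "mat_over P F"
    and s: "\<And>i. Suc i < n \<Longrightarrow> \<exists>c\<in>P. s (Suc i) = s i * c"
    and d: "\<And>k. k \<le> n \<Longrightarrow> det_ideal P n k F (\<Prod>i<k. s i)"
    and D: "intertwining F n s XD YD" "unit_lead (det XD)" "unit_lead (det YD)"
  shows "eqv P n F (diag_of n s)"
proof -
  obtain XC YC where C: "intertwining F n s XC YC" "res_unit (det XC)" "res_unit (det YC)"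
    using residue_smith[OF F s d] unfolding intertwining_def by blast
  have chain: "\<exists>c\<in>P. s p = s j * c" if "j \<le> p" "p < n" for j p
    using that
  proof (induction p rule: dec_induct)
    case base
    then show ?case using subring_one[OF P] by (intro bexI[of _ 1]) auto
  next
    case (step p)
    then obtain c c' where "c \<in> P" "s p = s j * c" "c' \<in> P" "s (Suc p) = s p * c'" using s[of p] by auto
    then show ?case using subring_mult[OF P, of c c'] by (intro bexI[of _ "c * c'"]) auto
  qed
  have "\<exists>XC YC XD YD. intertwining F n s XC YC \<and> res_unit (det XC) \<and> res_unit (det YC) \<and>
    intertwining F n s XD YD \<and> unit_lead (det XD) \<and> unit_lead (det YD) \<and>
    agree j XD XC \<and> agree j YD YC" if "j \<le> n" for j
    using that
  proof (induction j)
    case 0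
    then show ?case using C D unfolding agree_def by blast
  next
    case (Suc j)
    then obtain XC YC XD YD where h: "intertwining F n s XC YC" "res_unit (det XC)" "res_unit (det YC)"
      "intertwining F n s XD YD" "unit_lead (det XD)" "unit_lead (det YD)"
      "agree j XD XC" "agree j YD YC" by auto
    have j: "j < n" using Suc by simp
    show ?case
    proof (cases "s j = 0")
      case True
      then have "s p = 0" if "j \<le> p" "p < n" for p using chain[OF that] by auto
      from match_column_zero[OF F(1) j this h] show ?thesis by simp
    next
      case False
      from match_column_nonzero[OF F(1) j False chain h] show ?thesis by simp
    qed
  qed
  from this[OF order_refl] obtain X Y X' Y' where h: "intertwining F n s X Y" "res_unit (det X)" "res_unit (det Y)"
      "intertwining F n s X' Y'" "unit_lead (det X')" "unit_lead (det Y')"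
      "agree n X' X" "agree n Y' Y" by blast
  have c: "X \<in> carrier_mat n n" "mat_over P X" "Y \<in> carrier_mat n n" "mat_over P Y"
    "X' \<in> carrier_mat n n" "Y' \<in> carrier_mat n n" using h unfolding intertwining_def by auto
  have "X' = X" "Y' = Y" using h(7,8) c unfolding agree_def by (auto intro!: mat_col_eqI)
  then have ul: "unit_lead (det X)" "unit_lead (det Y)" using h by auto
  have "X \<in> GLs P n" "Y \<in> GLs P n"
    using GLs_iff_det[OF P c(1,2)] GLs_iff_det[OF P c(3,4)] unit_lead_residue_unit[OF ul(1)]
      unit_lead_residue_unit[OF ul(2)] h(2,3) unfolding res_unit_def by blast+
  then obtain Z where Z: "Z \<in> GLs P n" "Y * Z = 1\<^sub>m n" using GLsE by blast
  have "X * diag_of n s * Z = F * (Y * Z)"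
    using h(1) assoc_mult_mat[OF F(1) c(3) GLs_carrier[OF Z(1)]] unfolding intertwining_def by simp
  then have "F = X * diag_of n s * Z" using Z(2) F(1) by simp
  then show ?thesis using \<open>X \<in> GLs P n\<close> Z(1) by (intro eqvI)
qed

end

section \<open>From local to global: Quillen patching\<close>

subsection \<open>Maximal ideals\<close>

definition ideal_in :: "'a::comm_ring_1 set \<Rightarrow> 'a set \<Rightarrow> bool" where
  "ideal_in A I \<longleftrightarrow> I \<subseteq> A \<and> 0 \<in> I \<and> (\<forall>x\<in>I. \<forall>y\<in>I. x + y \<in> I) \<and> (\<forall>a\<in>A. \<forall>x\<in>I. a * x \<in> I)"

definition maximal_in :: "'a::comm_ring_1 set \<Rightarrow> 'a set \<Rightarrow> bool" where
  "maximal_in A m \<longleftrightarrow> ideal_in A m \<and> 1 \<notin> m \<and> (\<forall>a\<in>A - m. \<exists>b\<in>A. 1 - a * b \<in> m)"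

lemma exists_maximal:
  assumes A: "subring_set A" and I: "ideal_in A I" "1 \<notin> I"
  shows "\<exists>m. maximal_in A m \<and> I \<subseteq> m"
proof -
  let ?S = "{J. ideal_in A J \<and> I \<subseteq> J \<and> 1 \<notin> J}"
  have "\<exists>m\<in>?S. \<forall>J\<in>?S. m \<subseteq> J \<longrightarrow> J = m"
  proof (rule subset_Zorn_nonempty)
    show "?S \<noteq> {}" using I by blast
    fix C assume C: "C \<noteq> {}" "subset.chain ?S C"
    have sub: "C \<subseteq> ?S" using C(2) unfolding subset.chain_def by blast
    have total: "J \<subseteq> K \<or> K \<subseteq> J" if "J \<in> C" "K \<in> C" for J K
      using C(2) that unfolding subset_chain_def by blast
    have "ideal_in A (\<Union>C)" unfolding ideal_in_def
    proof (intro conjI ballI)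
      show "\<Union>C \<subseteq> A" "0 \<in> \<Union>C" using sub C(1) unfolding ideal_in_def by auto
      show "x + y \<in> \<Union>C" if xy: "x \<in> \<Union>C" "y \<in> \<Union>C" for x y
      proof -
        obtain J K where "J \<in> C" "x \<in> J" "K \<in> C" "y \<in> K" using xy by blast
        then obtain L where "L \<in> C" "x \<in> L" "y \<in> L" using total[of J K] by blast
        then show ?thesis using sub unfolding ideal_in_def by blast
      qed
      show "a * x \<in> \<Union>C" if "a \<in> A" "x \<in> \<Union>C" for a x
        using that sub unfolding ideal_in_def by blast
    qed
    moreover have "I \<subseteq> \<Union>C" "1 \<notin> \<Union>C" using sub C(1) by auto
    ultimately show "\<Union>C \<in> ?S" by blast
  qed
  then obtain m where "m \<in> ?S" and maxS: "\<forall>J\<in>?S. m \<subseteq> J \<longrightarrow> J = m" by (elim bexE)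
  then have m: "ideal_in A m" "I \<subseteq> m" "1 \<notin> m" by simp_all
  have max: "J = m" if "ideal_in A J" "I \<subseteq> J" "1 \<notin> J" "m \<subseteq> J" for J
    using maxS that by simp
  have "\<exists>b\<in>A. 1 - a * b \<in> m" if a: "a \<in> A" "a \<notin> m" for a
  proof -
    let ?J = "{x + a * b | x b. x \<in> m \<and> b \<in> A}"
    have mA: "m \<subseteq> A" and m0: "0 \<in> m" and madd: "\<And>x y. x \<in> m \<Longrightarrow> y \<in> m \<Longrightarrow> x + y \<in> m"
      and mmult: "\<And>c x. c \<in> A \<Longrightarrow> x \<in> m \<Longrightarrow> c * x \<in> m"
      using m(1) unfolding ideal_in_def by auto
    have "ideal_in A ?J" unfolding ideal_in_def
    proof (intro conjI ballI)
      show "?J \<subseteq> A" using mA a A by (auto intro: subring_closed)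
      show "0 \<in> ?J" using m0 subring_zero[OF A] by force
      show "x + y \<in> ?J" if xy: "x \<in> ?J" "y \<in> ?J" for x y
      proof -
        obtain u b v c where "x = u + a * b" "y = v + a * c" "u \<in> m" "v \<in> m" "b \<in> A" "c \<in> A"
          using xy by blast
        then have "x + y = (u + v) + a * (b + c)" "u + v \<in> m" "b + c \<in> A"
          using madd A by (auto simp: algebra_simps intro: subring_add)
        then show ?thesis by blast
      qed
      show "c * x \<in> ?J" if cx: "c \<in> A" "x \<in> ?J" for c x
      proof -
        obtain u b where "x = u + a * b" "u \<in> m" "b \<in> A" using cx by blast
        then have "c * x = c * u + a * (c * b)" "c * u \<in> m" "c * b \<in> A"
          using mmult cx A by (auto simp: algebra_simps intro: subring_mult)
        then show ?thesis by blast
      qed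
    qed
    moreover have "m \<subseteq> ?J" using subring_zero[OF A] by force
    moreover have "a \<in> ?J" using m0 subring_one[OF A] by force
    ultimately have "1 \<in> ?J" using max[of ?J] m(2) a(2) by blast
    then obtain x b where "1 = x + a * b" "x \<in> m" "b \<in> A" by blast
    then have "b \<in> A" "1 - a * b = x" by (auto simp: diff_eq_eq)
    then show ?thesis using \<open>x \<in> m\<close> by blast
  qed
  then show ?thesis using m unfolding maximal_in_def by blast
qed

lemma maximal_prime:
  assumes A: "subring_set A" and m: "maximal_in A m" and a: "a \<in> A" "a \<notin> m" and b: "b \<in> A" "b \<notin> m"
  shows "a * b \<notin> m"
proof
  assume ab: "a * b \<in> m"
  obtain c where c: "c \<in> A" "1 - a * c \<in> m" using m a unfolding maximal_in_def by blast
  have "b * (1 - a * c) + c * (a * b) \<in> m"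
    using m ab b c unfolding maximal_in_def ideal_in_def by blast
  then show False using b by (simp add: algebra_simps)
qed

lemma maximal_mult_set:
  assumes "subring_set A" "maximal_in A m" shows "mult_set A (A - m)"
  using assms maximal_prime[OF assms] unfolding mult_set_def maximal_in_def ideal_in_def
  by (auto intro: subring_one subring_mult)

lemma localization_at_maximal:
  fixes A :: "'k::field set"
  assumes A: "subring_set A" and m: "maximal_in A m"
  shows "local_subring (loc A (A - m)) (loc m (A - m))"
proof
  note T = maximal_mult_set[OF A m]
  have mA: "m \<subseteq> A" and m0: "0 \<in> m" and madd: "\<And>x y. x \<in> m \<Longrightarrow> y \<in> m \<Longrightarrow> x + y \<in> m"
    and mmult: "\<And>c x. c \<in> A \<Longrightarrow> x \<in> m \<Longrightarrow> c * x \<in> m" and m1: "1 \<notin> m"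
    using m unfolding maximal_in_def ideal_in_def by auto
  have T0: "t \<noteq> 0" "t \<in> A" if "t \<in> A - m" for t using that m0 by auto
  have Tm: "s * t \<in> A - m" if "s \<in> A - m" "t \<in> A - m" for s t using that T unfolding mult_set_def by blast
  show "subring_set (loc A (A - m))" by (rule loc_subring[OF A T])
  show "loc m (A - m) \<subseteq> loc A (A - m)" using mA unfolding loc_def by blast
  show "0 \<in> loc m (A - m)" using locI[OF m0, of 1 "A - m"] m1 subring_one[OF A] by simp
  show "x + y \<in> loc m (A - m)" if xy: "x \<in> loc m (A - m)" "y \<in> loc m (A - m)" for x y
  proof -
    obtain a s b t where h: "x = a / s" "y = b / t" "a \<in> m" "b \<in> m" "s \<in> A - m" "t \<in> A - m"
      using xy unfolding loc_def by blast
    then have "x + y = (t * a + s * b) / (s * t)" using T0 by (simp add: field_simps)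
    moreover have "t * a + s * b \<in> m" using h by (intro madd mmult) auto
    ultimately show ?thesis using locI Tm h by metis
  qed
  show "x * y \<in> loc m (A - m)" if xy: "x \<in> loc A (A - m)" "y \<in> loc m (A - m)" for x y
  proof -
    obtain a s b t where h: "x = a / s" "y = b / t" "a \<in> A" "b \<in> m" "s \<in> A - m" "t \<in> A - m"
      using xy unfolding loc_def by blast
    then have "x * y = (a * b) / (s * t)" by simp
    then show ?thesis using locI Tm h mmult by metis
  qed
  show "1 \<notin> loc m (A - m)" unfolding loc_def using T0 by auto
  show "inverse x \<in> loc A (A - m)" if x: "x \<in> loc A (A - m)" "x \<notin> loc m (A - m)" for x
  proof -
    obtain a s where h: "x = a / s" "a \<in> A" "s \<in> A - m" using x unfolding loc_def by blast
    then have "a \<notin> m" using x(2) locI by metis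
    then have "s / a \<in> loc A (A - m)" using h by (intro locI) auto
    then show ?thesis using h by simp
  qed
qed

subsection \<open>Local-global principle\<close>

definition powers :: "'a::comm_ring_1 \<Rightarrow> 'a set" where "powers c = range (\<lambda>n. c ^ n)"

lemma powers_mult_set: "subring_set A \<Longrightarrow> c \<in> A \<Longrightarrow> c \<noteq> 0 \<Longrightarrow> mult_set A (powers (c :: 'f::field))"
  unfolding mult_set_def powers_def
  by (auto intro: subring_power simp: power_add[symmetric]) (metis power_0 rangeI)

lemma one_powers: "1 \<in> powers c" unfolding powers_def by (metis power_0 rangeI)

lemma locE_powers: assumes "x \<in> loc A (powers c)" obtains a k where "a \<in> A" "x = a / c ^ k"
  using assms unfolding loc_def powers_def by auto

lemma locI_powers: "a \<in> A \<Longrightarrow> a / c ^ k \<in> loc A (powers c)"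
  unfolding powers_def by (intro locI) auto

lemma loc_powers_mono:
  assumes A: "subring_set A" and "c \<in> A" "d \<in> A" "d \<noteq> 0"
  shows "loc A (powers c) \<subseteq> loc A (powers (c * d))"
proof
  fix x assume "x \<in> loc A (powers c)"
  then obtain a k where "a \<in> A" "x = a / c ^ k" by (rule locE_powers)
  then have "x = (a * d ^ k) / (c * d) ^ k" "a * d ^ k \<in> A"
    using assms by (auto simp: power_mult_distrib intro: subring_closed)
  then show "x \<in> loc A (powers (c * d))" using locI_powers by metis
qed

text \<open>Gluing over two comaximal basic open sets, together with solutions near every maximal ideal, gives
  a global solution: the denominators that can be allowed form an ideal.\<close>

lemma local_global_principle:
  fixes A :: "'f::field set"
  assumes A: "subring_set A"
    and mono: "\<And>B B'. B \<subseteq> B' \<Longrightarrow> Q B \<Longrightarrow> Q B'"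
    and patch: "\<And>B c d. subring_set B \<Longrightarrow> c \<in> B \<Longrightarrow> d \<in> B \<Longrightarrow> c \<noteq> 0 \<Longrightarrow> d \<noteq> 0 \<Longrightarrow> c + d = 1 \<Longrightarrow>
      Q (loc B (powers c)) \<Longrightarrow> Q (loc B (powers d)) \<Longrightarrow> Q B"
    and local: "\<And>m. maximal_in A m \<Longrightarrow> \<exists>c\<in>A - m. Q (loc A (powers c))"
  shows "Q A"
proof -
  define I where "I = {c\<in>A. c = 0 \<or> Q (loc A (powers c))}"
  have "ideal_in A I" unfolding ideal_in_def
  proof (intro conjI ballI)
    show "I \<subseteq> A" unfolding I_def by blast
    show "0 \<in> I" using subring_zero[OF A] unfolding I_def by simp
    show "a * x \<in> I" if "a \<in> A" "x \<in> I" for a x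
    proof (cases "a * x = 0")
      case False
      then have x: "x \<in> A" "Q (loc A (powers x))" "a \<noteq> 0" using that unfolding I_def by auto
      have "Q (loc A (powers (x * a)))" by (rule mono[OF loc_powers_mono[OF A x(1) that(1) x(3)] x(2)])
      then show ?thesis using that x A unfolding I_def by (auto simp: mult.commute intro: subring_mult)
    next
      case True
      show ?thesis unfolding True I_def using subring_zero[OF A] by simp
    qed
    show "c + d \<in> I" if cd: "c \<in> I" "d \<in> I" for c d
    proof (cases "c = 0 \<or> d = 0 \<or> c + d = 0")
      case True
      then show ?thesis using cd subring_zero[OF A] unfolding I_def by auto
    next
      case False
      then have c: "c \<in> A" "d \<in> A" "Q (loc A (powers c))" "Q (loc A (powers d))" "c + d \<in> A"
        using cd A unfolding I_def by (auto intro: subring_add)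
      define B where "B = loc A (powers (c + d))"
      have B: "subring_set B" unfolding B_def using False c(5)
        by (intro loc_subring[OF A] powers_mult_set[OF A]) auto
      have sub: "loc A (powers x) \<subseteq> loc B (powers (x / (c + d)))" if "x \<noteq> 0" for x
      proof
        fix y assume "y \<in> loc A (powers x)"
        then obtain a k where y: "a \<in> A" "y = a / x ^ k" by (rule locE_powers)
        have "a / (c + d) ^ k \<in> B" unfolding B_def by (rule locI_powers[OF y(1)])
        moreover have "y = (a / (c + d) ^ k) / (x / (c + d)) ^ k"
          unfolding y(2) using False that by (simp add: power_divide)
        ultimately show "y \<in> loc B (powers (x / (c + d)))" using locI_powers by metis
      qed
      have "x / (c + d) \<in> B" if "x \<in> A" for x using locI_powers[OF that, of "c + d" 1] unfolding B_def by simp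
      moreover have "c / (c + d) + d / (c + d) = 1" using False by (simp add: add_divide_distrib[symmetric])
      ultimately have "Q B"
        using patch[OF B, of "c / (c + d)" "d / (c + d)"] mono[OF sub c(3)] mono[OF sub c(4)] c False by auto
      then show ?thesis using c(5) unfolding I_def B_def by simp
    qed
  qed
  have "1 \<in> I"
  proof (rule ccontr)
    assume "1 \<notin> I"
    then obtain m where m: "maximal_in A m" "I \<subseteq> m" using exists_maximal[OF A \<open>ideal_in A I\<close>] by blast
    obtain c where "c \<in> A - m" "Q (loc A (powers c))" using local[OF m(1)] by blast
    then show False using m(2) unfolding I_def by blast
  qed
  then have "Q (loc A (powers 1))" unfolding I_def by simp
  moreover have "loc A (powers 1) = A" unfolding loc_def powers_def by auto
  ultimately show ?thesis by simp
qed

lemma comaximal_powers: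
  assumes A: "subring_set A" and c: "c \<in> A" "d \<in> A" "c + d = (1 :: 'a::comm_ring_1)"
  shows "\<exists>u\<in>A. \<exists>v\<in>A. u * c ^ k + v * d ^ l = 1"
proof -
  have step: "\<exists>u\<in>A. \<exists>v\<in>A. u * a + v * (b * b') = 1"
    if h: "\<exists>u\<in>A. \<exists>v\<in>A. u * a + v * b = 1" "\<exists>u\<in>A. \<exists>v\<in>A. u * a + v * b' = 1" "a \<in> A" "b \<in> A" "b' \<in> A" for a b b'
  proof -
    obtain u v u' v' where uv: "u \<in> A" "v \<in> A" "u * a + v * b = 1" "u' \<in> A" "v' \<in> A" "u' * a + v' * b' = 1"
      using h by blast
    have "(u * a + v * b) * (u' * a + v' * b') = 1" unfolding uv by simp
    then have "(u * u' * a + u * v' * b' + v * b * u') * a + (v * v') * (b * b') = 1"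
      by (simp add: algebra_simps)
    moreover have "u * u' * a + u * v' * b' + v * b * u' \<in> A" "v * v' \<in> A"
      using uv h A by (auto intro!: subring_add[OF A] subring_mult[OF A])
    ultimately show ?thesis by blast
  qed
  have 1: "\<exists>u\<in>A. \<exists>v\<in>A. u * c + v * d ^ l = 1" for l
  proof (induction l)
    case 0
    show ?case using subring_zero[OF A] subring_one[OF A] by (intro bexI[of _ 0] bexI[of _ 1]) auto
  next
    case (Suc l)
    have "\<exists>u\<in>A. \<exists>v\<in>A. u * c + v * d = 1"
      using c subring_one[OF A] by (intro bexI[of _ 1]) auto
    from step[OF this Suc c(1,2) subring_power[OF A c(2)]] show ?case by simp
  qed
  have "\<exists>v\<in>A. \<exists>u\<in>A. v * d ^ l + u * c ^ k = 1"
  proof (induction k)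
    case 0
    show ?case using subring_zero[OF A] subring_one[OF A] by (intro bexI[of _ 0] bexI[of _ 1]) auto
  next
    case (Suc k)
    have "\<exists>v\<in>A. \<exists>u\<in>A. v * d ^ l + u * c = 1" using 1[of l] by (metis add.commute)
    from step[OF this Suc subring_power[OF A c(2)] c(1) subring_power[OF A c(1)]] show ?case by simp
  qed
  then show ?thesis by (metis add.commute)
qed

lemma loc_inter_comaximal:
  fixes A :: "'f::field set"
  assumes A: "subring_set A" and c: "c \<in> A" "d \<in> A" "c \<noteq> 0" "d \<noteq> 0" "c + d = 1"
  shows "loc A (powers c) \<inter> loc A (powers d) \<subseteq> A"
proof
  fix x assume x: "x \<in> loc A (powers c) \<inter> loc A (powers d)"
  obtain a k where a: "a \<in> A" "x = a / c ^ k" using x by (blast elim: locE_powers)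
  obtain b l where b: "b \<in> A" "x = b / d ^ l" using x by (blast elim: locE_powers)
  obtain u v where uv: "u \<in> A" "v \<in> A" "u * c ^ k + v * d ^ l = 1"
    using comaximal_powers[OF A c(1,2,5)] by blast
  have e: "c ^ k * x = a" using a(2) c(3) by simp
  have e': "d ^ l * x = b" using b(2) c(4) by simp
  have "x = (u * c ^ k + v * d ^ l) * x" unfolding uv by simp
  also have "\<dots> = u * a + v * b" unfolding e[symmetric] e'[symmetric] by (simp add: algebra_simps)
  finally show "x \<in> A" using uv a b A by (auto intro: subring_closed)
qed

subsection \<open>Scaling the variable\<close>

definition scale :: "'k::field \<Rightarrow> 'k poly \<Rightarrow> 'k poly" where
  "scale \<mu> p = pcompose p [:0, \<mu>:]"

lemma coeff_scale: "coeff (scale \<mu> p) i = \<mu> ^ i * coeff p i"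
  unfolding scale_def by (simp add: coeff_pcompose_linear)

interpretation scale: comm_ring_hom "scale \<mu>" for \<mu>
  by unfold_locales (auto simp: scale_def pcompose_add pcompose_mult one_pCons pcompose_pCons)

lemma scale_scale_0: "scale \<mu> (scale 0 p) = scale 0 p"
  by (intro poly_eqI) (simp add: coeff_scale power_0_left)

lemma scale_0_scale: "scale 0 (scale \<mu> p) = scale 0 p"
  by (intro poly_eqI) (simp add: coeff_scale power_0_left)

lemma scale_in: "subring_set A \<Longrightarrow> \<mu> \<in> A \<Longrightarrow> p \<in> polys_over A \<Longrightarrow> scale \<mu> p \<in> polys_over A"
  by (intro polys_overI) (auto simp: coeff_scale polys_over_coeff intro: subring_closed)

subsection \<open>Patching\<close>

text \<open>The matrix is equivalent to its constant term, by matrices that are the identity at \<open>0\<close>. This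
  normalization is what makes local solutions fit together.\<close>

definition const_equivalent :: "nat \<Rightarrow> 'k::field poly mat \<Rightarrow> 'k set \<Rightarrow> bool" where
  "const_equivalent n F B \<longleftrightarrow> (\<exists>U\<in>GLs (polys_over B) n. \<exists>V\<in>GLs (polys_over B) n.
     map_mat (scale 0) U = 1\<^sub>m n \<and> map_mat (scale 0) V = 1\<^sub>m n \<and> F = U * map_mat (scale 0) F * V)"

lemma const_equivalent_mono: "B \<subseteq> B' \<Longrightarrow> const_equivalent n F B \<Longrightarrow> const_equivalent n F B'"
  unfolding const_equivalent_def using GLs_mono[OF _ polys_over_mono] by metis

lemma map_scale_mult:
  "M \<in> carrier_mat n n \<Longrightarrow> N \<in> carrier_mat n n \<Longrightarrow>
    map_mat (scale \<mu>) (M * N) = map_mat (scale \<mu>) M * map_mat (scale \<mu>) N"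
  by (rule scale.mat_hom_mult)

lemma common_denominator_poly_mat:
  fixes A :: "'k::field set"
  assumes A: "subring_set A" and T: "mult_set A T" and M: "M \<in> carrier_mat n n" "mat_over (polys_over (loc A T)) M"
  shows "\<exists>t\<in>T. \<forall>i<n. \<forall>j<n. \<forall>k. t * coeff (M $$ (i, j)) k \<in> A"
proof -
  define X where "X = (\<Union>i\<in>{..<n}. \<Union>j\<in>{..<n}. coeff (M $$ (i, j)) ` {..degree (M $$ (i, j))})"
  have "finite X" unfolding X_def by auto
  moreover have "X \<subseteq> loc A T" unfolding X_def using mat_overD[OF M(2,1)] by (auto intro!: polys_over_coeff)
  ultimately obtain t where t: "t \<in> T" "\<forall>x\<in>X. t * x \<in> A" using common_denominator[OF A T] by blast
  have "t * coeff (M $$ (i, j)) k \<in> A" if "i < n" "j < n" for i j k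
  proof (cases "k \<le> degree (M $$ (i, j))")
    case True
    then have "coeff (M $$ (i, j)) k \<in> X" unfolding X_def using that by blast
    then show ?thesis using t by blast
  next
    case False
    then show ?thesis using subring_zero[OF A] by (simp add: coeff_eq_0)
  qed
  then show ?thesis using t(1) by blast
qed

text \<open>The coefficients of \<open>q(\<mu> x) - q(x)\<close> have a factor \<open>d ^ (2 * N)\<close>, because \<open>\<mu>\<close> is congruent to 1; it
cancels the denominators of both \<open>p\<close> and \<open>q\<close>.\<close>

lemma scale_near_one:
  fixes A :: "'k::field set"
  assumes A: "subring_set A" and pq: "Polynomial.smult (d ^ N) p \<in> polys_over A" "Polynomial.smult (d ^ N) q \<in> polys_over A"
    and \<mu>: "\<mu> \<in> A" "\<nu> \<in> A" "\<mu> = 1 - d ^ (2 * N) * \<nu>"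
  shows "p * (scale \<mu> q - q) \<in> polys_over A"
proof -
  have geo: "\<exists>w\<in>A. \<mu> ^ k - 1 = d ^ (2 * N) * w" for k
  proof (induction k)
    case 0
    show ?case using subring_zero[OF A] by (intro bexI[of _ 0]) auto
  next
    case (Suc k)
    then obtain w where w: "w \<in> A" "\<mu> ^ k - 1 = d ^ (2 * N) * w" by blast
    have "\<mu> ^ Suc k - 1 = \<mu> * (\<mu> ^ k - 1) + (\<mu> - 1)" by (simp add: algebra_simps)
    also have "\<dots> = d ^ (2 * N) * (\<mu> * w - \<nu>)" unfolding w(2) using \<mu>(3) by (simp add: algebra_simps)
    finally show ?case using w \<mu> A by (intro bexI[of _ "\<mu> * w - \<nu>"]) (auto intro: subring_closed)
  qed
  have "coeff (p * (scale \<mu> q - q)) i \<in> A" for i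
  proof -
    have "coeff (p * (scale \<mu> q - q)) i = (\<Sum>k\<le>i. coeff p k * ((\<mu> ^ (i - k) - 1) * coeff q (i - k)))"
      unfolding coeff_mult by (simp add: coeff_scale algebra_simps)
    also have "\<dots> \<in> A"
    proof (intro subring_sum[OF A])
      fix k
      obtain w where w: "w \<in> A" "\<mu> ^ (i - k) - 1 = d ^ (2 * N) * w" using geo by blast
      have eq: "coeff p k * ((\<mu> ^ (i - k) - 1) * coeff q (i - k)) = (d ^ N * coeff p k) * (w * (d ^ N * coeff q (i - k)))"
        unfolding w(2) mult_2 power_add by (simp only: ac_simps)
      have h: "d ^ N * coeff p k \<in> A" "d ^ N * coeff q (i - k) \<in> A"
        using pq polys_over_coeff[of _ A] by (metis coeff_smult)+
      show "coeff p k * ((\<mu> ^ (i - k) - 1) * coeff q (i - k)) \<in> A"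
        unfolding eq by (intro subring_mult[OF A] h w(1))
    qed
    finally show ?thesis .
  qed
  then show ?thesis by (rule polys_overI)
qed

text \<open>Scaling keeps the constant term and multiplies every other coefficient by a multiple of \<open>\<mu>\<close>, which
cancels its denominator.\<close>

lemma scale_near_zero:
  fixes A :: "'k::field set"
  assumes A: "subring_set A" and q: "\<And>k. c ^ N * coeff q k \<in> A" and q0: "coeff q 0 \<in> A"
    and \<mu>: "\<mu> \<in> A" "u \<in> A" "\<mu> = u * c ^ N"
  shows "scale \<mu> q \<in> polys_over A"
proof (rule polys_overI)
  fix k
  show "coeff (scale \<mu> q) k \<in> A"
  proof (cases k)
    case 0
    then show ?thesis using q0 by (simp add: coeff_scale)
  next
    case (Suc i)
    have "coeff (scale \<mu> q) k = \<mu> ^ i * (u * (c ^ N * coeff q k))"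
      unfolding coeff_scale Suc using \<mu>(3) by (simp add: ac_simps)
    then show ?thesis
      using subring_mult[OF A subring_power[OF A \<mu>(1)] subring_mult[OF A \<mu>(2) q]] by simp
  qed
qed

lemma mat_over_near_one:
  fixes A :: "'k::field set"
  assumes A: "subring_set A" and G: "G \<in> carrier_mat n n" "G' \<in> carrier_mat n n" "G * G' = 1\<^sub>m n"
    and den: "\<And>i j k. i < n \<Longrightarrow> j < n \<Longrightarrow> d ^ N * coeff (G $$ (i, j)) k \<in> A"
      "\<And>i j k. i < n \<Longrightarrow> j < n \<Longrightarrow> d ^ N * coeff (G' $$ (i, j)) k \<in> A"
    and \<mu>: "\<mu> \<in> A" "\<nu> \<in> A" "\<mu> = 1 - d ^ (2 * N) * \<nu>"
  shows "mat_over (polys_over A) (G * map_mat (scale \<mu>) G')" "mat_over (polys_over A) (map_mat (scale \<mu>) G * G')"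
proof -
  note PA = polys_over_subring[OF A]
  have s: "Polynomial.smult (d ^ N) (G $$ (i, j)) \<in> polys_over A" "Polynomial.smult (d ^ N) (G' $$ (i, j)) \<in> polys_over A"
    if "i < n" "j < n" for i j using den that by (auto intro: polys_overI)
  have one: "(\<Sum>l\<in>{0..<n}. G $$ (i, l) * G' $$ (l, j)) \<in> polys_over A" if ij: "i < n" "j < n" for i j
    using mat_mult_entry[OF G(1,2) ij] mat_overD[OF mat_over_one[OF PA] one_carrier_mat ij] unfolding G(3) by simp
  show "mat_over (polys_over A) (G * map_mat (scale \<mu>) G')" unfolding mat_over_def
  proof (intro allI impI)
    fix i j assume "i < dim_row (G * map_mat (scale \<mu>) G')" "j < dim_col (G * map_mat (scale \<mu>) G')"
    then have ij: "i < n" "j < n" using G by auto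
    have "(G * map_mat (scale \<mu>) G') $$ (i, j) = (\<Sum>l\<in>{0..<n}. G $$ (i, l) * scale \<mu> (G' $$ (l, j)))"
      using mat_mult_entry[OF G(1) _ ij, of "map_mat (scale \<mu>) G'"] G ij by simp
    also have "\<dots> = (\<Sum>l\<in>{0..<n}. G $$ (i, l) * G' $$ (l, j))
        + (\<Sum>l\<in>{0..<n}. G $$ (i, l) * (scale \<mu> (G' $$ (l, j)) - G' $$ (l, j)))"
      by (simp add: sum.distrib[symmetric] algebra_simps)
    also have "\<dots> \<in> polys_over A"
      using ij by (intro subring_add[OF PA] one subring_sum[OF PA] scale_near_one[OF A s(1) s(2) \<mu>]) auto
    finally show "(G * map_mat (scale \<mu>) G') $$ (i, j) \<in> polys_over A" .
  qed
  show "mat_over (polys_over A) (map_mat (scale \<mu>) G * G')" unfolding mat_over_def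
  proof (intro allI impI)
    fix i j assume "i < dim_row (map_mat (scale \<mu>) G * G')" "j < dim_col (map_mat (scale \<mu>) G * G')"
    then have ij: "i < n" "j < n" using G by auto
    have "(map_mat (scale \<mu>) G * G') $$ (i, j) = (\<Sum>l\<in>{0..<n}. scale \<mu> (G $$ (i, l)) * G' $$ (l, j))"
      using mat_mult_entry[OF _ G(2) ij, of "map_mat (scale \<mu>) G"] G ij by simp
    also have "\<dots> = (\<Sum>l\<in>{0..<n}. G $$ (i, l) * G' $$ (l, j))
        + (\<Sum>l\<in>{0..<n}. G' $$ (l, j) * (scale \<mu> (G $$ (i, l)) - G $$ (i, l)))"
      by (simp add: sum.distrib[symmetric] algebra_simps)
    also have "\<dots> \<in> polys_over A"
      using ij by (intro subring_add[OF PA] one subring_sum[OF PA] scale_near_one[OF A s(2) s(1) \<mu>]) auto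
    finally show "(map_mat (scale \<mu>) G * G') $$ (i, j) \<in> polys_over A" .
  qed
qed

lemma mat_over_near_zero:
  fixes A :: "'k::field set"
  assumes A: "subring_set A" and G: "G \<in> carrier_mat n n" "map_mat (scale 0) G = 1\<^sub>m n"
    and den: "\<And>i j k. i < n \<Longrightarrow> j < n \<Longrightarrow> c ^ N * coeff (G $$ (i, j)) k \<in> A"
    and \<mu>: "\<mu> \<in> A" "u \<in> A" "\<mu> = u * c ^ N"
  shows "mat_over (polys_over A) (map_mat (scale \<mu>) G)"
  unfolding mat_over_def
proof (intro allI impI)
  fix i j assume "i < dim_row (map_mat (scale \<mu>) G)" "j < dim_col (map_mat (scale \<mu>) G)"
  then have ij: "i < n" "j < n" using G by auto
  have "scale 0 (G $$ (i, j)) = 1\<^sub>m n $$ (i, j)" using G(2) G(1) ij by (metis carrier_matD index_map_mat(1))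
  then have "coeff (scale 0 (G $$ (i, j))) 0 \<in> A" using ij A by (auto simp: subring_one subring_zero)
  then have "scale \<mu> (G $$ (i, j)) \<in> polys_over A"
    using den[OF ij] by (intro scale_near_zero[OF A _ _ \<mu>]) (auto simp: coeff_scale)
  then show "map_mat (scale \<mu>) G $$ (i, j) \<in> polys_over A" using ij G by simp
qed

text \<open>Quillen's patching: the transition matrix \<open>G\<close> between two local solutions is the product of
  \<open>G(x) * G(\<mu> x)\<^sup>-\<^sup>1\<close> and \<open>G(\<mu> x)\<close>. If \<open>\<mu>\<close> is close to 1 with respect to \<open>d\<close> and close to 0 with
  respect to \<open>c\<close>, then these factors can be absorbed by the two local solutions.\<close>

lemma patch_const_equivalent:
  fixes A :: "'k::field set"
  assumes A: "subring_set A" and c: "c \<in> A" "d \<in> A" "c \<noteq> 0" "d \<noteq> 0" "c + d = 1" and F: "F \<in> carrier_mat n n"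
    and Qc: "const_equivalent n F (loc A (powers c))" and Qd: "const_equivalent n F (loc A (powers d))"
  shows "const_equivalent n F A"
proof -
  define Ac where "Ac = loc A (powers c)"
  define Ad where "Ad = loc A (powers d)"
  define Acd where "Acd = loc A (powers (c * d))"
  let ?F0 = "map_mat (scale 0) F"
  let ?e = "map_mat (scale 0)"
  have cF0: "?F0 \<in> carrier_mat n n" using F by auto
  have rc: "subring_set Ac" "subring_set Ad" "subring_set Acd"
    unfolding Ac_def Ad_def Acd_def using c A by (auto intro!: loc_subring powers_mult_set subring_mult[OF A])
  note pr = polys_over_subring[OF rc(1)] polys_over_subring[OF rc(2)] polys_over_subring[OF rc(3)]
  have A_sub: "A \<subseteq> Ac" "A \<subseteq> Ad" unfolding Ac_def Ad_def by (auto intro: loc_incl[OF one_powers, THEN subsetD])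
  have sub: "polys_over Ac \<subseteq> polys_over Acd" "polys_over Ad \<subseteq> polys_over Acd"
    unfolding Ac_def Ad_def Acd_def using loc_powers_mono[OF A, of c d] loc_powers_mono[OF A, of d c] c
    by (auto simp: mult.commute intro!: polys_over_mono)
  obtain Uc Vc where Uc: "Uc \<in> GLs (polys_over Ac) n" "?e Uc = 1\<^sub>m n" and Vc: "Vc \<in> GLs (polys_over Ac) n" "?e Vc = 1\<^sub>m n"
    and Fc: "F = Uc * ?F0 * Vc" using Qc unfolding const_equivalent_def Ac_def by blast
  obtain Ud Vd where Ud: "Ud \<in> GLs (polys_over Ad) n" "?e Ud = 1\<^sub>m n" and Vd: "Vd \<in> GLs (polys_over Ad) n" "?e Vd = 1\<^sub>m n"
    and Fd: "F = Ud * ?F0 * Vd" using Qd unfolding const_equivalent_def Ad_def by blast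
  obtain Uc' where Uc': "Uc' \<in> GLs (polys_over Ac) n" "Uc * Uc' = 1\<^sub>m n" "Uc' * Uc = 1\<^sub>m n" using GLsE[OF Uc(1)] .
  obtain Vc' where Vc': "Vc' \<in> GLs (polys_over Ac) n" "Vc * Vc' = 1\<^sub>m n" "Vc' * Vc = 1\<^sub>m n" using GLsE[OF Vc(1)] .
  obtain Ud' where Ud': "Ud' \<in> GLs (polys_over Ad) n" "Ud * Ud' = 1\<^sub>m n" "Ud' * Ud = 1\<^sub>m n" using GLsE[OF Ud(1)] .
  obtain Vd' where Vd': "Vd' \<in> GLs (polys_over Ad) n" "Vd * Vd' = 1\<^sub>m n" "Vd' * Vd = 1\<^sub>m n" using GLsE[OF Vd(1)] .
  note cs = GLs_carrier[OF Uc(1)] GLs_carrier[OF Vc(1)] GLs_carrier[OF Ud(1)] GLs_carrier[OF Vd(1)]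
    GLs_carrier[OF Uc'(1)] GLs_carrier[OF Vc'(1)] GLs_carrier[OF Ud'(1)] GLs_carrier[OF Vd'(1)]
  note os = GLs_over[OF Uc(1)] GLs_over[OF Vc(1)] GLs_over[OF Ud(1)] GLs_over[OF Vd(1)]
    GLs_over[OF Uc'(1)] GLs_over[OF Vc'(1)] GLs_over[OF Ud'(1)] GLs_over[OF Vd'(1)]
  have e_inv: "?e M' = 1\<^sub>m n" if "?e M = 1\<^sub>m n" "M * M' = 1\<^sub>m n" "M \<in> carrier_mat n n" "M' \<in> carrier_mat n n" for M M'
  proof -
    have "?e (M * M') = ?e M * ?e M'" by (rule map_scale_mult[OF that(3,4)])
    then show ?thesis using that scale.mat_hom_one[of 0 n] left_mult_one_mat[of "?e M'" n n]
      by (metis map_carrier_mat)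
  qed
  define G where "G = Uc' * Ud"
  define G' where "G' = Ud' * Uc"
  define H where "H = Vc * Vd'"
  define H' where "H' = Vd * Vc'"
  have cG: "G \<in> carrier_mat n n" "G' \<in> carrier_mat n n" "H \<in> carrier_mat n n" "H' \<in> carrier_mat n n"
    unfolding G_def G'_def H_def H'_def using cs by auto
  have cancel: "X * Y * (Y' * X') = 1\<^sub>m n"
    if "X \<in> carrier_mat n n" "Y \<in> carrier_mat n n" "X' \<in> carrier_mat n n" "Y' \<in> carrier_mat n n" "Y * Y' = 1\<^sub>m n" "X * X' = 1\<^sub>m n"
    for X Y X' Y' :: "'k poly mat"
  proof -
    have "X * Y * (Y' * X') = X * (Y * Y') * X'" using that(1-4) by (simp add: assoc_mult_mat[of _ n n _ n _ n])
    also have "\<dots> = X * X'" unfolding that(5) using that(1) by simp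
    also note that(6)
    finally show ?thesis .
  qed
  have GG: "G * G' = 1\<^sub>m n" "G' * G = 1\<^sub>m n" "H * H' = 1\<^sub>m n" "H' * H = 1\<^sub>m n"
    unfolding G_def G'_def H_def H'_def using cs Uc' Ud' Vc' Vd' by (auto intro!: cancel)
  have oG: "mat_over (polys_over Acd) G" "mat_over (polys_over Acd) G'" "mat_over (polys_over Acd) H" "mat_over (polys_over Acd) H'"
    unfolding G_def G'_def H_def H'_def
    using cs mat_over_mono[OF os(1) sub(1)] mat_over_mono[OF os(2) sub(1)] mat_over_mono[OF os(3) sub(2)]
      mat_over_mono[OF os(4) sub(2)] mat_over_mono[OF os(5) sub(1)] mat_over_mono[OF os(6) sub(1)]
      mat_over_mono[OF os(7) sub(2)] mat_over_mono[OF os(8) sub(2)] pr(3)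
    by (auto intro!: mat_over_mult[of _ _ _ n n n])
  have eG: "?e G = 1\<^sub>m n" "?e G' = 1\<^sub>m n" "?e H = 1\<^sub>m n" "?e H' = 1\<^sub>m n"
    unfolding G_def G'_def H_def H'_def
    using cs e_inv[OF Uc(2) Uc'(2)] e_inv[OF Ud(2) Ud'(2)] e_inv[OF Vc(2) Vc'(2)] e_inv[OF Vd(2) Vd'(2)]
      Uc(2) Ud(2) Vc(2) Vd(2) by (simp_all add: map_scale_mult[of _ n])
  have comm: "G * ?F0 = ?F0 * H"
  proof -
    have "Uc * ?F0 * Vc = Ud * ?F0 * Vd" using Fc Fd by simp
    then have "Uc' * (Uc * ?F0 * Vc) * Vd' = Uc' * (Ud * ?F0 * Vd) * Vd'" by simp
    moreover have "Uc' * (Uc * ?F0 * Vc) * Vd' = (Uc' * Uc) * ?F0 * (Vc * Vd')"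
      using cs cF0 by (simp add: assoc_mult_mat[of _ n n _ n _ n])
    moreover have "Uc' * (Ud * ?F0 * Vd) * Vd' = (Uc' * Ud) * ?F0 * (Vd * Vd')"
      using cs cF0 by (simp add: assoc_mult_mat[of _ n n _ n _ n])
    ultimately show ?thesis unfolding G_def H_def using cF0 cs Uc' Vd' by simp
  qed
  have comm': "G' * ?F0 = ?F0 * H'"
  proof -
    have "G' * (G * ?F0) * H' = G' * (?F0 * H) * H'" unfolding comm ..
    moreover have "G' * (G * ?F0) * H' = (G' * G) * (?F0 * H')" using cG cF0 by (simp add: assoc_mult_mat[of _ n n _ n _ n])
    moreover have "G' * (?F0 * H) * H' = (G' * ?F0) * (H * H')" using cG cF0 by (simp add: assoc_mult_mat[of _ n n _ n _ n])
    ultimately show ?thesis unfolding GG using cG cF0 by simp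
  qed
  have cd: "c * d \<in> A" "c * d \<noteq> 0" using c A by (auto intro: subring_mult)
  have den: "\<exists>N. \<forall>i<n. \<forall>j<n. \<forall>k. (c * d) ^ N * coeff (M $$ (i, j)) k \<in> A"
    if M: "M \<in> carrier_mat n n" "mat_over (polys_over Acd) M" for M
  proof -
    obtain t where "t \<in> powers (c * d)" "\<forall>i<n. \<forall>j<n. \<forall>k. t * coeff (M $$ (i, j)) k \<in> A"
      using common_denominator_poly_mat[OF A powers_mult_set[OF A cd] M[unfolded Acd_def]] by blast
    then show ?thesis unfolding powers_def by blast
  qed
  obtain N1 where N1: "\<forall>i<n. \<forall>j<n. \<forall>k. (c * d) ^ N1 * coeff (G $$ (i, j)) k \<in> A"
    using den[OF cG(1) oG(1)] by blast
  obtain N2 where N2: "\<forall>i<n. \<forall>j<n. \<forall>k. (c * d) ^ N2 * coeff (G' $$ (i, j)) k \<in> A"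
    using den[OF cG(2) oG(2)] by blast
  obtain N3 where N3: "\<forall>i<n. \<forall>j<n. \<forall>k. (c * d) ^ N3 * coeff (H $$ (i, j)) k \<in> A"
    using den[OF cG(3) oG(3)] by blast
  obtain N4 where N4: "\<forall>i<n. \<forall>j<n. \<forall>k. (c * d) ^ N4 * coeff (H' $$ (i, j)) k \<in> A"
    using den[OF cG(4) oG(4)] by blast
  define N where "N = N1 + N2 + N3 + N4"
  have up: "(c * d) ^ N * x \<in> A" if "(c * d) ^ M * x \<in> A" "M \<le> N" for M x
  proof -
    have eq: "(c * d) ^ N * x = (c * d) ^ (N - M) * ((c * d) ^ M * x)"
      using that(2) by (simp add: mult.assoc[symmetric] power_add[symmetric])
    show ?thesis unfolding eq by (rule subring_mult[OF A subring_power[OF A cd(1)] that(1)])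
  qed
  have toc: "d ^ N * x \<in> Ac" and tod: "c ^ N * x \<in> Ad" if "(c * d) ^ N * x \<in> A" for x
  proof -
    have "d ^ N * x = ((c * d) ^ N * x) / c ^ N" "c ^ N * x = ((c * d) ^ N * x) / d ^ N"
      using c by (simp_all add: power_mult_distrib)
    then show "d ^ N * x \<in> Ac" "c ^ N * x \<in> Ad" using locI_powers[OF that] unfolding Ac_def Ad_def by metis+
  qed
  have le: "N1 \<le> N" "N2 \<le> N" "N3 \<le> N" "N4 \<le> N" unfolding N_def by simp_all
  have bound1: "(c * d) ^ N * coeff (G $$ (i, j)) k \<in> A" if "i < n" "j < n" for i j k
    by (rule up[OF _ le(1)]) (use N1 that in blast)
  have bound2: "(c * d) ^ N * coeff (G' $$ (i, j)) k \<in> A" if "i < n" "j < n" for i j k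
    by (rule up[OF _ le(2)]) (use N2 that in blast)
  have bound3: "(c * d) ^ N * coeff (H $$ (i, j)) k \<in> A" if "i < n" "j < n" for i j k
    by (rule up[OF _ le(3)]) (use N3 that in blast)
  have bound4: "(c * d) ^ N * coeff (H' $$ (i, j)) k \<in> A" if "i < n" "j < n" for i j k
    by (rule up[OF _ le(4)]) (use N4 that in blast)
  \<comment> \<open>\<open>\<mu> = u * c ^ N = 1 - v * d ^ (2 * N)\<close>: near zero for the powers of \<open>c\<close>, near one for those of \<open>d\<close>\<close>
  obtain u v where uv: "u \<in> A" "v \<in> A" "u * c ^ N + v * d ^ (2 * N) = 1"
    using comaximal_powers[OF A c(1,2,5)] by blast
  define \<mu> where "\<mu> = u * c ^ N"
  have \<mu>A: "\<mu> \<in> A" unfolding \<mu>_def using uv c A by (auto intro: subring_closed)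
  have \<mu>: "\<mu> = 1 - d ^ (2 * N) * v" using uv(3) unfolding \<mu>_def by (simp add: algebra_simps)
  let ?s = "map_mat (scale \<mu>)"
  have c1: "\<mu> \<in> Ac" "v \<in> Ac" "\<mu> \<in> Ad" "u \<in> Ad" using A_sub \<mu>A uv by auto
  have near1: "mat_over (polys_over Ac) (G * ?s G')" "mat_over (polys_over Ac) (?s G * G')"
    "mat_over (polys_over Ac) (H * ?s H')" "mat_over (polys_over Ac) (?s H * H')"
    using mat_over_near_one[OF rc(1) cG(1,2) GG(1) toc[OF bound1] toc[OF bound2] c1(1,2) \<mu>]
      mat_over_near_one[OF rc(1) cG(3,4) GG(3) toc[OF bound3] toc[OF bound4] c1(1,2) \<mu>] by blast+
  have near0: "mat_over (polys_over Ad) (?s G)" "mat_over (polys_over Ad) (?s G')"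
    "mat_over (polys_over Ad) (?s H)" "mat_over (polys_over Ad) (?s H')"
    using mat_over_near_zero[OF rc(2) cG(1) eG(1) tod[OF bound1] c1(3,4) \<mu>_def]
      mat_over_near_zero[OF rc(2) cG(2) eG(2) tod[OF bound2] c1(3,4) \<mu>_def]
      mat_over_near_zero[OF rc(2) cG(3) eG(3) tod[OF bound3] c1(3,4) \<mu>_def]
      mat_over_near_zero[OF rc(2) cG(4) eG(4) tod[OF bound4] c1(3,4) \<mu>_def] by blast+
  have sc: "?s G \<in> carrier_mat n n" "?s G' \<in> carrier_mat n n" "?s H \<in> carrier_mat n n" "?s H' \<in> carrier_mat n n"
    using cG by auto
  have sG: "?s G * ?s G' = 1\<^sub>m n" "?s G' * ?s G = 1\<^sub>m n" "?s H * ?s H' = 1\<^sub>m n" "?s H' * ?s H = 1\<^sub>m n"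
    using GG map_scale_mult[OF cG(1,2), of \<mu>] map_scale_mult[OF cG(2,1), of \<mu>] map_scale_mult[OF cG(3,4), of \<mu>]
      map_scale_mult[OF cG(4,3), of \<mu>] scale.mat_hom_one[of \<mu> n] by simp_all
  define U where "U = Ud * ?s G'"
  define U' where "U' = ?s G * Ud'"
  define V where "V = ?s H * Vd"
  define V' where "V' = Vd' * ?s H'"
  have cU: "U \<in> carrier_mat n n" "U' \<in> carrier_mat n n" "V \<in> carrier_mat n n" "V' \<in> carrier_mat n n"
    unfolding U_def U'_def V_def V'_def using cs sc by auto
  have inv: "U * U' = 1\<^sub>m n" "U' * U = 1\<^sub>m n" "V * V' = 1\<^sub>m n" "V' * V = 1\<^sub>m n"
    unfolding U_def U'_def V_def V'_def
    by (rule cancel[OF cs(3) sc(2) cs(7) sc(1) sG(2) Ud'(2)], rule cancel[OF sc(1) cs(7) sc(2) cs(3) Ud'(3) sG(1)],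
        rule cancel[OF sc(3) cs(4) sc(4) cs(8) Vd'(2) sG(3)], rule cancel[OF cs(8) sc(4) cs(4) sc(3) sG(4) Vd'(3)])
  have od: "mat_over (polys_over Ad) U" "mat_over (polys_over Ad) U'" "mat_over (polys_over Ad) V" "mat_over (polys_over Ad) V'"
    unfolding U_def U'_def V_def V'_def
    using mat_over_mult[OF pr(2) os(3) near0(2) cs(3) sc(2)] mat_over_mult[OF pr(2) near0(1) os(7) sc(1) cs(7)]
      mat_over_mult[OF pr(2) near0(3) os(4) sc(3) cs(4)] mat_over_mult[OF pr(2) os(8) near0(4) cs(8) sc(4)] by blast+
  have Ud_eq: "Ud = Uc * G"
  proof -
    have "Uc * G = (Uc * Uc') * Ud" unfolding G_def using cs by (simp add: assoc_mult_mat[of _ n n _ n _ n])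
    then show ?thesis using Uc' cs by simp
  qed
  have Ud'_eq: "Ud' = G' * Uc'"
  proof -
    have "G' * Uc' = Ud' * (Uc * Uc')" unfolding G'_def using cs by (simp add: assoc_mult_mat[of _ n n _ n _ n])
    then show ?thesis using Uc' cs by simp
  qed
  have Vd_eq: "Vd = H' * Vc"
  proof -
    have "H' * Vc = Vd * (Vc' * Vc)" unfolding H'_def using cs by (simp add: assoc_mult_mat[of _ n n _ n _ n])
    then show ?thesis using Vc' cs by simp
  qed
  have Vd'_eq: "Vd' = Vc' * H"
  proof -
    have "Vc' * H = (Vc' * Vc) * Vd'" unfolding H_def using cs by (simp add: assoc_mult_mat[of _ n n _ n _ n])
    then show ?thesis using Vc' cs by simp
  qed
  have Uc_form: "U = Uc * (G * ?s G')" "U' = (?s G * G') * Uc'" "V = (?s H * H') * Vc" "V' = Vc' * (H * ?s H')"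
    unfolding U_def U'_def V_def V'_def Ud_eq Ud'_eq Vd_eq Vd'_eq
    using cs cG sc by (simp_all add: assoc_mult_mat[of _ n n _ n _ n])
  have oc: "mat_over (polys_over Ac) U" "mat_over (polys_over Ac) U'" "mat_over (polys_over Ac) V" "mat_over (polys_over Ac) V'"
    unfolding Uc_form
    using mat_over_mult[OF pr(1) os(1) near1(1) cs(1) mult_carrier_mat[OF cG(1) sc(2)]]
      mat_over_mult[OF pr(1) near1(2) os(5) mult_carrier_mat[OF sc(1) cG(2)] cs(5)]
      mat_over_mult[OF pr(1) near1(4) os(2) mult_carrier_mat[OF sc(3) cG(4)] cs(2)]
      mat_over_mult[OF pr(1) os(6) near1(3) cs(6) mult_carrier_mat[OF cG(3) sc(4)]] by blast+
  have inter: "mat_over (polys_over A) M" if "mat_over (polys_over Ac) M" "mat_over (polys_over Ad) M" for M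
    using that loc_inter_comaximal[OF A c] unfolding mat_over_def polys_over_def Ac_def Ad_def by blast
  have gl: "U \<in> GLs (polys_over A) n" "V \<in> GLs (polys_over A) n"
    using inter[OF oc(1) od(1)] inter[OF oc(2) od(2)] inter[OF oc(3) od(3)] inter[OF oc(4) od(4)] cU inv
    by (auto intro: GLsI)
  have es: "?e (?s M) = ?e M" for M by (intro eq_matI) (auto simp: scale_0_scale)
  have eU: "?e U = 1\<^sub>m n" "?e V = 1\<^sub>m n"
    unfolding U_def V_def using map_scale_mult[OF cs(3) sc(2), of 0] map_scale_mult[OF sc(3) cs(4), of 0]
      Ud(2) Vd(2) eG es by simp_all
  have sF0: "?s ?F0 = ?F0" by (intro eq_matI) (auto simp: scale_scale_0)
  have scomm: "?s G' * ?F0 = ?F0 * ?s H'"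
    using comm' map_scale_mult[OF cG(2) cF0, of \<mu>] map_scale_mult[OF cF0 cG(4), of \<mu>] unfolding sF0 by simp
  have "U * ?F0 * V = Ud * (?s G' * ?F0) * ?s H * Vd"
    unfolding U_def V_def using cs sc cF0 by (simp add: assoc_mult_mat[of _ n n _ n _ n])
  also have "\<dots> = Ud * ?F0 * (?s H' * ?s H) * Vd"
    unfolding scomm using cs sc cF0 by (simp add: assoc_mult_mat[of _ n n _ n _ n])
  also have "\<dots> = Ud * ?F0 * Vd" unfolding sG using cs cF0 by simp
  also note Fd[symmetric]
  finally have "F = U * ?F0 * V" ..
  then show ?thesis unfolding const_equivalent_def using gl eU by blast
qed

text \<open>Finitely many denominators occur, and their product is a single element to invert. This passes from a
localization at a maximal ideal to a neighbourhood.\<close>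

lemma GLs_poly_denominator:
  fixes A :: "'k::field set"
  assumes A: "subring_set A" and T: "mult_set A T" and U: "U \<in> GLs (polys_over (loc A T)) n"
  shows "\<exists>t\<in>T. U \<in> GLs (polys_over (loc A (powers t))) n"
proof -
  obtain U' where U': "U' \<in> GLs (polys_over (loc A T)) n" "U * U' = 1\<^sub>m n" "U' * U = 1\<^sub>m n" using GLsE[OF U] .
  have T': "t \<in> A" "t \<noteq> 0" if "t \<in> T" for t using T that unfolding mult_set_def by auto
  have den: "\<exists>t\<in>T. mat_over (polys_over (loc A (powers t))) M"
    if M: "M \<in> GLs (polys_over (loc A T)) n" for M
  proof -
    note c = GLs_carrier[OF M]
    obtain t where t: "t \<in> T" "\<forall>i<n. \<forall>j<n. \<forall>k. t * coeff (M $$ (i, j)) k \<in> A"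
      using common_denominator_poly_mat[OF A T c GLs_over[OF M]] by blast
    have "coeff (M $$ (i, j)) k \<in> loc A (powers t)" if "i < n" "j < n" for i j k
    proof -
      have "t * coeff (M $$ (i, j)) k \<in> A" using t(2) that by blast
      from locI_powers[OF this, of t 1] show ?thesis using T'[OF t(1)] by simp
    qed
    then show ?thesis using t(1) c unfolding mat_over_def polys_over_def by auto
  qed
  obtain t where t: "t \<in> T" "mat_over (polys_over (loc A (powers t))) U" using den[OF U] by blast
  obtain t' where t': "t' \<in> T" "mat_over (polys_over (loc A (powers t'))) U'" using den[OF U'(1)] by blast
  have "t * t' \<in> T" using T t t' unfolding mult_set_def by blast
  moreover have "mat_over (polys_over (loc A (powers (t * t')))) U" "mat_over (polys_over (loc A (powers (t * t')))) U'"
    using mat_over_mono[OF t(2) polys_over_mono] mat_over_mono[OF t'(2) polys_over_mono]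
      loc_powers_mono[OF A T'(1)[OF t(1)] T'[OF t'(1)]] loc_powers_mono[OF A T'(1)[OF t'(1)] T'[OF t(1)]]
    by (auto simp: mult.commute)
  ultimately show ?thesis
    using GLsI[OF GLs_carrier[OF U] _ GLs_carrier[OF U'(1)] _ U'(2,3)] by blast
qed

text \<open>The diagonal matrix is constant. So it can be eliminated between the equivalence and its value at \<open>0\<close>,
and the products \<open>U(x) * U(0)\<^sup>-\<^sup>1\<close> and \<open>V(0)\<^sup>-\<^sup>1 * V(x)\<close> are the identity at \<open>0\<close>.\<close>

lemma normalize_equivalence:
  fixes F :: "'k::field poly mat"
  assumes B: "subring_set B" and e: "eqv (polys_over B) n F (diag_of n (\<lambda>i. [:t i:]))"
  shows "const_equivalent n F B"
proof -
  let ?S = "diag_of n (\<lambda>i. [:t i:])" and ?e = "map_mat (scale 0)"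
  note PB = polys_over_subring[OF B]
  obtain U V where U: "U \<in> GLs (polys_over B) n" and V: "V \<in> GLs (polys_over B) n" and F: "F = U * ?S * V"
    using e unfolding eqv_def by blast
  have img: "scale 0 ` polys_over B \<subseteq> polys_over B" using scale_in[OF B subring_zero[OF B]] by auto
  have eGL: "?e W \<in> GLs (polys_over B) n" if "W \<in> GLs (polys_over B) n" for W
    using GLs_mono[OF scale.GLs_map[OF that] img] .
  obtain U0 where U0: "U0 \<in> GLs (polys_over B) n" "?e U * U0 = 1\<^sub>m n" "U0 * ?e U = 1\<^sub>m n" using GLsE[OF eGL[OF U]] .
  obtain V0 where V0: "V0 \<in> GLs (polys_over B) n" "?e V * V0 = 1\<^sub>m n" "V0 * ?e V = 1\<^sub>m n" using GLsE[OF eGL[OF V]] .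
  have cS: "?S \<in> carrier_mat n n" by (rule diag_of_carrier)
  note c = GLs_carrier[OF U] GLs_carrier[OF V] GLs_carrier[OF U0(1)] GLs_carrier[OF V0(1)]
    GLs_carrier[OF eGL[OF U]] GLs_carrier[OF eGL[OF V]]
  have eS: "?e ?S = ?S"
    unfolding diag_of_def by (intro eq_matI) (auto simp: scale_def pcompose_pCons)
  have ee: "?e (?e W) = ?e W" for W by (intro eq_matI) (auto simp: scale_scale_0)
  have e0: "?e W0 = W0" if "?e W * W0 = 1\<^sub>m n" "W0 * ?e W = 1\<^sub>m n" "W \<in> carrier_mat n n" "W0 \<in> carrier_mat n n" for W W0
  proof -
    have "?e W * ?e W0 = ?e (?e W * W0)" using map_scale_mult[of "?e W" n W0 0] that by (simp add: ee)
    then have "?e W * ?e W0 = 1\<^sub>m n" unfolding that(1) scale.mat_hom_one .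
    then have "W0 * (?e W * ?e W0) = W0" using that by simp
    moreover have "W0 * (?e W * ?e W0) = (W0 * ?e W) * ?e W0"
      by (rule assoc_mult_mat[symmetric]) (use that in auto)
    ultimately show ?thesis using that by simp
  qed
  have eF: "?e F = ?e U * ?S * ?e V"
    unfolding F using map_scale_mult[OF mult_carrier_mat[OF c(1) cS] c(2), of 0] map_scale_mult[OF c(1) cS, of 0] eS by simp
  have "(U * U0) * (?e U * S * ?e V) * (V0 * V) = U * (U0 * ?e U) * S * (?e V * V0) * V"
    if "S \<in> carrier_mat n n" for S
    using c that by (simp add: assoc_mult_mat[of _ n n _ n _ n])
  from this[OF cS] have "(U * U0) * ?e F * (V0 * V) = U * (U0 * ?e U) * ?S * (?e V * V0) * V"
    unfolding eF .
  also have "\<dots> = F" unfolding U0(3) V0(2) F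
    using c right_mult_one_mat[OF mult_carrier_mat[OF c(1) cS]] by simp
  finally have "F = (U * U0) * ?e F * (V0 * V)" ..
  moreover have "?e (U * U0) = 1\<^sub>m n" "?e (V0 * V) = 1\<^sub>m n"
    using map_scale_mult[OF c(1) c(3), of 0] map_scale_mult[OF c(4) c(2), of 0]
      e0[OF U0(2,3) c(1) c(3)] e0[OF V0(2,3) c(2) c(4)] U0 V0 by simp_all
  ultimately show ?thesis
    using GLs_mult[OF PB U U0(1)] GLs_mult[OF PB V0(1) V] unfolding const_equivalent_def by blast
qed

text \<open>The hypothesis on \<open>XD\<close> and \<open>YD\<close> says that \<open>F\<close> becomes equivalent to the diagonal matrix when polynomials
with unit leading coefficients are inverted. Locally this implies equivalence to the diagonal matrix over \<open>A[x]\<close>;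
the normalized form of this equivalence compares \<open>F\<close> with its constant term and is independent of choices
in the diagonal form, so that it can be patched.\<close>

theorem const_equivalent_of_infinity:
  fixes A :: "'k::field set" and F :: "'k poly mat"
  assumes sA: "subring_set A" and F: "F \<in> carrier_mat n n" "mat_over (polys_over A) F"
    and t: "\<And>i. Suc i < n \<Longrightarrow> \<exists>c\<in>A. t (Suc i) = t i * c"
    and d: "\<And>k. k \<le> n \<Longrightarrow> det_ideal (polys_over A) n k F [:\<Prod>i<k. t i:]"
    and D: "XD \<in> carrier_mat n n" "mat_over (polys_over A) XD" "YD \<in> carrier_mat n n" "mat_over (polys_over A) YD"
      "XD * diag_of n (\<lambda>i. [:t i:]) = F * YD"
    and gX: "gX \<in> polys_over A" "lead_coeff (det XD * gX) \<noteq> 0" "inverse (lead_coeff (det XD * gX)) \<in> A"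
    and gY: "gY \<in> polys_over A" "lead_coeff (det YD * gY) \<noteq> 0" "inverse (lead_coeff (det YD * gY)) \<in> A"
  shows "const_equivalent n F A"
proof (rule local_global_principle[where Q = "const_equivalent n F", OF sA])
  show "const_equivalent n F B'" if "B \<subseteq> B'" "const_equivalent n F B" for B B'
    using const_equivalent_mono that .
  show "const_equivalent n F B"
    if "subring_set B" "c \<in> B" "d \<in> B" "c \<noteq> 0" "d \<noteq> 0" "c + d = 1"
      "const_equivalent n F (loc B (powers c))" "const_equivalent n F (loc B (powers d))" for B c d
    using patch_const_equivalent[OF that(1-6) F(1) that(7,8)] .
  show "\<exists>c\<in>A - m. const_equivalent n F (loc A (powers c))" if m: "maximal_in A m" for m
  proof -
    define B where "B = loc A (A - m)"
    define M where "M = loc m (A - m)"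
    interpret local_subring B M unfolding B_def M_def by (rule localization_at_maximal[OF sA m])
    note T = maximal_mult_set[OF sA m]
    have AB: "A \<subseteq> B" unfolding B_def using T unfolding mult_set_def by (intro loc_incl) blast
    note PAB = polys_over_mono[OF AB]
    have unit: "u \<notin> M" if "u \<noteq> 0" "inverse u \<in> A" for u
    proof
      assume "u \<in> M"
      then obtain a r where a: "a \<in> m" "r \<in> A - m" "u = a / r" unfolding M_def loc_def by blast
      have "r \<noteq> 0" using a(2) m unfolding maximal_in_def ideal_in_def by auto
      then have "r = inverse u * a" using a(3) that(1) by auto
      then show False using a m that(2) unfolding maximal_in_def ideal_in_def by blast
    qed
    have ul: "unit_lead (det X)"
      if "X \<in> carrier_mat n n" "mat_over (polys_over A) X" "g \<in> polys_over A"
        "lead_coeff (det X * g) \<noteq> 0" "inverse (lead_coeff (det X * g)) \<in> A" for X g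
    proof -
      have X: "det X \<in> P" using det_in_subring[OF polys_over_subring[OF sA] that(2,1)] PAB by blast
      have g: "g \<in> P" using that(3) PAB by blast
      have "unit_lead (det X * g)" unfolding unit_lead_def
        using unit[OF that(4,5)] subring_mult[OF P X g] by blast
      then show ?thesis using X g by (rule unit_lead_factor)
    qed
    have "eqv P n F (diag_of n (\<lambda>i. [:t i:]))"
    proof (rule horrocks_smith[OF F(1) mat_over_mono[OF F(2) PAB]])
      show "\<exists>c\<in>P. [:t (Suc i):] = [:t i:] * c" if i: "Suc i < n" for i
      proof -
        obtain c where "c \<in> A" "t (Suc i) = t i * c" using t[OF i] by blast
        then show ?thesis using AB polys_over_const[of B c] subring_zero[OF A]
          by (intro bexI[of _ "[:c:]"]) auto
      qed
      show "det_ideal P n k F (\<Prod>i<k. [:t i:])" if "k \<le> n" for k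
      proof -
        have "(\<Prod>i<k. [:t i:]) = [:\<Prod>i<k. t i:]" by (induction k) (auto simp: one_pCons mult.commute)
        then show ?thesis using det_ideal_mono[OF d[OF that] PAB] by simp
      qed
      show "intertwining F n (\<lambda>i. [:t i:]) XD YD"
        unfolding intertwining_def using D mat_over_mono[OF _ PAB] by blast
    qed (use ul D gX gY in auto)
    then have "const_equivalent n F B"
      using normalize_equivalence[OF A] by blast
    then obtain U V where U: "U \<in> GLs P n" and V: "V \<in> GLs P n" and UV: "map_mat (scale 0) U = 1\<^sub>m n"
      "map_mat (scale 0) V = 1\<^sub>m n" "F = U * map_mat (scale 0) F * V"
      unfolding const_equivalent_def by blast
    obtain c where c: "c \<in> A - m" "U \<in> GLs (polys_over (loc A (powers c))) n"
      using GLs_poly_denominator[OF sA T U[unfolded B_def]] by blast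
    obtain c' where c': "c' \<in> A - m" "V \<in> GLs (polys_over (loc A (powers c'))) n"
      using GLs_poly_denominator[OF sA T V[unfolded B_def]] by blast
    have nz: "c \<noteq> 0" "c' \<noteq> 0" using c c' T unfolding mult_set_def by auto
    have "U \<in> GLs (polys_over (loc A (powers (c * c')))) n" "V \<in> GLs (polys_over (loc A (powers (c * c')))) n"
      using GLs_mono[OF c(2) polys_over_mono] GLs_mono[OF c'(2) polys_over_mono]
        loc_powers_mono[OF sA, of c c'] loc_powers_mono[OF sA, of c' c] c(1) c'(1) nz
      by (auto simp: mult.commute)
    moreover have "c * c' \<in> A - m" using c(1) c'(1) T unfolding mult_set_def by blast
    ultimately show ?thesis using UV unfolding const_equivalent_def by blast
  qed
qed

section \<open>An invariant factor divisible by the variable\<close>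

interpretation coeff0: comm_ring_hom "\<lambda>p :: 'k::field poly. coeff p 0"
  by unfold_locales (auto simp: coeff_mult)

interpretation const: comm_ring_hom "\<lambda>a :: 'k::field. [:a:]"
  by unfold_locales (auto simp: one_pCons mult.commute)

lemma divide_by_var:
  assumes "p \<in> polys_over A" "coeff p 0 = 0" shows "\<exists>q\<in>polys_over A. p = [:0, 1:] * q"
proof -
  obtain a q where p: "p = pCons a q" by (cases p) auto
  then have "a = 0" using assms(2) by simp
  moreover have "coeff q i \<in> A" for i using polys_over_coeff[OF assms(1), of "Suc i"] unfolding p by simp
  ultimately show ?thesis using p by (intro bexI[of _ q]) (auto intro: polys_overI)
qed

lemma minor_repeated_col:
  assumes "j < k" "j' < k" "j \<noteq> j'" "g j = g j'"
  shows "minor k f g F = 0"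
  unfolding minor_def
  by (rule det_identical_columns[of _ k j j']) (use assms in \<open>auto intro!: eq_vecI\<close>)

definition mult_last :: "nat \<Rightarrow> 'a::comm_ring_1 \<Rightarrow> 'a mat \<Rightarrow> 'a mat" where
  "mult_last r c F = mat (Suc r) (Suc r) (\<lambda>(i, j). if j = r then c * F $$ (i, j) else F $$ (i, j))"

lemma mult_last_carrier[simp]: "mult_last r c F \<in> carrier_mat (Suc r) (Suc r)"
  unfolding mult_last_def by auto

lemma minor_mult_last:
  assumes fg: "\<forall>i<k. f i < Suc r \<and> g i < Suc r"
  shows "(\<forall>j<k. g j \<noteq> r) \<and> minor k f g (mult_last r c F) = minor k f g F \<or>
    (\<exists>j<k. g j = r) \<and> minor k f g (mult_last r c F) = c * minor k f g F"
proof (cases "\<exists>j<k. g j = r")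
  case False
  have "mat k k (\<lambda>(i, j). mult_last r c F $$ (f i, g j)) = mat k k (\<lambda>(i, j). F $$ (f i, g j))"
    using fg False by (intro eq_matI) (auto simp: mult_last_def)
  then show ?thesis using False unfolding minor_def by simp
next
  case True
  then obtain j where j: "j < k" "g j = r" by blast
  show ?thesis
  proof (cases "\<exists>j'<k. j' \<noteq> j \<and> g j' = r")
    case True
    then obtain j' where j': "j' < k" "j' \<noteq> j" "g j' = r" by blast
    have "minor k f g M = 0" for M :: "'a mat" using j j' by (intro minor_repeated_col[of j' k j]) auto
    then show ?thesis using j by auto
  next
    case False
    let ?M = "mat k k (\<lambda>(i, j). F $$ (f i, g j))"
    have "mat k k (\<lambda>(i, j). mult_last r c F $$ (f i, g j)) = replace_col ?M (c \<cdot>\<^sub>v col ?M j) j"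
      using fg False j by (intro eq_matI) (auto simp: mult_last_def replace_col_def)
    then have "minor k f g (mult_last r c F) = det_col ?M j (c \<cdot>\<^sub>v col ?M j)"
      unfolding minor_def det_col_def by simp
    also have "\<dots> = c * det ?M"
      using det_col_smult[of ?M k j "col ?M j" c] det_col_self[of ?M k j] j by (auto simp: carrier_vecI)
    finally show ?thesis using j unfolding minor_def by auto
  qed
qed

text \<open>Dividing the last column by the variable removes one factor from the last invariant factor only:
  the others are nonzero constants, hence prime to the variable.\<close>

lemma det_ideal_divide_last:
  fixes A :: "'k::field set"
  assumes A: "subring_set A" and G: "G \<in> carrier_mat (Suc r) (Suc r)" "mat_over (polys_over A) G"
    and c: "c \<in> A" "c \<noteq> 0" and k: "k \<le> Suc r"
    and d: "det_ideal (polys_over A) (Suc r) k (mult_last r [:0, 1:] G)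
      (if k = Suc r then [:0, 1:] * [:c:] else [:c:])"
  shows "det_ideal (polys_over A) (Suc r) k G [:c:]"
proof -
  note PA = polys_over_subring[OF A]
  let ?X = "[:0, 1:] :: 'k poly" and ?l = "Suc r" and ?F = "mult_last r [:0, 1:] G"
  have XP: "?X \<in> polys_over A" using subring_zero[OF A] subring_one[OF A]
    by (auto intro!: polys_overI simp: coeff_pCons split: nat.splits)
  have no_last: "minor k f g G = 0" if "k = ?l" "\<forall>j<k. g j \<noteq> r" "\<forall>i<k. f i < ?l \<and> g i < ?l" for f g
  proof -
    have "g j < r" if "j < ?l" for j
      using \<open>\<forall>i<k. f i < ?l \<and> g i < ?l\<close> \<open>\<forall>j<k. g j \<noteq> r\<close> \<open>k = ?l\<close> that by (metis less_SucE)
    then have "g ` {..<?l} \<subseteq> {..<r}" by auto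
    then have "card (g ` {..<?l}) \<le> r" using card_mono[of "{..<r}"] by fastforce
    then have "\<not> inj_on g {..<?l}" using card_image[of g "{..<?l}"] by fastforce
    then obtain j j' where "j < ?l" "j' < ?l" "j \<noteq> j'" "g j = g j'" unfolding inj_on_def by auto
    then show ?thesis using minor_repeated_col[of j k j'] \<open>k = ?l\<close> by simp
  qed
  have mult: "\<exists>w\<in>polys_over A. m = [:c:] * w" if m: "m \<in> kminors ?l k G" for m
  proof -
    obtain f g where fg: "\<forall>i<k. f i < ?l \<and> g i < ?l" and mm: "m = minor k f g G"
      using m unfolding kminors_def by auto
    have "minor k f g ?F \<in> kminors ?l k ?F" using fg by (intro kminorsI) auto
    then obtain w where w: "w \<in> polys_over A" "minor k f g ?F = (if k = ?l then ?X * [:c:] else [:c:]) * w"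
      using d unfolding det_ideal_def by blast
    show ?thesis
    proof (cases "\<exists>j<k. g j = r")
      case False
      show ?thesis
      proof (cases "k = ?l")
        case True
        then show ?thesis using no_last[OF _ _ fg] False subring_zero[OF PA] mm by auto
      next
        case nk: False
        have "minor k f g ?F = minor k f g G" using minor_mult_last[OF fg, of ?X G] False by blast
        then show ?thesis using w nk mm by auto
      qed
    next
      case True
      then have e: "minor k f g ?F = ?X * m" using minor_mult_last[OF fg, of ?X G] mm by blast
      show ?thesis
      proof (cases "k = ?l")
        case True
        then have "?X * m = ?X * ([:c:] * w)" using w(2) e by (simp add: mult.assoc)
        then have "m = [:c:] * w" by (subst (asm) mult_left_cancel) auto
        then show ?thesis using w(1) by blast
      next
        case False
        then have "?X * m = [:c:] * w" using w(2) e by simp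
        then have "coeff ([:c:] * w) 0 = 0" by (metis coeff_mult_0 coeff_pCons_0 mult_zero_left)
        then have "coeff w 0 = 0" using c(2) by simp
        then obtain w' where w': "w' \<in> polys_over A" "w = ?X * w'" using divide_by_var[OF w(1)] by blast
        have "?X * m = ?X * ([:c:] * w')" using \<open>?X * m = [:c:] * w\<close> unfolding w'(2) by (simp only: ac_simps)
        then have "m = [:c:] * w'" by (subst (asm) mult_left_cancel) auto
        then show ?thesis using w'(1) by blast
      qed
    qed
  qed
  have "[:c:] \<in> lin (polys_over A) (kminors ?l k G)"
  proof (cases "k = ?l")
    case False
    have "kminors ?l k ?F \<subseteq> lin (polys_over A) (kminors ?l k G)"
    proof
      fix x assume "x \<in> kminors ?l k ?F"
      then obtain f g where fg: "\<forall>i<k. f i < ?l \<and> g i < ?l" and x: "x = minor k f g ?F"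
        unfolding kminors_def by auto
      have "minor k f g G \<in> lin (polys_over A) (kminors ?l k G)"
        using fg by (intro lin_gen[OF PA] kminorsI) auto
      then show "x \<in> lin (polys_over A) (kminors ?l k G)"
        using minor_mult_last[OF fg, of ?X G] lin_mult[OF PA XP] unfolding x by metis
    qed
    then show ?thesis using d False lin_trans[OF PA] unfolding det_ideal_def by auto
  next
    case True
    have "\<exists>v\<in>lin (polys_over A) (kminors ?l k G). u = ?X * v" if "u \<in> lin (polys_over A) (kminors ?l k ?F)" for u
      using that
    proof induction
      case zero
      show ?case using lin.zero by (intro bexI[of _ 0]) auto
    next
      case (step a x u)
      then obtain v where v: "v \<in> lin (polys_over A) (kminors ?l k G)" "u = ?X * v" by blast
      obtain f g where fg: "\<forall>i<k. f i < ?l \<and> g i < ?l" and x: "x = minor k f g ?F"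
        using step unfolding kminors_def by auto
      have mg: "minor k f g G \<in> kminors ?l k G" using fg by (intro kminorsI) auto
      have "x = ?X * minor k f g G"
        using minor_mult_last[OF fg, of ?X G] no_last[OF True _ fg] unfolding x by auto
      then have "a * x + u = ?X * (a * minor k f g G + v)" unfolding v(2) by (simp add: algebra_simps)
      then show ?case using lin.step[OF step(1) mg v(1)] by blast
    qed
    moreover have "?X * [:c:] \<in> lin (polys_over A) (kminors ?l k ?F)"
      using d True unfolding det_ideal_def by (simp only: if_True simp_thms)
    ultimately obtain v where v: "v \<in> lin (polys_over A) (kminors ?l k G)" "?X * [:c:] = ?X * v"
      by blast
    then have "[:c:] = v" by (subst (asm) mult_left_cancel) auto
    then show ?thesis using v(1) by simp
  qed
  then show ?thesis using mult unfolding det_ideal_def by blast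
qed

lemma mult_last_mult_right:
  assumes "U \<in> carrier_mat (Suc r) (Suc r)" "G \<in> carrier_mat (Suc r) (Suc r)"
  shows "mult_last r c (U * G) = U * mult_last r c (G :: 'a::comm_ring_1 mat)"
proof (rule eq_matI)
  fix i j assume "i < dim_row (U * mult_last r c G)" "j < dim_col (U * mult_last r c G)"
  then have ij: "i < Suc r" "j < Suc r" using assms unfolding mult_last_def by auto
  have "(U * mult_last r c G) $$ (i, j) = (\<Sum>q\<in>{0..<Suc r}. U $$ (i, q) * mult_last r c G $$ (q, j))"
    by (rule mat_mult_entry[OF assms(1) mult_last_carrier ij])
  also have "\<dots> = (if j = r then c else 1) * (\<Sum>q\<in>{0..<Suc r}. U $$ (i, q) * G $$ (q, j))"
    unfolding sum_distrib_left mult_last_def using ij by (intro sum.cong) auto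
  also have "\<dots> = (if j = r then c else 1) * (U * G) $$ (i, j)" by (simp only: mat_mult_entry[OF assms ij])
  also have "\<dots> = mult_last r c (U * G) $$ (i, j)" using ij unfolding mult_last_def by simp
  finally show "mult_last r c (U * G) $$ (i, j) = (U * mult_last r c G) $$ (i, j)" ..
qed (use assms in \<open>auto simp: mult_last_def\<close>)

text \<open>A matrix that is the identity at \<open>0\<close> may be moved past the multiplication of the last column by
  the variable: its off-diagonal entries are divisible by the variable.\<close>

lemma mult_last_absorb:
  fixes A :: "'k::field set"
  assumes A: "subring_set A" and G: "G \<in> carrier_mat (Suc r) (Suc r)"
    and V: "V \<in> GLs (polys_over A) (Suc r)" "map_mat (scale 0) V = 1\<^sub>m (Suc r)"
  shows "eqv (polys_over A) (Suc r) (mult_last r [:0, 1:] (G * V)) (mult_last r [:0, 1:] G)"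
proof -
  let ?X = "[:0, 1:] :: 'k poly" and ?l = "Suc r"
  note PA = polys_over_subring[OF A]
  have XP: "?X \<in> polys_over A" using subring_zero[OF A] subring_one[OF A]
    by (auto intro!: polys_overI simp: coeff_pCons split: nat.splits)
  have twist: "\<exists>W'\<in>carrier_mat ?l ?l. mat_over (polys_over A) W' \<and>
      (\<forall>M\<in>carrier_mat ?l ?l. mult_last r ?X (M * W) = mult_last r ?X M * W')"
    if W: "W \<in> GLs (polys_over A) ?l" "map_mat (scale 0) W = 1\<^sub>m ?l" for W
  proof -
    note cW = GLs_carrier[OF W(1)]
    have W0: "coeff (W $$ (i, j)) 0 = (if i = j then 1 else 0)" if "i < ?l" "j < ?l" for i j
    proof -
      have "scale 0 (W $$ (i, j)) = 1\<^sub>m ?l $$ (i, j)" using W(2) cW that by (metis carrier_matD index_map_mat(1))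
      then have "coeff (scale 0 (W $$ (i, j))) 0 = coeff (1\<^sub>m ?l $$ (i, j)) 0" by simp
      then show ?thesis using that by (auto simp: coeff_scale)
    qed
    define h where "h j = (SOME q. q \<in> polys_over A \<and> W $$ (r, j) = ?X * q)" for j
    have h: "h j \<in> polys_over A" "W $$ (r, j) = ?X * h j" if "j < r" for j
    proof -
      have "\<exists>q. q \<in> polys_over A \<and> W $$ (r, j) = ?X * q"
        using divide_by_var[OF mat_overD[OF GLs_over[OF W(1)] cW, of r j]] W0[of r j] that by auto
      from someI_ex[OF this] show "h j \<in> polys_over A" "W $$ (r, j) = ?X * h j" unfolding h_def by auto
    qed
    define W' where "W' = mat ?l ?l (\<lambda>(i, j). if i = r \<and> j \<noteq> r then h j
        else if i \<noteq> r \<and> j = r then ?X * W $$ (i, j) else W $$ (i, j))"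
    have cW': "W' \<in> carrier_mat ?l ?l" unfolding W'_def by auto
    have "mat_over (polys_over A) W'" unfolding W'_def
      using mat_overD[OF GLs_over[OF W(1)] cW] h XP
      by (auto intro!: mat_over_mat subring_mult[OF PA] simp del: mult_pCons_left)
    moreover have "mult_last r ?X (M * W) = mult_last r ?X M * W'" if M: "M \<in> carrier_mat ?l ?l" for M
    proof (rule eq_matI)
      fix i j assume "i < dim_row (mult_last r ?X M * W')" "j < dim_col (mult_last r ?X M * W')"
      then have ij: "i < ?l" "j < ?l" using cW' unfolding mult_last_def by auto
      have "mult_last r ?X (M * W) $$ (i, j) = (if j = r then ?X else 1) * (M * W) $$ (i, j)"
        using ij unfolding mult_last_def by simp
      also have "(M * W) $$ (i, j) = (\<Sum>q\<in>{0..<?l}. M $$ (i, q) * W $$ (q, j))"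
        by (rule mat_mult_entry[OF M cW ij])
      also have "(if j = r then ?X else 1) * \<dots> = (\<Sum>q\<in>{0..<?l}. mult_last r ?X M $$ (i, q) * W' $$ (q, j))"
        unfolding sum_distrib_left
      proof (rule sum.cong[OF refl])
        fix q assume q: "q \<in> {0..<?l}"
        show "(if j = r then ?X else 1) * (M $$ (i, q) * W $$ (q, j)) = mult_last r ?X M $$ (i, q) * W' $$ (q, j)"
          using q ij h[of j] unfolding mult_last_def W'_def by (auto simp: less_Suc_eq)
      qed
      also have "\<dots> = (mult_last r ?X M * W') $$ (i, j)"
        by (rule mat_mult_entry[OF mult_last_carrier cW' ij, symmetric])
      finally show "mult_last r ?X (M * W) $$ (i, j) = (mult_last r ?X M * W') $$ (i, j)" .
    qed (use cW' in \<open>auto simp: mult_last_def\<close>)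
    ultimately show ?thesis using cW' by blast
  qed
  obtain V' where V': "V' \<in> GLs (polys_over A) ?l" "V * V' = 1\<^sub>m ?l" "V' * V = 1\<^sub>m ?l" using GLsE[OF V(1)] .
  note c = GLs_carrier[OF V(1)] GLs_carrier[OF V'(1)]
  have "map_mat (scale 0) V' = 1\<^sub>m ?l"
    using map_scale_mult[OF c, of 0] V(2) V'(2) scale.mat_hom_one[of 0 ?l] left_mult_one_mat[of "map_mat (scale 0) V'" ?l ?l] c
    by (metis map_carrier_mat)
  from twist[OF V'(1) this] obtain W' where W': "W' \<in> carrier_mat ?l ?l" "mat_over (polys_over A) W'"
    "\<And>M. M \<in> carrier_mat ?l ?l \<Longrightarrow> mult_last r ?X (M * V') = mult_last r ?X M * W'" by blast
  from twist[OF V] obtain W where W: "W \<in> carrier_mat ?l ?l" "mat_over (polys_over A) W"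
    "\<And>M. M \<in> carrier_mat ?l ?l \<Longrightarrow> mult_last r ?X (M * V) = mult_last r ?X M * W" by blast
  have inv: "Z * Z' = 1\<^sub>m ?l"
    if Z: "Z \<in> carrier_mat ?l ?l" "Z' \<in> carrier_mat ?l ?l" "Y \<in> carrier_mat ?l ?l" "Y' \<in> carrier_mat ?l ?l" "Y * Y' = 1\<^sub>m ?l"
      "\<And>M. M \<in> carrier_mat ?l ?l \<Longrightarrow> mult_last r ?X (M * Y) = mult_last r ?X M * Z"
      "\<And>M. M \<in> carrier_mat ?l ?l \<Longrightarrow> mult_last r ?X (M * Y') = mult_last r ?X M * Z'" for Z Z' Y Y' :: "'k poly mat"
  proof -
    let ?D = "mult_last r ?X (1\<^sub>m ?l)"
    have "?D * (Z * Z') = ?D * Z * Z'" using assoc_mult_mat[OF mult_last_carrier Z(1,2)] by simp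
    also have "\<dots> = mult_last r ?X (1\<^sub>m ?l * Y * Y')"
      using Z(6)[of "1\<^sub>m ?l"] Z(7)[of "1\<^sub>m ?l * Y"] Z(3) by simp
    also have "\<dots> = ?D" using Z(3,4,5) by simp
    finally have eq: "?D * (Z * Z') = ?D" .
    have nz: "(if i = r then ?X else 1) \<noteq> 0" for i :: nat by simp
    show ?thesis
    proof (rule eq_matI)
      fix i j assume "i < dim_row (1\<^sub>m ?l :: 'k poly mat)" "j < dim_col (1\<^sub>m ?l :: 'k poly mat)"
      then have ij: "i < ?l" "j < ?l" by auto
      have "(?D * (Z * Z')) $$ (i, j) = (\<Sum>q\<in>{0..<?l}. ?D $$ (i, q) * (Z * Z') $$ (q, j))"
        by (rule mat_mult_entry[OF mult_last_carrier mult_carrier_mat[OF Z(1,2)] ij])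
      also have "\<dots> = (\<Sum>q\<in>{0..<?l}. if q = i then (if i = r then ?X else 1) * (Z * Z') $$ (i, j) else 0)"
        using ij by (intro sum.cong) (auto simp: mult_last_def)
      also have "\<dots> = (if i = r then ?X else 1) * (Z * Z') $$ (i, j)" using ij by simp
      finally have "(if i = r then ?X else 1) * (Z * Z') $$ (i, j) = ?D $$ (i, j)" unfolding eq ..
      also have "\<dots> = (if i = r then ?X else 1) * 1\<^sub>m ?l $$ (i, j)" using ij by (auto simp: mult_last_def)
      finally show "(Z * Z') $$ (i, j) = 1\<^sub>m ?l $$ (i, j)" by (simp only: mult_left_cancel[OF nz[of i]])
    qed (use Z in auto)
  qed
  have "W \<in> GLs (polys_over A) ?l"
    by (rule GLsI[OF W(1,2) W'(1,2)])
       (rule inv[OF W(1) W'(1) c V'(2) W(3) W'(3)], assumption+, rule inv[OF W'(1) W(1) c(2,1) V'(3) W'(3) W(3)], assumption+)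
  then show ?thesis unfolding W(3)[OF G] by (rule eqv_right[OF PA _ mult_last_carrier])
qed

text \<open>Selecting rows and columns, with repetitions, is multiplication by matrices of zeros and ones.\<close>

lemma full_minor_multiple_of_det:
  fixes F :: "'a::comm_ring_1 mat"
  assumes A: "subring_set A" and F: "F \<in> carrier_mat n n" and m: "m \<in> kminors n n F"
  shows "\<exists>c\<in>A. m = det F * c"
proof -
  obtain f g where fg: "\<forall>i<n. f i < n \<and> g i < n" and m: "m = minor n f g F"
    using m unfolding kminors_def by auto
  define S where "S h = mat n n (\<lambda>(i, j). if j = h i then 1 else (0 :: 'a))" for h
  have S: "S h \<in> carrier_mat n n" "mat_over A (S h)" for h
    unfolding S_def using A by (auto intro!: mat_over_mat simp: subring_one subring_zero)
  have T: "transpose_mat (S g) \<in> carrier_mat n n" using S by auto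
  have "mat n n (\<lambda>(i, j). F $$ (f i, g j)) = S f * F * transpose_mat (S g)"
  proof (rule eq_matI)
    fix i j assume "i < dim_row (S f * F * transpose_mat (S g))" "j < dim_col (S f * F * transpose_mat (S g))"
    then have ij: "i < n" "j < n" using carrier_matD(1)[OF S(1)] by auto
    have SF: "(S f * F) $$ (i, q) = F $$ (f i, q)" if "q < n" for q
    proof -
      have "(S f * F) $$ (i, q) = (\<Sum>p\<in>{0..<n}. S f $$ (i, p) * F $$ (p, q))"
        by (rule mat_mult_entry[OF S(1) F ij(1) that])
      also have "\<dots> = (\<Sum>p\<in>{0..<n}. if p = f i then F $$ (f i, q) else 0)"
        using ij unfolding S_def by (intro sum.cong) auto
      finally show ?thesis using fg ij by simp
    qed
    have "(S f * F * transpose_mat (S g)) $$ (i, j) = (\<Sum>q\<in>{0..<n}. (S f * F) $$ (i, q) * transpose_mat (S g) $$ (q, j))"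
      by (rule mat_mult_entry[OF mult_carrier_mat[OF S(1) F] T ij])
    also have "\<dots> = (\<Sum>q\<in>{0..<n}. if q = g j then F $$ (f i, g j) else 0)"
      using ij SF unfolding S_def by (intro sum.cong) auto
    finally show "mat n n (\<lambda>(i, j). F $$ (f i, g j)) $$ (i, j) = (S f * F * transpose_mat (S g)) $$ (i, j)"
      using fg ij by simp
  qed (use carrier_matD(1)[OF S(1)] in auto)
  then have "m = det (S f * F * transpose_mat (S g))" unfolding m minor_def by simp
  also have "\<dots> = det (S f) * det F * det (S g)"
    using det_mult[OF mult_carrier_mat[OF S(1) F] T] det_mult[OF S(1) F] det_transpose[OF S(1)[of g]] by simp
  finally show ?thesis
    using det_in_subring[OF A S(2) S(1)] A by (intro bexI[of _ "det (S f) * det (S g)"]) (auto intro: subring_mult)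
qed

lemma minor_upper_triangular:
  fixes F :: "'a::comm_ring_1 mat"
  assumes "\<And>i j. j < i \<Longrightarrow> i < k \<Longrightarrow> F $$ (f i, g j) = 0"
  shows "minor k f g F = (\<Prod>i<k. F $$ (f i, g i))"
proof -
  let ?M = "mat k k (\<lambda>(i, j). F $$ (f i, g j))"
  have "upper_triangular ?M" using assms by auto
  then have "det ?M = prod_list (diag_mat ?M)" by (rule det_upper_triangular[of _ k]) auto
  also have "\<dots> = (\<Prod>i<k. F $$ (f i, g i))"
    unfolding diag_mat_def by (simp add: prod.list_conv_set_nth lessThan_atLeast0)
  finally show ?thesis unfolding minor_def .
qed

text \<open>The induction step for a variable \<open>x\<close> that occurs in the last invariant factor. After diagonalizing
  the residue modulo \<open>x\<close>, the last column is divisible by \<open>x\<close>. The matrix with this factor removed is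
  equivalent to its constant term by normalized matrices, and these commute with putting the factor back.
  The constant term is triangular, and its determinantal ideals allow to clear its last column.\<close>

theorem smith_step_variable:
  fixes A :: "'k::field set" and F :: "'k poly mat"
  assumes A: "subring_set A" and F: "F \<in> carrier_mat (Suc r) (Suc r)" "mat_over (polys_over A) F"
    and \<tau>: "\<And>i. i < r \<Longrightarrow> \<tau> i \<in> A \<and> \<tau> i \<noteq> 0" and \<sigma>: "\<sigma> \<in> A" "\<sigma> \<noteq> 0"
    and d: "\<And>k. k \<le> r \<Longrightarrow> det_ideal (polys_over A) (Suc r) k F [:\<Prod>i<k. \<tau> i:]"
    and dl: "det_ideal (polys_over A) (Suc r) (Suc r) F ([:0, 1:] * [:(\<Prod>i<r. \<tau> i) * \<sigma>:])"
    and H0: "eqv A (Suc r) (map_mat (\<lambda>p. coeff p 0) F) (diag_of (Suc r) (\<lambda>i. if i < r then \<tau> i else 0))"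
    and HD: "\<And>G. G \<in> carrier_mat (Suc r) (Suc r) \<Longrightarrow> mat_over (polys_over A) G \<Longrightarrow>
      (\<And>k. k \<le> Suc r \<Longrightarrow> det_ideal (polys_over A) (Suc r) k G [:\<Prod>i<k. if i < r then \<tau> i else \<sigma>:]) \<Longrightarrow>
      const_equivalent (Suc r) G A"
  shows "eqv (polys_over A) (Suc r) F (diag_of (Suc r) (\<lambda>i. if i < r then [:\<tau> i:] else [:0, 1:] * [:\<sigma>:]))"
proof -
  let ?X = "[:0, 1:] :: 'k poly" and ?l = "Suc r" and ?c0 = "map_mat (\<lambda>p :: 'k poly. coeff p 0)"
    and ?C = "map_mat (\<lambda>a :: 'k. [:a:])"
  let ?S0 = "diag_of ?l (\<lambda>i. if i < r then \<tau> i else 0)"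
  define s where "s i = (if i < r then \<tau> i else \<sigma>)" for i
  note PA = polys_over_subring[OF A]
  have XP: "?X \<in> polys_over A" using subring_zero[OF A] subring_one[OF A]
    by (auto intro!: polys_overI simp: coeff_pCons split: nat.splits)
  have constA: "(\<lambda>a. [:a:]) ` A \<subseteq> polys_over A" using polys_over_const subring_zero[OF A] by blast
  have c0A: "(\<lambda>p. coeff p 0) ` polys_over A \<subseteq> A" using polys_over_coeff by blast
  have prod_s: "(\<Prod>i<k. s i) = (\<Prod>i<k. \<tau> i)" if "k \<le> r" for k using that unfolding s_def by (intro prod.cong) auto
  have prod_sl: "(\<Prod>i<?l. s i) = (\<Prod>i<r. \<tau> i) * \<sigma>" using prod_s[of r] unfolding s_def by simp
  have sA: "s i \<in> A" "s i \<noteq> 0" if "i < ?l" for i using \<tau>[of i] \<sigma> that unfolding s_def by auto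
  obtain U0 V0 where U0: "U0 \<in> GLs A ?l" and V0: "V0 \<in> GLs A ?l" and F0: "?c0 F = U0 * ?S0 * V0"
    using H0 unfolding eqv_def by blast
  obtain U0' where U0': "U0' \<in> GLs A ?l" "U0 * U0' = 1\<^sub>m ?l" "U0' * U0 = 1\<^sub>m ?l" using GLsE[OF U0] .
  obtain V0' where V0': "V0' \<in> GLs A ?l" "V0 * V0' = 1\<^sub>m ?l" "V0' * V0 = 1\<^sub>m ?l" using GLsE[OF V0] .
  note c = GLs_carrier[OF U0] GLs_carrier[OF V0] GLs_carrier[OF U0'(1)] GLs_carrier[OF V0'(1)]
  have CGL: "?C U0' \<in> GLs (polys_over A) ?l" "?C V0' \<in> GLs (polys_over A) ?l"
    using GLs_mono[OF const.GLs_map[OF U0'(1)] constA] GLs_mono[OF const.GLs_map[OF V0'(1)] constA] .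
  \<comment> \<open>\<open>F\<close> with diagonal constant term; its last column is divisible by the variable\<close>
  define F1 where "F1 = ?C U0' * F * ?C V0'"
  have e1: "eqv (polys_over A) ?l F1 F" unfolding F1_def by (rule eqvI[OF CGL refl])
  have cF1: "F1 \<in> carrier_mat ?l ?l" "mat_over (polys_over A) F1"
    using eqv_carrier[OF e1] eqv_over[OF PA e1 F] .
  have c0C: "?c0 (?C M) = M" for M by (intro eq_matI) auto
  have c0F1: "?c0 F1 = ?S0"
  proof -
    have "?c0 F1 = U0' * ?c0 F * V0'"
      unfolding F1_def using coeff0.mat_hom_mult[OF mult_carrier_mat[OF GLs_carrier[OF CGL(1)] F(1)] GLs_carrier[OF CGL(2)]]
        coeff0.mat_hom_mult[OF GLs_carrier[OF CGL(1)] F(1)] by (simp add: c0C)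
    also have "\<dots> = ?S0" unfolding F0
      by (rule mult_cancel_inverses[OF c(1,2,3,4) diag_of_carrier U0'(3) V0'(2)])
    finally show ?thesis .
  qed
  have F1_0: "coeff (F1 $$ (i, j)) 0 = (if i = j \<and> i < r then \<tau> i else 0)" if "i < ?l" "j < ?l" for i j
  proof -
    have "?c0 F1 $$ (i, j) = coeff (F1 $$ (i, j)) 0" using cF1 that by simp
    then have "coeff (F1 $$ (i, j)) 0 = (if i = j then if i < r then \<tau> i else 0 else 0)"
      unfolding c0F1 diag_of_def using that by simp
    then show ?thesis by (cases "i = j"; cases "i < r") simp_all
  qed
  define G where "G = mat ?l ?l (\<lambda>(i, j). if j = r then SOME q. q \<in> polys_over A \<and> F1 $$ (i, j) = ?X * q else F1 $$ (i, j))"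
  have Gr: "G $$ (i, r) \<in> polys_over A \<and> F1 $$ (i, r) = ?X * G $$ (i, r)" if i: "i < ?l" for i
  proof -
    have "coeff (F1 $$ (i, r)) 0 = 0" using F1_0[OF i, of r] by (cases "i = r") auto
    then have "\<exists>q. q \<in> polys_over A \<and> F1 $$ (i, r) = ?X * q"
      using divide_by_var[OF mat_overD[OF cF1(2,1) i, of r]] by blast
    from someI_ex[OF this] show ?thesis unfolding G_def using i by simp
  qed
  have cG: "G \<in> carrier_mat ?l ?l" unfolding G_def by auto
  have Gj: "G $$ (i, j) = F1 $$ (i, j)" if "i < ?l" "j < ?l" "j \<noteq> r" for i j using that unfolding G_def by simp
  have oG: "mat_over (polys_over A) G" unfolding mat_over_def using cG Gr Gj mat_overD[OF cF1(2,1)] by (metis carrier_matD)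
  have F1G: "F1 = mult_last r ?X G"
    using cF1(1) Gr Gj unfolding mult_last_def by (intro eq_matI) (auto simp del: mult_pCons_left)
  have dG: "det_ideal (polys_over A) ?l k G [:\<Prod>i<k. s i:]" if k: "k \<le> ?l" for k
  proof (rule det_ideal_divide_last[OF A cG oG _ _ k])
    show "(\<Prod>i<k. s i) \<in> A" using sA k by (intro subring_prod[OF A]) auto
    show "(\<Prod>i<k. s i) \<noteq> 0" using sA k by auto
    have "det_ideal (polys_over A) ?l k F (if k = ?l then ?X * [:\<Prod>i<k. s i:] else [:\<Prod>i<k. s i:])"
    proof (cases "k = ?l")
      case True
      then show ?thesis using dl prod_sl by simp
    next
      case False
      then show ?thesis using d[of k] prod_s[of k] k by simp
    qed
    then show "det_ideal (polys_over A) ?l k (mult_last r ?X G) (if k = ?l then ?X * [:\<Prod>i<k. s i:] else [:\<Prod>i<k. s i:])"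
      unfolding F1G[symmetric] by (rule det_ideal_eqv[OF PA F(1) e1])
  qed
  have "const_equivalent ?l G A" using HD[OF cG oG] dG unfolding s_def by blast
  then obtain U V where U: "U \<in> GLs (polys_over A) ?l" and V: "V \<in> GLs (polys_over A) ?l"
    and V0e: "map_mat (scale 0) V = 1\<^sub>m ?l" and GUV: "G = U * map_mat (scale 0) G * V"
    unfolding const_equivalent_def by blast
  define G0 where "G0 = map_mat (scale 0) G"
  have cG0: "G0 \<in> carrier_mat ?l ?l" unfolding G0_def using cG by auto
  have "F1 = U * mult_last r ?X (G0 * V)"
  proof -
    have "G = U * (G0 * V)" using GUV assoc_mult_mat[OF GLs_carrier[OF U] cG0 GLs_carrier[OF V]] unfolding G0_def by simp
    then show ?thesis unfolding F1G using mult_last_mult_right[OF GLs_carrier[OF U] mult_carrier_mat[OF cG0 GLs_carrier[OF V]]] by simp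
  qed
  then have e2: "eqv (polys_over A) ?l F1 (mult_last r ?X (G0 * V))"
    using eqv_left[OF PA U mult_last_carrier] by simp
  have e3: "eqv (polys_over A) ?l (mult_last r ?X (G0 * V)) (mult_last r ?X G0)"
    by (rule mult_last_absorb[OF A cG0 V V0e])
  \<comment> \<open>The constant term is diagonal except for its last column. Its minors show that the \<open>i\<close>-th entry of this
    column is a multiple \<open>q i\<close> of the \<open>i\<close>-th invariant factor. So \<open>diag s\<close> can be split off on the left, and the
    remaining factor \<open>W\<close> is triangular with the unit \<open>q r\<close> in the corner.\<close>
  define Gc where "Gc = ?c0 G"
  have cGc: "Gc \<in> carrier_mat ?l ?l" unfolding Gc_def using cG by auto
  have Gc_entry: "Gc $$ (i, j) = (if i = j then \<tau> i else 0)" if "i < ?l" "j < r" for i j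
    using F1_0[of i j] Gj[of i j] that cG unfolding Gc_def by auto
  have dGc: "det_ideal A ?l k Gc (\<Prod>i<k. s i)" if "k \<le> ?l" for k
    using det_ideal_mono[OF coeff0.det_ideal_map[OF cG dG[OF that]] c0A] unfolding Gc_def by simp
  define g where "g i = Gc $$ (i, r)" for i
  have gdiv: "\<exists>q\<in>A. g i = s i * q" if i: "i < ?l" for i
  proof -
    define h where "h j = (if j < i then j else r)" for j
    have "minor (Suc i) id h Gc = (\<Prod>j<Suc i. Gc $$ (id j, h j))"
      using i by (intro minor_upper_triangular) (auto simp: h_def Gc_entry)
    also have "\<dots> = (\<Prod>j<i. s j) * g i"
      using i unfolding h_def g_def by (simp, intro disjI2 prod.cong) (auto simp: Gc_entry s_def)
    finally have m: "minor (Suc i) id h Gc = (\<Prod>j<i. s j) * g i" .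
    have "minor (Suc i) id h Gc \<in> kminors ?l (Suc i) Gc" using i by (intro kminorsI) (auto simp: h_def)
    then obtain q where q: "q \<in> A" "(\<Prod>j<i. s j) * g i = (\<Prod>j<Suc i. s j) * q"
      using dGc[of "Suc i"] i unfolding det_ideal_def m[symmetric] by auto
    moreover have "(\<Prod>j<i. s j) \<noteq> 0" using sA i by auto
    ultimately show ?thesis by (intro bexI[of _ q]) (auto simp: mult.assoc)
  qed
  define q where "q i = (SOME q. q \<in> A \<and> g i = s i * q)" for i
  have q: "q i \<in> A" "g i = s i * q i" if i: "i < ?l" for i
  proof -
    have "\<exists>q. q \<in> A \<and> g i = s i * q" using gdiv[OF i] by blast
    from someI_ex[OF this] show "q i \<in> A" "g i = s i * q i" unfolding q_def by auto
  qed
  have detGc: "det Gc = (\<Prod>i<?l. s i) * q r"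
  proof -
    have "det Gc = minor ?l id id Gc" unfolding minor_def
      using cGc by (intro arg_cong[of _ _ det] eq_matI) auto
    also have "\<dots> = (\<Prod>j<?l. Gc $$ (id j, id j))"
      by (intro minor_upper_triangular) (auto simp: Gc_entry)
    also have "\<dots> = (\<Prod>j<r. \<tau> j) * g r" unfolding g_def by (simp, intro disjI2 prod.cong) (auto simp: Gc_entry)
    finally show ?thesis using prod_sl q(2)[of r] by (simp add: s_def ac_simps)
  qed
  have "\<exists>u\<in>A. q r * u = 1"
  proof -
    have "(\<Prod>i<?l. s i) \<in> lin A (kminors ?l ?l Gc)" using dGc[of ?l] unfolding det_ideal_def by simp
    then obtain u where u: "u \<in> A" "(\<Prod>i<?l. s i) = det Gc * u"
      using lin_multiple[OF A] full_minor_multiple_of_det[OF A cGc] by blast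
    moreover have "(\<Prod>i<?l. s i) \<noteq> 0" using sA by auto
    ultimately have "q r * u = 1" unfolding detGc by (metis mult.assoc mult_cancel_left2 mult.right_neutral)
    then show ?thesis using u by blast
  qed
  then obtain u where u: "u \<in> A" "q r * u = 1" by blast
  define W where "W = mat ?l ?l (\<lambda>(i, j). if j = r then (if i = r then [:q r:] else ?X * [:q i:]) else if i = j then 1 else 0)"
  have cW: "W \<in> carrier_mat ?l ?l" unfolding W_def by auto
  have XqP: "?X * [:q i:] \<in> polys_over A" "[:q i:] \<in> polys_over A" if "i < ?l" for i
  proof -
    show 1: "[:q i:] \<in> polys_over A" using q(1)[OF that] constA by blast
    show "?X * [:q i:] \<in> polys_over A" by (rule subring_mult[OF PA XP 1])
  qed
  have oW: "mat_over (polys_over A) W" unfolding W_def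
    using XqP PA by (auto intro!: mat_over_mat simp: subring_one subring_zero simp del: mult_pCons_left)
  have "det W = minor ?l id id W" unfolding minor_def
    using cW by (intro arg_cong[of _ _ det] eq_matI) auto
  also have "\<dots> = (\<Prod>j<?l. W $$ (id j, id j))"
    by (intro minor_upper_triangular) (auto simp: W_def)
  also have "\<dots> = (\<Prod>j<r. W $$ (j, j)) * W $$ (r, r)" by simp
  also have "(\<Prod>j<r. W $$ (j, j)) = 1" by (intro prod.neutral) (auto simp: W_def)
  also have "1 * W $$ (r, r) = [:q r:]" by (simp add: W_def)
  finally have detW: "det W = [:q r:]" .
  have "det W * [:u:] = [:q r * u:]" unfolding detW by simp
  also have "\<dots> = 1" unfolding u(2) by (rule one_pCons[symmetric])
  finally have "det W * [:u:] = 1" .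
  moreover have "[:u:] \<in> polys_over A" using u(1) constA by blast
  ultimately have WGL: "W \<in> GLs (polys_over A) ?l"
    using GLs_iff_det[OF PA cW oW] by blast
  let ?S = "diag_of ?l (\<lambda>i. if i < r then [:\<tau> i:] else ?X * [:\<sigma>:])"
  have "mult_last r ?X G0 = ?S * W"
  proof (rule eq_matI)
    fix i j assume "i < dim_row (?S * W)" "j < dim_col (?S * W)"
    then have ij: "i < ?l" "j < ?l" using cW by auto
    have "(?S * W) $$ (i, j) = (\<Sum>p\<in>{0..<?l}. ?S $$ (i, p) * W $$ (p, j))"
      by (rule mat_mult_entry[OF diag_of_carrier cW ij])
    also have "\<dots> = (\<Sum>p\<in>{0..<?l}. if p = i then (if i < r then [:\<tau> i:] else ?X * [:\<sigma>:]) * W $$ (i, j) else 0)"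
      using ij unfolding diag_of_def by (intro sum.cong) auto
    also have "\<dots> = (if i < r then [:\<tau> i:] else ?X * [:\<sigma>:]) * W $$ (i, j)" using ij by simp
    finally have R: "(?S * W) $$ (i, j) = (if i < r then [:\<tau> i:] else ?X * [:\<sigma>:]) * W $$ (i, j)" .
    have G0e: "G0 $$ (i, j) = [:Gc $$ (i, j):]" unfolding G0_def Gc_def
      using ij cG by (auto intro!: poly_eqI simp: coeff_scale coeff_pCons power_0_left split: nat.splits)
    have g: "Gc $$ (i, r) = s i * q i" using q(2)[OF ij(1)] unfolding g_def .
    show "mult_last r ?X G0 $$ (i, j) = (?S * W) $$ (i, j)"
    proof (cases "j = r")
      case True
      then show ?thesis unfolding R using ij g G0e unfolding mult_last_def W_def s_def by auto
    next
      case False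
      then have "j < r" using ij by simp
      then show ?thesis unfolding R using ij G0e Gc_entry[OF ij(1), of j] unfolding mult_last_def W_def by auto
    qed
  qed (use cW in \<open>auto simp: mult_last_def\<close>)
  then have e4: "eqv (polys_over A) ?l (mult_last r ?X G0) ?S"
    using eqv_right[OF PA WGL diag_of_carrier] by simp
  have "eqv (polys_over A) ?l F1 ?S"
    by (rule eqv_trans[OF PA e2 eqv_trans[OF PA e3 e4 diag_of_carrier] diag_of_carrier])
  then show ?thesis by (rule eqv_trans[OF PA eqv_sym[OF e1 F(1)] _ diag_of_carrier])
qed

section \<open>Polynomial rings in some of the variables\<close>

lemma polys_in_subring: "subring_set (polys_in I :: ('n::{finite,linorder}, 'a::field) mpoly set)"
proof -
  have "p - q \<in> polys_in I" if "p \<in> polys_in I" "q \<in> polys_in I" for p q :: "('n, 'a) mpoly"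
    using that keys_diff[of p q] unfolding polys_in_def by blast
  moreover have "p * q \<in> polys_in I" if pq: "p \<in> polys_in I" "q \<in> polys_in I" for p q :: "('n, 'a) mpoly"
    unfolding polys_in_def
  proof (intro CollectI ballI)
    fix m assume "m \<in> Poly_Mapping.keys (p * q)"
    then obtain a b where "a \<in> Poly_Mapping.keys p" "b \<in> Poly_Mapping.keys q" "m = a + b"
      using keys_mult[of p q] by blast
    then show "Poly_Mapping.keys m \<subseteq> I" using pq keys_add[of a b] unfolding polys_in_def by blast
  qed
  moreover have "(1 :: ('n, 'a) mpoly) \<in> polys_in I" unfolding polys_in_def by simp
  ultimately show ?thesis unfolding subring_set_def by blast
qed

lemma polys_in_mono: "I \<subseteq> J \<Longrightarrow> polys_in I \<subseteq> polys_in J"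
  unfolding polys_in_def by blast

lemma polys_in_UNIV: "polys_in UNIV = UNIV"
  unfolding polys_in_def by blast

lemma Var_in: "x \<in> I \<Longrightarrow> Var x \<in> polys_in I"
  unfolding polys_in_def Var_def by simp

lemma Var_power: "(Var x :: ('n, 'a::field) mpoly) ^ k = Poly_Mapping.single (Poly_Mapping.single x k) 1"
proof (induction k)
  case (Suc k)
  then show ?case unfolding Var_def by (simp add: mult_single single_add[symmetric])
qed (simp add: single_one)

lemma mpoly_sum_monomials:
  fixes p :: "('n, 'a::field) mpoly"
  shows "p = (\<Sum>m\<in>Poly_Mapping.keys p. Poly_Mapping.single m (Poly_Mapping.lookup p m))"
  by (rule poly_mapping_eqI)
     (auto simp: lookup_sum lookup_single when_def in_keys_iff)

lemma lookup_mult_monomial: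
  fixes p :: "('n, 'a::field) mpoly"
  shows "Poly_Mapping.lookup (p * Poly_Mapping.single t 1) u = (\<Sum>m\<in>Poly_Mapping.keys p. Poly_Mapping.lookup p m when m + t = u)"
proof -
  have "p * Poly_Mapping.single t 1 = (\<Sum>m\<in>Poly_Mapping.keys p. Poly_Mapping.single m (Poly_Mapping.lookup p m)) * Poly_Mapping.single t 1"
    using mpoly_sum_monomials[of p] by simp
  also have "\<dots> = (\<Sum>m\<in>Poly_Mapping.keys p. Poly_Mapping.single (m + t) (Poly_Mapping.lookup p m))"
    by (simp add: sum_distrib_right mult_single)
  finally show ?thesis by (simp add: lookup_sum lookup_single)
qed

text \<open>A polynomial in the variables \<open>insert x J\<close> is a polynomial in \<open>x\<close> with coefficients in the
  variables \<open>J\<close>, in a unique way.\<close>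

lemma poly_in_Var_exists:
  fixes p :: "('n::{finite,linorder}, 'a::field) mpoly"
  assumes "p \<in> polys_in (insert x J)"
  shows "\<exists>q\<in>polys_over (polys_in J). poly q (Var x) = p"
proof -
  let ?E = "{poly q (Var x :: ('n, 'a) mpoly) | q. q \<in> polys_over (polys_in J)}"
  note sub = polys_in_subring[of J, where ?'a = 'a]
  note PS = polys_over_subring[OF sub]
  have add: "a + b \<in> ?E" if "a \<in> ?E" "b \<in> ?E" for a b
    using that subring_add[OF PS] by clarsimp (metis poly_add)
  have zero: "0 \<in> ?E" using subring_zero[OF PS] by force
  have mono: "Poly_Mapping.single m c \<in> ?E" if m: "Poly_Mapping.keys m \<subseteq> insert x J" for m and c :: 'a
  proof -
    define k where "k = Poly_Mapping.lookup m x"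
    define m' where "m' = m - Poly_Mapping.single x k"
    have "m = m' + Poly_Mapping.single x k"
      unfolding m'_def k_def
      by (rule poly_mapping_eqI) (auto simp: lookup_add lookup_minus lookup_single when_def)
    then have "Poly_Mapping.single m c = Poly_Mapping.single m' c * Var x ^ k"
      unfolding Var_power mult_single by simp
    also have "\<dots> = poly (monom (Poly_Mapping.single m' c) k) (Var x)" by (simp add: poly_monom)
    finally have e: "Poly_Mapping.single m c = poly (monom (Poly_Mapping.single m' c) k) (Var x)" .
    have "Poly_Mapping.keys m' \<subseteq> J"
    proof
      fix y assume "y \<in> Poly_Mapping.keys m'"
      then have "Poly_Mapping.lookup m' y \<noteq> 0" by (simp add: in_keys_iff)
      then have "y \<noteq> x" "Poly_Mapping.lookup m y \<noteq> 0" unfolding m'_def k_def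
        by (auto simp: lookup_minus lookup_single when_def split: if_splits)
      then have "y \<in> Poly_Mapping.keys m" by (simp only: in_keys_iff not_False_eq_True)
      then show "y \<in> J" using m \<open>y \<noteq> x\<close> by blast
    qed
    then have "Poly_Mapping.single m' c \<in> polys_in J" unfolding polys_in_def by simp
    then have "monom (Poly_Mapping.single m' c) k \<in> polys_over (polys_in J)"
      by (intro polys_over_monom subring_zero[OF sub])
    then show ?thesis unfolding e by blast
  qed
  have "(\<Sum>m\<in>M. Poly_Mapping.single m (Poly_Mapping.lookup p m)) \<in> ?E" if "finite M" "M \<subseteq> Poly_Mapping.keys p" for M
    using that
  proof (induction M rule: finite_induct)
    case (insert m M)
    then have "Poly_Mapping.keys m \<subseteq> insert x J" using assms unfolding polys_in_def by blast
    then have "Poly_Mapping.single m (Poly_Mapping.lookup p m) + (\<Sum>m\<in>M. Poly_Mapping.single m (Poly_Mapping.lookup p m)) \<in> ?E"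
      using insert by (intro add mono) auto
    then show ?case using insert by simp
  qed (simp only: sum.empty zero)
  from this[of "Poly_Mapping.keys p"] have "p \<in> ?E" using mpoly_sum_monomials[of p] by simp
  then show ?thesis by blast
qed

lemma poly_in_Var_unique:
  fixes q :: "('n::{finite,linorder}, 'a::field) mpoly poly"
  assumes q: "q \<in> polys_over (polys_in J)" and x: "x \<notin> J" and zero: "poly q (Var x) = 0"
  shows "q = 0"
proof (rule ccontr)
  assume "q \<noteq> 0"
  define k0 where "k0 = degree q"
  have c0: "coeff q k0 \<noteq> 0" unfolding k0_def using \<open>q \<noteq> 0\<close> by simp
  then obtain m where m: "m \<in> Poly_Mapping.keys (coeff q k0)" by (metis ex_in_conv keys_eq_empty)
  define u where "u = m + Poly_Mapping.single x k0"
  have no_x: "Poly_Mapping.lookup m' x = 0" if "m' \<in> Poly_Mapping.keys (coeff q k)" for m' k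
  proof -
    have "Poly_Mapping.keys m' \<subseteq> J" using polys_over_coeff[OF q, of k] that unfolding polys_in_def by blast
    then have "x \<notin> Poly_Mapping.keys m'" using x by blast
    then show ?thesis by (simp only: in_keys_iff not_not)
  qed
  have term_zero: "Poly_Mapping.lookup (coeff q k * Var x ^ k) u = (if k = k0 then Poly_Mapping.lookup (coeff q k0) m else 0)" for k
  proof (cases "k = k0")
    case True
    have "Poly_Mapping.lookup (coeff q k * Var x ^ k) u = (\<Sum>m'\<in>Poly_Mapping.keys (coeff q k0). Poly_Mapping.lookup (coeff q k0) m' when m' = m)"
      unfolding Var_power lookup_mult_monomial u_def True by simp
    also have "\<dots> = Poly_Mapping.lookup (coeff q k0) m" using m by (simp add: when_def)
    finally show ?thesis using True by simp
  next
    case False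
    have "m' + Poly_Mapping.single x k \<noteq> u" if m': "m' \<in> Poly_Mapping.keys (coeff q k)" for m'
    proof
      assume "m' + Poly_Mapping.single x k = u"
      then have "Poly_Mapping.lookup (m' + Poly_Mapping.single x k) x = Poly_Mapping.lookup u x" by simp
      then show False using no_x[OF m'] no_x[OF m] False unfolding u_def by (simp add: lookup_add)
    qed
    then show ?thesis using False unfolding Var_power lookup_mult_monomial by simp
  qed
  have "0 = Poly_Mapping.lookup (poly q (Var x)) u" unfolding zero by simp
  also have "\<dots> = (\<Sum>k\<le>degree q. Poly_Mapping.lookup (coeff q k * Var x ^ k) u)" unfolding poly_altdef lookup_sum ..
  also have "\<dots> = Poly_Mapping.lookup (coeff q k0) m" unfolding term_zero by (simp add: k0_def)
  finally show False using m by (simp add: in_keys_iff)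
qed

subsection \<open>Inverting the polynomials in some variables\<close>

definition Pin :: "'n::{finite,linorder} set \<Rightarrow> ('n, 'a::field) mpoly fract set" where
  "Pin J = to_fract ` polys_in J"

definition zvar :: "'n::{finite,linorder} \<Rightarrow> ('n, 'a::field) mpoly fract" where
  "zvar x = to_fract (Var x)"

text \<open>\<open>K(z_i : i \<in> I)[z_j : j \<in> J]\<close>\<close>

definition ratpoly :: "'n::{finite,linorder} set \<Rightarrow> 'n set \<Rightarrow> ('n, 'a::field) mpoly fract set" where
  "ratpoly I J = loc (Pin (I \<union> J)) (Pin I - {0})"

lemma Pin_subring: "subring_set (Pin J)"
  unfolding Pin_def by (rule to_fract_hom.subring_image[OF polys_in_subring])

lemma Pin_mono: "I \<subseteq> J \<Longrightarrow> Pin I \<subseteq> Pin J"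
  unfolding Pin_def using polys_in_mono by blast

lemma zvar_in: "x \<in> J \<Longrightarrow> zvar x \<in> Pin J"
  unfolding Pin_def zvar_def by (intro imageI Var_in)

lemma Pin_mult_set: "mult_set (Pin (I \<union> J)) (Pin I - {0})"
proof -
  have "Pin I \<subseteq> Pin (I \<union> J)" by (rule Pin_mono) simp
  then show ?thesis unfolding mult_set_def
    using subring_one[OF Pin_subring] subring_mult[OF Pin_subring] by simp blast
qed

lemma ratpoly_subring: "subring_set (ratpoly I J)"
  unfolding ratpoly_def by (rule loc_subring[OF Pin_subring Pin_mult_set])

lemma Pin_ratpoly: "Pin (I \<union> J) \<subseteq> ratpoly I J"
  unfolding ratpoly_def using Pin_mult_set unfolding mult_set_def by (intro loc_incl) blast

lemma loc_mono: "A \<subseteq> B \<Longrightarrow> S \<subseteq> T \<Longrightarrow> loc A S \<subseteq> loc B T"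
  unfolding loc_def by blast

lemma ratpoly_mono: "I \<subseteq> I' \<Longrightarrow> I \<union> J \<subseteq> I' \<union> J' \<Longrightarrow> ratpoly I J \<subseteq> ratpoly I' J'"
  unfolding ratpoly_def using Pin_mono[of I I'] Pin_mono[of "I \<union> J" "I' \<union> J'"] by (intro loc_mono) auto

lemma ratpoly_inverse: "p \<in> Pin I \<Longrightarrow> p \<noteq> 0 \<Longrightarrow> inverse p \<in> ratpoly I J"
  unfolding ratpoly_def inverse_eq_divide by (intro locI subring_one[OF Pin_subring]) blast

lemma ratpoly_empty:
  "ratpoly {} UNIV = (range to_fract :: ('n::{finite,linorder}, 'a::field) mpoly fract set)"
proof -
  have "a / c \<in> range to_fract" if "c \<in> Pin {}" "c \<noteq> 0" "a \<in> range to_fract" for a c :: "('n, 'a) mpoly fract"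
  proof -
    obtain c' where c': "c = to_fract c'" "c' \<in> polys_in {}" using \<open>c \<in> Pin {}\<close> unfolding Pin_def by blast
    obtain a' where a': "a = to_fract a'" using \<open>a \<in> range to_fract\<close> by blast
    have k: "Poly_Mapping.keys c' \<subseteq> {0}" using c'(2) unfolding polys_in_def by auto
    define u where "u = Poly_Mapping.lookup c' 0"
    have "c' = Poly_Mapping.single 0 u"
      unfolding u_def using k by (intro poly_mapping_eqI) (auto simp: lookup_single when_def in_keys_iff)
    moreover from this have "u \<noteq> 0" using \<open>c \<noteq> 0\<close> c'(1) by auto
    ultimately have "c' * Poly_Mapping.single 0 (inverse u) = 1" by (simp add: mult_single)
    then have "c * to_fract (Poly_Mapping.single 0 (inverse u)) = 1" unfolding c'(1) to_fract_mult[symmetric] by simp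
    then have "a / c = to_fract (a' * Poly_Mapping.single 0 (inverse u))"
      unfolding a' using \<open>c \<noteq> 0\<close> by (simp add: field_simps)
    then show ?thesis by blast
  qed
  moreover have "range to_fract \<subseteq> ratpoly {} UNIV"
    using Pin_ratpoly[of "{}" UNIV] unfolding Pin_def by (simp add: polys_in_UNIV)
  ultimately show ?thesis unfolding ratpoly_def loc_def Pin_def[of "{} \<union> UNIV"] by (auto simp: polys_in_UNIV)
qed

lemma poly_map_to_fract: "poly (map_poly to_fract q) (to_fract v) = to_fract (poly q v)"
  by (induction q) (auto simp: map_poly_pCons)

lemma lift_map_poly:
  assumes "q \<in> polys_over (h ` X)" "0 \<in> X" "h 0 = 0"
  shows "\<exists>q'\<in>polys_over X. map_poly h q' = q"
  using assms(1)
proof (induction q)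
  case 0
  show ?case using assms(2) by (intro bexI[of _ 0]) (auto intro: polys_overI)
next
  case (pCons a q)
  have "coeff q i \<in> h ` X" for i using polys_over_coeff[OF pCons.prems, of "Suc i"] by simp
  then have "q \<in> polys_over (h ` X)" by (rule polys_overI)
  then obtain q' where q': "q' \<in> polys_over X" "map_poly h q' = q" using pCons.IH by blast
  obtain a' where "a' \<in> X" "a = h a'" using polys_over_coeff[OF pCons.prems, of 0] by auto
  then show ?case using q'
    by (intro bexI[of _ "pCons a' q'"]) (auto intro!: polys_overI simp: coeff_pCons polys_over_coeff map_poly_pCons[of h, OF assms(3)] split: nat.splits)
qed

lemma Pin_insert_exists:
  assumes "p \<in> Pin (insert x J)" shows "\<exists>q\<in>polys_over (Pin J). poly q (zvar x) = p"
proof -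
  obtain p' where p': "p = to_fract p'" "p' \<in> polys_in (insert x J)" using assms unfolding Pin_def by blast
  obtain q where q: "q \<in> polys_over (polys_in J)" "poly q (Var x) = p'" using poly_in_Var_exists[OF p'(2)] by blast
  have "map_poly to_fract q \<in> polys_over (Pin J)"
    using q(1) unfolding Pin_def by (intro polys_overI) (auto simp: coeff_map_poly polys_over_coeff)
  then show ?thesis using poly_map_to_fract[of q "Var x"] q(2) p'(1) unfolding zvar_def by auto
qed

lemma Pin_unique:
  assumes "q \<in> polys_over (Pin J)" "x \<notin> J" "poly q (zvar x) = 0" shows "q = 0"
proof -
  obtain q' where q': "q' \<in> polys_over (polys_in J)" "map_poly to_fract q' = q"
    using lift_map_poly[OF assms(1)[unfolded Pin_def]] subring_zero[OF polys_in_subring] by auto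
  have "to_fract (poly q' (Var x)) = 0"
    using assms(3) unfolding q'(2)[symmetric] zvar_def poly_map_to_fract .
  then have "poly q' (Var x) = 0" by simp
  then have "q' = 0" by (rule poly_in_Var_unique[OF q'(1) assms(2)])
  then show ?thesis using q'(2) by simp
qed

subsection \<open>Adjoining one variable\<close>

lemma poly_in_subring:
  "subring_set B \<Longrightarrow> p \<in> polys_over B \<Longrightarrow> y \<in> B \<Longrightarrow> poly p y \<in> B"
  unfolding poly_altdef by (intro subring_sum subring_mult subring_power) (auto simp: polys_over_coeff)

lemma pcompose_over:
  assumes "subring_set B" "p \<in> polys_over B" "q \<in> polys_over B" shows "pcompose p q \<in> polys_over B"
  using assms(2)
proof (induction p)
  case 0
  show ?case using subring_zero[OF polys_over_subring[OF assms(1)]] by simp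
next
  case (pCons a p)
  have "coeff p i \<in> B" for i using polys_over_coeff[OF pCons.prems, of "Suc i"] by simp
  then have "pcompose p q \<in> polys_over B" using pCons.IH by (auto intro: polys_overI)
  moreover have "[:a:] \<in> polys_over B"
    using polys_over_coeff[OF pCons.prems, of 0] subring_zero[OF assms(1)] by (intro polys_over_const) auto
  ultimately show ?case unfolding pcompose_pCons
    using polys_over_subring[OF assms(1)] assms(3) by (intro subring_add subring_mult)
qed

text \<open>The ring \<open>ratpoly I (insert x J)\<close> is a polynomial ring over \<open>ratpoly I J\<close>, not only in the variable
  \<open>x\<close> but in every \<open>x - f\<close> with \<open>f\<close> in the coefficient ring. So the induction can use \<open>x - f\<close> as
  its variable.\<close>

locale adjoin =
  fixes I J :: "'n::{finite,linorder} set" and x :: 'n and f :: "('n, 'a::field) mpoly fract"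
  assumes x: "x \<notin> I \<union> J" and f: "f \<in> ratpoly I J"
begin

abbreviation A :: "('n, 'a) mpoly fract set" where "A \<equiv> ratpoly I J"
definition y where "y = zvar x - f"

lemma A: "subring_set A" by (rule ratpoly_subring)
lemma PA: "subring_set (polys_over A)" by (rule polys_over_subring[OF A])

lemma A_sub: "A \<subseteq> ratpoly I (insert x J)" "A \<subseteq> ratpoly (insert x I) J"
  by (rule ratpoly_mono; auto)+

lemma shift_over: "p \<in> polys_over A \<Longrightarrow> c \<in> A \<Longrightarrow> pcompose p [:c, 1:] \<in> polys_over A"
  using subring_one[OF A] subring_zero[OF A]
  by (intro pcompose_over[OF A]) (auto intro!: polys_overI simp: coeff_pCons split: nat.splits)

lemma poly_y_in: "p \<in> polys_over A \<Longrightarrow> poly p y \<in> ratpoly I (insert x J)"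
proof (rule poly_in_subring[OF ratpoly_subring])
  show "p \<in> polys_over A \<Longrightarrow> p \<in> polys_over (ratpoly I (insert x J))" using polys_over_mono[OF A_sub(1)] by blast
  have "zvar x \<in> ratpoly I (insert x J)" by (rule subsetD[OF Pin_ratpoly zvar_in]) simp
  then show "y \<in> ratpoly I (insert x J)" unfolding y_def
    using A_sub(1) f ratpoly_subring by (auto intro: subring_minus)
qed

lemma Pin_as_poly:
  assumes "(p :: ('n, 'a) mpoly fract) \<in> Pin (insert x I \<union> J)"
  shows "\<exists>q\<in>polys_over (Pin (I \<union> J)). poly q (zvar x) = p"
  using Pin_insert_exists[of p x "I \<union> J"] assms by simp

lemma shift_y: "poly (pcompose q [:f, 1:]) y = poly q (zvar x)"
  unfolding y_def by (simp add: poly_pcompose)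

lemma surj_y:
  assumes "p \<in> ratpoly I (insert x J)" shows "\<exists>q\<in>polys_over A. poly q y = p"
proof -
  obtain a t where p: "p = a / t" "a \<in> Pin (I \<union> insert x J)" "t \<in> Pin I - {0}"
    using assms unfolding ratpoly_def loc_def by blast
  obtain q where q: "q \<in> polys_over (Pin (I \<union> J))" "poly q (zvar x) = a" using Pin_as_poly p(2) by auto
  define q' where "q' = Polynomial.smult (inverse t) q"
  have "q' \<in> polys_over A" unfolding q'_def
    using q(1) Pin_ratpoly p(3) ratpoly_inverse[of t I J]
    by (intro polys_over_smult[OF A]) (auto dest: polys_over_mono[THEN subsetD])
  moreover have "poly q' (zvar x) = p" unfolding q'_def p(1) using q(2) by (simp add: divide_inverse mult.commute)
  ultimately show ?thesis using shift_over[OF _ f] shift_y by metis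
qed

lemma inj_y:
  assumes q: "q \<in> polys_over A" "poly q y = 0" shows "q = 0"
proof -
  define p where "p = pcompose q [:- f, 1:]"
  have p: "p \<in> polys_over A" unfolding p_def using shift_over[OF q(1)] subring_uminus[OF A f] by blast
  have "finite (coeff p ` {..degree p})" "coeff p ` {..degree p} \<subseteq> loc (Pin (I \<union> J)) (Pin I - {0})"
    using polys_over_coeff[OF p] unfolding ratpoly_def by auto
  then obtain t where t: "t \<in> Pin I - {0}" "\<forall>a\<in>coeff p ` {..degree p}. t * a \<in> Pin (I \<union> J)"
    using common_denominator[OF Pin_subring Pin_mult_set] by blast
  have "coeff (Polynomial.smult t p) i \<in> Pin (I \<union> J)" for i
    using t(2) subring_zero[OF Pin_subring] by (cases "i \<le> degree p") (auto simp: coeff_eq_0)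
  moreover have "poly (Polynomial.smult t p) (zvar x) = 0"
    using q(2) unfolding p_def y_def by (simp add: poly_pcompose)
  ultimately have "Polynomial.smult t p = 0" by (intro Pin_unique[OF polys_overI x])
  then have "p = 0" using t(1) by simp
  have "pcompose 1 [:f, 1:] = 1" using pcompose_const[of 1 "[:f, 1:]"] unfolding one_pCons .
  then have X: "pcompose [:- f, 1:] [:f, 1:] = [:0, 1:]" by (simp add: pcompose_pCons)
  have "q = pcompose q (pcompose [:- f, 1:] [:f, 1:])" unfolding X by (rule pcompose_idR[symmetric])
  also have "\<dots> = pcompose p [:f, 1:]" unfolding p_def by (rule pcompose_assoc)
  also have "\<dots> = 0" using \<open>p = 0\<close> by simp
  finally show ?thesis .
qed

interpretation ev: comm_ring_hom "\<lambda>p. poly p y"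
  by unfold_locales auto

definition unit_leads where
  "unit_leads = {q \<in> polys_over A. lead_coeff q \<noteq> 0 \<and> inverse (lead_coeff q) \<in> A}"

lemma unit_leads_mult: "p \<in> unit_leads \<Longrightarrow> q \<in> unit_leads \<Longrightarrow> p * q \<in> unit_leads"
  unfolding unit_leads_def using PA A by (auto intro: subring_mult simp: lead_coeff_mult)

lemma unit_leads_mult_set: "mult_set ((\<lambda>p. poly p y) ` polys_over A) ((\<lambda>p. poly p y) ` unit_leads)"
  unfolding mult_set_def
proof (intro conjI ballI)
  show "(\<lambda>p. poly p y) ` unit_leads \<subseteq> (\<lambda>p. poly p y) ` polys_over A" unfolding unit_leads_def by blast
  have "1 \<in> unit_leads" unfolding unit_leads_def using subring_one[OF PA] subring_one[OF A] by simp
  then show "1 \<in> (\<lambda>p. poly p y) ` unit_leads" by force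
  show "0 \<notin> (\<lambda>p. poly p y) ` unit_leads"
  proof
    assume "0 \<in> (\<lambda>p. poly p y) ` unit_leads"
    then obtain q where "q \<in> unit_leads" "poly q y = 0" by force
    then show False using inj_y unfolding unit_leads_def by auto
  qed
  show "s * t \<in> (\<lambda>p. poly p y) ` unit_leads"
    if st: "s \<in> (\<lambda>p. poly p y) ` unit_leads" "t \<in> (\<lambda>p. poly p y) ` unit_leads" for s t
  proof -
    obtain p q where "p \<in> unit_leads" "s = poly p y" "q \<in> unit_leads" "t = poly q y" using st by blast
    then show ?thesis using unit_leads_mult by (intro image_eqI[of _ _ "p * q"]) auto
  qed
qed

text \<open>The leading coefficient in \<open>x\<close> of a nonzero polynomial in the variables \<open>insert x I\<close> is a nonzero
polynomial in the variables \<open>I\<close>, hence a unit of \<open>A\<close>; the substitution \<open>x = y + f\<close> does not change it.\<close>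

lemma ratpoly_at_infinity:
  "ratpoly (insert x I) J \<subseteq> loc ((\<lambda>p. poly p y) ` polys_over A) ((\<lambda>p. poly p y) ` unit_leads)"
proof
  fix r :: "('n, 'a) mpoly fract" assume "r \<in> ratpoly (insert x I) J"
  then obtain a t where r: "r = a / t" "a \<in> Pin (insert x I \<union> J)" "t \<in> Pin (insert x I)" "t \<noteq> 0"
    unfolding ratpoly_def loc_def by blast
  have P: "Pin (I \<union> J) \<subseteq> A" "Pin I \<subseteq> A" using Pin_ratpoly[of I J] Pin_mono[of I "I \<union> J"] by auto
  obtain p where p: "p \<in> polys_over (Pin (I \<union> J))" "poly p (zvar x) = a" using Pin_as_poly[OF r(2)] by blast
  have "poly (pcompose p [:f, 1:]) y = a" "pcompose p [:f, 1:] \<in> polys_over A"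
    using shift_y p(2) shift_over[OF _ f] polys_over_mono[OF P(1)] p(1) by auto
  then have a: "a \<in> (\<lambda>p. poly p y) ` polys_over A" by blast
  obtain q where q: "q \<in> polys_over (Pin I)" "poly q (zvar x) = t" using Pin_insert_exists[OF r(3)] by blast
  have "lead_coeff (pcompose q [:f, 1:]) = lead_coeff q" by (simp add: lead_coeff_comp)
  moreover have "lead_coeff q \<noteq> 0" using q(2) r(4) by auto
  moreover have "inverse (lead_coeff q) \<in> A"
    using ratpoly_inverse[OF polys_over_coeff[OF q(1)]] \<open>lead_coeff q \<noteq> 0\<close> by blast
  moreover have "pcompose q [:f, 1:] \<in> polys_over A" using shift_over[OF _ f] polys_over_mono[OF P(2)] q(1) by blast
  ultimately have "pcompose q [:f, 1:] \<in> unit_leads" unfolding unit_leads_def by (simp only: mem_Collect_eq simp_thms)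
  moreover have "poly (pcompose q [:f, 1:]) y = t" using shift_y q(2) by simp
  ultimately have "t \<in> (\<lambda>p. poly p y) ` unit_leads" by (metis rev_image_eqI)
  then show "r \<in> loc ((\<lambda>p. poly p y) ` polys_over A) ((\<lambda>p. poly p y) ` unit_leads)"
    unfolding r(1) by (intro locI a)
qed

end

section \<open>Induction on the number of variables\<close>

context adjoin
begin

interpretation ev: comm_ring_hom "\<lambda>p. poly p y"
  by unfold_locales auto

abbreviation R :: "('n, 'a) mpoly fract set" where "R \<equiv> ratpoly I (insert x J)"
abbreviation D :: "('n, 'a) mpoly fract set" where "D \<equiv> ratpoly (insert x I) J"

lemma ev_image: "(\<lambda>p. poly p y) ` polys_over A = R"
  using poly_y_in surj_y by blast

lemma ev_inj: "p \<in> polys_over A \<Longrightarrow> q \<in> polys_over A \<Longrightarrow> poly p y = poly q y \<Longrightarrow> p = q"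
  using inj_y[of "p - q"] subring_minus[OF PA] by simp

lemma R_sub_D: "R \<subseteq> D"
  by (rule ratpoly_mono) auto

lemma lift_mat:
  assumes "F \<in> carrier_mat n n" "mat_over R F"
  obtains F' where "F' \<in> carrier_mat n n" "mat_over (polys_over A) F'" "map_mat (\<lambda>p. poly p y) F' = F"
proof -
  define h where "h a = (SOME q. q \<in> polys_over A \<and> poly q y = a)" for a
  have h: "h a \<in> polys_over A" "poly (h a) y = a" if "a \<in> R" for a
  proof -
    have "\<exists>q. q \<in> polys_over A \<and> poly q y = a" using surj_y[OF that] by blast
    from someI_ex[OF this] show "h a \<in> polys_over A" "poly (h a) y = a" unfolding h_def by auto
  qed
  show ?thesis
  proof (rule that[of "map_mat h F"])
    show "map_mat h F \<in> carrier_mat n n" using assms by auto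
    show "mat_over (polys_over A) (map_mat h F)" using assms(2) h(1) unfolding mat_over_def by auto
    show "map_mat (\<lambda>p. poly p y) (map_mat h F) = F"
      using assms(2) h(2) unfolding mat_over_def by (intro eq_matI) auto
  qed
qed

lemma lin_lift:
  assumes "M \<subseteq> polys_over A" "u \<in> lin R ((\<lambda>p. poly p y) ` M)"
  shows "\<exists>v\<in>lin (polys_over A) M. poly v y = u"
  using assms(2)
proof induction
  case zero
  show ?case using lin.zero by (intro bexI[of _ 0]) auto
next
  case (step c m v)
  obtain c' where "c' \<in> polys_over A" "poly c' y = c" using surj_y[OF step(1)] by blast
  moreover obtain m' where "m' \<in> M" "poly m' y = m" using step(2) by blast
  moreover obtain v' where "v' \<in> lin (polys_over A) M" "poly v' y = v" using step.IH by blast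
  ultimately show ?case using lin.step[of c' "polys_over A" m' M v'] by (intro bexI[of _ "c' * m' + v'"]) auto
qed

lemma det_ideal_lift:
  assumes F: "F \<in> carrier_mat n n" "mat_over (polys_over A) F" and d: "d \<in> polys_over A"
    and di: "det_ideal R n k (map_mat (\<lambda>p. poly p y) F) (poly d y)"
  shows "det_ideal (polys_over A) n k F d"
proof -
  have sub: "kminors n k F \<subseteq> polys_over A" using minor_in_subring[OF PA F(2,1)] by blast
  have "\<exists>c\<in>polys_over A. m = d * c" if m: "m \<in> kminors n k F" for m
  proof -
    have "poly m y \<in> kminors n k (map_mat (\<lambda>p. poly p y) F)" unfolding ev.kminors_map[OF F(1)] using m by blast
    then obtain c where c: "c \<in> R" "poly m y = poly d y * c" using di unfolding det_ideal_def by blast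
    obtain c' where c': "c' \<in> polys_over A" "poly c' y = c" using surj_y[OF c(1)] by blast
    have "m = d * c'" using c c' sub m d by (intro ev_inj subring_mult[OF PA]) auto
    then show ?thesis using c' by blast
  qed
  moreover have "d \<in> lin (polys_over A) (kminors n k F)"
  proof -
    obtain v where v: "v \<in> lin (polys_over A) (kminors n k F)" "poly v y = poly d y"
      using lin_lift[OF sub] di unfolding det_ideal_def ev.kminors_map[OF F(1)] by blast
    have "v \<in> polys_over A"
      by (rule lin_closed_ideal[OF v(1) subring_zero[OF PA]]) (use sub PA in \<open>auto intro: subring_add subring_mult\<close>)
    then show ?thesis using ev_inj[OF _ d v(2)] v(1) by simp
  qed
  ultimately show ?thesis unfolding det_ideal_def by blast
qed

text \<open>An equivalence over the ring \<open>D\<close>, in which the nonzero polynomials in \<open>x\<close> and the variables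
  \<open>I\<close> are invertible, is turned into
  an intertwining relation over \<open>A[y]\<close> by clearing denominators.\<close>

lemma clear_denominators_infinity:
  assumes F: "F \<in> carrier_mat n n" "mat_over (polys_over A) F" and s: "\<And>i. i < n \<Longrightarrow> s i \<in> A"
    and e: "eqv D n (map_mat (\<lambda>p. poly p y) F) (diag_of n s)"
  shows "\<exists>X Y gX gY. X \<in> carrier_mat n n \<and> mat_over (polys_over A) X \<and> Y \<in> carrier_mat n n \<and> mat_over (polys_over A) Y \<and>
    X * diag_of n (\<lambda>i. [:s i:]) = F * Y \<and> gX \<in> polys_over A \<and> det X * gX \<in> unit_leads \<and>
    gY \<in> polys_over A \<and> det Y * gY \<in> unit_leads"
proof -
  let ?ev = "map_mat (\<lambda>p. poly p y)" and ?L = "loc ((\<lambda>p. poly p y) ` polys_over A) ((\<lambda>p. poly p y) ` unit_leads)"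
  note LD = ratpoly_at_infinity
  note rev = ev.subring_image[OF PA]
  note Ls = loc_subring[OF rev unit_leads_mult_set]
  obtain U V where U: "U \<in> GLs ?L n" and V: "V \<in> GLs ?L n" and FUV: "?ev F = U * diag_of n s * V"
    using eqv_mono[OF e LD] unfolding eqv_def by blast
  obtain V' where V': "V' \<in> GLs ?L n" "V * V' = 1\<^sub>m n" "V' * V = 1\<^sub>m n" using GLsE[OF V] .
  note c = GLs_carrier[OF U] GLs_carrier[OF V] GLs_carrier[OF V'(1)]
  have "?ev F * V' = U * diag_of n s * (V * V')" unfolding FUV
    by (rule assoc_mult_mat[OF mult_carrier_mat[OF c(1) diag_of_carrier] c(2,3)])
  then have rel: "?ev F * V' = U * diag_of n s"
    using right_mult_one_mat[OF mult_carrier_mat[OF c(1) diag_of_carrier]] V'(2) by simp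
  obtain t where t: "t \<in> (\<lambda>p. poly p y) ` unit_leads" "mat_over R (t \<cdot>\<^sub>m U)" "mat_over R (t \<cdot>\<^sub>m V')"
    using common_denominator_mats[OF rev unit_leads_mult_set c(1) GLs_over[OF U] c(3) GLs_over[OF V'(1)]]
    unfolding ev_image by blast
  obtain q where q: "q \<in> unit_leads" "t = poly q y" using t(1) by blast
  have lift: "\<exists>X g. X \<in> carrier_mat n n \<and> mat_over (polys_over A) X \<and> ?ev X = t \<cdot>\<^sub>m W \<and> g \<in> polys_over A \<and> det X * g \<in> unit_leads"
    if W: "W \<in> GLs ?L n" "mat_over R (t \<cdot>\<^sub>m W)" for W
  proof -
    note cW = GLs_carrier[OF W(1)]
    obtain X where X: "X \<in> carrier_mat n n" "mat_over (polys_over A) X" "?ev X = t \<cdot>\<^sub>m W"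
      using lift_mat[OF _ W(2), of n] cW by auto
    obtain e where e: "e \<in> ?L" "det W * e = 1" using GLs_iff_det[OF Ls cW GLs_over[OF W(1)]] W(1) by blast
    obtain p r where pr: "p \<in> polys_over A" "r \<in> unit_leads" "e = poly p y / poly r y"
      using e(1) unfolding loc_def by blast
    have r: "poly r y \<noteq> 0" "r \<in> polys_over A" using pr(2) inj_y unfolding unit_leads_def by auto
    have "poly (det X) y = det (t \<cdot>\<^sub>m W)" unfolding X(3)[symmetric] by simp
    also have "\<dots> = t ^ n * det W" using cW by (simp add: det_smult)
    finally have "poly (det X * p) y = t ^ n * (det W * e) * poly r y" unfolding pr(3) using r by simp
    then have "poly (det X * p) y = poly (q ^ n * r) y" unfolding e(2) q(2) by simp
    moreover have "q ^ n * r \<in> unit_leads"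
    proof -
      have "1 \<in> unit_leads" using subring_one[OF PA] subring_one[OF A] unfolding unit_leads_def by simp
      then have "q ^ k \<in> unit_leads" for k
        by (induction k) (simp_all add: unit_leads_mult[OF q(1)])
      then show ?thesis using unit_leads_mult pr(2) by blast
    qed
    moreover from this have "q ^ n * r \<in> polys_over A" unfolding unit_leads_def by blast
    ultimately have "det X * p = q ^ n * r"
      using subring_mult[OF PA det_in_subring[OF PA X(2,1)] pr(1)] by (intro ev_inj)
    then have "det X * p \<in> unit_leads" using \<open>q ^ n * r \<in> unit_leads\<close> by simp
    then show ?thesis using X pr(1) by blast
  qed
  obtain X gX where X: "X \<in> carrier_mat n n" "mat_over (polys_over A) X" "?ev X = t \<cdot>\<^sub>m U" "gX \<in> polys_over A" "det X * gX \<in> unit_leads"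
    using lift[OF U t(2)] by blast
  obtain Y gY where Y: "Y \<in> carrier_mat n n" "mat_over (polys_over A) Y" "?ev Y = t \<cdot>\<^sub>m V'" "gY \<in> polys_over A" "det Y * gY \<in> unit_leads"
    using lift[OF V'(1) t(3)] by blast
  have dS: "diag_of n s = ?ev (diag_of n (\<lambda>i. [:s i:]))" unfolding diag_of_def by (intro eq_matI) auto
  have "?ev (X * diag_of n (\<lambda>i. [:s i:])) = ?ev X * diag_of n s"
    unfolding dS by (rule ev.mat_hom_mult[OF X(1) diag_of_carrier])
  also have "\<dots> = t \<cdot>\<^sub>m (?ev F * V')" unfolding X(3) rel by (rule mult_smult_assoc_mat[OF c(1) diag_of_carrier])
  also have "\<dots> = ?ev F * ?ev Y" unfolding Y(3) using c F by (simp add: mult_smult_distrib[of _ n n _ n])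
  also have "\<dots> = ?ev (F * Y)" by (rule ev.mat_hom_mult[OF F(1) Y(1), symmetric])
  finally have eq: "?ev (X * diag_of n (\<lambda>i. [:s i:])) = ?ev (F * Y)" .
  have oS: "mat_over (polys_over A) (diag_of n (\<lambda>i. [:s i:]))"
    using s by (intro diag_of_over[OF PA] polys_over_const subring_zero[OF A]) auto
  have "X * diag_of n (\<lambda>i. [:s i:]) = F * Y"
  proof (rule eq_matI)
    fix i j assume "i < dim_row (F * Y)" "j < dim_col (F * Y)"
    then have ij: "i < n" "j < n" using F Y by auto
    note cm = mult_carrier_mat[OF X(1) diag_of_carrier[of n "\<lambda>i. [:s i:]"]] mult_carrier_mat[OF F(1) Y(1)]
    have "poly ((X * diag_of n (\<lambda>i. [:s i:])) $$ (i, j)) y = ?ev (X * diag_of n (\<lambda>i. [:s i:])) $$ (i, j)"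
      using cm(1) ij by (metis carrier_matD index_map_mat(1))
    also have "\<dots> = poly ((F * Y) $$ (i, j)) y" unfolding eq using cm(2) ij by (metis carrier_matD index_map_mat(1))
    finally show "(X * diag_of n (\<lambda>i. [:s i:])) $$ (i, j) = (F * Y) $$ (i, j)"
      using mat_overD[OF mat_over_mult[OF PA X(2) oS X(1) diag_of_carrier] cm(1) ij]
        mat_overD[OF mat_over_mult[OF PA F(2) Y(2) F(1) Y(1)] cm(2) ij] by (intro ev_inj)
  qed (use X Y F in auto)
  then show ?thesis using X Y by blast
qed

lemma const_equivalent_adjoin:
  assumes F: "F \<in> carrier_mat n n" "mat_over (polys_over A) F" and s: "\<And>i. i < n \<Longrightarrow> s i \<in> A"
    and chain: "\<And>i. Suc i < n \<Longrightarrow> \<exists>c\<in>A. s (Suc i) = s i * c"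
    and d: "\<And>k. k \<le> n \<Longrightarrow> det_ideal (polys_over A) n k F [:\<Prod>i<k. s i:]"
    and e: "eqv D n (map_mat (\<lambda>p. poly p y) F) (diag_of n s)"
  shows "const_equivalent n F A"
proof -
  obtain X Y gX gY where h: "X \<in> carrier_mat n n" "mat_over (polys_over A) X" "Y \<in> carrier_mat n n"
    "mat_over (polys_over A) Y" "X * diag_of n (\<lambda>i. [:s i:]) = F * Y"
    "gX \<in> polys_over A" "det X * gX \<in> unit_leads" "gY \<in> polys_over A" "det Y * gY \<in> unit_leads"
    using clear_denominators_infinity[OF F s e] by blast
  show ?thesis
    using h(7,9) unfolding unit_leads_def
    by (intro const_equivalent_of_infinity[OF A F chain d h(1-5) h(6) _ _ h(8)]) auto
qed

text \<open>The matrix is equivalent to its value at \<open>y = 0\<close>, which has entries in \<open>A\<close>.\<close>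

lemma smith_adjoin_const:
  assumes F: "F \<in> carrier_mat n n" "mat_over R F" and s: "\<And>i. i < n \<Longrightarrow> s i \<in> A"
    and chain: "\<And>i. Suc i < n \<Longrightarrow> \<exists>c\<in>A. s (Suc i) = s i * c"
    and d: "\<And>k. k \<le> n \<Longrightarrow> det_ideal R n k F (\<Prod>i<k. s i)"
    and e: "eqv D n F (diag_of n s)"
    and H: "\<And>G. G \<in> carrier_mat n n \<Longrightarrow> mat_over A G \<Longrightarrow> (\<And>k. k \<le> n \<Longrightarrow> det_ideal A n k G (\<Prod>i<k. s i)) \<Longrightarrow>
      eqv A n G (diag_of n s)"
  shows "eqv R n F (diag_of n s)"
proof -
  let ?ev = "map_mat (\<lambda>p. poly p y)" and ?c0 = "map_mat (\<lambda>p :: ('n, 'a) mpoly fract poly. coeff p 0)"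
  obtain F' where F': "F' \<in> carrier_mat n n" "mat_over (polys_over A) F'" "?ev F' = F" using lift_mat[OF F] .
  have sA: "(\<Prod>i<k. s i) \<in> A" if "k \<le> n" for k using s that by (intro subring_prod[OF A]) auto
  have d': "det_ideal (polys_over A) n k F' [:\<Prod>i<k. s i:]" if "k \<le> n" for k
    by (rule det_ideal_lift[OF F'(1,2)])
       (use d[OF that] F'(3) polys_over_const[OF subring_zero[OF A] sA[OF that]] in auto)
  have "const_equivalent n F' A" using const_equivalent_adjoin[OF F'(1,2) s chain d'] e F'(3) by simp
  then obtain U V where U: "U \<in> GLs (polys_over A) n" and V: "V \<in> GLs (polys_over A) n"
    and FUV: "F' = U * map_mat (scale 0) F' * V" unfolding const_equivalent_def by blast
  have c0A: "(\<lambda>p. coeff p 0) ` polys_over A \<subseteq> A" using polys_over_coeff by blast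
  have cF: "?c0 F' \<in> carrier_mat n n" "mat_over A (?c0 F')"
    using F'(1) mat_over_mono[OF coeff0.mat_over_map[OF F'(2)] c0A] by auto
  have "det_ideal A n k (?c0 F') (\<Prod>i<k. s i)" if "k \<le> n" for k
    using det_ideal_mono[OF coeff0.det_ideal_map[OF F'(1) d'[OF that]] c0A] by simp
  then have e0: "eqv A n (?c0 F') (diag_of n s)" using H cF by blast
  have sc: "scale 0 p = [:coeff p 0:]" for p :: "('n, 'a) mpoly fract poly"
    by (intro poly_eqI) (simp add: coeff_scale coeff_pCons power_0_left split: nat.splits)
  have "?ev (map_mat (scale 0) F') = ?c0 F'" by (intro eq_matI) (auto simp: sc)
  moreover have "eqv (polys_over A) n F' (map_mat (scale 0) F')" by (rule eqvI[OF U V FUV])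
  ultimately have "eqv R n F (?c0 F')" using ev.eqv_map[of "polys_over A" n F' "map_mat (scale 0) F'"] F' ev_image by simp
  then show ?thesis using eqv_trans[OF ratpoly_subring _ eqv_mono[OF e0 A_sub(1)] diag_of_carrier] by blast
qed

text \<open>The values at \<open>y = 0\<close> have the last invariant factor zero; this is the case to which \<open>H0\<close> applies.\<close>

lemma smith_adjoin_variable:
  assumes F: "F \<in> carrier_mat (Suc r) (Suc r)" "mat_over R F"
    and \<tau>: "\<And>i. i < r \<Longrightarrow> \<tau> i \<in> A \<and> \<tau> i \<noteq> 0" and \<sigma>: "\<sigma> \<in> A" "\<sigma> \<noteq> 0"
    and chain: "\<And>i. i < r \<Longrightarrow> \<exists>c\<in>A. (if Suc i < r then \<tau> (Suc i) else \<sigma>) = \<tau> i * c"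
    and d: "\<And>k. k \<le> Suc r \<Longrightarrow> det_ideal R (Suc r) k F (\<Prod>i<k. if i < r then \<tau> i else y * \<sigma>)"
    and H0: "\<And>G. G \<in> carrier_mat (Suc r) (Suc r) \<Longrightarrow> mat_over A G \<Longrightarrow>
      (\<And>k. k \<le> Suc r \<Longrightarrow> det_ideal A (Suc r) k G (\<Prod>i<k. if i < r then \<tau> i else 0)) \<Longrightarrow>
      eqv A (Suc r) G (diag_of (Suc r) (\<lambda>i. if i < r then \<tau> i else 0))"
    and HD: "\<And>G. G \<in> carrier_mat (Suc r) (Suc r) \<Longrightarrow> mat_over R G \<Longrightarrow>
      (\<And>k. k \<le> Suc r \<Longrightarrow> det_ideal R (Suc r) k G (\<Prod>i<k. if i < r then \<tau> i else \<sigma>)) \<Longrightarrow>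
      eqv D (Suc r) G (diag_of (Suc r) (\<lambda>i. if i < r then \<tau> i else \<sigma>))"
  shows "eqv R (Suc r) F (diag_of (Suc r) (\<lambda>i. if i < r then \<tau> i else y * \<sigma>))"
proof -
  let ?ev = "map_mat (\<lambda>p. poly p y)" and ?c0 = "map_mat (\<lambda>p :: ('n, 'a) mpoly fract poly. coeff p 0)"
    and ?X = "[:0, 1:] :: ('n, 'a) mpoly fract poly"
  let ?s = "\<lambda>i. if i < r then \<tau> i else \<sigma>"
  obtain F' where F': "F' \<in> carrier_mat (Suc r) (Suc r)" "mat_over (polys_over A) F'" "?ev F' = F" using lift_mat[OF F] .
  have XP: "?X \<in> polys_over A" using subring_zero[OF A] subring_one[OF A]
    by (auto intro!: polys_overI simp: coeff_pCons split: nat.splits)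
  have c0A: "(\<lambda>p. coeff p 0) ` polys_over A \<subseteq> A" using polys_over_coeff by blast
  have prodA: "(\<Prod>i<k. \<tau> i) \<in> A" if "k \<le> r" for k using \<tau> that by (intro subring_prod[OF A]) auto
  have const: "[:a:] \<in> polys_over A" if "a \<in> A" for a using polys_over_const[OF subring_zero[OF A] that] .
  have prod_eq: "(\<Prod>i<k. if i < r then \<tau> i else u) = (\<Prod>i<k. \<tau> i)" if "k \<le> r" for k u
    using that by (intro prod.cong) auto
  have prod_Suc: "(\<Prod>i<Suc r. if i < r then \<tau> i else u) = (\<Prod>i<r. \<tau> i) * u" for u
    using prod_eq[of r u] by simp
  have d1: "det_ideal (polys_over A) (Suc r) k F' [:\<Prod>i<k. \<tau> i:]" if "k \<le> r" for k
    by (rule det_ideal_lift[OF F'(1,2) const[OF prodA[OF that]]]) (use d[of k] prod_eq[OF that] F'(3) that in simp)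
  have d2: "det_ideal (polys_over A) (Suc r) (Suc r) F' (?X * [:(\<Prod>i<r. \<tau> i) * \<sigma>:])"
  proof (rule det_ideal_lift[OF F'(1,2)])
    show "?X * [:(\<Prod>i<r. \<tau> i) * \<sigma>:] \<in> polys_over A"
      using prodA[of r] \<sigma> by (intro subring_mult[OF PA XP] const subring_mult[OF A]) auto
    have e: "poly (?X * [:(\<Prod>i<r. \<tau> i) * \<sigma>:]) y = (\<Prod>i<r. \<tau> i) * (y * \<sigma>)" by simp
    show "det_ideal R (Suc r) (Suc r) (?ev F') (poly (?X * [:(\<Prod>i<r. \<tau> i) * \<sigma>:]) y)"
      using d[of "Suc r"] unfolding prod_Suc F'(3) e by blast
  qed
  have "eqv (polys_over A) (Suc r) F' (diag_of (Suc r) (\<lambda>i. if i < r then [:\<tau> i:] else ?X * [:\<sigma>:]))"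
  proof (rule smith_step_variable[OF A F'(1,2) \<tau> \<sigma> d1 d2])
    show "eqv A (Suc r) (?c0 F') (diag_of (Suc r) (\<lambda>i. if i < r then \<tau> i else 0))"
    proof (rule H0)
      show "?c0 F' \<in> carrier_mat (Suc r) (Suc r)" "mat_over A (?c0 F')"
        using F'(1) mat_over_mono[OF coeff0.mat_over_map[OF F'(2)] c0A] by auto
      show "det_ideal A (Suc r) k (?c0 F') (\<Prod>i<k. if i < r then \<tau> i else 0)" if "k \<le> Suc r" for k
      proof (cases "k = Suc r")
        case True
        then show ?thesis
          using det_ideal_mono[OF coeff0.det_ideal_map[OF F'(1) d2] c0A] unfolding True prod_Suc by simp
      next
        case False
        then have "k \<le> r" using that by simp
        then show ?thesis
          using det_ideal_mono[OF coeff0.det_ideal_map[OF F'(1) d1] c0A] prod_eq[of k 0] by simp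
      qed
    qed
    show "const_equivalent (Suc r) G A"
      if G: "G \<in> carrier_mat (Suc r) (Suc r)" "mat_over (polys_over A) G"
        "\<And>k. k \<le> Suc r \<Longrightarrow> det_ideal (polys_over A) (Suc r) k G [:\<Prod>i<k. ?s i:]" for G
    proof (rule const_equivalent_adjoin[OF G(1,2) _ _ G(3)])
      show "?s i \<in> A" if "i < Suc r" for i using \<tau> \<sigma> by simp
      show "\<exists>c\<in>A. ?s (Suc i) = ?s i * c" if "Suc i < Suc r" for i using chain[of i] that by simp
      show "eqv D (Suc r) (?ev G) (diag_of (Suc r) ?s)"
      proof (rule HD)
        show "?ev G \<in> carrier_mat (Suc r) (Suc r)" using G by auto
        show "mat_over R (?ev G)" using ev.mat_over_map[OF G(2)] unfolding ev_image .
        show "det_ideal R (Suc r) k (?ev G) (\<Prod>i<k. ?s i)" if "k \<le> Suc r" for k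
          using ev.det_ideal_map[OF G(1) G(3)[OF that]] unfolding ev_image by simp
      qed
    qed
  qed
  from ev.eqv_map[OF this diag_of_carrier]
  have "eqv R (Suc r) F (diag_of (Suc r) ((\<lambda>p. poly p y) \<circ> (\<lambda>i. if i < r then [:\<tau> i:] else ?X * [:\<sigma>:])))"
    unfolding ev_image F'(3) ev.map_diag_of .
  moreover have "(\<lambda>p. poly p y) \<circ> (\<lambda>i. if i < r then [:\<tau> i:] else ?X * [:\<sigma>:]) = (\<lambda>i. if i < r then \<tau> i else y * \<sigma>)"
    by (rule ext) simp
  ultimately show ?thesis by simp
qed

end

lemma ratpoly_field: "a \<in> ratpoly I {} \<Longrightarrow> a \<noteq> 0 \<Longrightarrow> inverse a \<in> ratpoly I {}"
proof -
  assume "a \<in> ratpoly I {}" "a \<noteq> 0"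
  then obtain p t where "a = p / t" "p \<in> Pin I" "t \<in> Pin I" "p \<noteq> 0" "t \<noteq> 0"
    unfolding ratpoly_def loc_def by auto
  then show "inverse a \<in> ratpoly I {}" unfolding ratpoly_def using locI[of t "Pin (I \<union> {})" p "Pin I - {0}"] by simp
qed

text \<open>Over one variable the ring is Euclidean.\<close>

lemma ratpoly_one_variable_euclidean:
  assumes "x \<notin> I"
  shows "\<exists>e. euclidean_mod_radical (ratpoly I {x} :: ('n::{finite,linorder}, 'a::field) mpoly fract set) {0} e"
proof -
  interpret adjoin I "{}" x "0 :: ('n, 'a) mpoly fract"
    by unfold_locales (use assms subring_zero[OF ratpoly_subring] in auto)
  interpret K: local_subring A "{0}"
    by unfold_locales (use subring_zero[OF A] ratpoly_field A in auto)
  define h where "h a = (SOME q. q \<in> polys_over A \<and> poly q y = a)" for a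
  have h: "h a \<in> polys_over A" "poly (h a) y = a" if "a \<in> ratpoly I {x}" for a
  proof -
    have "\<exists>q. q \<in> polys_over A \<and> poly q y = a" using surj_y[OF that] by blast
    from someI_ex[OF this] show "h a \<in> polys_over A" "poly (h a) y = a" unfolding h_def by auto
  qed
  have hh: "h (poly q y) = q" if "q \<in> polys_over A" for q
    using ev_inj[OF _ that] h[OF poly_y_in[OF that]] by blast
  have "euclidean_mod_radical (ratpoly I {x}) {0} (\<lambda>a. degree (h a))"
  proof
    show "\<exists>q\<in>ratpoly I {x}. a - q * b \<in> {0} \<or> degree (h (a - q * b)) < degree (h b)"
      if ab: "a \<in> ratpoly I {x}" "b \<in> ratpoly I {x}" "b \<notin> {0}" for a b
    proof -
      have "h b \<noteq> 0" using h(2)[OF ab(2)] ab(3) by auto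
      then have "K.unit_lead (h b)" unfolding K.unit_lead_def using h(1)[OF ab(2)] by simp
      then obtain q where q: "q \<in> polys_over A" "h a - q * h b \<in> polys_over A"
        "h a - q * h b = 0 \<or> degree (h a - q * h b) < degree (h b)"
        using K.unit_lead_division h(1)[OF ab(1)] by blast
      have e: "poly (h a - q * h b) y = a - poly q y * b" using h ab by simp
      have "h (a - poly q y * b) = h a - q * h b" using hh[OF q(2)] unfolding e .
      moreover have "h a - q * h b = 0 \<Longrightarrow> a - poly q y * b = 0" using e by (metis poly_0)
      ultimately show ?thesis using q(3) poly_y_in[OF q(1)] by (intro bexI[of _ "poly q y"]) auto
    qed
  qed (use ratpoly_subring subring_zero[OF ratpoly_subring] subring_one[OF ratpoly_subring] in auto)
  then show ?thesis by blast
qed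

text \<open>The last invariant factor is \<open>\<tau> r * e\<close>. The factor \<open>e\<close> is a product of some of the linear factors; it
may also be zero, as this happens modulo one of its factors. The claim is proved for both forms simultaneously,
and for all sets \<open>I\<close> and \<open>J\<close>, because the step from \<open>J\<close> to a smaller set uses the rings in which the removed
variable has been set to \<open>f x\<close>, and those in which it has been moved to \<open>I\<close>.\<close>

theorem smith_ratpoly:
  fixes f :: "'n::{finite,linorder} \<Rightarrow> ('n, 'a::field) mpoly fract"
  assumes fP: "\<And>j. j \<noteq> Max UNIV \<Longrightarrow> f j \<in> Pin {j<..}"
    and \<tau>: "\<And>i. i \<le> r \<Longrightarrow> \<tau> i \<in> Pin {Max UNIV} \<and> \<tau> i \<noteq> 0"
    and chain: "\<And>i. i < r \<Longrightarrow> \<exists>c\<in>Pin {Max UNIV}. \<tau> (Suc i) = \<tau> i * c"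
    and J: "\<And>j k. j \<in> J \<Longrightarrow> j \<le> k \<Longrightarrow> k \<in> J" "Max UNIV \<in> J" and IJ: "I \<inter> J = {}"
    and e: "e = 0 \<or> (\<exists>Q \<subseteq> J - {Max UNIV}. e = (\<Prod>j\<in>Q. zvar j - f j))"
    and F: "F \<in> carrier_mat (Suc r) (Suc r)" "mat_over (ratpoly I J) F"
    and d: "\<And>k. k \<le> Suc r \<Longrightarrow> det_ideal (ratpoly I J) (Suc r) k F (\<Prod>i<k. if i < r then \<tau> i else \<tau> r * e)"
  shows "eqv (ratpoly I J) (Suc r) F (diag_of (Suc r) (\<lambda>i. if i < r then \<tau> i else \<tau> r * e))"
  using J IJ e F d
proof (induction "card J" arbitrary: I J e F rule: less_induct)
  case less
  let ?N = "Max UNIV :: 'n"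
  have sub_N: "Pin {?N} \<subseteq> ratpoly I' J'" if "?N \<in> J'" for I' J' :: "'n set"
    using Pin_mono[of "{?N}" "I' \<union> J'"] Pin_ratpoly[of I' J'] that by blast
  have le_N: "j \<le> ?N" for j by (rule Max_ge) auto
  have y_in: "zvar j - f j \<in> Pin J'" if "j \<in> J'" "j \<noteq> ?N" "{j..} \<subseteq> J'" for j J'
  proof -
    have "{j<..} \<subseteq> J'" using that(3) by auto
    then have "f j \<in> Pin J'" using fP[OF that(2)] Pin_mono by blast
    then show ?thesis using zvar_in[OF that(1)] by (intro subring_minus[OF Pin_subring])
  qed
  show ?case
  proof (cases "J = {?N}")
    case True
    obtain sz where "euclidean_mod_radical (ratpoly I {?N} :: ('n, 'a) mpoly fract set) {0} sz"
      using ratpoly_one_variable_euclidean[of ?N I] less.prems(2,3) by auto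
    then interpret E: euclidean_mod_radical "ratpoly I {?N} :: ('n, 'a) mpoly fract set" "{0}" sz .
    have e01: "e = 0 \<or> e = 1" using less.prems(4) True by auto
    \<comment> \<open>without linear factors in \<open>J\<close>, the factor \<open>e\<close> is the empty product or zero\<close>
    show ?thesis unfolding True
    proof (rule E.smith_of_det_ideals[OF less.prems(5)])
      show "mat_over (ratpoly I {?N}) F" using less.prems(6) True by simp
      show "det_ideal (ratpoly I {?N}) (Suc r) k F (\<Prod>i<k. if i < r then \<tau> i else \<tau> r * e)" if "k \<le> Suc r" for k
        using less.prems(7)[OF that] True by simp
      show "\<exists>c\<in>ratpoly I {?N}. (if Suc i < r then \<tau> (Suc i) else \<tau> r * e) = (if i < r then \<tau> i else \<tau> r * e) * c"
        if i: "Suc i < Suc r" for i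
      proof -
        obtain c where c: "c \<in> Pin {?N}" "\<tau> (Suc i) = \<tau> i * c" using chain[of i] i by auto
        have cR: "c \<in> ratpoly I {?N}" "0 \<in> ratpoly I {?N}" using c(1) sub_N subring_zero[OF ratpoly_subring] by blast+
        show ?thesis
        proof (cases "Suc i < r")
          case True
          then show ?thesis using c(2) cR by auto
        next
          case False
          then have "r = Suc i" using i by simp
          then show ?thesis using e01 c(2) cR by auto
        qed
      qed
    qed
  next
    case False
    define x where "x = Min J"
    have x: "x \<in> J" "\<And>j. j \<in> J \<Longrightarrow> x \<le> j" unfolding x_def using less.prems(2) by (auto intro: Min_in)
    have xN: "x \<noteq> ?N"
    proof
      assume "x = ?N"
      then have "J \<subseteq> {?N}" using x(2) le_N by (auto intro: antisym)
      then show False using False less.prems(2) by auto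
    qed
    define J' where "J' = J - {x}"
    have J'_up: "k \<in> J'" if "j \<in> J'" "j \<le> k" for j k
      using that x less.prems(1)[of j k] unfolding J'_def by (auto intro: antisym)
    have NJ': "?N \<in> J'" unfolding J'_def using less.prems(2) xN by simp
    have gt_x: "{x<..} \<subseteq> J'" unfolding J'_def using less.prems(1)[OF x(1)] by auto
    have JJ': "insert x J' = J" unfolding J'_def using x(1) by auto
    have card: "card J' < card J" unfolding J'_def using x(1) by (intro psubset_card_mono) auto
    have disj: "I \<inter> J' = {}" "insert x I \<inter> J' = {}" "x \<notin> I \<union> J'" using less.prems(3) x(1) unfolding J'_def by auto
    have fx: "f x \<in> ratpoly I J'" using fP[OF xN] Pin_mono[OF gt_x] Pin_mono[of J' "I \<union> J'"] Pin_ratpoly by blast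
    interpret adjoin I J' x "f x" by unfold_locales (use disj fx in auto)
    have y_eq: "y = zvar x - f x" by (rule y_def)
    have \<tau>A: "\<tau> i \<in> A" if "i \<le> r" for i using \<tau>[OF that] sub_N[OF NJ'] by blast
    have yA: "zvar j - f j \<in> A" "zvar j - f j \<in> Pin J'" if "j \<in> J'" "j \<noteq> ?N" for j
    proof -
      show "zvar j - f j \<in> Pin J'" using y_in[OF that] J'_up[OF that(1)] by auto
      then show "zvar j - f j \<in> A" using Pin_mono[of J' "I \<union> J'"] Pin_ratpoly by blast
    qed
    have prodA: "(\<Prod>j\<in>Q. zvar j - f j) \<in> A" if "Q \<subseteq> J' - {?N}" for Q
      using yA(1) that by (intro subring_prod[OF A]) auto
    have chainA: "\<exists>c\<in>A. (if Suc i < r then \<tau> (Suc i) else \<tau> r * e') = \<tau> i * c" if i: "i < r" and e': "e' \<in> A" for i e'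
    proof -
      obtain c where c: "c \<in> Pin {?N}" "\<tau> (Suc i) = \<tau> i * c" using chain[OF i] by blast
      have cA: "c \<in> A" "c * e' \<in> A" using c(1) sub_N[OF NJ'] e' subring_mult[OF A] by blast+
      show ?thesis
      proof (cases "Suc i < r")
        case True
        then show ?thesis using c cA by auto
      next
        case False
        then have "r = Suc i" using i by simp
        then show ?thesis using c cA by (intro bexI[of _ "c * e'"]) auto
      qed
    qed
    have RJ: "ratpoly I J = R" unfolding JJ' ..
    show ?thesis
    proof (cases "e = 0 \<or> (\<exists>Q \<subseteq> J' - {?N}. e = (\<Prod>j\<in>Q. zvar j - f j))")
      case True
      have eA: "e \<in> A" using True prodA subring_zero[OF A] by blast
      show ?thesis unfolding RJ
      proof (rule smith_adjoin_const)
        show "F \<in> carrier_mat (Suc r) (Suc r)" "mat_over R F" using less.prems(5,6) RJ by auto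
        show "(if i < r then \<tau> i else \<tau> r * e) \<in> A" if "i < Suc r" for i
          using \<tau>A[of i] \<tau>A[of r] eA subring_mult[OF A] that by auto
        show "\<exists>c\<in>A. (if Suc i < r then \<tau> (Suc i) else \<tau> r * e) = (if i < r then \<tau> i else \<tau> r * e) * c"
          if "Suc i < Suc r" for i using chainA[OF _ eA, of i] that by simp
        show "det_ideal R (Suc r) k F (\<Prod>i<k. if i < r then \<tau> i else \<tau> r * e)" if "k \<le> Suc r" for k
          using less.prems(7)[OF that] RJ by simp
        show "eqv D (Suc r) F (diag_of (Suc r) (\<lambda>i. if i < r then \<tau> i else \<tau> r * e))"
        proof (rule less.hyps[OF card J'_up NJ' disj(2) True less.prems(5)])
          show "mat_over D F" using mat_over_mono[OF less.prems(6)] R_sub_D RJ by simp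
          show "det_ideal D (Suc r) k F (\<Prod>i<k. if i < r then \<tau> i else \<tau> r * e)" if "k \<le> Suc r" for k
            using det_ideal_mono[OF less.prems(7)[OF that]] R_sub_D RJ by simp
        qed
        show "eqv A (Suc r) G (diag_of (Suc r) (\<lambda>i. if i < r then \<tau> i else \<tau> r * e))"
          if "G \<in> carrier_mat (Suc r) (Suc r)" "mat_over A G"
            "\<And>k. k \<le> Suc r \<Longrightarrow> det_ideal A (Suc r) k G (\<Prod>i<k. if i < r then \<tau> i else \<tau> r * e)" for G
          using less.hyps[OF card J'_up NJ' disj(1) True that] .
      qed
    next
      case False
      then obtain Q where Q: "Q \<subseteq> J - {?N}" "e = (\<Prod>j\<in>Q. zvar j - f j)" using less.prems(4) by blast
      have xQ: "x \<in> Q"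
      proof (rule ccontr)
        assume "x \<notin> Q"
        then have "Q \<subseteq> J' - {?N}" using Q(1) unfolding J'_def by auto
        then show False using False Q(2) by blast
      qed
      define e' where "e' = (\<Prod>j\<in>Q - {x}. zvar j - f j)"
      have Q': "Q - {x} \<subseteq> J' - {?N}" using Q(1) unfolding J'_def by auto
      have e'A: "e' \<in> A" unfolding e'_def by (rule prodA[OF Q'])
      have ee': "e = y * e'" unfolding Q(2) e'_def y_eq by (rule prod.remove) (use xQ in auto)
      have nz: "zvar j - f j \<noteq> 0" if j: "j \<noteq> ?N" for j
      proof
        assume "zvar j - f j = 0"
        then have "poly [:- f j, 1:] (zvar j) = 0" by simp
        moreover have "[:- f j, 1:] \<in> polys_over (Pin {j<..})"
          using subring_uminus[OF Pin_subring fP[OF j]] subring_one[OF Pin_subring] subring_zero[OF Pin_subring]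
          by (auto intro!: polys_overI simp: coeff_pCons split: nat.splits)
        ultimately have "[:- f j, 1:] = 0" using Pin_unique[of "[:- f j, 1:]" "{j<..}" j] by simp
        then show False by simp
      qed
      have e'0: "e' \<noteq> 0" unfolding e'_def using nz Q' by auto
      have eS: "\<tau> r * e = y * (\<tau> r * e')" unfolding ee' by simp
      show ?thesis unfolding RJ eS
      proof (rule smith_adjoin_variable)
        show "F \<in> carrier_mat (Suc r) (Suc r)" "mat_over R F" using less.prems(5,6) RJ by auto
        show "\<tau> i \<in> A \<and> \<tau> i \<noteq> 0" if "i < r" for i using \<tau>A[of i] \<tau>[of i] that by simp
        show "\<tau> r * e' \<in> A" "\<tau> r * e' \<noteq> 0" using \<tau>A[of r] \<tau>[of r] e'A e'0 subring_mult[OF A] by auto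
        show "\<exists>c\<in>A. (if Suc i < r then \<tau> (Suc i) else \<tau> r * e') = \<tau> i * c" if "i < r" for i
          by (rule chainA[OF that e'A])
        show "det_ideal R (Suc r) k F (\<Prod>i<k. if i < r then \<tau> i else y * (\<tau> r * e'))" if "k \<le> Suc r" for k
          using less.prems(7)[OF that] unfolding eS RJ by blast
        show "eqv A (Suc r) G (diag_of (Suc r) (\<lambda>i. if i < r then \<tau> i else 0))"
          if G: "G \<in> carrier_mat (Suc r) (Suc r)" "mat_over A G"
            "\<And>k. k \<le> Suc r \<Longrightarrow> det_ideal A (Suc r) k G (\<Prod>i<k. if i < r then \<tau> i else 0)" for G
        proof -
          have "eqv A (Suc r) G (diag_of (Suc r) (\<lambda>i. if i < r then \<tau> i else \<tau> r * 0))"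
            by (rule less.hyps[OF card J'_up NJ' disj(1) _ G(1,2)]) (use G(3) in \<open>unfold mult_zero_right, blast+\<close>)
          then show ?thesis unfolding mult_zero_right .
        qed
        show "eqv D (Suc r) G (diag_of (Suc r) (\<lambda>i. if i < r then \<tau> i else \<tau> r * e'))"
          if G: "G \<in> carrier_mat (Suc r) (Suc r)" "mat_over R G"
            "\<And>k. k \<le> Suc r \<Longrightarrow> det_ideal R (Suc r) k G (\<Prod>i<k. if i < r then \<tau> i else \<tau> r * e')" for G
        proof (rule less.hyps[OF card J'_up NJ' disj(2) _ G(1)])
          show "e' = 0 \<or> (\<exists>Q\<subseteq>J' - {?N}. e' = (\<Prod>j\<in>Q. zvar j - f j))" using Q' unfolding e'_def by blast
          show "mat_over D G" using mat_over_mono[OF G(2) R_sub_D] .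
          show "det_ideal D (Suc r) k G (\<Prod>i<k. if i < r then \<tau> i else \<tau> r * e')" if "k \<le> Suc r" for k
            using det_ideal_mono[OF G(3)[OF that] R_sub_D] .
        qed
      qed
    qed
  qed
qed

section \<open>Prime elements and greatest common divisors\<close>

lemma dvd_times_primes_cancel:
  fixes c :: "'r::idom"
  assumes "\<forall>p\<in>#M. prime_elem p \<and> \<not> p dvd c" "c dvd w * prod_mset M"
  shows "c dvd w"
  using assms
proof (induction M)
  case (add p M)
  then have p: "prime_elem p" "\<not> p dvd c" by auto
  obtain k where k: "w * (p * prod_mset M) = c * k"
    using add.prems(2) unfolding prod_mset.add_mset by (rule dvdE)
  then have "p dvd c * k" by (metis dvd_triv_left mult.left_commute)
  then obtain k' where k': "k = p * k'" using p prime_elem_dvd_mult_iff[OF p(1)] by (auto elim: dvdE)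
  have "p * (w * prod_mset M) = p * (c * k')" using k unfolding k' by (simp add: ac_simps)
  then have "w * prod_mset M = c * k'" using p(1) by (simp add: prime_elem_def)
  then show ?case using add.IH add.prems(1) by auto
qed simp

lemma primes_dvd_right_factor:
  fixes a :: "'r::idom"
  assumes "\<forall>p\<in>#M. prime_elem p \<and> \<not> p dvd a" "prod_mset M dvd a * b"
  shows "prod_mset M dvd b"
  using assms
proof (induction M arbitrary: b)
  case (add p M)
  have p: "prime_elem p" "\<not> p dvd a" using add.prems(1) by auto
  obtain k where k: "a * b = p * prod_mset M * k"
    using add.prems(2) unfolding prod_mset.add_mset by (rule dvdE)
  have "p dvd a * b" unfolding k mult.assoc by simp
  then obtain b' where b': "b = p * b'" using p prime_elem_dvd_mult_iff[OF p(1)] by (auto elim: dvdE)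
  have "p * (a * b') = p * (prod_mset M * k)" using k unfolding b' by (simp add: ac_simps)
  then have "a * b' = prod_mset M * k" using p(1) by (simp add: prime_elem_def)
  then have "prod_mset M dvd b'" using add.IH[of b'] add.prems(1) by auto
  then show ?case unfolding b' by simp
qed simp

text \<open>Primes that divide the whole set are split off one after the other. When none is left, every
  common divisor is a unit.\<close>

lemma gcd_exists_if_common_divisors_divide_primes:
  fixes X :: "'r::idom set"
  assumes "\<forall>p\<in>#M. prime_elem p" "\<And>c. \<forall>a\<in>X. c dvd a \<Longrightarrow> c dvd prod_mset M"
  shows "\<exists>d. is_gcd_of d X"
  using assms
proof (induction "size M" arbitrary: M X)
  case 0
  then have "is_gcd_of 1 X" unfolding is_gcd_of_def by simp
  then show ?case by blast
next
  case (Suc n)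
  show ?case
  proof (cases "\<exists>p\<in>#M. \<forall>a\<in>X. p dvd a")
    case True
    then obtain p M' where M: "M = add_mset p M'" and pX: "\<forall>a\<in>X. p dvd a" by (metis multi_member_split)
    have p: "prime_elem p" "p \<noteq> 0" using Suc.prems(1) unfolding M by (auto simp: prime_elem_def)
    define X' where "X' = {b. p * b \<in> X}"
    have X: "\<exists>b\<in>X'. a = p * b" if "a \<in> X" for a using pX that unfolding X'_def by (metis dvdE mem_Collect_eq)
    have "\<exists>d. is_gcd_of d X'"
    proof (rule Suc.hyps(1)[of M'])
      show "n = size M'" "\<forall>p\<in>#M'. prime_elem p" using Suc.hyps(2) Suc.prems(1) unfolding M by auto
      fix c assume "\<forall>a\<in>X'. c dvd a"
      then have "\<forall>a\<in>X. p * c dvd a" using X by fastforce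
      then have "p * c dvd p * prod_mset M'" using Suc.prems(2)[of "p * c"] unfolding M prod_mset.add_mset by blast
      then show "c dvd prod_mset M'" using p(2) by simp
    qed
    then obtain d where d: "is_gcd_of d X'" ..
    have "p * d dvd a" if "a \<in> X" for a using X[OF that] d unfolding is_gcd_of_def by auto
    moreover have "c dvd p * d" if c: "\<forall>a\<in>X. c dvd a" for c
    proof (cases "p dvd c")
      case True
      then obtain c' where c': "c = p * c'" ..
      have "\<forall>b\<in>X'. c' dvd b" using c p(2) unfolding X'_def c' by auto
      then show ?thesis using d unfolding is_gcd_of_def c' by auto
    next
      case False
      have "c dvd b" if "b \<in> X'" for b
        using dvd_times_primes_cancel[of "{#p#}" c b] c that False p(1) unfolding X'_def by (simp add: mult.commute)
      then show ?thesis using d unfolding is_gcd_of_def by auto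
    qed
    ultimately have "is_gcd_of (p * d) X" unfolding is_gcd_of_def by blast
    then show ?thesis by blast
  next
    case False
    have "c dvd 1" if c: "\<forall>a\<in>X. c dvd a" for c
    proof (rule dvd_times_primes_cancel[of M])
      show "\<forall>p\<in>#M. prime_elem p \<and> \<not> p dvd c" using False c Suc.prems(1) dvd_trans by blast
      show "c dvd 1 * prod_mset M" using Suc.prems(2)[OF c] by simp
    qed
    then have "is_gcd_of 1 X" unfolding is_gcd_of_def by simp
    then show ?thesis by blast
  qed
qed

subsection \<open>Primes of polynomial rings\<close>

text \<open>Primes relative to a subring; they are followed from \<open>K[z_n]\<close> to rings with more and more variables.\<close>

definition prime_in :: "'a::idom set \<Rightarrow> 'a \<Rightarrow> bool" where
  "prime_in A p \<longleftrightarrow> p \<in> A \<and> p \<noteq> 0 \<and> (\<forall>c\<in>A. p * c \<noteq> 1) \<and>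
    (\<forall>a\<in>A. \<forall>b\<in>A. a * b \<in> (*) p ` A \<longrightarrow> a \<in> (*) p ` A \<or> b \<in> (*) p ` A)"

lemma prime_in_UNIV: "prime_in UNIV p \<Longrightarrow> prime_elem p"
proof -
  have "x \<in> (*) p ` UNIV \<longleftrightarrow> p dvd x" for x by (auto simp: dvd_def)
  then show "prime_in UNIV p \<Longrightarrow> prime_elem p" unfolding prime_in_def prime_elem_def by (auto elim: dvdE)
qed

text \<open>A polynomial ring over the domain \<open>A / p\<close> is a domain. In terms of coefficients: if \<open>p\<close> divides the
product of the constant terms, it divides one of them, and this term can be removed.\<close>

lemma prime_divides_all_coeffs:
  fixes a b :: "'a::idom poly"
  assumes A: "subring_set A" and p: "prime_in A p"
    and "a \<in> polys_over A" "b \<in> polys_over A" "a * b \<in> polys_over ((*) p ` A)"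
  shows "a \<in> polys_over ((*) p ` A) \<or> b \<in> polys_over ((*) p ` A)"
proof -
  let ?m = "(*) p ` A"
  have m0: "0 \<in> ?m" using subring_zero[OF A] by force
  have m_mult: "c * x \<in> ?m" if "c \<in> ?m" "x \<in> A" for c x
    using that subring_mult[OF A] by (auto simp: mult.assoc)
  have m_minus: "c - x \<in> ?m" if "c \<in> ?m" "x \<in> ?m" for c x
    using that subring_minus[OF A] by (auto simp: right_diff_distrib[symmetric])
  have tail: "q \<in> polys_over B" "c \<in> B" if "pCons c q \<in> polys_over B" for c :: 'a and q B
    using polys_over_coeff[OF that, of "Suc _"] polys_over_coeff[OF that, of 0] by (auto intro: polys_overI)
  have cons: "pCons c q \<in> polys_over B" if "c \<in> B" "q \<in> polys_over B" for c :: 'a and q B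
    using that by (auto intro!: polys_overI simp: coeff_pCons polys_over_coeff split: nat.splits)
  have strip: "q \<in> polys_over ?m"
    if "Polynomial.smult c r + pCons 0 q \<in> polys_over ?m" "c \<in> ?m" "r \<in> polys_over A" for c q r
  proof (rule polys_overI)
    fix i
    have "coeff (Polynomial.smult c r + pCons 0 q) (Suc i) - c * coeff r (Suc i) \<in> ?m"
      using that by (intro m_minus m_mult polys_over_coeff)
    then show "coeff q i \<in> ?m" by simp
  qed
  show ?thesis using assms(3-5)
  proof (induction a arbitrary: b)
    case 0
    show ?case using m0 by (auto intro: polys_overI)
  next
    case (pCons a0 a)
    note IH = pCons.IH and aA = pCons.prems(1)
    show ?case using pCons.prems(2,3)
    proof (induction b)
      case 0
      show ?case using m0 by (auto intro: polys_overI)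
    next
      case (pCons b0 b)
      have "a0 * b0 \<in> ?m" using polys_over_coeff[OF pCons.prems(2), of 0] by (simp add: coeff_mult mult.commute)
      then consider "a0 \<in> ?m" | "b0 \<in> ?m"
        using p tail(2)[OF aA] tail(2)[OF pCons.prems(1)] unfolding prime_in_def by blast
      then show ?case
      proof cases
        case 1
        have "pCons a0 a * pCons b0 b = Polynomial.smult a0 (pCons b0 b) + pCons 0 (a * pCons b0 b)"
          by (rule mult_pCons_left)
        then have "Polynomial.smult a0 (pCons b0 b) + pCons 0 (a * pCons b0 b) \<in> polys_over ?m"
          using pCons.prems(2) by (simp only:)
        then have "a * pCons b0 b \<in> polys_over ?m" using strip 1 pCons.prems(1) by blast
        then have "a \<in> polys_over ?m \<or> pCons b0 b \<in> polys_over ?m"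
          using IH[OF tail(1)[OF aA] pCons.prems(1)] by blast
        then show ?thesis using cons 1 by blast
      next
        case 2
        have "pCons a0 a * pCons b0 b = Polynomial.smult b0 (pCons a0 a) + pCons 0 (pCons a0 a * b)"
          by (rule mult_pCons_right)
        then have "Polynomial.smult b0 (pCons a0 a) + pCons 0 (pCons a0 a * b) \<in> polys_over ?m"
          using pCons.prems(2) by (simp only:)
        then have "pCons a0 a * b \<in> polys_over ?m" using strip 2 aA by blast
        then have "pCons a0 a \<in> polys_over ?m \<or> b \<in> polys_over ?m"
          using pCons.IH[OF tail(1)[OF pCons.prems(1)]] by blast
        then show ?thesis using cons 2 by blast
      qed
    qed
  qed
qed

lemma polys_in_as_poly:
  fixes p :: "('n::{finite,linorder}, 'a::field) mpoly"
  assumes "x \<notin> J"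
  shows "p \<in> polys_in (insert x J) \<longleftrightarrow> (\<exists>q\<in>polys_over (polys_in J). poly q (Var x) = p)"
proof
  assume "\<exists>q\<in>polys_over (polys_in J). poly q (Var x) = p"
  then obtain q where q: "q \<in> polys_over (polys_in J)" "poly q (Var x) = p" by blast
  have "q \<in> polys_over (polys_in (insert x J))"
    using q(1) polys_over_mono[OF polys_in_mono[of J "insert x J"]] by blast
  then show "p \<in> polys_in (insert x J)"
    using poly_in_subring[OF polys_in_subring _ Var_in[of x "insert x J"]] q(2) by auto
qed (use poly_in_Var_exists in blast)

lemma poly_in_Var_eq:
  fixes q :: "('n::{finite,linorder}, 'a::field) mpoly poly"
  assumes "q \<in> polys_over (polys_in J)" "q' \<in> polys_over (polys_in J)" "x \<notin> J" "poly q (Var x) = poly q' (Var x)"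
  shows "q = q'"
proof -
  have "q - q' \<in> polys_over (polys_in J)"
    using assms(1,2) by (rule subring_minus[OF polys_over_subring[OF polys_in_subring]])
  then have "q - q' = 0" using assms(3,4) by (intro poly_in_Var_unique[of "q - q'" J x]) auto
  then show ?thesis by simp
qed

lemma prime_in_insert:
  fixes p :: "('n::{finite,linorder}, 'a::field) mpoly"
  assumes p: "prime_in (polys_in J) p" and x: "x \<notin> J"
  shows "prime_in (polys_in (insert x J)) p"
proof -
  let ?A = "polys_in J :: ('n, 'a) mpoly set" and ?B = "polys_in (insert x J) :: ('n, 'a) mpoly set"
  note A = polys_in_subring[of J, where ?'a = 'a]
  note B = polys_in_as_poly[OF x]
  have pA: "p \<in> ?A" "p \<noteq> 0" using p unfolding prime_in_def by auto
  have multiples: "poly q (Var x) \<in> (*) p ` ?B \<longleftrightarrow> q \<in> polys_over ((*) p ` ?A)" if q: "q \<in> polys_over ?A" for q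
  proof
    assume "poly q (Var x) \<in> (*) p ` ?B"
    then obtain b where b: "b \<in> ?B" "poly q (Var x) = p * b" by (auto elim: imageE)
    obtain c where "c \<in> polys_over ?A" "poly c (Var x) = b" using B b(1) by blast
    then have c: "c \<in> polys_over ?A" "poly q (Var x) = p * poly c (Var x)" using b(2) by simp_all
    have "q = Polynomial.smult p c"
      using c q pA by (intro poly_in_Var_eq[OF _ _ x] polys_over_smult[OF A]) auto
    then show "q \<in> polys_over ((*) p ` ?A)" using c(1) by (auto intro!: polys_overI simp: polys_over_coeff)
  next
    assume "q \<in> polys_over ((*) p ` ?A)"
    then obtain c where c: "c \<in> polys_over ?A" "map_poly ((*) p) c = q"
      using lift_map_poly[of q "(*) p" ?A] subring_zero[OF A] by auto
    have "q = Polynomial.smult p c" unfolding c(2)[symmetric] by (intro poly_eqI) (simp add: coeff_map_poly)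
    then have "poly q (Var x) = p * poly c (Var x)" by simp
    moreover have "poly c (Var x) \<in> ?B" using B c(1) by blast
    ultimately show "poly q (Var x) \<in> (*) p ` ?B" by blast
  qed
  have "p * c \<noteq> 1" if c: "c \<in> ?B" for c
  proof
    assume e: "p * c = 1"
    obtain q where q: "q \<in> polys_over ?A" "poly q (Var x) = c" using B c by blast
    have "Polynomial.smult p q = 1"
      using q e pA subring_one[OF polys_over_subring[OF A]]
      by (intro poly_in_Var_eq[OF _ _ x] polys_over_smult[OF A]) auto
    then have "coeff (Polynomial.smult p q) 0 = coeff 1 0" by simp
    then have "p * coeff q 0 = 1" by simp
    then show False using p polys_over_coeff[OF q(1)] unfolding prime_in_def by blast
  qed
  moreover have "a \<in> (*) p ` ?B \<or> b \<in> (*) p ` ?B" if ab: "a \<in> ?B" "b \<in> ?B" "a * b \<in> (*) p ` ?B" for a b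
  proof -
    obtain qa qb where q: "qa \<in> polys_over ?A" "poly qa (Var x) = a" "qb \<in> polys_over ?A" "poly qb (Var x) = b"
      using B ab(1,2) by blast
    have "qa * qb \<in> polys_over ((*) p ` ?A)"
      using ab(3) multiples[OF subring_mult[OF polys_over_subring[OF A] q(1,3)]] q(2,4) by simp
    then show ?thesis using prime_divides_all_coeffs[OF A p q(1,3)] multiples q by blast
  qed
  moreover have "p \<in> ?B" using pA(1) polys_in_mono[of J "insert x J"] by blast
  ultimately show ?thesis using pA(2) unfolding prime_in_def by blast
qed

lemma prime_in_imp_prime_elem:
  fixes p :: "('n::{finite,linorder}, 'a::field) mpoly"
  assumes "prime_in (polys_in J) p" shows "prime_elem p"
proof -
  have "prime_in (polys_in (J \<union> X)) p" if "finite X" for X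
    using that
  proof (induction X rule: finite_induct)
    case (insert x X)
    then show ?case using prime_in_insert[of "J \<union> X" p x] by (cases "x \<in> J") (auto simp: insert_absorb)
  qed (use assms in simp)
  from this[of UNIV] show ?thesis by (intro prime_in_UNIV) (simp add: polys_in_UNIV)
qed

subsection \<open>Polynomials in one of the variables\<close>

text \<open>The embedding of the univariate polynomials that sends the variable to \<open>z_x\<close>.\<close>

definition univ :: "'n \<Rightarrow> 'a::field poly \<Rightarrow> ('n::{finite,linorder}, 'a) mpoly" where
  "univ x q = poly (map_poly (Poly_Mapping.single 0) q) (Var x)"

lemma polys_in_empty: "polys_in {} = range (Poly_Mapping.single 0 :: 'a::field \<Rightarrow> ('n::{finite,linorder}, 'a) mpoly)"
proof -
  have "c \<in> range (Poly_Mapping.single 0)" if "c \<in> polys_in {}" for c :: "('n, 'a) mpoly"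
  proof -
    have "Poly_Mapping.keys c \<subseteq> {0}" using that unfolding polys_in_def by auto
    then have "c = Poly_Mapping.single 0 (Poly_Mapping.lookup c 0)"
      by (intro poly_mapping_eqI) (auto simp: lookup_single when_def in_keys_iff)
    then show ?thesis by blast
  qed
  then show ?thesis unfolding polys_in_def by (auto split: if_splits)
qed

lemma single_0_sum: "Poly_Mapping.single 0 (sum f I) = (\<Sum>i\<in>I. Poly_Mapping.single 0 (f i))"
  by (induction I rule: infinite_finite_induct) (simp_all add: single_add)

lemma univ_mult:
  fixes x :: "'n::{finite,linorder}" and p q :: "'a::field poly"
  shows "univ x (p * q) = univ x p * univ x q"
proof -
  have "map_poly (Poly_Mapping.single 0) (p * q) = (map_poly (Poly_Mapping.single 0) p :: ('n, 'a) mpoly poly) * map_poly (Poly_Mapping.single 0) q"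
    by (intro poly_eqI) (simp add: coeff_map_poly coeff_mult single_0_sum mult_single)
  then show ?thesis unfolding univ_def by simp
qed

lemma univ_const: "univ x [:c:] = Poly_Mapping.single 0 c"
  unfolding univ_def by (simp add: map_poly_pCons)

lemma univ_one: "univ x 1 = 1"
  unfolding one_pCons univ_const single_one ..

lemma map_single_over: "map_poly (Poly_Mapping.single 0) q \<in> polys_over (polys_in {} :: ('n::{finite,linorder}, 'a::field) mpoly set)"
  unfolding polys_in_empty by (intro polys_overI) (simp add: coeff_map_poly)

lemma univ_inj:
  fixes x :: "'n::{finite,linorder}" and p q :: "'a::field poly"
  assumes "univ x p = univ x q" shows "p = q"
proof (rule poly_eqI)
  fix i
  have "map_poly (Poly_Mapping.single 0) p = (map_poly (Poly_Mapping.single 0) q :: ('n, 'a) mpoly poly)"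
    using assms unfolding univ_def by (intro poly_in_Var_eq[OF map_single_over map_single_over]) auto
  then have "coeff (map_poly (Poly_Mapping.single 0) p) i = (coeff (map_poly (Poly_Mapping.single 0) q) i :: ('n, 'a) mpoly)" by simp
  then show "coeff p i = coeff q i" by (simp add: coeff_map_poly) (metis lookup_single_eq)
qed

lemma range_univ: "range (univ x) = polys_in {x}"
proof (intro equalityI subsetI)
  fix p assume "p \<in> range (univ x)"
  then show "p \<in> polys_in {x}"
    using map_single_over polys_in_as_poly[of x "{}"] unfolding univ_def by auto
next
  fix p :: "('a, 'b) mpoly" assume "p \<in> polys_in {x}"
  then obtain q where q: "q \<in> polys_over (polys_in {})" "poly q (Var x) = p" using polys_in_as_poly[of x "{}" p] by auto
  obtain q' where "map_poly (Poly_Mapping.single 0) q' = q"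
    using lift_map_poly[OF q(1)[unfolded polys_in_empty]] by auto
  then show "p \<in> range (univ x)" using q(2) unfolding univ_def by blast
qed

lemma prime_elem_univ: assumes "prime_elem q" shows "prime_elem (univ x q)"
proof (rule prime_in_imp_prime_elem)
  note one = univ_one[of x]
  have zero: "univ x 0 = 0" unfolding univ_def by simp
  have "univ x q * univ x c \<noteq> 1" for c
    using univ_inj[of x "q * c" 1] assms unfolding univ_mult one prime_elem_def by (metis dvd_triv_left)
  moreover have "univ x a \<in> (*) (univ x q) ` polys_in {x} \<longleftrightarrow> q dvd a" for a
  proof -
    have "univ x a \<in> (*) (univ x q) ` range (univ x) \<longleftrightarrow> (\<exists>c. univ x a = univ x (q * c))" unfolding univ_mult by auto
    then show ?thesis unfolding range_univ dvd_def using univ_inj by metis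
  qed
  moreover have "univ x q \<noteq> 0" using univ_inj[of x q 0] assms zero unfolding prime_elem_def by auto
  moreover have "q dvd a \<or> q dvd b" if "q dvd a * b" for a b using that assms by (rule prime_elem_dvd_multD[rotated])
  ultimately show "prime_in (polys_in {x}) (univ x q)"
    unfolding prime_in_def range_univ[symmetric] by (auto simp: univ_mult[symmetric])
qed

text \<open>A univariate polynomial over a field is a product of primes, and these stay prime when the other variables
are adjoined.\<close>

lemma prime_factors_univariate:
  fixes h :: "('n::{finite,linorder}, 'a::field) mpoly"
  assumes "h \<in> polys_in {x}" "h \<noteq> 0"
  shows "\<exists>u M. u dvd 1 \<and> (\<forall>p\<in>#M. prime_elem p) \<and> h = u * prod_mset M"
proof -
  obtain q where h: "h = univ x q" using assms(1) unfolding range_univ[symmetric] by blast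
  have q: "q \<noteq> 0" using assms(2) unfolding h univ_def by auto
  obtain M where M: "prod_mset M = Polynomial.smult (inverse (lead_coeff q)) q" "\<forall>p\<in>#M. prime_elem p"
    using field_poly_prod_mset_prime_factorization[OF q] field_poly_in_prime_factorization_imp_prime by blast
  have "q = [:lead_coeff q:] * prod_mset M" unfolding M(1) using q by simp
  then have "h = univ x ([:lead_coeff q:] * prod_mset M)" unfolding h by (rule arg_cong)
  also have "\<dots> = Poly_Mapping.single 0 (lead_coeff q) * univ x (prod_mset M)" unfolding univ_mult univ_const ..
  also have "univ x (prod_mset N) = prod_mset (image_mset (univ x) N)" for N :: "'a poly multiset"
    by (induction N) (simp_all add: univ_mult univ_one)
  finally have e: "h = Poly_Mapping.single 0 (lead_coeff q) * prod_mset (image_mset (univ x) M)" .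
  have "Poly_Mapping.single 0 (lead_coeff q) * Poly_Mapping.single 0 (inverse (lead_coeff q)) = (1 :: ('n, 'a) mpoly)"
    using q by (simp add: mult_single)
  then have "(Poly_Mapping.single 0 (lead_coeff q) :: ('n, 'a) mpoly) dvd 1" by (metis dvd_triv_left)
  moreover have "\<forall>p\<in>#image_mset (univ x) M. prime_elem p" using M(2) prime_elem_univ by auto
  ultimately show ?thesis using e by blast
qed

subsection \<open>The linear factors\<close>

text \<open>Divisibility by \<open>z_x - f\<close> is vanishing under the substitution \<open>z_x = f\<close>.\<close>

lemma Var_minus_dvd_iff:
  fixes f :: "('n::{finite,linorder}, 'a::field) mpoly"
  assumes f: "f \<in> polys_in (UNIV - {x})" and q: "q \<in> polys_over (polys_in (UNIV - {x}))"
  shows "Var x - f dvd poly q (Var x) \<longleftrightarrow> poly q f = 0"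
proof
  let ?A = "polys_in (UNIV - {x}) :: ('n, 'a) mpoly set"
  note A = polys_in_subring[of "UNIV - {x}", where ?'a = 'a]
  assume "Var x - f dvd poly q (Var x)"
  then obtain c where c: "poly q (Var x) = (Var x - f) * c" ..
  obtain c' where c': "c' \<in> polys_over ?A" "poly c' (Var x) = c"
    using poly_in_Var_exists[of c x "UNIV - {x}"] by (auto simp: polys_in_UNIV insert_absorb)
  have "[:- f, 1:] \<in> polys_over ?A"
    using subring_uminus[OF A f] subring_one[OF A] subring_zero[OF A]
    by (auto intro!: polys_overI simp: coeff_pCons split: nat.splits)
  then have o: "[:- f, 1:] * c' \<in> polys_over ?A" using c'(1) by (rule subring_mult[OF polys_over_subring[OF A]])
  have "poly q (Var x) = poly ([:- f, 1:] * c') (Var x)" unfolding c poly_mult c'(2) by simp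
  then have "q = [:- f, 1:] * c'" by (intro poly_in_Var_eq[OF q o]) auto
  then have "poly q f = poly [:- f, 1:] f * poly c' f" by (simp only: poly_mult)
  then show "poly q f = 0" by simp
next
  assume "poly q f = 0"
  then obtain c where "q = [:- f, 1:] * c" unfolding poly_eq_0_iff_dvd by blast
  then have "poly q (Var x) = poly [:- f, 1:] (Var x) * poly c (Var x)" by (simp only: poly_mult)
  then show "Var x - f dvd poly q (Var x)" by simp
qed

lemma Var_minus_not_dvd:
  fixes f :: "('n::{finite,linorder}, 'a::field) mpoly"
  assumes f: "f \<in> polys_in (UNIV - {x})" and a: "a \<in> polys_in (UNIV - {x})" "a \<noteq> 0"
  shows "\<not> Var x - f dvd a"
  using Var_minus_dvd_iff[OF f polys_over_const[OF subring_zero[OF polys_in_subring] a(1)]] a(2) by simp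

lemma prime_elem_Var_minus:
  fixes f :: "('n::{finite,linorder}, 'a::field) mpoly"
  assumes f: "f \<in> polys_in (UNIV - {x})"
  shows "prime_elem (Var x - f)"
proof -
  let ?A = "polys_in (UNIV - {x}) :: ('n, 'a) mpoly set"
  note A = polys_in_subring[of "UNIV - {x}", where ?'a = 'a]
  have ev: "\<exists>q\<in>polys_over ?A. poly q (Var x) = p" for p
    using poly_in_Var_exists[of p x "UNIV - {x}"] by (simp add: polys_in_UNIV insert_absorb)
  have "Var x - f dvd a \<or> Var x - f dvd b" if d: "Var x - f dvd a * b" for a b
  proof -
    obtain qa qb where q: "qa \<in> polys_over ?A" "poly qa (Var x) = a" "qb \<in> polys_over ?A" "poly qb (Var x) = b"
      using ev by blast
    have "poly (qa * qb) f = 0"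
      using d Var_minus_dvd_iff[OF f subring_mult[OF polys_over_subring[OF A] q(1,3)]] q(2,4) by simp
    then show ?thesis using Var_minus_dvd_iff[OF f] q by auto
  qed
  moreover have "\<not> Var x - f dvd 1" using Var_minus_not_dvd[OF f subring_one[OF A]] by simp
  moreover have "Var x - f \<noteq> 0"
  proof
    assume "Var x - f = 0"
    then have "poly [:- f, 1:] (Var x) = poly 0 (Var x)" by simp
    then have "[:- f, 1:] = 0"
      using subring_uminus[OF A f] subring_one[OF A] subring_zero[OF A]
      by (intro poly_in_Var_eq[of _ "UNIV - {x}"]) (auto intro!: polys_overI simp: coeff_pCons split: nat.splits)
    then show False by simp
  qed
  ultimately show ?thesis unfolding prime_elem_def by blast
qed

text \<open>A divisor of a nonzero polynomial has no variables that do not occur in it, as degrees add up.\<close>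

lemma divisor_in_polys_in:
  fixes a b :: "('n::{finite,linorder}, 'a::field) mpoly"
  assumes "a * b \<in> polys_in J" "a * b \<noteq> 0"
  shows "a \<in> polys_in J"
proof -
  have "a \<in> polys_in (UNIV - {x})" if x: "x \<notin> J" for x
  proof -
    let ?A = "polys_in (UNIV - {x}) :: ('n, 'a) mpoly set"
    note A = polys_in_subring[of "UNIV - {x}", where ?'a = 'a]
    have ev: "\<exists>q\<in>polys_over ?A. poly q (Var x) = p" for p
      using poly_in_Var_exists[of p x "UNIV - {x}"] by (simp add: polys_in_UNIV insert_absorb)
    obtain qa qb where q: "qa \<in> polys_over ?A" "poly qa (Var x) = a" "qb \<in> polys_over ?A" "poly qb (Var x) = b"
      using ev by blast
    have ab: "a * b \<in> ?A" using assms(1) polys_in_mono[of J "UNIV - {x}"] x by blast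
    have "qa * qb = [:a * b:]"
      using q ab polys_over_const[OF subring_zero[OF A] ab] subring_mult[OF polys_over_subring[OF A]]
      by (intro poly_in_Var_eq[of _ "UNIV - {x}" _ x]) auto
    moreover from this have "qa \<noteq> 0" "qb \<noteq> 0" using assms(2) by auto
    ultimately have "degree qa = 0" using degree_mult_eq[of qa qb] by simp
    then obtain c where "qa = [:c:]" by (metis degree_eq_zeroE)
    then show ?thesis using q(1,2) polys_over_coeff[of qa ?A 0] by simp
  qed
  then show ?thesis unfolding polys_in_def by blast
qed

section \<open>Minors of a square matrix\<close>

text \<open>Minors with arbitrary row and column maps generate the same ideal as minors of submatrices: the
  former vanish when an index is repeated, and sorting the indices costs a sign.\<close>

lemma minors_subset_kminors:
  assumes "F \<in> carrier_mat n n" shows "minors k F \<subseteq> kminors n k F"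
proof
  fix m assume "m \<in> minors k F"
  then obtain I J where IJ: "m = det (submatrix F I J)" "I \<subseteq> {..<n}" "J \<subseteq> {..<n}" "card I = k" "card J = k"
    using assms unfolding minors_def by auto
  have e: "{i. i < n \<and> i \<in> X} = X" if "X \<subseteq> {..<n}" for X using that by auto
  have "submatrix F I J = mat k k (\<lambda>(i, j). F $$ (pick I i, pick J j))"
    unfolding submatrix_def using assms IJ by (simp add: e)
  then have "m = minor k (pick I) (pick J) F" unfolding IJ(1) minor_def by simp
  moreover have "pick X i < n" if "X \<subseteq> {..<n}" "card X = k" "i < k" for X i
    using that pick_le[of i n X] by (simp add: e)
  ultimately show "m \<in> kminors n k F" using IJ by (auto intro: kminorsI)
qed

lemma minor_permute_rows:
  assumes "\<sigma> permutes {0..<k}" shows "minor k (f \<circ> \<sigma>) g F = signof \<sigma> * minor k f g F"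
proof -
  have "\<sigma> i < k" if "i < k" for i using permutes_in_image[OF assms, of i] that by simp
  then have "mat k k (\<lambda>(i, j). F $$ ((f \<circ> \<sigma>) i, g j)) = mat k k (\<lambda>(i, j). mat k k (\<lambda>(i, j). F $$ (f i, g j)) $$ (\<sigma> i, j))"
    by (intro eq_matI) auto
  then show ?thesis unfolding minor_def using det_permute_rows[OF _ assms, of "mat k k (\<lambda>(i, j). F $$ (f i, g j))"] by simp
qed

lemma minor_transpose:
  assumes "F \<in> carrier_mat n n" "\<forall>i<k. f i < n \<and> g i < n"
  shows "minor k g f (transpose_mat F) = minor k f g F"
proof -
  have "mat k k (\<lambda>(i, j). transpose_mat F $$ (g i, f j)) = transpose_mat (mat k k (\<lambda>(i, j). F $$ (f i, g j)))"
    using assms by (intro eq_matI) auto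
  then show ?thesis unfolding minor_def by (simp add: det_transpose[of _ k])
qed

lemma sort_indices:
  fixes f :: "nat \<Rightarrow> nat"
  assumes "inj_on f {..<k}"
  shows "\<exists>\<sigma>. \<sigma> permutes {0..<k} \<and> (\<forall>i<k. f i = pick (f ` {..<k}) (\<sigma> i))"
proof -
  let ?I = "f ` {..<k}"
  define \<sigma> where "\<sigma> i = (if i < k then card {a \<in> ?I. a < f i} else i)" for i
  have p: "f i = pick ?I (\<sigma> i)" if "i < k" for i
    using pick_card_in_set[of "f i" ?I] that unfolding \<sigma>_def by simp
  have lt: "\<sigma> i < k" if i: "i < k" for i
  proof -
    have "card {a \<in> ?I. a < f i} < card ?I" using i by (intro psubset_card_mono) auto
    then show ?thesis using i card_image[OF assms] unfolding \<sigma>_def by simp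
  qed
  have inj: "inj_on \<sigma> {0..<k}"
  proof (rule inj_onI)
    fix i j assume ij: "i \<in> {0..<k}" "j \<in> {0..<k}" "\<sigma> i = \<sigma> j"
    then have "f i = f j" using p[of i] p[of j] by simp
    then show "i = j" using assms ij(1,2) by (auto dest: inj_onD)
  qed
  have "\<sigma> ` {0..<k} = {0..<k}" using lt by (intro endo_inj_surj inj) auto
  then have "\<sigma> permutes {0..<k}" using inj by (intro bij_imp_permutes) (auto simp: bij_betw_def \<sigma>_def)
  then show ?thesis using p by blast
qed

lemma kminors_subset_lin_minors:
  fixes F :: "'r::idom mat"
  assumes F: "F \<in> carrier_mat n n" shows "kminors n k F \<subseteq> lin UNIV (minors k F)"
proof
  fix m assume "m \<in> kminors n k F"
  then obtain f g where fg: "\<forall>i<k. f i < n \<and> g i < n" and m: "m = minor k f g F" unfolding kminors_def by blast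
  have U: "subring_set (UNIV :: 'r set)" unfolding subring_set_def by simp
  show "m \<in> lin UNIV (minors k F)"
  proof (cases "inj_on f {..<k} \<and> inj_on g {..<k}")
    case False
    then obtain i j where "i < k" "j < k" "i \<noteq> j" "f i = f j \<or> g i = g j" unfolding inj_on_def by auto
    then have "m = 0" unfolding m using minor_repeated_row[of i k j f g F] minor_repeated_col[of i k j g f F] by auto
    then show ?thesis by (simp add: lin.zero)
  next
    case True
    let ?I = "f ` {..<k}" and ?J = "g ` {..<k}"
    obtain \<sigma> where \<sigma>: "\<sigma> permutes {0..<k}" "\<forall>i<k. f i = pick ?I (\<sigma> i)" using sort_indices True by blast
    obtain \<tau> where \<tau>: "\<tau> permutes {0..<k}" "\<forall>i<k. g i = pick ?J (\<tau> i)" using sort_indices True by blast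
    have IJ: "?I \<subseteq> {..<n}" "?J \<subseteq> {..<n}" "card ?I = k" "card ?J = k" using fg True by (auto simp: card_image)
    have e: "{i. i < n \<and> i \<in> X} = X" if "X \<subseteq> {..<n}" for X using that by auto
    have pk: "pick X i < n" if "X \<subseteq> {..<n}" "card X = k" "i < k" for X i
      using that pick_le[of i n X] by (simp add: e)
    have \<tau>k: "\<tau> i < k" if "i < k" for i using permutes_in_image[OF \<tau>(1), of i] that by simp
    have sub: "minor k (pick ?I) (pick ?J) F \<in> minors k F"
    proof -
      have "submatrix F ?I ?J = mat k k (\<lambda>(i, j). F $$ (pick ?I i, pick ?J j))"
        unfolding submatrix_def using F IJ by (simp add: e)
      then have "minor k (pick ?I) (pick ?J) F = det (submatrix F ?I ?J)" unfolding minor_def by simp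
      then show ?thesis unfolding minors_def using IJ F by auto
    qed
    have "m = minor k (pick ?I \<circ> \<sigma>) (pick ?J \<circ> \<tau>) F"
      unfolding m minor_def using \<sigma>(2) \<tau>(2) by (intro arg_cong[of _ _ det] eq_matI) auto
    also have "\<dots> = signof \<sigma> * minor k (pick ?I) (pick ?J \<circ> \<tau>) F" by (rule minor_permute_rows[OF \<sigma>(1)])
    also have "minor k (pick ?I) (pick ?J \<circ> \<tau>) F = minor k (pick ?J \<circ> \<tau>) (pick ?I) (transpose_mat F)"
      using pk IJ \<tau>k by (intro minor_transpose[OF F, symmetric]) auto
    also have "\<dots> = signof \<tau> * minor k (pick ?J) (pick ?I) (transpose_mat F)" by (rule minor_permute_rows[OF \<tau>(1)])
    also have "minor k (pick ?J) (pick ?I) (transpose_mat F) = minor k (pick ?I) (pick ?J) F"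
      using pk IJ by (intro minor_transpose[OF F]) auto
    finally show ?thesis using lin_mult[OF U UNIV_I] lin_gen[OF U sub] by metis
  qed
qed

text \<open>Laplace expansion, repeatedly.\<close>

lemma kminors_descend:
  fixes F :: "'r::comm_ring_1 mat"
  assumes "k \<le> j" shows "kminors n j F \<subseteq> lin UNIV (kminors n k F)"
  using assms
proof (induction j rule: dec_induct)
  have U: "subring_set (UNIV :: 'r set)" unfolding subring_set_def by simp
  case base
  show ?case using lin_gen[OF U] by blast
next
  have U: "subring_set (UNIV :: 'r set)" unfolding subring_set_def by simp
  case (step j)
  show ?case
  proof
    fix m assume "m \<in> kminors n (Suc j) F"
    then obtain f g where fg: "\<forall>i<Suc j. f i < n \<and> g i < n" and m: "m = minor (Suc j) f g F" unfolding kminors_def by blast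
    have "minor j (f \<circ> insert_index 0) (g \<circ> insert_index i) F \<in> lin UNIV (kminors n k F)" for i
      using fg by (intro subsetD[OF step.IH] kminorsI) (simp add: insert_index_less)
    then show "m \<in> lin UNIV (kminors n k F)" unfolding m minor_laplace[OF zero_less_Suc]
      by (intro lin_sum lin_mult[OF U]) auto
  qed
qed

lemma det_in_kminors: "F \<in> carrier_mat n n \<Longrightarrow> det F \<in> kminors n n F"
proof -
  assume F: "F \<in> carrier_mat n n"
  have "mat n n (\<lambda>(i, j). F $$ (id i, id j)) = F" using F by (intro eq_matI) auto
  then show ?thesis using kminorsI[of n id n id F] unfolding minor_def by simp
qed

text \<open>Multiplication by the greatest common divisor turns combinations of reduced minors into combinations of
minors.\<close>

lemma reduced_minors_ideal_UNIV_iff: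
  fixes F :: "'r::idom mat"
  assumes d: "\<forall>m\<in>minors k F. minors_gcd k F dvd m" "minors_gcd k F \<noteq> 0"
  shows "reduced_minors_ideal k F = UNIV \<longleftrightarrow> minors_gcd k F \<in> lin UNIV (minors k F)"
proof -
  let ?d = "minors_gcd k F" and ?R = "reduced_minors k F"
  interpret mod: Modules.module "(*) :: 'r \<Rightarrow> 'r \<Rightarrow> 'r" by unfold_locales (simp_all add: algebra_simps)
  show ?thesis unfolding reduced_minors_ideal_def
  proof
    assume "mod.span ?R = UNIV"
    then have "1 \<in> mod.span ?R" by simp
    then have "?d * 1 \<in> lin UNIV (minors k F)"
    proof (induction rule: mod.span_induct_alt)
      case base
      show ?case by (simp add: lin.zero)
    next
      case (step c x y)
      then have "?d * x \<in> minors k F" unfolding reduced_minors_def by auto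
      then have "c * (?d * x) + ?d * y \<in> lin UNIV (minors k F)" using step by (intro lin.step) auto
      then show ?case unfolding distrib_left mult.left_commute[of ?d c x] .
    qed
    then show "?d \<in> lin UNIV (minors k F)" by simp
  next
    have "\<exists>w\<in>mod.span ?R. v = ?d * w" if "v \<in> lin UNIV (minors k F)" for v
      using that
    proof induction
      case zero
      show ?case using mod.span_zero by force
    next
      case (step c m v)
      obtain x where x: "m = ?d * x" using d(1) step(2) by (auto elim: dvdE)
      then have "x \<in> ?R" using step(2) unfolding reduced_minors_def by auto
      moreover obtain w where w: "w \<in> mod.span ?R" "v = ?d * w" using step.IH by blast
      ultimately have "c * x + w \<in> mod.span ?R" by (metis mod.span_add mod.span_scale mod.span_base)
      moreover have "c * m + v = ?d * (c * x + w)" unfolding x w(2) distrib_left mult.left_commute[of ?d c x] ..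
      ultimately show ?case by (rule bexI[rotated])
    qed
    moreover assume "?d \<in> lin UNIV (minors k F)"
    ultimately obtain w where "w \<in> mod.span ?R" "?d = ?d * w" by blast
    moreover from this(2) have "w = 1" using d(2) by simp
    ultimately have "1 \<in> mod.span ?R" by simp
    then have "a * 1 \<in> mod.span ?R" for a by (rule mod.span_scale)
    then show "mod.span ?R = UNIV" by auto
  qed
qed

section \<open>Invariant factors\<close>

text \<open>If the determinant is a product of primes, the minors of each order have a greatest common divisor,
  since all their common divisors divide the determinant.\<close>

locale prime_factored_det =
  fixes F :: "'r::idom mat" and l :: nat and u :: 'r and M :: "'r multiset"
  assumes F: "F \<in> carrier_mat l l" and det: "det F = u * prod_mset M" and u: "u dvd 1"
    and M: "\<forall>p\<in>#M. prime_elem p"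
begin

lemma U: "subring_set (UNIV :: 'r set)" unfolding subring_set_def by simp

lemma dvd_lin:
  fixes c :: 'r
  assumes "\<forall>m\<in>X. c dvd m" "v \<in> lin UNIV X" shows "c dvd v"
proof -
  have "\<exists>a\<in>UNIV. v = c * a" using assms(1) by (intro lin_multiple[OF U assms(2)]) (auto elim: dvdE)
  then show ?thesis by auto
qed

lemma dvd_minors_iff: "(\<forall>m\<in>minors k F. c dvd m) \<longleftrightarrow> (\<forall>m\<in>kminors l k F. c dvd m)"
  using minors_subset_kminors[OF F] kminors_subset_lin_minors[OF F] dvd_lin[of "minors k F" c] by blast

lemma det_nonzero: "det F \<noteq> 0"
proof -
  have "0 \<notin># M" using M by (auto simp: prime_elem_def)
  then show ?thesis using u unfolding det by (auto simp: prod_mset_zero_iff)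
qed

lemma common_divisor_dvd_det:
  assumes "k \<le> l" "\<forall>m\<in>minors k F. c dvd m" shows "c dvd det F"
  using dvd_lin[of "kminors l k F" c "det F"] assms dvd_minors_iff kminors_descend[OF assms(1), of l F] det_in_kminors[OF F]
  by blast

lemma minors_gcd_0: "minors_gcd 0 F = 1" unfolding minors_gcd_def by simp

lemma minors_gcd_is_gcd: assumes k: "k \<le> l" shows "is_gcd_of (minors_gcd k F) (minors k F)"
proof (cases "k = 0")
  case True
  have "kminors l 0 F = {1}" unfolding kminors_def minor_def by (auto simp: det_dim_zero)
  then have "\<forall>m\<in>minors 0 F. c dvd m \<Longrightarrow> c dvd 1" for c unfolding dvd_minors_iff by simp
  then show ?thesis unfolding True minors_gcd_0 is_gcd_of_def by simp
next
  case False
  have "c dvd prod_mset M" if c: "\<forall>a\<in>minors k F. c dvd a" for c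
  proof -
    have "c dvd prod_mset M * u" using common_divisor_dvd_det[OF k c] unfolding det by (simp add: mult.commute)
    then show ?thesis using dvd_mult_unit_iff[OF u] by simp
  qed
  then have "\<exists>d. is_gcd_of d (minors k F)" by (rule gcd_exists_if_common_divisors_divide_primes[OF M])
  then show ?thesis using False someI_ex[of "\<lambda>d. is_gcd_of d (minors k F)"] unfolding minors_gcd_def by simp
qed

lemma minors_gcd_dvd: "k \<le> l \<Longrightarrow> m \<in> kminors l k F \<Longrightarrow> minors_gcd k F dvd m"
  using minors_gcd_is_gcd[of k] dvd_minors_iff[of k "minors_gcd k F"] unfolding is_gcd_of_def by blast

lemma dvd_minors_gcd: "k \<le> l \<Longrightarrow> (\<And>m. m \<in> kminors l k F \<Longrightarrow> c dvd m) \<Longrightarrow> c dvd minors_gcd k F"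
  using minors_gcd_is_gcd[of k] dvd_minors_iff[of k c] unfolding is_gcd_of_def by blast

lemma minors_gcd_nonzero: "k \<le> l \<Longrightarrow> minors_gcd k F \<noteq> 0"
  using common_divisor_dvd_det[of k "minors_gcd k F"] minors_gcd_is_gcd[of k] det_nonzero
  unfolding is_gcd_of_def by auto

lemma minors_gcd_det: "minors_gcd l F dvd det F" "det F dvd minors_gcd l F"
proof -
  show "minors_gcd l F dvd det F" using minors_gcd_dvd det_in_kminors[OF F] by blast
  show "det F dvd minors_gcd l F"
    using full_minor_multiple_of_det[OF U F] by (intro dvd_minors_gcd) (auto simp: dvd_def)
qed

lemma minors_gcd_Suc:
  assumes k: "k < l" shows "minors_gcd (Suc k) F = minors_gcd k F * invariant_factor (Suc k) F"
proof -
  have "minors_gcd k F dvd m" if "m \<in> kminors l (Suc k) F" for m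
    using dvd_lin[of "kminors l k F" "minors_gcd k F" m] minors_gcd_dvd[of k] kminors_descend[of k "Suc k" l F] that k
    by auto
  then have "minors_gcd k F dvd minors_gcd (Suc k) F" using k by (intro dvd_minors_gcd) auto
  then obtain q where q: "minors_gcd (Suc k) F = minors_gcd k F * q" ..
  moreover have "minors_gcd k F \<noteq> 0" using minors_gcd_nonzero k by simp
  ultimately have "invariant_factor (Suc k) F = q" unfolding invariant_factor_def by (intro the_equality) auto
  then show ?thesis using q by simp
qed

abbreviation "s i \<equiv> invariant_factor (Suc i) F"

lemma minors_gcd_prod: "k \<le> l \<Longrightarrow> minors_gcd k F = (\<Prod>i<k. s i)"
  by (induction k) (simp_all add: minors_gcd_0 minors_gcd_Suc)

lemma smith_form_diag: "smith_form F = diag_of l s"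
proof -
  have "det (map_mat to_fract F) \<noteq> 0" using det_nonzero by simp
  then have "rank_mat F = l"
    using F vec_space.det_rank_iff[of "map_mat to_fract F" l] unfolding rank_mat_def by simp
  then show ?thesis using F unfolding smith_form_def diag_of_def by (intro eq_matI) auto
qed

lemma det_ideal_iff:
  assumes k: "k \<le> l"
  shows "reduced_minors_ideal k F = UNIV \<longleftrightarrow> det_ideal UNIV l k F (minors_gcd k F)"
proof -
  have gcd: "\<forall>m\<in>minors k F. minors_gcd k F dvd m" using minors_gcd_is_gcd[OF k] unfolding is_gcd_of_def by blast
  have "lin UNIV (minors k F) = lin UNIV (kminors l k F)"
    using lin_mono[OF subset_UNIV minors_subset_kminors[OF F]] lin_trans[OF U kminors_subset_lin_minors[OF F]] by blast
  then show ?thesis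
    using reduced_minors_ideal_UNIV_iff[OF gcd minors_gcd_nonzero[OF k]] minors_gcd_dvd[OF k]
    unfolding det_ideal_def dvd_def by auto
qed

text \<open>Equivalent matrices have the same determinantal ideals, and those of the Smith form contain the
  products of its first diagonal entries.\<close>

lemma reduced_minors_ideal_of_equivalent:
  assumes e: "equivalent_mat F (smith_form F)" and k: "k \<le> l"
  shows "reduced_minors_ideal k F = UNIV"
proof -
  let ?S = "diag_of l s"
  obtain A B where AB: "A \<in> carrier_mat l l" "B \<in> carrier_mat l l" "unimodular A" "unimodular B" "F = A * ?S * B"
    using e unfolding equivalent_mat_def smith_form_diag by (auto simp: diag_of_def)
  have GL: "C \<in> GLs UNIV l" if "C \<in> carrier_mat l l" "unimodular C" for C :: "'r mat"
    using that GLs_iff_det[OF U that(1)] unfolding unimodular_def mat_over_def by (auto elim!: dvdE)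
  have "eqv UNIV l ?S F"
    by (rule eqv_sym[OF eqvI[OF GL[OF AB(1,3)] GL[OF AB(2,4)] AB(5)] diag_of_carrier])
  then obtain A' B' where AB': "A' \<in> GLs UNIV l" "B' \<in> GLs UNIV l" "?S = A' * F * B'" unfolding eqv_def by blast
  have "minor k id id ?S = (\<Prod>i<k. ?S $$ (id i, id i))"
    using k by (intro minor_upper_triangular) (auto simp: diag_of_def)
  also have "\<dots> = minors_gcd k F" unfolding minors_gcd_prod[OF k] using k by (intro prod.cong) (auto simp: diag_of_def)
  finally have d: "minor k id id ?S = minors_gcd k F" .
  have "minor k id id ?S \<in> kminors l k ?S" using k by (intro kminorsI) simp
  then have "minors_gcd k F \<in> kminors l k (A' * F * B')" unfolding d AB'(3)[symmetric] .
  then have "minors_gcd k F \<in> lin UNIV (kminors l k F)"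
    by (rule minors_mult_subset[OF U GLs_carrier[OF AB'(1)] GLs_over[OF AB'(1)] GLs_carrier[OF AB'(2)] GLs_over[OF AB'(2)] F])
  then show ?thesis unfolding det_ideal_iff[OF k] det_ideal_def using minors_gcd_dvd[OF k] unfolding dvd_def by auto
qed

end

subsection \<open>The invariant factors divide one another\<close>

lemma (in local_subring) euclidean_trivial: "euclidean_mod_radical A m (\<lambda>_. 0)"
proof
  show "\<exists>w\<in>A. (1 + x) * w = 1" if x: "x \<in> m" for x
  proof -
    have "1 + x \<notin> m" using m_minus[of "1 + x" x] x m_proper by auto
    moreover have "1 + x \<in> A" using x m_subset subring_one[OF A] by (auto intro: subring_add[OF A])
    ultimately have "inverse (1 + x) \<in> A" "1 + x \<noteq> 0" using units m_zero by auto
    then show ?thesis by (intro bexI[of _ "inverse (1 + x)"]) auto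
  qed
  show "\<exists>q\<in>A. a - q * b \<in> m \<or> (0 :: nat) < 0" if ab: "a \<in> A" "b \<in> A" "b \<notin> m" for a b
  proof -
    have "b \<noteq> 0" using ab m_zero by auto
    then have "a - (a * inverse b) * b = 0" by (simp add: mult.assoc)
    then show ?thesis using subring_mult[OF A ab(1) units[OF ab(2,3)]] m_zero by metis
  qed
qed (use A m_subset m_zero m_add m_mult in auto)

text \<open>The denominators that are possible for \<open>t\<close> form an ideal. If it were proper, a maximal ideal
would contain it, but the localization there provides a denominator outside.\<close>

lemma in_all_localizations:
  fixes A :: "'k::field set"
  assumes A: "subring_set A" and loc: "\<And>m. maximal_in A m \<Longrightarrow> t \<in> loc A (A - m)"
  shows "t \<in> A"
proof (rule ccontr)
  assume t: "t \<notin> A"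
  let ?I = "{a \<in> A. a * t \<in> A}"
  have "ideal_in A ?I" unfolding ideal_in_def
    using A by (auto simp: distrib_right mult.assoc intro: subring_closed)
  moreover have "1 \<notin> ?I" using t by simp
  ultimately obtain m where m: "maximal_in A m" "?I \<subseteq> m" using exists_maximal[OF A] by blast
  obtain a b where ab: "t = a / b" "a \<in> A" "b \<in> A - m" using loc[OF m(1)] unfolding loc_def by blast
  have "b \<noteq> 0" using ab(3) m(1) unfolding maximal_in_def ideal_in_def by auto
  then have "b \<in> ?I" using ab by simp
  then show False using m(2) ab(3) by blast
qed

text \<open>If all determinantal ideals are principal, their generators give a chain of invariant factors.
  Divisibility can be tested in the localizations at maximal ideals, and over a local ring a matrix with
  principal determinantal ideals is diagonalized by peeling off one factor at a time.\<close>

lemma principal_det_ideals_chain: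
  fixes A :: "'k::field set"
  assumes A: "subring_set A" and F: "F \<in> carrier_mat n n" "mat_over A F"
    and d: "\<And>k. k \<le> n \<Longrightarrow> det_ideal A n k F (d k) \<and> d k \<noteq> 0" "d 0 = 1" and k: "Suc k < n"
  shows "\<exists>c\<in>A. d k * d (Suc (Suc k)) = d (Suc k) ^ 2 * c"
proof -
  let ?t = "d k * d (Suc (Suc k)) / d (Suc k) ^ 2"
  have nz: "d (Suc k) \<noteq> 0" using d(1) k by simp
  have "?t \<in> loc A (A - m)" if m: "maximal_in A m" for m
  proof -
    interpret L: local_subring "loc A (A - m)" "loc m (A - m)" by (rule localization_at_maximal[OF A m])
    interpret E: euclidean_mod_radical "loc A (A - m)" "loc m (A - m)" "\<lambda>_. 0" by (rule L.euclidean_trivial)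
    have AL: "A \<subseteq> loc A (A - m)" using maximal_mult_set[OF A m] unfolding mult_set_def by (intro loc_incl) blast
    have "\<exists>c\<in>loc A (A - m). d k * d (Suc (Suc k)) = d (Suc k) ^ 2 * c"
      using d(1) det_ideal_mono[OF _ AL]
      by (intro E.det_ideals_divisibility[where d = d, OF F(1) mat_over_mono[OF F(2) AL] _ d(2) k]) auto
    then show ?thesis using nz by auto
  qed
  then have "?t \<in> A" by (rule in_all_localizations[OF A])
  then show ?thesis using nz by (intro bexI[of _ ?t]) auto
qed

lemma (in prime_factored_det) invariant_factors_chain:
  assumes J: "\<And>k. k \<le> l \<Longrightarrow> det_ideal UNIV l k F (minors_gcd k F)" and k: "Suc k < l"
  shows "s k dvd s (Suc k)"
proof -
  let ?A = "range (to_fract :: 'r \<Rightarrow> 'r fract)" and ?d = "\<lambda>k. to_fract (minors_gcd k F)"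
  have "\<exists>c\<in>?A. ?d k * ?d (Suc (Suc k)) = ?d (Suc k) ^ 2 * c"
  proof (rule principal_det_ideals_chain[OF _ _ _ _ _ k])
    show "subring_set ?A" by (rule to_fract_hom.subring_image[OF U])
    show "map_mat to_fract F \<in> carrier_mat l l" using F by simp
    show "mat_over ?A (map_mat to_fract F)" unfolding mat_over_def by simp
    show "det_ideal ?A l k (map_mat to_fract F) (?d k) \<and> ?d k \<noteq> 0" if "k \<le> l" for k
      using to_fract_hom.det_ideal_map[OF F J[OF that]] minors_gcd_nonzero[OF that] by simp
    show "?d 0 = 1" by (simp add: minors_gcd_0)
  qed
  then obtain c where "?d k * ?d (Suc (Suc k)) = ?d (Suc k) ^ 2 * to_fract c" by blast
  then have "to_fract (minors_gcd k F * minors_gcd (Suc (Suc k)) F) = to_fract (minors_gcd (Suc k) F ^ 2 * c)"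
    by (simp add: power2_eq_square)
  then have "minors_gcd k F * minors_gcd (Suc (Suc k)) F = minors_gcd (Suc k) F ^ 2 * c" by (simp only: to_fract_eq_iff)
  then have "(minors_gcd k F * minors_gcd (Suc k) F) * s (Suc k) = (minors_gcd k F * minors_gcd (Suc k) F) * (s k * c)"
    using minors_gcd_Suc[OF k] minors_gcd_Suc[of k] k by (simp add: power2_eq_square ac_simps)
  then have "s (Suc k) = s k * c" using minors_gcd_nonzero[of k] minors_gcd_nonzero[of "Suc k"] k by simp
  then show ?thesis by simp
qed

section \<open>Equivalence to the Smith form\<close>

lemma prime_elem_dvd_prod_finite:
  assumes "prime_elem p" "finite S" "p dvd prod g S" shows "\<exists>k\<in>S. p dvd g k"
  using assms(2,3)
proof (induction S rule: finite_induct)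
  case empty
  then show ?case using assms(1) unfolding prime_elem_def by simp
next
  case (insert k S)
  then show ?case using prime_elem_dvd_mult_iff[OF assms(1)] by auto
qed

text \<open>Matrices over the image of a domain in its fraction field come from matrices over the domain.\<close>

lemma equivalent_mat_of_eqv:
  fixes F S :: "'r::idom mat"
  assumes F: "F \<in> carrier_mat n n" and S: "S \<in> carrier_mat n n"
    and e: "eqv (range to_fract) n (map_mat to_fract F) (map_mat to_fract S)"
  shows "equivalent_mat F S"
proof -
  have lift: "\<exists>W\<in>carrier_mat n n. unimodular W \<and> map_mat to_fract W = V" if V: "V \<in> GLs (range to_fract) n" for V :: "'r fract mat"
  proof -
    have cV: "V \<in> carrier_mat n n" "mat_over (range to_fract) V" using V GLs_carrier GLs_over by blast+
    define W where "W = map_mat (inv_into UNIV to_fract) V"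
    have W: "W \<in> carrier_mat n n" unfolding W_def using cV by simp
    have WV: "map_mat to_fract W = V"
      unfolding W_def using cV(2) unfolding mat_over_def by (intro eq_matI) (auto simp: f_inv_into_f)
    have "subring_set (range to_fract :: 'r fract set)"
      by (rule to_fract_hom.subring_image) (simp add: subring_set_def)
    then obtain a where "det V * to_fract a = 1" using GLs_iff_det[OF _ cV] V by blast
    then have "to_fract (det W * a) = 1" unfolding WV[symmetric] by simp
    then have "det W * a = 1" by (metis to_fract_1 to_fract_eq_iff)
    then have "unimodular W" using W unfolding unimodular_def by (metis carrier_matD dvd_triv_left square_mat.simps)
    then show ?thesis using W WV by blast
  qed
  obtain A B where AB: "A \<in> GLs (range to_fract) n" "B \<in> GLs (range to_fract) n"
    "map_mat to_fract F = A * map_mat to_fract S * B" using e unfolding eqv_def by blast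
  obtain A' where A': "A' \<in> carrier_mat n n" "unimodular A'" "map_mat to_fract A' = A" using lift[OF AB(1)] by blast
  obtain B' where B': "B' \<in> carrier_mat n n" "unimodular B'" "map_mat to_fract B' = B" using lift[OF AB(2)] by blast
  have "map_mat to_fract F = map_mat to_fract (A' * S * B')"
    unfolding AB(3) A'(3)[symmetric] B'(3)[symmetric]
    by (simp only: to_fract_hom.mat_hom_mult[OF A'(1) S] to_fract_hom.mat_hom_mult[OF mult_carrier_mat[OF A'(1) S] B'(1)])
  then have "F = A' * S * B'" by (rule to_fract_hom.mat_hom_inj)
  then show ?thesis using A' B' F S unfolding equivalent_mat_def by auto
qed

text \<open>The linear factors are primes, no two of them are associated, and none divides \<open>h\<close>. So the square of a
linear factor does not divide the determinant, and a linear factor that divided an earlier invariant factor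
would divide the last one as well. Hence the earlier invariant factors divide \<open>h\<close>, and divisors of \<open>h\<close> are
polynomials in the last variable.\<close>

theorem theorem3p5:
  fixes F :: "('n::{finite,linorder}, 'a::field) mpoly mat"
    and f :: "'n \<Rightarrow> ('n, 'a) mpoly"
    and h :: "('n, 'a) mpoly"
    and l :: nat
  assumes "CARD('n) \<ge> 2"
    and "l \<ge> 1"
    and "F \<in> carrier_mat l l"
    and "\<And>i. i \<noteq> Max UNIV \<Longrightarrow> f i \<in> polys_in {i<..}"
    and "h \<in> polys_in {Max UNIV}"
    and "h \<noteq> 0"
    and "det F = (\<Prod>i \<in> UNIV - {Max UNIV}. Var i - f i) * h"
  shows "equivalent_mat F (smith_form F) \<longleftrightarrow>
    (\<forall>k \<in> {1..l}. reduced_minors_ideal k F = UNIV)"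
proof -
  note l = assms(2) and F = assms(3) and f = assms(4) and h = assms(5,6) and det = assms(7)
  let ?N = "Max UNIV :: 'n"
  define Q where "Q = UNIV - {?N}"
  define y where "y i = Var i - f i" for i
  define Y where "Y = image_mset y (mset_set Q)"
  have Y_prod: "prod_mset Y = (\<Prod>j\<in>Q. y j)" unfolding Y_def by (simp add: prod_unfold_prod_mset)
  have det_y: "det F = prod_mset Y * h" unfolding Y_prod Q_def y_def det ..
  have f': "f j \<in> polys_in (UNIV - {j})" if "j \<in> Q" for j
    using f[of j] that polys_in_mono[of "{j<..}" "UNIV - {j}"] unfolding Q_def by auto
  have y_prime: "prime_elem (y j)" if "j \<in> Q" for j unfolding y_def by (rule prime_elem_Var_minus[OF f'[OF that]])
  have Y_prime: "\<forall>p\<in>#Y. prime_elem p" using y_prime unfolding Y_def by auto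
  have y_h: "\<not> y j dvd h" if "j \<in> Q" for j
    using that h polys_in_mono[of "{?N}" "UNIV - {j}"] unfolding y_def Q_def
    by (intro Var_minus_not_dvd f') (auto simp: Q_def)
  have y_lt: "\<not> y j dvd y k" if jk: "j \<in> Q" "k \<in> Q" "j < k" for j k
    unfolding y_def[of j]
  proof (rule Var_minus_not_dvd[OF f'[OF jk(1)]])
    have "{k<..} \<subseteq> {k..}" by auto
    then have "f k \<in> polys_in {k..}" "Var k \<in> polys_in {k..}"
      using f[of k] jk(2) polys_in_mono[of "{k<..}" "{k..}"] Var_in[of k "{k..}"] unfolding Q_def by auto
    then have "y k \<in> polys_in {k..}" unfolding y_def by (intro subring_minus[OF polys_in_subring])
    moreover have "{k..} \<subseteq> UNIV - {j}" using jk(3) by auto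
    ultimately show "y k \<in> polys_in (UNIV - {j})" using polys_in_mono by blast
    show "y k \<noteq> 0" using y_prime[OF jk(2)] unfolding prime_elem_def by blast
  qed
  have y_y: "\<not> y j dvd y k" if jk: "j \<in> Q" "k \<in> Q" "j \<noteq> k" for j k
  proof (cases "j < k")
    case True
    then show ?thesis using y_lt jk by blast
  next
    case False
    then have "\<not> y k dvd y j" using y_lt jk by auto
    show ?thesis
    proof
      assume "y j dvd y k"
      then obtain c where c: "y k = y j * c" ..
      then have "y k dvd c" using \<open>\<not> y k dvd y j\<close> prime_elem_dvd_mult_iff[OF y_prime[OF jk(2)], of "y j" c] by auto
      then obtain c' where c': "c = y k * c'" ..
      have "y k * 1 = y k * (y j * c')" unfolding mult_1_right mult.left_commute[of "y k"] c'[symmetric] by (rule c)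
      then have "y j dvd 1" using y_prime[OF jk(2)] unfolding prime_elem_def by (metis dvd_triv_left mult_left_cancel)
      then show False using y_prime[OF jk(1)] unfolding prime_elem_def by blast
    qed
  qed
  have y_square: "\<not> y j * y j dvd det F" if j: "j \<in> Q" for j
  proof
    have "prod_mset Y = y j * (\<Prod>k\<in>Q - {j}. y k)" unfolding Y_prod using j by (intro prod.remove) auto
    then have "det F = y j * ((\<Prod>k\<in>Q - {j}. y k) * h)" unfolding det_y by (simp only: mult.assoc)
    moreover assume "y j * y j dvd det F"
    ultimately have "y j dvd (\<Prod>k\<in>Q - {j}. y k) * h" using y_prime[OF j] unfolding prime_elem_def by simp
    then have "y j dvd (\<Prod>k\<in>Q - {j}. y k)" using y_h[OF j] prime_elem_dvd_mult_iff[OF y_prime[OF j]] by blast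
    then show False using prime_elem_dvd_prod_finite[OF y_prime[OF j], of "Q - {j}" y] y_y[OF j] by auto
  qed
  obtain u H where H: "u dvd 1" "\<forall>p\<in>#H. prime_elem p" "h = u * prod_mset H"
    using prime_factors_univariate[OF h] by blast
  interpret prime_factored_det F l u "Y + H"
    by unfold_locales (use F H Y_prime det_y in \<open>auto simp: ac_simps\<close>)
  show ?thesis
  proof
    assume "equivalent_mat F (smith_form F)"
    then show "\<forall>k \<in> {1..l}. reduced_minors_ideal k F = UNIV" using reduced_minors_ideal_of_equivalent by auto
  next
    assume red: "\<forall>k \<in> {1..l}. reduced_minors_ideal k F = UNIV"
    have J: "det_ideal UNIV l k F (minors_gcd k F)" if "k \<le> l" for k
    proof (cases "k = 0")
      case True
      have "kminors l 0 F = {1}" unfolding kminors_def minor_def by (auto simp: det_dim_zero)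
      then show ?thesis unfolding True minors_gcd_0 det_ideal_def using lin_gen[OF U] by simp
    next
      case False
      then show ?thesis using red that det_ideal_iff[OF that] by simp
    qed
    obtain r where r: "l = Suc r" using l by (cases l) auto
    have chain: "s i dvd s (Suc i)" if "i < r" for i using invariant_factors_chain[OF J] that r by simp
    have dvd_last: "s i dvd s r" if "i \<le> r" for i
      using that by (induction rule: inc_induct) (auto intro: dvd_trans[OF chain])
    have prod_s: "(\<Prod>i<l. s i) dvd det F" "det F dvd (\<Prod>i<l. s i)"
      using minors_gcd_det minors_gcd_prod[of l] by simp_all
    have y_s: "\<not> y j dvd s i" if i: "i < r" and j: "j \<in> Q" for i j
    proof
      assume d: "y j dvd s i"
      then have "y j dvd s r" using dvd_last[of i] i dvd_trans by (metis less_imp_le)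
      then have "y j * y j dvd s i * s r" using d by (rule mult_dvd_mono[rotated])
      also have "s i * s r = prod s {i, r}" using i by simp
      also have "\<dots> dvd (\<Prod>i<l. s i)" using i r by (intro prod_dvd_prod_subset) auto
      also note prod_s(1)
      finally show False using y_square[OF j] by blast
    qed
    have Y_s: "\<forall>p\<in>#Y. prime_elem p \<and> \<not> p dvd s i" if "i < r" for i
      using y_s[OF that] y_prime unfolding Y_def by auto
    have s_h: "s i dvd h" if i: "i < r" for i
    proof (rule dvd_times_primes_cancel[OF Y_s[OF i]])
      have "s i dvd (\<Prod>i<l. s i)" using i r by (intro dvd_prodI) auto
      also note prod_s(1)
      finally show "s i dvd h * prod_mset Y" unfolding det_y by (simp only: mult.commute)
    qed
    have in_N: "a \<in> polys_in {?N} \<and> a \<noteq> 0" if b: "a dvd b" "b \<in> polys_in {?N}" "b \<noteq> 0" for a b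
      using b divisor_in_polys_in[of a _ "{?N}"] by (auto elim!: dvdE)
    have "prod_mset Y dvd s r"
    proof (rule primes_dvd_right_factor)
      show "\<forall>p\<in>#Y. prime_elem p \<and> \<not> p dvd (\<Prod>i<r. s i)"
      proof
        fix p assume "p \<in># Y"
        then obtain j where j: "j \<in> Q" "p = y j" unfolding Y_def by auto
        have "\<not> y j dvd (\<Prod>i<r. s i)" using prime_elem_dvd_prod_finite[OF y_prime[OF j(1)], of "{..<r}" s] y_s j(1) by auto
        then show "prime_elem p \<and> \<not> p dvd (\<Prod>i<r. s i)" using y_prime j by simp
      qed
      have "prod_mset Y dvd det F" unfolding det_y by simp
      also note prod_s(2)
      finally show "prod_mset Y dvd (\<Prod>i<r. s i) * s r" unfolding r by simp
    qed
    then obtain t where t: "s r = prod_mset Y * t" ..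
    have Y0: "prod_mset Y \<noteq> 0" using det_nonzero unfolding det_y by auto
    have "prod_mset Y * ((\<Prod>i<r. s i) * t) dvd prod_mset Y * h"
      using prod_s(1) unfolding det_y r prod.lessThan_Suc t mult.left_commute[of "prod s {..<r}"] .
    then have "(\<Prod>i<r. s i) * t dvd h" using Y0 unfolding dvd_mult_cancel_left by blast
    then have "t dvd h" by (rule dvd_mult_right)
    define \<tau> where "\<tau> i = (if i < r then s i else t)" for i
    have \<tau>_in: "\<tau> i \<in> polys_in {?N} \<and> \<tau> i \<noteq> 0" for i
      using in_N[OF _ h] s_h \<open>t dvd h\<close> unfolding \<tau>_def by auto
    have \<tau>_chain: "\<exists>c\<in>polys_in {?N}. \<tau> (Suc i) = \<tau> i * c" if i: "i < r" for i
    proof -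
      have "s i dvd t * prod_mset Y" using dvd_last[of i] i unfolding t by (simp add: mult.commute)
      then have "s i dvd t" by (rule dvd_times_primes_cancel[OF Y_s[OF i]])
      then have "\<tau> i dvd \<tau> (Suc i)" using chain[OF i] i unfolding \<tau>_def by auto
      then obtain c where c: "\<tau> (Suc i) = \<tau> i * c" ..
      then have "c dvd \<tau> (Suc i)" by simp
      then have "c \<in> polys_in {?N}" using in_N[of c "\<tau> (Suc i)"] \<tau>_in by blast
      then show ?thesis using c by blast
    qed
    let ?R = "range (to_fract :: ('n, 'a) mpoly \<Rightarrow> _)" and ?G = "map_mat to_fract F"
    define e where "e = to_fract (prod_mset Y)"
    have s_eq: "to_fract (s i) = (if i < r then to_fract (\<tau> i) else to_fract (\<tau> r) * e)" if "i \<le> r" for i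
      using that t unfolding \<tau>_def e_def by (auto simp: mult.commute)
    have diag: "diag_of (Suc r) (\<lambda>i. if i < r then to_fract (\<tau> i) else to_fract (\<tau> r) * e) = map_mat to_fract (smith_form F)"
      unfolding smith_form_diag to_fract_hom.map_diag_of r by (intro eq_matI) (auto simp: diag_of_def s_eq)
    have "eqv (ratpoly {} UNIV) (Suc r) ?G (diag_of (Suc r) (\<lambda>i. if i < r then to_fract (\<tau> i) else to_fract (\<tau> r) * e))"
    proof (rule smith_ratpoly[where f = "\<lambda>j. to_fract (f j)"])
      show "to_fract (f j) \<in> Pin {j<..}" if "j \<noteq> ?N" for j using f[OF that] unfolding Pin_def by blast
      show "to_fract (\<tau> i) \<in> Pin {?N} \<and> to_fract (\<tau> i) \<noteq> 0" for i using \<tau>_in[of i] unfolding Pin_def by auto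
      show "\<exists>c\<in>Pin {?N}. to_fract (\<tau> (Suc i)) = to_fract (\<tau> i) * c" if "i < r" for i
        using \<tau>_chain[OF that] unfolding Pin_def by auto
      have "e = (\<Prod>j\<in>Q. zvar j - to_fract (f j))"
        unfolding e_def Y_prod y_def zvar_def by (simp add: to_fract_hom.hom_prod)
      then show "e = 0 \<or> (\<exists>Q\<subseteq>UNIV - {?N}. e = (\<Prod>j\<in>Q. zvar j - to_fract (f j)))" unfolding Q_def by blast
      show "?G \<in> carrier_mat (Suc r) (Suc r)" using F r by simp
      show "mat_over (ratpoly {} UNIV) ?G" unfolding ratpoly_empty mat_over_def by simp
      show "det_ideal (ratpoly {} UNIV) (Suc r) k ?G (\<Prod>i<k. if i < r then to_fract (\<tau> i) else to_fract (\<tau> r) * e)"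
        if k: "k \<le> Suc r" for k
      proof -
        have "(\<Prod>i<k. if i < r then to_fract (\<tau> i) else to_fract (\<tau> r) * e) = (\<Prod>i<k. to_fract (s i))"
          using k by (intro prod.cong refl s_eq[symmetric]) auto
        also have "\<dots> = to_fract (minors_gcd k F)" using minors_gcd_prod[of k] k r by (simp add: to_fract_hom.hom_prod)
        finally show ?thesis
          unfolding ratpoly_empty using to_fract_hom.det_ideal_map[OF F J[of k]] k r by simp
      qed
    qed auto
    then have "eqv ?R l ?G (map_mat to_fract (smith_form F))" unfolding diag ratpoly_empty r .
    moreover have "smith_form F \<in> carrier_mat l l" by (simp add: smith_form_diag)
    ultimately show "equivalent_mat F (smith_form F)" by (intro equivalent_mat_of_eqv[OF F])
  qed
qed

end
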